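(* The distributions $\sigma_1^{(k)}$ and $\sigma_0^{(k)}$ can be distinguished by a bounded-error quantum query algorithm making $O(k^5\log^2N\log k)$ queries with advantage $2/3$. However, for every constant $d\ge1$, every circuit of depth $d$ (AC0 circuit) of size $o\!\left(\exp\!\left(N^{\frac{1}{4(d-1)}}\right)\right)$ distinguishes these distributions with advantage at most $\exp(-\Omega(k))$.
   Context: Let $n\in\mathbb{N}$, $N=2^n$ sufficiently large, $k\in\mathbb{N}$ with $k=o(N^{1/50})$, $\epsilon=\frac{1}{60k^2\ln N}$; asymptotics as $N\to\infty$. $H_N$ is the $N\times N$ matrix with $H_N(a,b)=N^{-1/2}(-1)^{\sum_i a_ib_i}$ for $a,b\in\{0,1\}^n$. For $z=(x,y)$, $x,y\in\mathbb{R}^N$, $forr(z)=\frac1N\langle x,H_Ny\rangle$. $F:\{-1,1\}^{2N}\to\{-1,1\}$: $F(z)=-1$ if $forr(z)\ge\epsilon/2$, $F(z)=1$ if $forr(z)\le\epsilon/4$, undefined otherwise; $F^{(k)}(z_1,\dots,z_k)=\prod_jF(z_j)$. $\mathcal{G}$ is the distribution on $\mathbb{R}^{2N}$ of $(x,H_Nx)$ with $x_i\sim\mathcal{N}(0,\epsilon)$ i.i.d.; $\mathcal{U}$ is uniform on $\{-1,1\}^{2N}$. The rounding $\tilde\mu$ of a distribution $\mu$ on $\mathbb{R}^M$: sample $z\sim\mu$, then independently set $z'_i=1$ with probability $\frac{1+trnc(z_i)}{2}$, else $-1$, where $trnc$ clips to $[-1,1]$. For $S\subseteq[k]$, $\tilde{\mathcal{G}}^S\mathcal{U}^{\bar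 S}$ is the distribution of $(x_1,\dots,x_k)$ with independent $x_j\sim\tilde{\mathcal{G}}$ for $j\in S$, $x_j\sim\mathcal{U}$ for $j\notin S$. $\tilde\mu_0^{(k)}=2^{-(k-1)}\sum_{|S|\text{ even}}\tilde{\mathcal{G}}^S\mathcal{U}^{\bar S}$, $\tilde\mu_1^{(k)}=2^{-(k-1)}\sum_{|S|\text{ odd}}\tilde{\mathcal{G}}^S\mathcal{U}^{\bar S}$. $\sigma_0^{(k)}$ is $\tilde\mu_0^{(k)}$ conditioned on $F^{(k)}(z)=1$, and $\sigma_1^{(k)}$ is $\tilde\mu_1^{(k)}$ conditioned on $F^{(k)}(z)=-1$. The advantage of a $\{-1,1\}$-valued test $C$ is $|\mathbb{E}_{\sigma_0^{(k)}}C-\mathbb{E}_{\sigma_1^{(k)}}C|$.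
   Formalization: The factor log k in the query bound is read as max(1, log k), since for k = 1 the literal bound is zero queries and the claim fails; for d = 1, where the exponent 1/(4(d-1)) is undefined, the circuit size is left unrestricted. *)

theory Defs
  imports
    "HOL-Probability.Probability"
    "HOL-Library.Landau_Symbols"
    "Jordan_Normal_Form.Schur_Decomposition"
begin

section \<open>Forrelation and its XOR\<close>

text \<open>Throughout, $N = 2^n$; an element $a$ of $\{0,1\}^n$ is the number $a < 2^n$ with binary
  digits $a_i$ = \<open>bit a i\<close>. A vector of length $M$ is a function on indices, of which only the
  values at \<open>i < M\<close> matter.\<close>

definition hadamard :: "nat \<Rightarrow> nat \<Rightarrow> nat \<Rightarrow> real" where
  "hadamard n a b =
     (1 / sqrt (2 ^ n)) * (- 1) ^ (\<Sum>i<n. of_bool (bit a i) * of_bool (bit b i))"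

definition hadamard_vec :: "nat \<Rightarrow> (nat \<Rightarrow> real) \<Rightarrow> nat \<Rightarrow> real" where
  "hadamard_vec n x a = (\<Sum>b<2 ^ n. hadamard n a b * x b)"

text \<open>For $z = (x,y)$ the vector $x$ is the first half of \<open>z\<close> and $y$ the second one.\<close>

definition forr :: "nat \<Rightarrow> (nat \<Rightarrow> real) \<Rightarrow> real" where
  "forr n z = (1 / 2 ^ n) * (\<Sum>a<2 ^ n. z a * hadamard_vec n (\<lambda>b. z (2 ^ n + b)) a)"

definition eps :: "nat \<Rightarrow> nat \<Rightarrow> real" where
  "eps n k = 1 / (60 * (real k)\<^sup>2 * ln (2 ^ n))"

definition forr_fun :: "nat \<Rightarrow> nat \<Rightarrow> (nat \<Rightarrow> real) \<Rightarrow> real option" where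
  "forr_fun n k z =
     (if forr n z \<ge> eps n k / 2 then Some (- 1)
      else if forr n z \<le> eps n k / 4 then Some 1
      else None)"

text \<open>An input of the XOR is \<open>z 0, \<dots>, z (k - 1)\<close>. The product is undefined as soon as one
  factor is.\<close>

definition forr_xor :: "nat \<Rightarrow> nat \<Rightarrow> (nat \<Rightarrow> nat \<Rightarrow> real) \<Rightarrow> real option" where
  "forr_xor n k z =
     (if \<exists>j<k. forr_fun n k (z j) = None then None
      else Some (\<Prod>j<k. the (forr_fun n k (z j))))"


section \<open>The distributions\<close>

text \<open>The sign vectors $\{-1,1\}^M$, extended by \<open>0\<close> outside of the index set.\<close>

definition sign_cube :: "nat \<Rightarrow> (nat \<Rightarrow> real) set" where
  "sign_cube M = PiE_dflt {..<M} 0 (\<lambda>_. {- 1, 1})"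

definition uniform_cube :: "nat \<Rightarrow> (nat \<Rightarrow> real) pmf" where
  "uniform_cube M = pmf_of_set (sign_cube M)"

definition gaussian_forr :: "nat \<Rightarrow> nat \<Rightarrow> (nat \<Rightarrow> real) measure" where
  "gaussian_forr n k =
     distr (\<Pi>\<^sub>M i\<in>{..<2 ^ n}. density lborel (\<lambda>t. ennreal (normal_density 0 (sqrt (eps n k)) t)))
       (\<Pi>\<^sub>M i\<in>{..<2 * 2 ^ n}. borel)
       (\<lambda>x. \<lambda>i\<in>{..<2 * 2 ^ n}. if i < 2 ^ n then x i else hadamard_vec n x (i - 2 ^ n))"

definition trnc :: "real \<Rightarrow> real" where
  "trnc t = max (- 1) (min 1 t)"

definition round_point :: "nat \<Rightarrow> (nat \<Rightarrow> real) \<Rightarrow> (nat \<Rightarrow> real) pmf" where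
  "round_point M z =
     Pi_pmf {..<M} 0
       (\<lambda>i. map_pmf (\<lambda>b. if b then 1 else - 1) (bernoulli_pmf ((1 + trnc (z i)) / 2)))"

text \<open>Two-stage sampling, given by its point probabilities; \<open>pmf_rounding\<close> below shows that these
  do form a probability mass function.\<close>

definition rounding :: "nat \<Rightarrow> (nat \<Rightarrow> real) measure \<Rightarrow> (nat \<Rightarrow> real) pmf" where
  "rounding M \<mu> = embed_pmf (\<lambda>w. \<integral>z. pmf (round_point M z) w \<partial>\<mu>)"

definition mixed_product :: "nat \<Rightarrow> nat \<Rightarrow> nat set \<Rightarrow> (nat \<Rightarrow> nat \<Rightarrow> real) pmf" where
  "mixed_product n k S =
     Pi_pmf {..<k} (\<lambda>_. 0)
       (\<lambda>j. if j \<in> S then rounding (2 * 2 ^ n) (gaussian_forr n k)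
            else uniform_cube (2 * 2 ^ n))"

text \<open>For \<open>k \<ge> 1\<close> there are $2^{k-1}$ sets of either parity, so the factor $2^{-(k-1)}$ is the one of
  the uniform mixture.\<close>

definition mu0 :: "nat \<Rightarrow> nat \<Rightarrow> (nat \<Rightarrow> nat \<Rightarrow> real) pmf" where
  "mu0 n k = bind_pmf (pmf_of_set {S. S \<subseteq> {..<k} \<and> even (card S)}) (mixed_product n k)"

definition mu1 :: "nat \<Rightarrow> nat \<Rightarrow> (nat \<Rightarrow> nat \<Rightarrow> real) pmf" where
  "mu1 n k = bind_pmf (pmf_of_set {S. S \<subseteq> {..<k} \<and> odd (card S)}) (mixed_product n k)"

definition sigma0 :: "nat \<Rightarrow> nat \<Rightarrow> (nat \<Rightarrow> nat \<Rightarrow> real) pmf" where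
  "sigma0 n k = cond_pmf (mu0 n k) {z. forr_xor n k z = Some 1}"

definition sigma1 :: "nat \<Rightarrow> nat \<Rightarrow> (nat \<Rightarrow> nat \<Rightarrow> real) pmf" where
  "sigma1 n k = cond_pmf (mu1 n k) {z. forr_xor n k z = Some (- 1)}"

text \<open>For a randomized test, \<open>f z\<close> is its expected output on input \<open>z\<close>.\<close>

definition advantage :: "nat \<Rightarrow> nat \<Rightarrow> ((nat \<Rightarrow> nat \<Rightarrow> real) \<Rightarrow> real) \<Rightarrow> real" where
  "advantage n k f =
     \<bar>measure_pmf.expectation (sigma0 n k) f - measure_pmf.expectation (sigma1 n k) f\<bar>"

text \<open>The input bits of algorithms and circuits: the concatenation of the blocks \<open>z j\<close>.\<close>

definition num_inputs :: "nat \<Rightarrow> nat \<Rightarrow> nat" where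
  "num_inputs n k = k * (2 * 2 ^ n)"

definition concat_input :: "nat \<Rightarrow> (nat \<Rightarrow> nat \<Rightarrow> real) \<Rightarrow> nat \<Rightarrow> real" where
  "concat_input n z m = z (m div (2 * 2 ^ n)) (m mod (2 * 2 ^ n))"


section \<open>Quantum query algorithms\<close>

text \<open>An algorithm on \<open>m\<close> input signs acts on $\mathbb{C}^{m+1} \otimes \mathbb{C}^w$, where
  \<open>w\<close> is the dimension of the workspace. The basis state $|i\rangle|j\rangle$ has number
  \<open>i * w + j\<close>. A query multiplies $|i\rangle|j\rangle$ by the sign \<open>x i\<close> if \<open>i < m\<close> and fixes
  $|m\rangle|j\rangle$ (the usual idle index of the phase oracle). The algorithm starts in basis
  state number \<open>0\<close>, applies the unitary \<open>init_op\<close>, then alternates queries with the unitaries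
  \<open>step_ops\<close>, and measures in the standard basis. It outputs \<open>- 1\<close> on the outcomes in
  \<open>minus_set\<close> and \<open>1\<close> on the others.\<close>

record query_alg =
  work_dim :: nat
  init_op :: "complex mat"
  step_ops :: "complex mat list"
  minus_set :: "nat set"

definition unitary_mat :: "nat \<Rightarrow> complex mat \<Rightarrow> bool" where
  "unitary_mat d U \<longleftrightarrow>
     U \<in> carrier_mat d d \<and> U * mat_adjoint U = 1\<^sub>m d \<and> mat_adjoint U * U = 1\<^sub>m d"

definition alg_dim :: "nat \<Rightarrow> query_alg \<Rightarrow> nat" where
  "alg_dim m A = (m + 1) * work_dim A"

definition wf_query_alg :: "nat \<Rightarrow> query_alg \<Rightarrow> bool" where
  "wf_query_alg m A \<longleftrightarrow>
     work_dim A \<ge> 1 \<and> unitary_mat (alg_dim m A) (init_op A) \<and>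
     (\<forall>U\<in>set (step_ops A). unitary_mat (alg_dim m A) U)"

definition num_queries :: "query_alg \<Rightarrow> nat" where
  "num_queries A = length (step_ops A)"

definition oracle_mat :: "nat \<Rightarrow> nat \<Rightarrow> (nat \<Rightarrow> real) \<Rightarrow> complex mat" where
  "oracle_mat m w x =
     Matrix.mat ((m + 1) * w) ((m + 1) * w)
       (\<lambda>(s, t). if s \<noteq> t then 0
                 else if s div w < m then complex_of_real (x (s div w)) else 1)"

definition final_state :: "nat \<Rightarrow> query_alg \<Rightarrow> (nat \<Rightarrow> real) \<Rightarrow> complex Matrix.vec" where
  "final_state m A x =
     foldl (\<lambda>v U. U *\<^sub>v (oracle_mat m (work_dim A) x *\<^sub>v v))
       (init_op A *\<^sub>v unit_vec (alg_dim m A) 0) (step_ops A)"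

definition output_prob :: "nat \<Rightarrow> query_alg \<Rightarrow> (nat \<Rightarrow> real) \<Rightarrow> real \<Rightarrow> real" where
  "output_prob m A x b =
     (\<Sum>s | s < alg_dim m A \<and> (if s \<in> minus_set A then - 1 else 1) = b.
        (cmod (vec_index (final_state m A x) s))\<^sup>2)"

definition expected_output :: "nat \<Rightarrow> query_alg \<Rightarrow> (nat \<Rightarrow> real) \<Rightarrow> real" where
  "expected_output m A x = output_prob m A x 1 - output_prob m A x (- 1)"


section \<open>Bounded-depth circuits\<close>

text \<open>A circuit is a directed acyclic graph of gates of unbounded fan-in, listed in topological
  order: gate number \<open>i\<close> refers to gates with numbers below \<open>i\<close>, and the last gate is the output.
  Inputs and negations are free: depth and size only count conjunctions and disjunctions.\<close>

datatype gate = InputG nat | NotG nat | AndG "nat set" | OrG "nat set"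

type_synonym circuit = "gate list"

fun wf_gate :: "nat \<Rightarrow> nat \<Rightarrow> gate \<Rightarrow> bool" where
  "wf_gate m i (InputG v) = (v < m)"
| "wf_gate m i (NotG j) = (j < i)"
| "wf_gate m i (AndG J) = (J \<subseteq> {..<i})"
| "wf_gate m i (OrG J) = (J \<subseteq> {..<i})"

definition wf_circuit :: "nat \<Rightarrow> circuit \<Rightarrow> bool" where
  "wf_circuit m C \<longleftrightarrow> C \<noteq> [] \<and> (\<forall>i<length C. wf_gate m i (C ! i))"

fun gate_value :: "(nat \<Rightarrow> bool) \<Rightarrow> bool list \<Rightarrow> gate \<Rightarrow> bool" where
  "gate_value x vs (InputG v) = x v"
| "gate_value x vs (NotG j) = (\<not> vs ! j)"
| "gate_value x vs (AndG J) = (\<forall>j\<in>J. vs ! j)"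
| "gate_value x vs (OrG J) = (\<exists>j\<in>J. vs ! j)"

definition circuit_value :: "circuit \<Rightarrow> (nat \<Rightarrow> bool) \<Rightarrow> bool" where
  "circuit_value C x = last (foldl (\<lambda>vs g. vs @ [gate_value x vs g]) [] C)"

fun gate_depth :: "nat list \<Rightarrow> gate \<Rightarrow> nat" where
  "gate_depth ds (InputG v) = 0"
| "gate_depth ds (NotG j) = ds ! j"
| "gate_depth ds (AndG J) = Suc (Max (insert 0 ((!) ds ` J)))"
| "gate_depth ds (OrG J) = Suc (Max (insert 0 ((!) ds ` J)))"

definition circuit_depth :: "circuit \<Rightarrow> nat" where
  "circuit_depth C = last (foldl (\<lambda>ds g. ds @ [gate_depth ds g]) [] C)"

fun counted_gate :: "gate \<Rightarrow> bool" where
  "counted_gate (InputG v) = False"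
| "counted_gate (NotG j) = False"
| "counted_gate (AndG J) = True"
| "counted_gate (OrG J) = True"

definition circuit_size :: "circuit \<Rightarrow> nat" where
  "circuit_size C = length (filter counted_gate C)"

text \<open>The sign \<open>- 1\<close> encodes the truth value \<open>True\<close>, for the inputs as well as for the output.\<close>

definition circuit_sign :: "circuit \<Rightarrow> (nat \<Rightarrow> real) \<Rightarrow> real" where
  "circuit_sign C x = (if circuit_value C (\<lambda>i. x i = - 1) then - 1 else 1)"


section \<open>Well-definedness of the rounding\<close>

lemma finite_sign_cube: "finite (sign_cube M)"
  unfolding sign_cube_def by (intro finite_PiE_dflt) auto

lemma set_round_point: "set_pmf (round_point M z) \<subseteq> sign_cube M"
  unfolding round_point_def sign_cube_def
  by (subst set_Pi_pmf) (auto simp: PiE_dflt_def split: if_splits)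

lemma pmf_round_coord:
  "pmf (map_pmf (\<lambda>b. if b then 1 else - 1) (bernoulli_pmf ((1 + trnc t) / 2))) (c :: real) =
     (if c = 1 then (1 + trnc t) / 2 else if c = - 1 then (1 - trnc t) / 2 else 0)"
proof -
  have r: "0 \<le> (1 + trnc t) / 2" "(1 + trnc t) / 2 \<le> 1"
    by (auto simp: trnc_def)
  have i: "inj (\<lambda>b. if b then 1 else - 1 :: real)"
    by (auto simp: inj_def)
  have 1: "pmf (map_pmf (\<lambda>b. if b then 1 else - 1 :: real) (bernoulli_pmf ((1 + trnc t) / 2))) 1
      = (1 + trnc t) / 2"
    using pmf_map_inj'[OF i, of "bernoulli_pmf ((1 + trnc t) / 2)" True] r by simp
  have 2: "pmf (map_pmf (\<lambda>b. if b then 1 else - 1 :: real) (bernoulli_pmf ((1 + trnc t) / 2))) (- 1)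
      = (1 - trnc t) / 2"
    using pmf_map_inj'[OF i, of "bernoulli_pmf ((1 + trnc t) / 2)" False] r by (simp add: field_simps)
  have 3: "pmf (map_pmf (\<lambda>b. if b then 1 else - 1 :: real) (bernoulli_pmf ((1 + trnc t) / 2))) c = 0"
    if "c \<noteq> 1" "c \<noteq> - 1"
    using that by (intro pmf_map_outside) auto
  show ?thesis using 1 2 3 by auto
qed

lemma pmf_rounding:
  assumes "prob_space \<mu>" and sets: "sets \<mu> = sets (\<Pi>\<^sub>M i\<in>{..<M}. borel)"
  shows "pmf (rounding M \<mu>) w = (\<integral>z. pmf (round_point M z) w \<partial>\<mu>)"
proof -
  interpret prob_space \<mu> by fact
  have [measurable]: "(\<lambda>z. z i) \<in> borel_measurable \<mu>" if "i < M" for i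
    using that by (subst measurable_cong_sets[OF sets refl]) (auto intro: measurable_component_singleton)
  have eq: "pmf (round_point M z) v =
      (if \<forall>i. i \<notin> {..<M} \<longrightarrow> v i = 0
       then \<Prod>i<M. if v i = 1 then (1 + trnc (z i)) / 2
                   else if v i = - 1 then (1 - trnc (z i)) / 2 else 0 else 0)" for z v
    unfolding round_point_def by (subst pmf_Pi) (auto simp: pmf_round_coord)
  have meas: "(\<lambda>z. pmf (round_point M z) v) \<in> borel_measurable \<mu>" for v
  proof (cases "\<forall>i. i \<notin> {..<M} \<longrightarrow> v i = 0")
    case True
    have "(\<lambda>z. \<Prod>i<M. if v i = 1 then (1 + trnc (z i)) / 2
             else if v i = - 1 then (1 - trnc (z i)) / 2 else 0) \<in> borel_measurable \<mu>"
    proof (rule borel_measurable_prod)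
      fix i assume "i \<in> {..<M}"
      then have [measurable]: "(\<lambda>z. z i) \<in> borel_measurable \<mu>" by simp
      show "(\<lambda>z. if v i = 1 then (1 + trnc (z i)) / 2
             else if v i = - 1 then (1 - trnc (z i)) / 2 else 0) \<in> borel_measurable \<mu>"
        unfolding trnc_def by measurable
    qed
    then show ?thesis using True by (simp add: eq)
  next
    case False
    then have "(\<lambda>z. pmf (round_point M z) v) = (\<lambda>z. 0)" by (auto simp: eq fun_eq_iff)
    then show ?thesis by simp
  qed
  have int: "integrable \<mu> (\<lambda>z. pmf (round_point M z) v)" for v
    by (rule integrable_const_bound[where B = 1]) (auto simp: pmf_le_1 meas)
  have nn: "0 \<le> (\<integral>z. pmf (round_point M z) v \<partial>\<mu>)" for v
    by (rule integral_nonneg_AE) simp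
  have outside: "(\<integral>z. pmf (round_point M z) v \<partial>\<mu>) = 0" if "v \<notin> sign_cube M" for v
  proof -
    have "pmf (round_point M z) v = 0" for z
      using that set_round_point[of M z] by (auto simp: set_pmf_eq)
    then show ?thesis by simp
  qed
  have "(\<integral>\<^sup>+v. ennreal (\<integral>z. pmf (round_point M z) v \<partial>\<mu>) \<partial>count_space UNIV) =
      (\<Sum>v\<in>sign_cube M. ennreal (\<integral>z. pmf (round_point M z) v \<partial>\<mu>))"
    by (rule nn_integral_count_space'[OF finite_sign_cube]) (auto simp: outside)
  also have "\<dots> = ennreal (\<Sum>v\<in>sign_cube M. \<integral>z. pmf (round_point M z) v \<partial>\<mu>)"
    using nn by (simp add: sum_ennreal)
  also have "(\<Sum>v\<in>sign_cube M. \<integral>z. pmf (round_point M z) v \<partial>\<mu>) =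
      (\<integral>z. (\<Sum>v\<in>sign_cube M. pmf (round_point M z) v) \<partial>\<mu>)"
    using int by (simp add: Bochner_Integration.integral_sum)
  also have "\<dots> = (\<integral>z. 1 \<partial>\<mu>)"
    by (rule Bochner_Integration.integral_cong)
      (auto intro!: sum_pmf_eq_1 finite_sign_cube set_round_point)
  also have "\<dots> = 1" by (simp add: prob_space)
  finally have "(\<integral>\<^sup>+v. ennreal (\<integral>z. pmf (round_point M z) v \<partial>\<mu>) \<partial>count_space UNIV) = 1"
    by simp
  then show ?thesis
    unfolding rounding_def by (intro pmf_embed_pmf nn) auto
qed

lemma prob_space_gaussian_forr:
  assumes "n \<ge> 1" and "k \<ge> 1"
  shows "prob_space (gaussian_forr n k)"
proof -
  let ?D = "density lborel (\<lambda>t. ennreal (normal_density 0 (sqrt (eps n k)) t))"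
  have "0 < sqrt (eps n k)"
    using assms by (auto simp: eps_def ln_realpow)
  then interpret D: prob_space ?D
    by (rule prob_space_normal_density)
  interpret P: product_prob_space "\<lambda>_. ?D" "{..<2 ^ n}" ..
  have [measurable]: "(\<lambda>x. x i) \<in> borel_measurable (\<Pi>\<^sub>M i\<in>{..<2 ^ n}. ?D)" if "i < 2 ^ n" for i
    using measurable_component_singleton[of i "{..<2 ^ n}" "\<lambda>_. ?D"] that by simp
  have "(\<lambda>x. \<lambda>i\<in>{..<2 * 2 ^ n}. if i < 2 ^ n then x i else hadamard_vec n x (i - 2 ^ n))
      \<in> measurable (\<Pi>\<^sub>M i\<in>{..<2 ^ n}. ?D) (\<Pi>\<^sub>M i\<in>{..<2 * 2 ^ n}. borel)"
  proof (rule measurable_restrict)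
    fix i :: nat
    have "(\<lambda>x. hadamard_vec n x (i - 2 ^ n)) \<in> borel_measurable (\<Pi>\<^sub>M i\<in>{..<2 ^ n}. ?D)"
      unfolding hadamard_vec_def by (intro borel_measurable_sum borel_measurable_times) auto
    then show "(\<lambda>x. if i < 2 ^ n then x i else hadamard_vec n x (i - 2 ^ n))
        \<in> borel_measurable (\<Pi>\<^sub>M i\<in>{..<2 ^ n}. ?D)"
      by (cases "i < 2 ^ n") simp_all
  qed
  then show ?thesis
    unfolding gaussian_forr_def by (rule P.prob_space_distr)
qed

end

theory Submission
  imports Defs "HOL-Probability.Hoeffding" "HOL-Real_Asymp.Real_Asymp"
begin

text \<open>Lower bound. The difference of the expectations of $f$ under $\tilde\mu_0^{(k)}$ and
  $\tilde\mu_1^{(k)}$ is $\pm 2^{-(k-1)} \sum_w f(w) \prod_j \Theta(w_j)$, where $\Theta$ is the difference of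
  the point probabilities of the rounded Gaussian and of the uniform distribution. Interpolating
  between $0$ and the Gaussian point, Stein's identity shows that up to truncation errors $\Theta$ is an
  average of second derivatives $\sum_{a,b} \epsilon H_{ab} \partial_a \partial_{N+b}$ of the multilinear
  kernel. Hence the sum only sees derivatives of $f$ of order $2k$, each with weight
  $(\epsilon / \sqrt N)^k$. For a circuit of depth $d$ the norm $\sum_T \lambda^{|T|} |\hat f(T)|$ is bounded by
  a constant for some $\lambda$ of order $N^{-1/4}$: a switching lemma, applied to one gate at a time,
  controls this norm directly. As $\lambda^{-2k}$ is of order $c^k N^{k/2}$, the total is
  $O(\epsilon)^k$. Conditioning on the value of $F^{(k)}$ changes little since $forr$ is concentrated.

  Upper bound. Querying once the uniform superposition over a block, applying $H_N$ to its second
  half and a Hadamard gate to the half bit gives an outcome of bias $forr(z_j)$; a threshold vote over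
  $O(\epsilon^{-2} \log k)$ independent runs computes $F(z_j)$ with error $1/(3k)$ for each $j$.\<close>

section \<open>Coefficient norms and restrictions\<close>

text \<open>Each restriction with star probability p multiplies the admissible weight \<lambda> by
  p, and switching gates of width r to trees of depth r needs p of order 1/r. Literals have width 1,
  so the bottom level costs only a constant and depth d costs d - 1 factors r. With r about
  N^(1/(4(d-1))) the size 3^r is allowed and \<lambda>^(-2) is of order sqrt N, just what the
  entries of H_N compensate. What remains per block is a constant times eps; since eps tends to 0,
  the rate is exp(-k) with c = 1 for every d. The obstacle is that the coefficient norm is not
  controlled by the size of a function: on the rare restrictions where a tree is too long it may be
  exponential in the number of inputs, so a small failure probability is not enough. Hence the
  failing part is kept as a function and bounded along its own query paths. The k^2 in eps pays for
  truncation: a coordinate beyond 1/2 has weight at most of order N^(-15 k^2/4), which must beat a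
  factor N^(2k) from the L1 norms of k kernels. The bound k = o(N^(1/50)) serves only the
  concentration of forr.\<close>

definition sg :: "bool \<Rightarrow> real" where "sg b = (if b then - 1 else 1)"

text \<open>The derivative in the directions \<open>T\<close>, at the point \<open>v\<close>, of the multilinear extension of \<open>f\<close>:
  its value at \<open>v\<close> for \<open>T = {}\<close>, and the Fourier coefficient at \<open>T\<close> for \<open>v = 0\<close>.\<close>

definition mlin_coeff :: "nat set \<Rightarrow> (nat \<Rightarrow> real) \<Rightarrow> nat set \<Rightarrow> ((nat \<Rightarrow> bool) \<Rightarrow> real) \<Rightarrow> real" where
  "mlin_coeff I v T f = (\<Sum>X\<in>Pow I. f (\<lambda>i. i \<in> X) *
     (\<Prod>i\<in>I. if i \<in> T then sg (i \<in> X) / 2 else (1 + v i * sg (i \<in> X)) / 2))"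

text \<open>Weights and base point vary with the variable, so that restricting and moving the base
  point can be done one variable at a time.\<close>

definition coeff_norm :: "nat set \<Rightarrow> (nat \<Rightarrow> real) \<Rightarrow> (nat \<Rightarrow> real) \<Rightarrow> ((nat \<Rightarrow> bool) \<Rightarrow> real) \<Rightarrow> real" where
  "coeff_norm I v l f = (\<Sum>T\<in>Pow I. (\<Prod>i\<in>T. l i) * \<bar>mlin_coeff I v T f\<bar>)"

lemma sum_Pow_insert:
  assumes "finite J" "i \<notin> J"
  shows "(\<Sum>X\<in>Pow (insert i J). g X) = (\<Sum>X\<in>Pow J. g X + g (insert i X))"
proof -
  have "(\<Sum>X\<in>Pow (insert i J). g X) = (\<Sum>X\<in>Pow J. g X) + (\<Sum>X\<in>insert i ` Pow J. g X)"
    unfolding Pow_insert using assms by (intro sum.union_disjoint) auto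
  also have "(\<Sum>X\<in>insert i ` Pow J. g X) = (\<Sum>X\<in>Pow J. g (insert i X))"
  proof (rule sum.reindex_cong[OF _ refl refl])
    show "inj_on (insert i) (Pow J)" using assms(2) by (auto simp: inj_on_def)
  qed
  finally show ?thesis by (simp add: sum.distrib)
qed

text \<open>In variable \<open>i\<close> the extension is affine: its value at \<open>v i\<close> is
  the mean of the two restrictions with weights (1 + v i)/2 and (1 - v i)/2, its slope is half their
  difference. The bit \<open>False\<close> is the sign 1.\<close>

lemma mlin_coeff_insert:
  assumes "finite J" "i \<notin> J"
  shows "mlin_coeff (insert i J) v T f =
     (if i \<in> T then 1 / 2 else (1 + v i) / 2) * mlin_coeff J v T (\<lambda>x. f (x(i := False)))
   + (if i \<in> T then - 1 / 2 else (1 - v i) / 2) * mlin_coeff J v T (\<lambda>x. f (x(i := True)))"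
proof -
  let ?w = "\<lambda>X j. if j \<in> T then sg (j \<in> X) / 2 else (1 + v j * sg (j \<in> X)) / 2"
  have a: "(\<lambda>j. j \<in> X) = (\<lambda>j. j \<in> X)(i := False)" if "X \<subseteq> J" for X
    using that assms by (auto simp: fun_eq_iff)
  have b: "(\<lambda>j. j \<in> insert i X) = (\<lambda>j. j \<in> X)(i := True)" for X
    by (auto simp: fun_eq_iff)
  have p1: "(\<Prod>j\<in>insert i J. ?w X j) = (if i \<in> T then 1 / 2 else (1 + v i) / 2) * (\<Prod>j\<in>J. ?w X j)"
    if "X \<subseteq> J" for X
    using that assms by (auto simp: sg_def)
  have p2: "(\<Prod>j\<in>insert i J. ?w (insert i X) j) =
      (if i \<in> T then - 1 / 2 else (1 - v i) / 2) * (\<Prod>j\<in>J. ?w X j)" for X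
  proof -
    have "j \<in> insert i X \<longleftrightarrow> j \<in> X" if "j \<in> J" for j using that assms(2) by auto
    then have "(\<Prod>j\<in>J. ?w (insert i X) j) = (\<Prod>j\<in>J. ?w X j)"
      by (intro prod.cong refl) (simp only:)
    then show ?thesis using assms by (auto simp: sg_def)
  qed
  have "mlin_coeff (insert i J) v T f = (\<Sum>X\<in>Pow J.
      f ((\<lambda>j. j \<in> X)(i := False)) * ((if i \<in> T then 1 / 2 else (1 + v i) / 2) * (\<Prod>j\<in>J. ?w X j)) +
      f ((\<lambda>j. j \<in> X)(i := True)) * ((if i \<in> T then - 1 / 2 else (1 - v i) / 2) * (\<Prod>j\<in>J. ?w X j)))"
    unfolding mlin_coeff_def sum_Pow_insert[OF assms]
    by (intro sum.cong refl arg_cong2[where f="(+)"] arg_cong2[where f="(*)"] arg_cong[where f=f]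
        p1 p2 a b) auto
  then show ?thesis unfolding mlin_coeff_def by (simp add: sum_distrib_left sum.distrib mult_ac)
qed

lemma mlin_coeff_cong:
  assumes "\<And>i. i \<in> I \<Longrightarrow> i \<notin> T \<Longrightarrow> v i = v' i" "\<And>i. i \<in> I \<Longrightarrow> i \<in> T \<longleftrightarrow> i \<in> T'"
  shows "mlin_coeff I v T f = mlin_coeff I v' T' f"
  unfolding mlin_coeff_def using assms by (intro sum.cong arg_cong2[where f="(*)"] prod.cong refl) auto

text \<open>\<open>T\<close> and \<open>insert i T\<close> are taken together: value and slope in
  direction \<open>i\<close> of one affine function. Every one-variable estimate below is this
  identity followed by an inequality between two real numbers.\<close>

lemma coeff_norm_insert:
  assumes "finite J" "i \<notin> J"
  shows "coeff_norm (insert i J) v l f = (\<Sum>T\<in>Pow J. (\<Prod>j\<in>T. l j) *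
     (\<bar>(1 + v i) / 2 * mlin_coeff J v T (\<lambda>x. f (x(i := False))) + (1 - v i) / 2 * mlin_coeff J v T (\<lambda>x. f (x(i := True)))\<bar>
      + l i * \<bar>(mlin_coeff J v T (\<lambda>x. f (x(i := False))) - mlin_coeff J v T (\<lambda>x. f (x(i := True)))) / 2\<bar>))"
proof -
  have "(\<Prod>j\<in>insert i T. l j) = l i * (\<Prod>j\<in>T. l j)" if "T \<subseteq> J" for T
    using that assms by (subst prod.insert) (auto dest: finite_subset)
  moreover have "mlin_coeff J v (insert i T) g = mlin_coeff J v T g" for T g
    using assms by (intro mlin_coeff_cong) auto
  ultimately show ?thesis
    unfolding coeff_norm_def sum_Pow_insert[OF assms] mlin_coeff_insert[OF assms]
    using assms(2)
    by (intro sum.cong refl) (auto simp: algebra_simps diff_divide_distrib)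
qed

lemma coeff_norm_upd:
  assumes "finite J" "i \<notin> J"
  shows "coeff_norm (insert i J) v l (\<lambda>x. f (x(i := b))) =
    (\<Sum>T\<in>Pow J. (\<Prod>j\<in>T. l j) * \<bar>mlin_coeff J v T (\<lambda>x. f (x(i := b)))\<bar>)"
proof -
  have "(1 + v i) / 2 * y + (1 - v i) / 2 * y = y" for y by (simp add: field_simps)
  then show ?thesis unfolding coeff_norm_insert[OF assms] by simp
qed

lemma coeff_norm_triangle: "finite I \<Longrightarrow> (\<And>i. i \<in> I \<Longrightarrow> l i \<ge> 0) \<Longrightarrow> coeff_norm I v l (\<lambda>x. f x + g x) \<le> coeff_norm I v l f + coeff_norm I v l g"
  unfolding coeff_norm_def sum.distrib[symmetric] distrib_left[symmetric]
  by (intro sum_mono mult_left_mono prod_nonneg)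
     (auto simp: mlin_coeff_def algebra_simps sum.distrib)

lemma coeff_norm_zero: "coeff_norm I v l (\<lambda>x. 0) = 0"
  unfolding coeff_norm_def mlin_coeff_def by simp

lemma coeff_norm_uminus: "coeff_norm I v l (\<lambda>x. - f x) = coeff_norm I v l f"
  unfolding coeff_norm_def mlin_coeff_def by (simp add: sum_negf)

text \<open>The cost of one query: neither the value at 0 nor the slope exceeds the mean of the
  absolute values at the two ends.\<close>

lemma coeff_norm_query:
  assumes "finite I" "i \<in> I" "\<And>j. j \<in> I \<Longrightarrow> l j \<ge> 0"
  shows "coeff_norm I (\<lambda>_. 0) l f \<le> (1 + l i) / 2 *
    (coeff_norm I (\<lambda>_. 0) l (\<lambda>x. f (x(i := False))) + coeff_norm I (\<lambda>_. 0) l (\<lambda>x. f (x(i := True))))"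
proof -
  define J where "J = I - {i}"
  have J: "finite J" "i \<notin> J" and I: "I = insert i J" using assms by (auto simp: J_def)
  have "\<bar>a / 2 + b / 2\<bar> + k * \<bar>(a - b) / 2\<bar> \<le> (1 + k) / 2 * (\<bar>a\<bar> + \<bar>b\<bar>)" if "k \<ge> 0" for a b k :: real
  proof -
    have "k * \<bar>(a - b) / 2\<bar> \<le> k * ((\<bar>a\<bar> + \<bar>b\<bar>) / 2)" by (rule mult_left_mono) (use that in auto)
    moreover have "\<bar>a / 2 + b / 2\<bar> \<le> (\<bar>a\<bar> + \<bar>b\<bar>) / 2" by (simp add: abs_if)
    ultimately show ?thesis by (simp add: algebra_simps)
  qed
  moreover have "(\<Prod>j\<in>T. l j) \<ge> 0" if "T \<subseteq> J" for T
    using that assms(3) I by (intro prod_nonneg) auto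
  ultimately have "coeff_norm I (\<lambda>_. 0) l f \<le> (\<Sum>T\<in>Pow J. (\<Prod>j\<in>T. l j) * ((1 + l i) / 2 *
      (\<bar>mlin_coeff J (\<lambda>_. 0) T (\<lambda>x. f (x(i := False)))\<bar> + \<bar>mlin_coeff J (\<lambda>_. 0) T (\<lambda>x. f (x(i := True)))\<bar>)))"
    unfolding I coeff_norm_insert[OF J] using assms(2,3)
    by (intro sum_mono mult_left_mono) auto
  also have "\<dots> = (1 + l i) / 2 *
    (coeff_norm I (\<lambda>_. 0) l (\<lambda>x. f (x(i := False))) + coeff_norm I (\<lambda>_. 0) l (\<lambda>x. f (x(i := True))))"
    unfolding I coeff_norm_upd[OF J] by (simp add: sum_distrib_left sum.distrib algebra_simps)
  finally show ?thesis .
qed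

definition put :: "nat set \<Rightarrow> (nat \<Rightarrow> 'a) \<Rightarrow> (nat \<Rightarrow> 'a) \<Rightarrow> nat \<Rightarrow> 'a" where
  "put V a x = (\<lambda>i. if i \<in> V then a i else x i)"

lemma put_empty [simp]: "put {} a x = x" by (simp add: put_def)

lemma coeff_norm_query_set:
  assumes "finite I" "V \<subseteq> I" "l \<ge> 0"
  shows "coeff_norm I (\<lambda>_. 0) (\<lambda>_. l) f \<le> ((1 + l) / 2) ^ card V *
    (\<Sum>A\<in>Pow V. coeff_norm I (\<lambda>_. 0) (\<lambda>_. l) (\<lambda>x. f (put V (\<lambda>i. i \<in> A) x)))"
proof -
  have "finite V" using assms finite_subset by blast
  then show ?thesis using assms(2)
  proof (induction V arbitrary: f rule: finite_induct)
    case (insert i V)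
    let ?n = "coeff_norm I (\<lambda>_. 0) (\<lambda>_. l)"
    have e: "(\<lambda>x. f (put (insert i V) (\<lambda>j. j \<in> A) x)) = (\<lambda>x. f ((put V (\<lambda>j. j \<in> A) x)(i := False)))"
      if "A \<in> Pow V" for A
      using that insert(2) by (intro ext arg_cong[where f=f]) (auto simp: put_def fun_eq_iff)
    have e': "(\<lambda>x. f (put (insert i V) (\<lambda>j. j \<in> insert i A) x)) = (\<lambda>x. f ((put V (\<lambda>j. j \<in> A) x)(i := True)))"
      if "A \<in> Pow V" for A
      using that insert(2) by (intro ext arg_cong[where f=f]) (auto simp: put_def fun_eq_iff)
    have "?n f \<le> (1 + l) / 2 * (?n (\<lambda>x. f (x(i := False))) + ?n (\<lambda>x. f (x(i := True))))"
      using insert.prems assms by (intro coeff_norm_query) auto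
    also have "\<dots> \<le> (1 + l) / 2 * (((1 + l) / 2) ^ card V *
       (\<Sum>A\<in>Pow V. ?n (\<lambda>x. f ((put V (\<lambda>j. j \<in> A) x)(i := False)))) + ((1 + l) / 2) ^ card V *
       (\<Sum>A\<in>Pow V. ?n (\<lambda>x. f ((put V (\<lambda>j. j \<in> A) x)(i := True)))))"
      using insert.IH[of "\<lambda>x. f (x(i := False))"] insert.IH[of "\<lambda>x. f (x(i := True))"] insert.prems assms
      by (intro mult_left_mono add_mono) auto
    also have "\<dots> = ((1 + l) / 2) ^ card (insert i V) *
        (\<Sum>A\<in>Pow (insert i V). ?n (\<lambda>x. f (put (insert i V) (\<lambda>i. i \<in> A) x)))"
    proof -
      have "(\<Sum>A\<in>Pow (insert i V). ?n (\<lambda>x. f (put (insert i V) (\<lambda>i. i \<in> A) x))) =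
         (\<Sum>A\<in>Pow V. ?n (\<lambda>x. f ((put V (\<lambda>j. j \<in> A) x)(i := False)))) +
         (\<Sum>A\<in>Pow V. ?n (\<lambda>x. f ((put V (\<lambda>j. j \<in> A) x)(i := True))))"
        unfolding sum_Pow_insert[OF insert(1,2)] sum.distrib[symmetric]
        by (intro sum.cong refl arg_cong2[where f="(+)"] arg_cong[where f="?n"] e e')
      then show ?thesis using insert(1,2) by (simp add: algebra_simps)
    qed
    finally show ?case .
  qed simp
qed

section \<open>Random restrictions and their effect on the coefficient norm\<close>

definition comb :: "(nat \<rightharpoonup> bool) \<Rightarrow> (nat \<Rightarrow> bool) \<Rightarrow> nat \<Rightarrow> bool" where
  "comb \<rho> x = (\<lambda>i. case \<rho> i of None \<Rightarrow> x i | Some b \<Rightarrow> b)"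

definition restrs :: "nat set \<Rightarrow> (nat \<rightharpoonup> bool) set" where "restrs I = {\<rho>. dom \<rho> \<subseteq> I}"

text \<open>The probability of \<open>\<rho>\<close> when every variable of \<open>I\<close> independently stays free with probability \<open>p\<close>
  and is otherwise fixed to a uniform bit.\<close>

definition restr_wt :: "real \<Rightarrow> nat set \<Rightarrow> (nat \<rightharpoonup> bool) \<Rightarrow> real" where
  "restr_wt p I \<rho> = (\<Prod>i\<in>I. if \<rho> i = None then p else (1 - p) / 2)"

lemma finite_restrs [simp]: "finite I \<Longrightarrow> finite (restrs I)"
proof -
  assume I: "finite I"
  have "restrs I \<subseteq> (\<lambda>(D, X) i. if i \<in> D then Some (i \<in> X) else None) ` (Pow I \<times> Pow I)"
  proof
    fix \<rho> assume "\<rho> \<in> restrs I"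
    moreover have "\<rho> = (\<lambda>i. if i \<in> dom \<rho> then Some (i \<in> {i. \<rho> i = Some True}) else None)"
      by (auto simp: fun_eq_iff)
    moreover have "{i. \<rho> i = Some True} \<subseteq> dom \<rho>" by auto
    ultimately show "\<rho> \<in> (\<lambda>(D, X) i. if i \<in> D then Some (i \<in> X) else None) ` (Pow I \<times> Pow I)"
      by (intro image_eqI[where x = "(dom \<rho>, {i. \<rho> i = Some True})"]) (auto simp: restrs_def)
  qed
  then show ?thesis by (rule finite_subset) (use I in auto)
qed

lemma restrs_outside: "\<rho> \<in> restrs J \<Longrightarrow> i \<notin> J \<Longrightarrow> \<rho> i = None"
  by (auto simp: restrs_def dom_def subset_iff)

lemma restrs_upd_None: "\<rho> \<in> restrs J \<Longrightarrow> i \<notin> J \<Longrightarrow> \<rho>(i := None) = \<rho>"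
  by (simp add: restrs_outside fun_upd_idem)

lemma comb_empty [simp]: "comb Map.empty x = x" by (simp add: comb_def)
lemma restrs_empty: "restrs {} = {Map.empty}" by (auto simp: restrs_def)

lemma comb_upd: "comb (\<rho>(i \<mapsto> b)) x = (comb \<rho> x)(i := b)"
  by (auto simp: comb_def fun_eq_iff)

lemma sum_restrs_insert:
  assumes "finite J" "i \<notin> J"
  shows "(\<Sum>\<rho>\<in>restrs (insert i J). g \<rho>) = (\<Sum>\<rho>\<in>restrs J. g \<rho> + g (\<rho>(i \<mapsto> False)) + g (\<rho>(i \<mapsto> True)))"
proof -
  have e: "restrs (insert i J) = restrs J \<union> (\<lambda>\<rho>. \<rho>(i \<mapsto> False)) ` restrs J \<union> (\<lambda>\<rho>. \<rho>(i \<mapsto> True)) ` restrs J"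
  proof (intro equalityI subsetI)
    fix \<rho> assume r: "\<rho> \<in> restrs (insert i J)"
    show "\<rho> \<in> restrs J \<union> (\<lambda>\<rho>. \<rho>(i \<mapsto> False)) ` restrs J \<union> (\<lambda>\<rho>. \<rho>(i \<mapsto> True)) ` restrs J"
    proof (cases "\<rho> i")
      case None
      then show ?thesis using r by (auto simp: restrs_def subset_iff dom_def)
    next
      case (Some b)
      then have "\<rho> = (\<rho>(i := None))(i \<mapsto> b)" by (auto simp: fun_eq_iff)
      moreover have "\<rho>(i := None) \<in> restrs J" using r by (auto simp: restrs_def subset_iff dom_def)
      ultimately have "\<rho> \<in> (\<lambda>\<rho>. \<rho>(i \<mapsto> b)) ` restrs J" by (rule image_eqI)
      then show ?thesis by (cases b) simp_all
    qed
  qed (use assms in \<open>auto simp: restrs_def subset_iff dom_def split: if_splits\<close>)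
  have inj: "inj_on (\<lambda>\<rho>. \<rho>(i \<mapsto> b)) (restrs J)" for b
  proof (rule inj_onI)
    fix \<rho> \<sigma> assume a: "\<rho> \<in> restrs J" "\<sigma> \<in> restrs J" "\<rho>(i \<mapsto> b) = \<sigma>(i \<mapsto> b)"
    then have "\<rho> i = None" "\<sigma> i = None" using assms(2) by (auto simp: restrs_def dom_def subset_iff)
    then show "\<rho> = \<sigma>" using a(3) by (metis fun_upd_triv fun_upd_upd)
  qed
  have ni: "\<rho> i = None" if "\<rho> \<in> restrs J" for \<rho> using that assms(2) by (auto simp: restrs_def dom_def subset_iff)
  have "(\<Sum>\<rho>\<in>restrs (insert i J). g \<rho>) = (\<Sum>\<rho>\<in>restrs J. g \<rho>) + (\<Sum>\<rho>\<in>(\<lambda>\<rho>. \<rho>(i \<mapsto> False)) ` restrs J. g \<rho>)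
      + (\<Sum>\<rho>\<in>(\<lambda>\<rho>. \<rho>(i \<mapsto> True)) ` restrs J. g \<rho>)"
  proof -
    have d1: "restrs J \<inter> (\<lambda>\<rho>. \<rho>(i \<mapsto> False)) ` restrs J = {}"
      using ni by (metis (no_types, lifting) disjoint_iff fun_upd_same imageE option.distinct(1))
    have d2: "\<sigma> i = Some True" if "\<sigma> \<in> (\<lambda>\<rho>. \<rho>(i \<mapsto> True)) ` restrs J" for \<sigma> using that by auto
    have d3: "\<sigma> i \<noteq> Some True" if "\<sigma> \<in> restrs J \<union> (\<lambda>\<rho>. \<rho>(i \<mapsto> False)) ` restrs J" for \<sigma>
      using that ni[of \<sigma>] by auto
    have d4: "(restrs J \<union> (\<lambda>\<rho>. \<rho>(i \<mapsto> False)) ` restrs J) \<inter> (\<lambda>\<rho>. \<rho>(i \<mapsto> True)) ` restrs J = {}"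
      using d2 d3 by blast
    show ?thesis unfolding e
      using sum.union_disjoint[OF _ _ d4, of g] sum.union_disjoint[OF _ _ d1, of g] assms(1) by simp
  qed
  then show ?thesis by (simp add: sum.reindex[OF inj] sum.distrib)
qed

lemma restr_wt_insert:
  assumes "finite J" "i \<notin> J"
  shows "restr_wt p (insert i J) (\<rho>(i := u)) = (if u = None then p else (1 - p) / 2) * restr_wt p J \<rho>"
proof -
  have "(\<Prod>j\<in>J. if (\<rho>(i := u)) j = None then p else (1 - p) / 2) = restr_wt p J \<rho>"
    unfolding restr_wt_def using assms by (intro prod.cong) auto
  then show ?thesis using assms by (simp add: restr_wt_def)
qed

text \<open>The slope, whose weight has shrunk to \<open>p * l i\<close>, is paid by the event that
  \<open>i\<close> stays free. The value at 0 is at most the mean over the two fixed bits, so it is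
  paid in every event.\<close>

lemma coeff_norm_restrict1:
  assumes "finite I" "i \<in> I" "\<And>j. j \<in> I \<Longrightarrow> l j \<ge> 0" "0 \<le> p" "p \<le> 1"
  shows "coeff_norm I (\<lambda>_. 0) (l(i := p * l i)) f \<le> p * coeff_norm I (\<lambda>_. 0) l f + (1 - p) / 2 *
    (coeff_norm I (\<lambda>_. 0) l (\<lambda>x. f (x(i := False))) + coeff_norm I (\<lambda>_. 0) l (\<lambda>x. f (x(i := True))))"
proof -
  define J where "J = I - {i}"
  have J: "finite J" "i \<notin> J" and I: "I = insert i J" using assms by (auto simp: J_def)
  have *: "\<bar>a / 2 + b / 2\<bar> + p * k * \<bar>(a - b) / 2\<bar> \<le>
      p * (\<bar>a / 2 + b / 2\<bar> + k * \<bar>(a - b) / 2\<bar>) + (1 - p) / 2 * (\<bar>a\<bar> + \<bar>b\<bar>)" for a b k :: real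
  proof -
    define y d where "y = \<bar>a / 2 + b / 2\<bar>" and "d = \<bar>(a - b) / 2\<bar>"
    have "y \<le> (\<bar>a\<bar> + \<bar>b\<bar>) / 2" unfolding y_def by (simp add: abs_if)
    then have "(1 - p) * y \<le> (1 - p) * ((\<bar>a\<bar> + \<bar>b\<bar>) / 2)"
      by (rule mult_left_mono) (use assms in auto)
    moreover have "p * (y + k * d) + (1 - p) / 2 * (\<bar>a\<bar> + \<bar>b\<bar>) =
        y + p * k * d + ((1 - p) * ((\<bar>a\<bar> + \<bar>b\<bar>) / 2) - (1 - p) * y)"
      by (simp add: algebra_simps)
    ultimately show ?thesis unfolding y_def[symmetric] d_def[symmetric] by linarith
  qed
  have pr: "(\<Prod>j\<in>T. l j) \<ge> 0" if "T \<subseteq> J" for T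
    using that assms(3) I by (intro prod_nonneg) auto
  have pe: "(\<Prod>j\<in>T. (l(i := p * l i)) j) = (\<Prod>j\<in>T. l j)" if "T \<subseteq> J" for T
    using that J by (intro prod.cong) auto
  define a where "a = (\<lambda>T. mlin_coeff J (\<lambda>_. 0) T (\<lambda>x. f (x(i := False))))"
  define b where "b = (\<lambda>T. mlin_coeff J (\<lambda>_. 0) T (\<lambda>x. f (x(i := True))))"
  have "coeff_norm I (\<lambda>_. 0) (l(i := p * l i)) f = (\<Sum>T\<in>Pow J. (\<Prod>j\<in>T. l j) *
      (\<bar>a T / 2 + b T / 2\<bar> + p * l i * \<bar>(a T - b T) / 2\<bar>))"
    unfolding I coeff_norm_insert[OF J] a_def b_def by (intro sum.cong refl arg_cong2[where f="(*)"] pe) auto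
  also have "\<dots> \<le> (\<Sum>T\<in>Pow J. (\<Prod>j\<in>T. l j) * (p * (\<bar>a T / 2 + b T / 2\<bar> + l i * \<bar>(a T - b T) / 2\<bar>)
      + (1 - p) / 2 * (\<bar>a T\<bar> + \<bar>b T\<bar>)))"
    by (intro sum_mono mult_left_mono * pr) auto
  also have "\<dots> = p * coeff_norm I (\<lambda>_. 0) l f + (1 - p) / 2 *
    (coeff_norm I (\<lambda>_. 0) l (\<lambda>x. f (x(i := False))) + coeff_norm I (\<lambda>_. 0) l (\<lambda>x. f (x(i := True))))"
    unfolding I coeff_norm_upd[OF J] unfolding coeff_norm_insert[OF J] a_def b_def
    by (simp add: sum_distrib_left sum.distrib distrib_left mult_ac)
  finally show ?thesis .
qed

lemma coeff_norm_restrict_aux: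
  assumes "finite J" "J \<subseteq> I" "finite I" "\<And>j. j \<in> I \<Longrightarrow> l j \<ge> 0" "0 \<le> p" "p \<le> 1"
  shows "coeff_norm I (\<lambda>_. 0) (\<lambda>i. if i \<in> J then p * l i else l i) f
    \<le> (\<Sum>\<rho>\<in>restrs J. restr_wt p J \<rho> * coeff_norm I (\<lambda>_. 0) l (\<lambda>x. f (comb \<rho> x)))"
  using assms(1,2)
proof (induction J arbitrary: f rule: finite_induct)
  case empty
  then show ?case by (simp add: restrs_empty restr_wt_def)
next
  case (insert i J)
  let ?l = "\<lambda>j. if j \<in> J then p * l j else l j"
  let ?n = "coeff_norm I (\<lambda>_. 0) l"
  have l: "(\<lambda>j. if j \<in> insert i J then p * l j else l j) = ?l(i := p * ?l i)"
    using insert(2) by (auto simp: fun_eq_iff)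
  have ni: "\<rho>(i := None) = \<rho>" if "\<rho> \<in> restrs J" for \<rho> using that insert(2) by (rule restrs_upd_None)
  have w: "restr_wt p (insert i J) \<rho> = p * restr_wt p J \<rho>" if "\<rho> \<in> restrs J" for \<rho>
    using restr_wt_insert[OF insert(1,2), of p \<rho> None] ni[OF that] by simp
  have "coeff_norm I (\<lambda>_. 0) (?l(i := p * ?l i)) f \<le> p * coeff_norm I (\<lambda>_. 0) ?l f + (1 - p) / 2 *
      (coeff_norm I (\<lambda>_. 0) ?l (\<lambda>x. f (x(i := False))) + coeff_norm I (\<lambda>_. 0) ?l (\<lambda>x. f (x(i := True))))"
    using assms insert.prems by (intro coeff_norm_restrict1) auto
  also have "\<dots> \<le> p * (\<Sum>\<rho>\<in>restrs J. restr_wt p J \<rho> * ?n (\<lambda>x. f (comb \<rho> x))) + (1 - p) / 2 *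
      ((\<Sum>\<rho>\<in>restrs J. restr_wt p J \<rho> * ?n (\<lambda>x. f ((comb \<rho> x)(i := False)))) +
       (\<Sum>\<rho>\<in>restrs J. restr_wt p J \<rho> * ?n (\<lambda>x. f ((comb \<rho> x)(i := True)))))"
    using assms insert.prems insert.IH[of f] insert.IH[of "\<lambda>x. f (x(i := False))"] insert.IH[of "\<lambda>x. f (x(i := True))"]
    by (intro mult_left_mono add_mono) auto
  also have "\<dots> = (\<Sum>\<rho>\<in>restrs (insert i J). restr_wt p (insert i J) \<rho> * ?n (\<lambda>x. f (comb \<rho> x)))"
    unfolding sum_restrs_insert[OF insert(1,2)]
    by (simp add: restr_wt_insert[OF insert(1,2)] w comb_upd sum.distrib sum_distrib_left distrib_left mult_ac cong: sum.cong)
  finally show ?case unfolding l .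
qed

lemma coeff_norm_restrict:
  assumes "finite I" "l \<ge> 0" "0 \<le> p" "p \<le> 1"
  shows "coeff_norm I (\<lambda>_. 0) (\<lambda>_. p * l) f
    \<le> (\<Sum>\<rho>\<in>restrs I. restr_wt p I \<rho> * coeff_norm I (\<lambda>_. 0) (\<lambda>_. l) (\<lambda>x. f (comb \<rho> x)))"
proof -
  have "coeff_norm I (\<lambda>_. 0) (\<lambda>_. p * l) f = coeff_norm I (\<lambda>_. 0) (\<lambda>i. if i \<in> I then p * l else l) f"
    unfolding coeff_norm_def by (intro sum.cong arg_cong2[where f="(*)"] prod.cong refl) auto
  then show ?thesis using coeff_norm_restrict_aux[of I I "\<lambda>_. l" p f] assms by auto
qed

lemma restr_wt_sum: "finite I \<Longrightarrow> (\<Sum>\<rho>\<in>restrs I. restr_wt p I \<rho>) = 1"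
proof (induction I rule: finite_induct)
  case empty
  then show ?case by (simp add: restrs_empty restr_wt_def)
next
  case (insert i I)
  have ni: "\<rho>(i := None) = \<rho>" if "\<rho> \<in> restrs I" for \<rho> using that insert(2) by (rule restrs_upd_None)
  have w: "restr_wt p (insert i I) \<rho> = p * restr_wt p I \<rho>" if "\<rho> \<in> restrs I" for \<rho>
    using restr_wt_insert[OF insert(1,2), of p \<rho> None] ni[OF that] by simp
  have "(\<Sum>\<rho>\<in>restrs (insert i I). restr_wt p (insert i I) \<rho>) = (\<Sum>\<rho>\<in>restrs I. restr_wt p I \<rho>)"
    unfolding sum_restrs_insert[OF insert(1,2)]
    by (intro sum.cong refl) (simp add: restr_wt_insert[OF insert(1,2)] w, simp add: field_simps)
  then show ?case using insert.IH by simp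
qed

text \<open>A coordinate of mean \<open>v i\<close> arises by leaving it free at 0 with probability
  1/2 and otherwise fixing it to a random sign of mean \<open>2 * v i\<close>, which exists because
  |v i| \<le> 1/2. Only the first event contributes to the slope, so the weight is halved. This is
  why the bound \<open>M\<close> is required for all restrictions of \<open>f\<close>.\<close>

lemma coeff_norm_point_aux:
  assumes "finite J" "J \<subseteq> I" "finite I" "l \<ge> 0" "\<And>i. i \<in> I \<Longrightarrow> \<bar>v i\<bar> \<le> 1 / 2"
    and "\<And>\<rho>. \<rho> \<in> restrs J \<Longrightarrow> coeff_norm I (\<lambda>_. 0) (\<lambda>_. l) (\<lambda>x. f (comb \<rho> x)) \<le> M"
  shows "coeff_norm I (\<lambda>i. if i \<in> J then v i else 0) (\<lambda>i. if i \<in> J then l / 2 else l) f \<le> M"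
  using assms(1,2,6)
proof (induction J arbitrary: f rule: finite_induct)
  case empty
  then show ?case using empty(2)[of Map.empty] by (simp add: restrs_empty)
next
  case (insert i J)
  let ?l = "\<lambda>j. if j \<in> J then l / 2 else l" and ?v = "\<lambda>j. if j \<in> J then v j else 0"
  let ?l' = "\<lambda>j. if j \<in> insert i J then l / 2 else l" and ?v' = "\<lambda>j. if j \<in> insert i J then v j else 0"
  let ?n = "coeff_norm I ?v ?l"
  define K where "K = I - {i}"
  have K: "finite K" "i \<notin> K" and I: "I = insert i K" using assms(3) insert.prems by (auto simp: K_def)
  have sub: "\<rho> \<in> restrs (insert i J)" if "\<rho> \<in> restrs J" for \<rho> using that by (auto simp: restrs_def)
  have sub2: "\<rho>(i \<mapsto> b) \<in> restrs (insert i J)" if "\<rho> \<in> restrs J" for \<rho> b using that by (auto simp: restrs_def)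
  have n1: "?n f \<le> M" using insert.prems sub by (intro insert.IH) auto
  have n2: "?n (\<lambda>x. f (x(i := b))) \<le> M" for b
  proof (rule insert.IH)
    fix \<rho> assume "\<rho> \<in> restrs J"
    then show "coeff_norm I (\<lambda>_. 0) (\<lambda>_. l) (\<lambda>x. f ((comb \<rho> x)(i := b))) \<le> M"
      using insert.prems(2)[OF sub2, of \<rho> b] by (simp only: comb_upd)
  qed (use insert.prems in auto)
  define a where "a = (\<lambda>T. mlin_coeff K ?v T (\<lambda>x. f (x(i := False))))"
  define b where "b = (\<lambda>T. mlin_coeff K ?v T (\<lambda>x. f (x(i := True))))"
  define w where "w = v i"
  have w: "\<bar>w\<bar> \<le> 1 / 2" using assms(5) insert.prems by (auto simp: w_def)
  have *: "\<bar>(1 + w) / 2 * a + (1 - w) / 2 * b\<bar> + l / 2 * \<bar>(a - b) / 2\<bar> \<le>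
     1 / 2 * (\<bar>a / 2 + b / 2\<bar> + l * \<bar>(a - b) / 2\<bar>) + 1 / 2 * ((1 + 2 * w) / 2 * \<bar>a\<bar> + (1 - 2 * w) / 2 * \<bar>b\<bar>)"
    for a b :: real
  proof -
    have e: "(1 + w) / 2 * a + (1 - w) / 2 * b = 1 / 2 * (a / 2 + b / 2) + (1 / 2 * ((1 + 2 * w) / 2) * a + 1 / 2 * ((1 - 2 * w) / 2) * b)"
      by (simp add: field_simps)
    have "\<bar>1 / 2 * ((1 + 2 * w) / 2) * a\<bar> = 1 / 2 * ((1 + 2 * w) / 2) * \<bar>a\<bar>"
      "\<bar>1 / 2 * ((1 - 2 * w) / 2) * b\<bar> = 1 / 2 * ((1 - 2 * w) / 2) * \<bar>b\<bar>"
      unfolding abs_mult using w by (auto simp: abs_if)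
    moreover have "\<bar>1 / 2 * (a / 2 + b / 2)\<bar> = 1 / 2 * \<bar>a / 2 + b / 2\<bar>" by (simp only: abs_mult)
    moreover have "\<bar>P + (Q + R)\<bar> \<le> \<bar>P\<bar> + (\<bar>Q\<bar> + \<bar>R\<bar>)" for P Q R :: real by linarith
    ultimately have "\<bar>(1 + w) / 2 * a + (1 - w) / 2 * b\<bar> \<le> 1 / 2 * \<bar>a / 2 + b / 2\<bar> +
        (1 / 2 * ((1 + 2 * w) / 2) * \<bar>a\<bar> + 1 / 2 * ((1 - 2 * w) / 2) * \<bar>b\<bar>)"
      unfolding e by metis
    then show ?thesis by (simp add: algebra_simps)
  qed
  have pr: "(\<Prod>j\<in>T. ?l j) \<ge> 0" for T using assms(4) by (intro prod_nonneg) auto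
  have pe: "(\<Prod>j\<in>T. ?l' j) = (\<Prod>j\<in>T. ?l j)" if "T \<subseteq> K" for T
    using that K by (intro prod.cong) auto
  have me: "mlin_coeff K ?v' T g = mlin_coeff K ?v T g" for T g using K by (intro mlin_coeff_cong) auto
  have "coeff_norm I ?v' ?l' f = (\<Sum>T\<in>Pow K. (\<Prod>j\<in>T. ?l j) *
      (\<bar>(1 + w) / 2 * a T + (1 - w) / 2 * b T\<bar> + l / 2 * \<bar>(a T - b T) / 2\<bar>))"
    unfolding I coeff_norm_insert[OF K] a_def b_def me w_def
    by (intro sum.cong refl arg_cong2[where f="(*)"] pe) auto
  also have "\<dots> \<le> (\<Sum>T\<in>Pow K. (\<Prod>j\<in>T. ?l j) * (1 / 2 * (\<bar>a T / 2 + b T / 2\<bar> + l * \<bar>(a T - b T) / 2\<bar>)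
      + 1 / 2 * ((1 + 2 * w) / 2 * \<bar>a T\<bar> + (1 - 2 * w) / 2 * \<bar>b T\<bar>)))"
    by (intro sum_mono mult_left_mono * pr)
  also have "\<dots> = 1 / 2 * ?n f + 1 / 2 * ((1 + 2 * w) / 2 * ?n (\<lambda>x. f (x(i := False))) +
      (1 - 2 * w) / 2 * ?n (\<lambda>x. f (x(i := True))))"
    unfolding I coeff_norm_upd[OF K] unfolding coeff_norm_insert[OF K] a_def b_def using insert(2)
    by (simp add: sum_distrib_left sum.distrib distrib_left mult_ac)
  also have "\<dots> \<le> 1 / 2 * M + 1 / 2 * ((1 + 2 * w) / 2 * M + (1 - 2 * w) / 2 * M)"
    using w by (intro add_mono mult_left_mono n1 n2) auto
  also have "\<dots> = M" by (simp add: field_simps)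
  finally show ?case .
qed

text \<open>Sets of equal size carry the common weight \<open>(l / 2) ^ t\<close>, so a single level
  is read off the whole norm.\<close>

lemma sum_mlin_coeff_point_le:
  assumes "finite I" "l > 0" "\<And>i. i \<in> I \<Longrightarrow> \<bar>v i\<bar> \<le> 1 / 2"
    and M: "\<And>\<rho>. \<rho> \<in> restrs I \<Longrightarrow> coeff_norm I (\<lambda>_. 0) (\<lambda>_. l) (\<lambda>x. f (comb \<rho> x)) \<le> M"
    and TT: "TT \<subseteq> Pow I" "\<And>T. T \<in> TT \<Longrightarrow> card T = t"
  shows "(\<Sum>T\<in>TT. \<bar>mlin_coeff I v T f\<bar>) \<le> (2 / l) ^ t * M"
proof -
  have "(l / 2) ^ t * (\<Sum>T\<in>TT. \<bar>mlin_coeff I v T f\<bar>) = (\<Sum>T\<in>TT. (\<Prod>i\<in>T. l / 2) * \<bar>mlin_coeff I v T f\<bar>)"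
    unfolding sum_distrib_left using TT by (intro sum.cong) auto
  also have "\<dots> \<le> coeff_norm I v (\<lambda>_. l / 2) f"
    unfolding coeff_norm_def using assms by (intro sum_mono2) (auto intro!: mult_nonneg_nonneg)
  also have "\<dots> = coeff_norm I (\<lambda>i. if i \<in> I then v i else 0) (\<lambda>i. if i \<in> I then l / 2 else l) f"
    unfolding coeff_norm_def by (intro sum.cong arg_cong2[where f="(*)"] prod.cong arg_cong[where f=abs] mlin_coeff_cong refl) auto
  also have "\<dots> \<le> M" using assms by (intro coeff_norm_point_aux) auto
  finally show ?thesis using assms(2) by (simp add: field_simps power_divide)
qed

section \<open>The switching argument\<close>

definition fix_vars :: "nat set \<Rightarrow> (nat \<Rightarrow> bool) \<Rightarrow> (nat \<rightharpoonup> bool) \<Rightarrow> (nat \<rightharpoonup> bool)" where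
  "fix_vars V a \<rho> = (\<lambda>i. if i \<in> V then Some (a i) else \<rho> i)"

definition unfix :: "nat set \<Rightarrow> (nat \<rightharpoonup> bool) \<Rightarrow> (nat \<rightharpoonup> bool)" where
  "unfix V \<rho> = (\<lambda>i. if i \<in> V then None else \<rho> i)"

type_synonym family = "(nat \<rightharpoonup> bool) \<Rightarrow> (nat \<Rightarrow> bool) \<Rightarrow> real"

text \<open>A family is a function of the restriction and of the values of the free variables. \<open>chg V a h\<close> views
  \<open>h\<close> at restrictions that fix \<open>V\<close> to \<open>a\<close>, pretending that \<open>V\<close> is still free.\<close>

definition chg :: "nat set \<Rightarrow> (nat \<Rightarrow> bool) \<Rightarrow> family \<Rightarrow> family" where
  "chg V a h = (\<lambda>\<rho> x. h (unfix V \<rho>) (put V a x))"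

definition dnf :: "(nat \<rightharpoonup> bool) list \<Rightarrow> (nat \<Rightarrow> bool) \<Rightarrow> bool" where
  "dnf ts x \<longleftrightarrow> (\<exists>t\<in>set ts. \<forall>i\<in>dom t. t i = Some (x i))"

definition stars :: "(nat \<rightharpoonup> bool) \<Rightarrow> (nat \<rightharpoonup> bool) \<Rightarrow> nat set" where
  "stars t \<rho> = {i \<in> dom t. \<rho> i = None}"

definition falsified :: "(nat \<rightharpoonup> bool) \<Rightarrow> (nat \<rightharpoonup> bool) \<Rightarrow> bool" where
  "falsified t \<rho> \<longleftrightarrow> (\<exists>i\<in>dom t. \<rho> i \<noteq> None \<and> \<rho> i \<noteq> t i)"

text \<open>Both functions follow the canonical decision tree of a DNF, which queries all free variables of the
  first term not yet falsified; \<open>c\<close> counts the queries so far. \<open>fail\<close> says that the path of \<open>x\<close>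
  makes more than \<open>r\<close> queries, and \<open>clip\<close> is the tree cut off at that depth.\<close>

fun fail :: "nat \<Rightarrow> (nat \<rightharpoonup> bool) list \<Rightarrow> (nat \<rightharpoonup> bool) \<Rightarrow> (nat \<Rightarrow> bool) \<Rightarrow> nat \<Rightarrow> bool" where
  "fail r [] \<rho> x c = False"
| "fail r (t # ts) \<rho> x c = (if falsified t \<rho> then fail r ts \<rho> x c
     else c + card (stars t \<rho>) > r \<or>
       (\<exists>i\<in>stars t \<rho>. t i \<noteq> Some (x i)) \<and> fail r ts (fix_vars (stars t \<rho>) x \<rho>) x (c + card (stars t \<rho>)))"

fun clip :: "nat \<Rightarrow> (nat \<rightharpoonup> bool) list \<Rightarrow> (nat \<rightharpoonup> bool) \<Rightarrow> (nat \<Rightarrow> bool) \<Rightarrow> nat \<Rightarrow> bool" where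
  "clip r [] \<rho> x c = False"
| "clip r (t # ts) \<rho> x c = (if falsified t \<rho> then clip r ts \<rho> x c
     else c + card (stars t \<rho>) \<le> r \<and>
       ((\<forall>i\<in>stars t \<rho>. t i = Some (x i)) \<or> clip r ts (fix_vars (stars t \<rho>) x \<rho>) x (c + card (stars t \<rho>))))"

lemma comb_fix_vars_stars: "comb (fix_vars (stars t \<rho>) x \<rho>) x = comb \<rho> x"
  by (auto simp: comb_def fix_vars_def stars_def fun_eq_iff split: option.splits)

lemma sat_comb_iff:
  "(\<forall>i\<in>dom t. t i = Some (comb \<rho> x i)) \<longleftrightarrow> \<not> falsified t \<rho> \<and> (\<forall>i\<in>stars t \<rho>. t i = Some (x i))"
proof -
  have c: "Some (comb \<rho> x i) = (if \<rho> i = None then Some (x i) else \<rho> i)" for i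
    by (auto simp: comb_def split: option.splits)
  show ?thesis
  proof (intro iffI conjI ballI)
    assume a: "\<forall>i\<in>dom t. t i = Some (comb \<rho> x i)"
    show "\<not> falsified t \<rho>"
    proof
      assume "falsified t \<rho>"
      then obtain i where i: "i \<in> dom t" "\<rho> i \<noteq> None" "\<rho> i \<noteq> t i" unfolding falsified_def by blast
      have "t i = \<rho> i" using bspec[OF a i(1)] c[of i] by (simp only: i(2) if_False)
      then show False using i(3) by simp
    qed
    fix i assume "i \<in> stars t \<rho>"
    then have i: "i \<in> dom t" "\<rho> i = None" by (auto simp: stars_def)
    show "t i = Some (x i)" using bspec[OF a i(1)] i(2) c[of i] by simp
  next
    fix i assume b: "\<not> falsified t \<rho> \<and> (\<forall>i\<in>stars t \<rho>. t i = Some (x i))" and i: "i \<in> dom t"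
    show "t i = Some (comb \<rho> x i)"
    proof (cases "\<rho> i = None")
      case True
      then have "i \<in> stars t \<rho>" using i by (simp add: stars_def)
      then show ?thesis using b True c[of i] by simp
    next
      case False
      then have "\<rho> i = t i" using b i unfolding falsified_def by blast
      then show ?thesis using False c[of i] by simp
    qed
  qed
qed

text \<open>Queried variables are moved into \<open>\<rho>\<close> without changing the total
  assignment (\<open>comb_fix_vars_stars\<close>), so tree and DNF can be compared term by term
  along one path.\<close>

lemma clip_eq_dnf: "\<not> fail r ts \<rho> x c \<Longrightarrow> clip r ts \<rho> x c = dnf ts (comb \<rho> x)"
proof (induction ts arbitrary: \<rho> c)
  case Nil
  then show ?case by (simp add: dnf_def)
next
  case (Cons t ts)
  have d: "dnf (t # ts) y \<longleftrightarrow> (\<forall>i\<in>dom t. t i = Some (y i)) \<or> dnf ts y" for y by (auto simp: dnf_def)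
  show ?case
  proof (cases "falsified t \<rho>")
    case True
    then show ?thesis unfolding d sat_comb_iff using Cons.prems Cons.IH[of \<rho> c] by simp
  next
    case False
    let ?\<sigma> = "fix_vars (stars t \<rho>) x \<rho>" and ?c = "c + card (stars t \<rho>)"
    have le: "?c \<le> r" using Cons.prems False by simp
    show ?thesis
    proof (cases "\<forall>i\<in>stars t \<rho>. t i = Some (x i)")
      case True
      then show ?thesis unfolding d sat_comb_iff using False le by simp
    next
      case ns: False
      then have "\<not> fail r ts ?\<sigma> x ?c" using Cons.prems False by auto
      then have "clip r ts ?\<sigma> x ?c = dnf ts (comb \<rho> x)" using Cons.IH comb_fix_vars_stars by metis
      then show ?thesis unfolding d sat_comb_iff using False le ns by simp
    qed
  qed
qed

text \<open>The path only queries variables that \<open>\<rho>\<close> leaves free, so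
  \<open>x\<close> may be changed on the variables fixed earlier.\<close>

lemma fail_cong:
  assumes "\<And>i. \<rho> i = None \<Longrightarrow> x i = y i"
  shows "fail r ts \<rho> x c = fail r ts \<rho> y c"
  using assms
proof (induction ts arbitrary: \<rho> c)
  case (Cons t ts)
  let ?V = "stars t \<rho>"
  have st: "x i = y i" if "i \<in> ?V" for i using that Cons.prems by (auto simp: stars_def)
  then have f: "fix_vars ?V x \<rho> = fix_vars ?V y \<rho>" by (auto simp: fix_vars_def fun_eq_iff)
  have 1: "fail r ts \<rho> x c = fail r ts \<rho> y c" using Cons.prems by (rule Cons.IH)
  have 2: "fail r ts (fix_vars ?V y \<rho>) x (c + card ?V) = fail r ts (fix_vars ?V y \<rho>) y (c + card ?V)"
  proof (rule Cons.IH)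
    fix i assume "fix_vars ?V y \<rho> i = None"
    then have "\<rho> i = None" by (simp add: fix_vars_def split: if_splits)
    then show "x i = y i" by (rule Cons.prems)
  qed
  have 3: "(\<exists>i\<in>?V. t i \<noteq> Some (x i)) \<longleftrightarrow> (\<exists>i\<in>?V. t i \<noteq> Some (y i))" using st by (intro bex_cong) auto
  show ?case by (simp only: fail.simps f 1 2 3)
qed simp

text \<open>The argument conditions only on events of this kind. Closure under fixing more variables
  allows a restriction that leaves variables of a term free to be mapped, inside the event, to one
  that satisfies the term.\<close>

definition dclosed :: "nat set \<Rightarrow> (nat \<rightharpoonup> bool) set \<Rightarrow> bool" where
  "dclosed I \<Delta> \<longleftrightarrow> (\<forall>\<rho>\<in>\<Delta>. \<forall>i\<in>I. \<forall>b. \<rho> i = None \<longrightarrow> \<rho>(i \<mapsto> b) \<in> \<Delta>)"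

text \<open>The induction measure of the switching argument: fixing a nonempty set of free variables
  lowers it.\<close>

definition live :: "(nat \<rightharpoonup> bool) set \<Rightarrow> nat set \<Rightarrow> nat set" where
  "live \<Delta> I = {i \<in> I. \<exists>\<rho>\<in>\<Delta>. \<rho> i = None}"

definition mass :: "real \<Rightarrow> nat set \<Rightarrow> (nat \<rightharpoonup> bool) set \<Rightarrow> real" where
  "mass p I \<Delta> = (\<Sum>\<rho>\<in>\<Delta>. restr_wt p I \<rho>)"

definition mean_coeff_norm :: "real \<Rightarrow> nat set \<Rightarrow> real \<Rightarrow> (nat \<rightharpoonup> bool) set \<Rightarrow> family \<Rightarrow> real" where
  "mean_coeff_norm p I l \<Delta> h = (\<Sum>\<rho>\<in>\<Delta>. restr_wt p I \<rho> * coeff_norm I (\<lambda>_. 0) (\<lambda>_. l) (h \<rho>))"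

lemma restr_wt_nonneg: "0 \<le> p \<Longrightarrow> p \<le> 1 \<Longrightarrow> restr_wt p I \<rho> \<ge> 0"
  unfolding restr_wt_def by (intro prod_nonneg) auto

lemma mass_mono: "0 \<le> p \<Longrightarrow> p \<le> 1 \<Longrightarrow> finite B \<Longrightarrow> A \<subseteq> B \<Longrightarrow> mass p I A \<le> mass p I B"
  unfolding mass_def by (intro sum_mono2) (auto simp: restr_wt_nonneg)

lemma dclosed_fix_vars:
  assumes "dclosed I \<Delta>" "\<rho> \<in> \<Delta>" "finite V" "V \<subseteq> I" "\<And>i. i \<in> V \<Longrightarrow> \<rho> i = None"
  shows "fix_vars V a \<rho> \<in> \<Delta>"
  using assms(3,4,5)
proof (induction V rule: finite_induct)
  case empty
  then show ?case using assms(2) by (simp add: fix_vars_def)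
next
  case (insert i V)
  have "fix_vars (insert i V) a \<rho> = (fix_vars V a \<rho>)(i \<mapsto> a i)" by (auto simp: fix_vars_def fun_eq_iff)
  moreover have "fix_vars V a \<rho> i = None" using insert by (auto simp: fix_vars_def)
  moreover have "fix_vars V a \<rho> \<in> \<Delta>" "i \<in> I" using insert by auto
  ultimately show ?case using assms(1) unfolding dclosed_def by metis
qed

lemma restr_wt_fix_vars:
  assumes "finite I" "V \<subseteq> I" "\<And>i. i \<in> V \<Longrightarrow> \<rho> i = None" "0 < p" "p < 1"
  shows "restr_wt p I \<rho> = (2 * p / (1 - p)) ^ card V * restr_wt p I (fix_vars V a \<rho>)"
proof -
  have fV: "finite V" using assms finite_subset by blast
  have s: "restr_wt p I \<sigma> = (\<Prod>i\<in>V. if \<sigma> i = None then p else (1 - p) / 2) * (\<Prod>i\<in>I - V. if \<sigma> i = None then p else (1 - p) / 2)" for \<sigma>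
    unfolding restr_wt_def using prod.subset_diff[OF assms(2,1)] by (simp add: mult.commute)
  have 1: "(\<Prod>i\<in>V. if \<rho> i = None then p else (1 - p) / 2) = p ^ card V"
    using assms(3) by simp
  have 2: "(\<Prod>i\<in>V. if fix_vars V a \<rho> i = None then p else (1 - p) / 2) = ((1 - p) / 2) ^ card V"
    by (simp add: fix_vars_def)
  have 3: "(\<Prod>i\<in>I - V. if fix_vars V a \<rho> i = None then p else (1 - p) / 2) = (\<Prod>i\<in>I - V. if \<rho> i = None then p else (1 - p) / 2)"
    by (intro prod.cong) (auto simp: fix_vars_def)
  have "p ^ card V = (2 * p / (1 - p)) ^ card V * ((1 - p) / 2) ^ card V"
  proof -
    have "2 * p / (1 - p) * ((1 - p) / 2) = p" using assms by simp
    then show ?thesis unfolding power_mult_distrib[symmetric] by (simp only:)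
  qed
  then show ?thesis unfolding s[of \<rho>] s[of "fix_vars V a \<rho>"] 1 2 3 by simp
qed

lemma unfix_fix_vars: "(\<And>i. i \<in> V \<Longrightarrow> \<rho> i = None) \<Longrightarrow> unfix V (fix_vars V a \<rho>) = \<rho>"
  by (auto simp: unfix_def fix_vars_def fun_eq_iff)

lemma sum_Pow_power_card:
  assumes "finite D"
  shows "(\<Sum>V\<in>Pow D. q ^ card V) = (1 + q :: real) ^ card D"
proof -
  have "(\<Prod>i\<in>D. q + 1) = (\<Sum>V\<in>Pow D. (\<Prod>i\<in>V. q) * (\<Prod>i\<in>D - V. 1))" by (rule prod_add[OF assms])
  then show ?thesis by (simp add: add.commute)
qed

text \<open>Hastad's weighting: the restrictions leaving exactly \<open>V\<close> free in the first live term have at most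
  \<open>(2 p / (1 - p)) ^ card V\<close> times the mass of those satisfying this term. The condition on \<open>w\<close>
  pays for the sum over \<open>V\<close>, and \<open>\<theta>\<close> is the gain per query.\<close>

lemma long_paths:
  assumes p: "0 < p" "p \<le> 1 / 2" and l: "0 \<le> l" "l \<le> 1" and \<theta>: "\<theta> \<ge> 1"
    and w: "(1 + 8 * p * \<theta>) ^ w \<le> 2" and I: "finite I" and B: "B \<ge> 0"
    and Qc: "\<And>\<Delta> h V a \<Delta>'. Q \<Delta> h \<Longrightarrow> V \<subseteq> I \<Longrightarrow>
       (\<And>\<rho>. \<rho> \<in> \<Delta>' \<Longrightarrow> unfix V \<rho> \<in> \<Delta> \<and> (\<forall>i\<in>V. \<rho> i = Some (a i))) \<Longrightarrow> Q \<Delta>' (chg V a h)"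
    and Qb: "\<And>\<Delta> h. Q \<Delta> h \<Longrightarrow> \<Delta> \<subseteq> restrs I \<Longrightarrow> dclosed I \<Delta> \<Longrightarrow> card (live \<Delta> I) < L \<Longrightarrow>
       mean_coeff_norm p I l \<Delta> h \<le> B * mass p I \<Delta>"
    and ts: "\<And>t. t \<in> set ts \<Longrightarrow> dom t \<subseteq> I \<and> card (dom t) \<le> w"
    and "Q \<Delta> h" "\<Delta> \<subseteq> restrs I" "dclosed I \<Delta>" "card (live \<Delta> I) \<le> L" "c \<le> r"
    and "\<And>\<rho> x. \<rho> \<in> \<Delta> \<Longrightarrow> h \<rho> x \<noteq> 0 \<Longrightarrow> fail r ts \<rho> x c"
  shows "mean_coeff_norm p I l \<Delta> h \<le> B * (\<theta> ^ c / \<theta> ^ r) * mass p I \<Delta>"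
  using ts assms(12-)
proof (induction ts arbitrary: \<Delta> h c)
  case Nil
  have "h \<rho> = (\<lambda>x. 0)" if "\<rho> \<in> \<Delta>" for \<rho>
  proof
    show "h \<rho> x = 0" for x using Nil.prems(7)[OF that, of x] by auto
  qed
  then have "mean_coeff_norm p I l \<Delta> h = 0" unfolding mean_coeff_norm_def by (intro sum.neutral) (simp add: coeff_norm_zero)
  moreover have "mass p I \<Delta> \<ge> 0" unfolding mass_def using p by (intro sum_nonneg restr_wt_nonneg) auto
  ultimately show ?case using B \<theta> by simp
next
  case (Cons t ts)
  have tI: "dom t \<subseteq> I" and tw: "card (dom t) \<le> w" using Cons.prems(1)[of t] by auto
  have ft: "finite (dom t)" using tI I finite_subset by blast
  have f\<Delta>: "finite \<Delta>" using Cons.prems(3) I finite_restrs finite_subset by blast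
  let ?g = "\<theta> ^ c / \<theta> ^ r"
  \<comment> \<open>The case \<open>V = {}\<close> of \<open>Qc\<close> passes from
    \<open>\<Delta>\<close> to a subset.\<close>
  have Qs: "Q \<Delta>' h" if "\<Delta>' \<subseteq> \<Delta>" for \<Delta>'
  proof -
    have "Q \<Delta>' (chg {} undefined h)"
      by (rule Qc[OF Cons.prems(2)]) (use that in \<open>auto simp: unfix_def\<close>)
    then show ?thesis by (simp add: chg_def unfix_def)
  qed
  define \<Delta>1 where "\<Delta>1 = {\<rho> \<in> \<Delta>. falsified t \<rho>}"
  \<comment> \<open>With \<open>\<Delta>1\<close> these sets partition \<open>\<Delta>\<close>
    according to the free variables of \<open>t\<close>. \<open>\<Delta>V {}\<close> consists of the
    restrictions satisfying \<open>t\<close>; all other parts are measured against its mass.\<close>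
  define \<Delta>V where "\<Delta>V = (\<lambda>V. {\<rho> \<in> \<Delta>. (\<forall>i\<in>V. \<rho> i = None) \<and> (\<forall>i\<in>dom t - V. \<rho> i = t i)})"
  have inD: "\<rho> \<in> \<Delta>" if "\<rho> \<in> \<Delta>V V" for \<rho> V using that by (simp add: \<Delta>V_def)
  have inT: "\<rho> i = t i" if "\<rho> \<in> \<Delta>V V" "i \<in> dom t - V" for \<rho> V i
    using that unfolding \<Delta>V_def by blast
  have VI: "\<rho> \<in> \<Delta>V V" if "\<rho> \<in> \<Delta>" "\<And>i. i \<in> V \<Longrightarrow> \<rho> i = None" "\<And>i. i \<in> dom t - V \<Longrightarrow> \<rho> i = t i" for \<rho> V
    using that unfolding \<Delta>V_def by blast
  have stV: "stars t \<rho> = V" "\<not> falsified t \<rho>" if "\<rho> \<in> \<Delta>V V" "V \<subseteq> dom t" for \<rho> V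
  proof -
    have *: "i \<in> V" if "\<rho> i = None" "t i = Some y" for i y
    proof (rule ccontr)
      assume "i \<notin> V"
      then have "i \<in> dom t - V" using that by auto
      then have "\<rho> i = t i" using \<open>\<rho> \<in> \<Delta>V V\<close> unfolding \<Delta>V_def by blast
      then show False using that by simp
    qed
    have V: "\<rho> i = None" if "i \<in> V" for i using that \<open>\<rho> \<in> \<Delta>V V\<close> by (simp add: \<Delta>V_def)
    show "stars t \<rho> = V"
    proof (intro equalityI subsetI)
      fix i assume "i \<in> stars t \<rho>"
      then obtain y where "\<rho> i = None" "t i = Some y" by (auto simp: stars_def)
      then show "i \<in> V" by (rule *)
    next
      fix i assume "i \<in> V"
      then show "i \<in> stars t \<rho>" using V \<open>V \<subseteq> dom t\<close> unfolding stars_def by blast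
    qed
    show "\<not> falsified t \<rho>"
    proof
      assume "falsified t \<rho>"
      then obtain i where i: "i \<in> dom t" "\<rho> i \<noteq> None" "\<rho> i \<noteq> t i" unfolding falsified_def by blast
      have "i \<notin> V" using V[of i] i(2) by auto
      then have "i \<in> dom t - V" using i(1) by simp
      then show False using \<open>\<rho> \<in> \<Delta>V V\<close> i(3) unfolding \<Delta>V_def by blast
    qed
  qed
  have part: "\<Delta> = \<Delta>1 \<union> (\<Union>V\<in>Pow (dom t). \<Delta>V V)"
  proof -
    have "\<rho> \<in> \<Delta>V (stars t \<rho>)" if "\<rho> \<in> \<Delta>" "\<not> falsified t \<rho>" for \<rho>
    proof -
      have "\<rho> i = t i" if "i \<in> dom t - stars t \<rho>" for i
      proof -
        have "i \<in> dom t" "\<rho> i \<noteq> None" using that by (auto simp: stars_def)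
        then show ?thesis using \<open>\<not> falsified t \<rho>\<close> unfolding falsified_def by blast
      qed
      moreover have "\<rho> i = None" if "i \<in> stars t \<rho>" for i using that by (simp add: stars_def)
      ultimately show ?thesis using that(1) unfolding \<Delta>V_def by blast
    qed
    moreover have "stars t \<rho> \<subseteq> dom t" for \<rho> by (auto simp: stars_def)
    ultimately have "\<Delta> \<subseteq> \<Delta>1 \<union> (\<Union>V\<in>Pow (dom t). \<Delta>V V)" unfolding \<Delta>1_def by blast
    moreover have "\<Delta>1 \<union> (\<Union>V\<in>Pow (dom t). \<Delta>V V) \<subseteq> \<Delta>" unfolding \<Delta>1_def using inD by blast
    ultimately show ?thesis by blast
  qed
  have split: "(\<Sum>\<rho>\<in>\<Delta>. g \<rho>) = (\<Sum>\<rho>\<in>\<Delta>1. g \<rho>) + (\<Sum>V\<in>Pow (dom t). \<Sum>\<rho>\<in>\<Delta>V V. g \<rho>)" for g :: "_ \<Rightarrow> real"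
  proof -
    have fin: "finite (\<Delta>V V)" "finite \<Delta>1" for V using f\<Delta> by (auto simp: \<Delta>V_def \<Delta>1_def)
    have "(\<Sum>\<rho>\<in>\<Delta>. g \<rho>) = (\<Sum>\<rho>\<in>\<Delta>1. g \<rho>) + (\<Sum>\<rho>\<in>(\<Union>V\<in>Pow (dom t). \<Delta>V V). g \<rho>)"
    proof (rule trans[OF sum.cong[OF part refl] sum.union_disjoint])
      show "\<Delta>1 \<inter> (\<Union>V\<in>Pow (dom t). \<Delta>V V) = {}" using stV(2) by (auto simp: \<Delta>1_def)
    qed (use fin ft in auto)
    also have "(\<Sum>\<rho>\<in>(\<Union>V\<in>Pow (dom t). \<Delta>V V). g \<rho>) = (\<Sum>V\<in>Pow (dom t). \<Sum>\<rho>\<in>\<Delta>V V. g \<rho>)"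
    proof (rule sum.UNION_disjoint)
      show "\<forall>V\<in>Pow (dom t). \<forall>V'\<in>Pow (dom t). V \<noteq> V' \<longrightarrow> \<Delta>V V \<inter> \<Delta>V V' = {}"
        using stV(1) by blast
    qed (use fin ft in auto)
    finally show ?thesis .
  qed
  have m0: "mass p I (\<Delta>V {}) \<ge> 0" unfolding mass_def using p by (intro sum_nonneg restr_wt_nonneg) auto
  have e1: "mean_coeff_norm p I l \<Delta>1 h \<le> B * ?g * mass p I \<Delta>1"
  proof (rule Cons.IH)
    show "dclosed I \<Delta>1" unfolding dclosed_def
    proof (intro ballI allI impI)
      fix \<rho> i b assume a: "\<rho> \<in> \<Delta>1" "i \<in> I" "\<rho> i = None"
      then obtain j where j: "j \<in> dom t" "\<rho> j \<noteq> None" "\<rho> j \<noteq> t j" by (auto simp: \<Delta>1_def falsified_def)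
      then have "falsified t (\<rho>(i \<mapsto> b))" unfolding falsified_def using a(3) by (intro bexI[of _ j]) auto
      then show "\<rho>(i \<mapsto> b) \<in> \<Delta>1" using a Cons.prems(4) unfolding \<Delta>1_def dclosed_def by auto
    qed
    have "card (live \<Delta>1 I) \<le> card (live \<Delta> I)" using I by (intro card_mono) (auto simp: live_def \<Delta>1_def)
    then show "card (live \<Delta>1 I) \<le> L" using Cons.prems by simp
    show "fail r ts \<rho> x c" if "\<rho> \<in> \<Delta>1" "h \<rho> x \<noteq> 0" for \<rho> x
      using Cons.prems(7)[of \<rho> x] that by (auto simp: \<Delta>1_def)
    show "Q \<Delta>1 h" by (rule Qs) (auto simp: \<Delta>1_def)
    show "\<Delta>1 \<subseteq> restrs I" using Cons.prems(3) by (auto simp: \<Delta>1_def)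
  qed (use Cons.prems(1,6) in auto)
  have eV: "mean_coeff_norm p I l (\<Delta>V V) h \<le> (8 * p * \<theta>) ^ card V * (B * ?g * mass p I (\<Delta>V {}))"
    if V: "V \<subseteq> dom t" "V \<noteq> {}" for V
  proof (cases "\<Delta>V V = {}")
    case True
    then show ?thesis using B \<theta> p m0 by (simp add: mean_coeff_norm_def)
  next
    case False
    have VsubI: "V \<subseteq> I" and fV: "finite V" using V tI ft finite_subset by auto
    have nV: "\<rho> i = None" if "\<rho> \<in> \<Delta>V V" "i \<in> V" for \<rho> i using that unfolding \<Delta>V_def by blast
    let ?a = "\<lambda>A i. i \<in> (A :: nat set)"
    define \<Delta>A where "\<Delta>A = (\<lambda>a. fix_vars V a ` \<Delta>V V)"
    have inj: "inj_on (fix_vars V a) (\<Delta>V V)" for a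
    proof (rule inj_on_inverseI[of _ "unfix V"])
      fix \<rho> assume "\<rho> \<in> \<Delta>V V"
      then show "unfix V (fix_vars V a \<rho>) = \<rho>" using nV by (intro unfix_fix_vars)
    qed
    have massA: "mass p I (\<Delta>V V) = (2 * p / (1 - p)) ^ card V * mass p I (\<Delta>A a)" for a
      unfolding mass_def \<Delta>A_def sum.reindex[OF inj] sum_distrib_left o_def
      using p nV by (intro sum.cong refl restr_wt_fix_vars I VsubI) auto
    \<comment> \<open>The heart of the weighting: fixing \<open>V\<close> to the values demanded by
      \<open>t\<close> leads into \<open>\<Delta>V {}\<close>. The mass of
      \<open>\<Delta>A a\<close> does not depend on \<open>a\<close>, so this one choice bounds it
      for all answers to the queries.\<close>
    have "\<Delta>A (\<lambda>i. the (t i)) \<subseteq> \<Delta>V {}"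
    proof
      fix \<sigma> assume "\<sigma> \<in> \<Delta>A (\<lambda>i. the (t i))"
      then obtain \<rho> where \<rho>: "\<rho> \<in> \<Delta>V V" "\<sigma> = fix_vars V (\<lambda>i. the (t i)) \<rho>" by (auto simp: \<Delta>A_def)
      have "\<rho> \<in> \<Delta>" by (rule inD[OF \<rho>(1)])
      then have "\<sigma> \<in> \<Delta>" unfolding \<rho>(2) using nV[OF \<rho>(1)] by (intro dclosed_fix_vars[OF Cons.prems(4)] fV VsubI) auto
      moreover have "\<sigma> i = t i" if "i \<in> dom t" for i
      proof (cases "i \<in> V")
        case True
        then show ?thesis using that unfolding \<rho>(2) fix_vars_def by auto
      next
        case False
        then show ?thesis using inT[OF \<rho>(1), of i] that unfolding \<rho>(2) fix_vars_def by simp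
      qed
      ultimately show "\<sigma> \<in> \<Delta>V {}" by (intro VI) auto
    qed
    then have "mass p I (\<Delta>A (\<lambda>i. the (t i))) \<le> mass p I (\<Delta>V {})"
      using p f\<Delta> by (intro mass_mono) (auto simp: \<Delta>V_def)
    moreover have "mass p I (\<Delta>A a) = mass p I (\<Delta>A b)" for a b
      using massA[of a] massA[of b] p by simp
    ultimately have mA: "mass p I (\<Delta>A a) \<le> mass p I (\<Delta>V {})" for a by metis
    have eA: "mean_coeff_norm p I l (\<Delta>A a) (chg V a h) \<le> B * (\<theta> ^ (c + card V) / \<theta> ^ r) * mass p I (\<Delta>V {})" for a
    proof -
      have QA: "Q (\<Delta>A a) (chg V a h)"
      proof (rule Qc[OF Cons.prems(2) VsubI])
        fix \<rho>' assume "\<rho>' \<in> \<Delta>A a"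
        then obtain \<rho> where "\<rho> \<in> \<Delta>V V" "\<rho>' = fix_vars V a \<rho>" by (auto simp: \<Delta>A_def)
        then show "unfix V \<rho>' \<in> \<Delta> \<and> (\<forall>i\<in>V. \<rho>' i = Some (a i))"
          using unfix_fix_vars[of V \<rho> a] nV inD by (simp add: fix_vars_def)
      qed
      have rA: "\<Delta>A a \<subseteq> restrs I"
      proof
        fix \<rho>' assume "\<rho>' \<in> \<Delta>A a"
        then obtain \<rho> where "\<rho> \<in> \<Delta>V V" "\<rho>' = fix_vars V a \<rho>" by (auto simp: \<Delta>A_def)
        moreover from this have "\<rho> \<in> restrs I" using Cons.prems(3) inD by blast
        ultimately show "\<rho>' \<in> restrs I" using VsubI by (auto simp: restrs_def fix_vars_def dom_def subset_iff split: if_splits)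
      qed
      have dA: "dclosed I (\<Delta>A a)" unfolding dclosed_def
      proof (intro ballI allI impI)
        fix \<rho>' i b assume a': "\<rho>' \<in> \<Delta>A a" "i \<in> I" "\<rho>' i = None"
        then obtain \<rho> where \<rho>: "\<rho> \<in> \<Delta>V V" "\<rho>' = fix_vars V a \<rho>" by (auto simp: \<Delta>A_def)
        have iV: "i \<notin> V" "\<rho> i = None" using a'(3) \<rho> by (auto simp: fix_vars_def split: if_splits)
        have it: "i \<notin> dom t" 
        proof
          assume "i \<in> dom t"
          then have "i \<in> dom t - V" using iV by simp
          then have "\<rho> i = t i" by (rule inT[OF \<rho>(1)])
          then show False using iV \<open>i \<in> dom t\<close> by auto
        qed
        have "\<rho>(i \<mapsto> b) \<in> \<Delta>" using inD[OF \<rho>(1)] iV a'(2) Cons.prems(4) unfolding dclosed_def by blast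
        then have "\<rho>(i \<mapsto> b) \<in> \<Delta>V V"
        proof (rule VI)
          fix j assume "j \<in> V"
          then show "(\<rho>(i \<mapsto> b)) j = None" using nV[OF \<rho>(1)] iV by auto
        next
          fix j assume "j \<in> dom t - V"
          then show "(\<rho>(i \<mapsto> b)) j = t j" using inT[OF \<rho>(1)] it by auto
        qed
        moreover have "\<rho>'(i \<mapsto> b) = fix_vars V a (\<rho>(i \<mapsto> b))" using iV \<rho>(2) by (auto simp: fix_vars_def fun_eq_iff)
        ultimately show "\<rho>'(i \<mapsto> b) \<in> \<Delta>A a" by (auto simp: \<Delta>A_def)
      qed
      have "live (\<Delta>A a) I \<subset> live \<Delta> I"
      proof (rule psubsetI)
        show "live (\<Delta>A a) I \<subseteq> live \<Delta> I"
        proof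
          fix j assume "j \<in> live (\<Delta>A a) I"
          then obtain \<rho> where "j \<in> I" "\<rho> \<in> \<Delta>V V" "fix_vars V a \<rho> j = None" by (auto simp: live_def \<Delta>A_def)
          then have "\<rho> \<in> \<Delta>" "\<rho> j = None" using inD by (auto simp: fix_vars_def split: if_splits)
          then show "j \<in> live \<Delta> I" using \<open>j \<in> I\<close> unfolding live_def by blast
        qed
        obtain i \<rho> where "i \<in> V" "\<rho> \<in> \<Delta>V V" using V False by blast
        then have "i \<in> live \<Delta> I" using nV VsubI inD unfolding live_def by blast
        moreover have "i \<notin> live (\<Delta>A a) I" using \<open>i \<in> V\<close> by (auto simp: live_def \<Delta>A_def fix_vars_def)
        ultimately show "live (\<Delta>A a) I \<noteq> live \<Delta> I" by blast
      qed
      then have lA: "card (live (\<Delta>A a) I) < L"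
      proof -
        have "finite (live \<Delta> I)" using I by (simp add: live_def)
        then show ?thesis using psubset_card_mono[OF _ \<open>live (\<Delta>A a) I \<subset> live \<Delta> I\<close>] Cons.prems(5) by linarith
      qed
      \<comment> \<open>Within the depth limit the tree continues with the remaining terms and the
        counter raised by \<open>card V\<close>. Beyond it, the factor with \<open>\<theta>\<close>
        is at least 1 and the crude bound \<open>Qb\<close> applies, because the queried variables
        are no longer live.\<close>
      have "mean_coeff_norm p I l (\<Delta>A a) (chg V a h) \<le> B * (\<theta> ^ (c + card V) / \<theta> ^ r) * mass p I (\<Delta>A a)"
      proof (cases "c + card V \<le> r")
        case True
        show ?thesis
        proof (rule Cons.IH[OF _ QA rA dA _ True])
          fix \<rho>' x assume x: "\<rho>' \<in> \<Delta>A a" "chg V a h \<rho>' x \<noteq> 0"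
          then obtain \<rho> where \<rho>: "\<rho> \<in> \<Delta>V V" "\<rho>' = fix_vars V a \<rho>" by (auto simp: \<Delta>A_def)
          have "h \<rho> (put V a x) \<noteq> 0" using x(2) unfolding chg_def \<rho>(2) using unfix_fix_vars[OF nV[OF \<rho>(1)]] by simp
          then have "fail r (t # ts) \<rho> (put V a x) c" using Cons.prems(7) inD[OF \<rho>(1)] by blast
          then have "fail r ts (fix_vars V (put V a x) \<rho>) (put V a x) (c + card V)"
            using stV[OF \<rho>(1) V(1)] True by auto
          moreover have "fix_vars V (put V a x) \<rho> = \<rho>'" unfolding \<rho>(2) by (auto simp: fix_vars_def put_def fun_eq_iff)
          ultimately have "fail r ts \<rho>' (put V a x) (c + card V)" by simp
          moreover have "fail r ts \<rho>' (put V a x) (c + card V) = fail r ts \<rho>' x (c + card V)"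
            by (rule fail_cong) (auto simp: \<rho>(2) fix_vars_def put_def split: if_splits)
          ultimately show "fail r ts \<rho>' x (c + card V)" by simp
        qed (use Cons.prems(1) lA in auto)
      next
        case False
        then have "\<theta> ^ r \<le> \<theta> ^ (c + card V)" using \<theta> by (intro power_increasing) auto
        then have "1 \<le> \<theta> ^ (c + card V) / \<theta> ^ r" using \<theta> by simp
        then have "B * 1 * mass p I (\<Delta>A a) \<le> B * (\<theta> ^ (c + card V) / \<theta> ^ r) * mass p I (\<Delta>A a)"
          using B p by (intro mult_right_mono mult_left_mono) (auto simp: mass_def intro!: sum_nonneg restr_wt_nonneg)
        then show ?thesis using Qb[OF QA rA dA lA] by simp
      qed
      also have "\<dots> \<le> B * (\<theta> ^ (c + card V) / \<theta> ^ r) * mass p I (\<Delta>V {})"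
        using B \<theta> mA by (intro mult_left_mono) auto
      finally show ?thesis .
    qed
    \<comment> \<open>Each queried variable contributes \<open>u\<close> from
      \<open>coeff_norm_query_set\<close>, 2 from its answers, \<open>q\<close> from the change of
      weight and \<open>\<theta>\<close> from the counter; with \<open>q \<le> 4 * p\<close> and
      \<open>u \<le> 1\<close> this is at most \<open>8 * p * \<theta>\<close>.\<close>
    define q :: real where "q = 2 * p / (1 - p)"
    define u :: real where "u = (1 + l) / 2"
    have q4: "0 \<le> q" "q \<le> 4 * p" and u1: "0 \<le> u" "u \<le> 1" using p l by (auto simp: field_simps q_def u_def)
    have "mean_coeff_norm p I l (\<Delta>V V) h \<le> (\<Sum>\<rho>\<in>\<Delta>V V. restr_wt p I \<rho> * ((u) ^ card V *
        (\<Sum>A\<in>Pow V. coeff_norm I (\<lambda>_. 0) (\<lambda>_. l) (\<lambda>x. h \<rho> (put V (?a A) x)))))"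
      unfolding mean_coeff_norm_def u_def using p l by (intro sum_mono mult_left_mono coeff_norm_query_set I VsubI restr_wt_nonneg) auto
    also have "\<dots> = (u) ^ card V *
        (\<Sum>A\<in>Pow V. \<Sum>\<rho>\<in>\<Delta>V V. restr_wt p I \<rho> * coeff_norm I (\<lambda>_. 0) (\<lambda>_. l) (\<lambda>x. h \<rho> (put V (?a A) x)))"
      by (subst sum.swap) (simp add: sum_distrib_left mult_ac)
    also have "\<dots> = (u) ^ card V * (\<Sum>A\<in>Pow V. q ^ card V * mean_coeff_norm p I l (\<Delta>A (?a A)) (chg V (?a A) h))"
    proof (intro arg_cong2[where f="(*)"] refl sum.cong)
      fix A
      show "(\<Sum>\<rho>\<in>\<Delta>V V. restr_wt p I \<rho> * coeff_norm I (\<lambda>_. 0) (\<lambda>_. l) (\<lambda>x. h \<rho> (put V (?a A) x))) =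
          q ^ card V * mean_coeff_norm p I l (\<Delta>A (?a A)) (chg V (?a A) h)"
        unfolding mean_coeff_norm_def \<Delta>A_def sum.reindex[OF inj] sum_distrib_left
      proof (intro sum.cong refl)
        fix \<rho> assume \<rho>: "\<rho> \<in> \<Delta>V V"
        have "restr_wt p I \<rho> = q ^ card V * restr_wt p I (fix_vars V (?a A) \<rho>)"
          unfolding q_def using p nV[OF \<rho>] by (intro restr_wt_fix_vars I VsubI) auto
        then show "restr_wt p I \<rho> * coeff_norm I (\<lambda>_. 0) (\<lambda>_. l) (\<lambda>x. h \<rho> (put V (?a A) x)) =
          q ^ card V * ((\<lambda>\<rho>. restr_wt p I \<rho> * coeff_norm I (\<lambda>_. 0) (\<lambda>_. l) (chg V (?a A) h \<rho>)) \<circ> fix_vars V (?a A)) \<rho>"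
          using unfix_fix_vars[OF nV[OF \<rho>]] by (simp add: chg_def)
      qed
    qed
    also have "\<dots> \<le> (u) ^ card V * (\<Sum>A\<in>Pow V. q ^ card V * (B * (\<theta> ^ (c + card V) / \<theta> ^ r) * mass p I (\<Delta>V {})))"
      using u1 q4 by (intro mult_left_mono sum_mono eA) auto
    also have "\<dots> = (u * 2 * q * \<theta>) ^ card V * (B * ?g * mass p I (\<Delta>V {}))"
      using fV by (simp add: card_Pow power_mult_distrib power_add mult_ac)
    also have "\<dots> \<le> (8 * p * \<theta>) ^ card V * (B * ?g * mass p I (\<Delta>V {}))"
    proof (rule mult_right_mono[OF power_mono])
      have "u * 2 * q * \<theta> \<le> 2 * (4 * p) * \<theta>"
        using u1 q4 \<theta> by (intro mult_right_mono mult_mono) auto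
      then show "u * 2 * q * \<theta> \<le> 8 * p * \<theta>" by simp
    qed (use u1 q4 \<theta> B m0 in auto)
    finally show ?thesis .
  qed
  \<comment> \<open>The term is satisfied without any query: the tree stops here, and it cannot fail
    because \<open>c \<le> r\<close>.\<close>
  have e0: "mean_coeff_norm p I l (\<Delta>V {}) h = 0"
  proof -
    have "h \<rho> x = 0" if "\<rho> \<in> \<Delta>V {}" for \<rho> x
    proof (rule ccontr)
      assume "h \<rho> x \<noteq> 0"
      then have "fail r (t # ts) \<rho> x c" using Cons.prems(7) inD[OF that] by blast
      then show False using stV[OF that] Cons.prems(6) by auto
    qed
    then have "\<And>\<rho>. \<rho> \<in> \<Delta>V {} \<Longrightarrow> h \<rho> = (\<lambda>x. 0)" by (intro ext)
    then show ?thesis unfolding mean_coeff_norm_def by (intro sum.neutral) (simp add: coeff_norm_zero)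
  qed
  have "(\<Sum>V\<in>Pow (dom t). mean_coeff_norm p I l (\<Delta>V V) h) = (\<Sum>V\<in>Pow (dom t) - {{}}. mean_coeff_norm p I l (\<Delta>V V) h)"
    using ft e0 by (subst sum.remove[of _ "{}"]) auto
  also have "\<dots> \<le> (\<Sum>V\<in>Pow (dom t) - {{}}. (8 * p * \<theta>) ^ card V * (B * ?g * mass p I (\<Delta>V {})))"
    by (intro sum_mono eV) auto
  also have "\<dots> = ((1 + 8 * p * \<theta>) ^ card (dom t) - 1) * (B * ?g * mass p I (\<Delta>V {}))"
    unfolding sum_distrib_right[symmetric] sum_Pow_power_card[OF ft, symmetric]
    using ft by (subst (2) sum.remove[of _ "{}"]) auto
  also have "\<dots> \<le> 1 * (B * ?g * mass p I (\<Delta>V {}))"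
  proof (rule mult_right_mono)
    have "(1 + 8 * p * \<theta>) ^ card (dom t) \<le> (1 + 8 * p * \<theta>) ^ w"
      using p \<theta> tw by (intro power_increasing) auto
    then show "(1 + 8 * p * \<theta>) ^ card (dom t) - 1 \<le> 1" using w by simp
  qed (use B \<theta> m0 in auto)
  finally have e2: "(\<Sum>V\<in>Pow (dom t). mean_coeff_norm p I l (\<Delta>V V) h) \<le> B * ?g * mass p I (\<Delta>V {})" by simp
  \<comment> \<open>The falsified part is bounded by its own mass and everything else by the mass of
    the satisfying part. These two are disjoint, so passing to the next term loses nothing.\<close>
  have "mass p I \<Delta>1 + mass p I (\<Delta>V {}) \<le> mass p I \<Delta>"
  proof -
    have "mass p I (\<Delta>V {}) \<le> (\<Sum>V\<in>Pow (dom t). mass p I (\<Delta>V V))"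
      using ft p by (intro member_le_sum) (auto simp: mass_def intro!: sum_nonneg restr_wt_nonneg)
    then show ?thesis using split[of "restr_wt p I"] by (simp add: mass_def)
  qed
  then have "B * ?g * (mass p I \<Delta>1 + mass p I (\<Delta>V {})) \<le> B * ?g * mass p I \<Delta>"
    using B \<theta> by (intro mult_left_mono) auto
  moreover have "mean_coeff_norm p I l \<Delta> h = mean_coeff_norm p I l \<Delta>1 h + (\<Sum>V\<in>Pow (dom t). mean_coeff_norm p I l (\<Delta>V V) h)"
    unfolding mean_coeff_norm_def by (rule split)
  ultimately show ?case using e1 e2 by (simp add: distrib_left)
qed

lemma mean_coeff_norm_triangle:
  assumes "finite I" "0 \<le> p" "p \<le> 1" "0 \<le> l"
  shows "mean_coeff_norm p I l \<Delta> (\<lambda>\<rho> x. f \<rho> x + g \<rho> x) \<le> mean_coeff_norm p I l \<Delta> f + mean_coeff_norm p I l \<Delta> g"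
  unfolding mean_coeff_norm_def sum.distrib[symmetric] distrib_left[symmetric]
  using assms by (intro sum_mono mult_left_mono coeff_norm_triangle restr_wt_nonneg) auto

lemma mean_coeff_norm_uminus: "mean_coeff_norm p I l \<Delta> (\<lambda>\<rho> x. - f \<rho> x) = mean_coeff_norm p I l \<Delta> f"
  unfolding mean_coeff_norm_def by (simp add: coeff_norm_uminus)

definition chg_closed :: "nat set \<Rightarrow> ((nat \<rightharpoonup> bool) set \<Rightarrow> family \<Rightarrow> bool) \<Rightarrow> bool" where
  "chg_closed I Q \<longleftrightarrow> (\<forall>\<Delta> h V a \<Delta>'. Q \<Delta> h \<longrightarrow> V \<subseteq> I \<longrightarrow>
     (\<forall>\<rho>\<in>\<Delta>'. unfix V \<rho> \<in> \<Delta> \<and> (\<forall>i\<in>V. \<rho> i = Some (a i))) \<longrightarrow> Q \<Delta>' (chg V a h))"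

text \<open>Replacing a gate by its clipped tree changes \<open>h\<close> only where the tree fails, and there the norm is
  bounded by the same statement for fewer live variables; this gives a fixed-point inequality for
  the constant instead of an error term depending on the number of inputs.\<close>

lemma gate_switch:
  assumes p: "0 < p" "p \<le> 1 / 2" and l: "0 \<le> l" "l \<le> 1" and \<theta>: "\<theta> \<ge> 1"
    and w: "(1 + 8 * p * \<theta>) ^ w \<le> 2" and I: "finite I" and K: "K \<ge> 0"
    and c0: "chg_closed I Q0" and c1: "chg_closed I Q1"
    and step: "\<And>\<Delta> h. Q0 \<Delta> h \<Longrightarrow> \<exists>ts h1. (\<forall>t\<in>set ts. dom t \<subseteq> I \<and> card (dom t) \<le> w) \<and> Q1 \<Delta> h1 \<and>
       (\<forall>\<rho>\<in>\<Delta>. \<forall>x. h \<rho> x \<noteq> h1 \<rho> x \<longrightarrow> fail r ts \<rho> x 0)"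
    and b1: "\<And>\<Delta> h. Q1 \<Delta> h \<Longrightarrow> \<Delta> \<subseteq> restrs I \<Longrightarrow> dclosed I \<Delta> \<Longrightarrow> mean_coeff_norm p I l \<Delta> h \<le> K * mass p I \<Delta>"
    and \<delta>: "1 / \<theta> ^ r \<le> \<delta>" "\<delta> < 1"
    and "Q0 \<Delta> h" "\<Delta> \<subseteq> restrs I" "dclosed I \<Delta>"
  shows "mean_coeff_norm p I l \<Delta> h \<le> (1 + \<delta>) / (1 - \<delta>) * K * mass p I \<Delta>"
  using assms(15-)
proof (induction "card (live \<Delta> I)" arbitrary: \<Delta> h rule: less_induct)
  case less
  \<comment> \<open>The solution of \<open>\<alpha> = 1 + (\<alpha> + 1) * \<delta>\<close>, for
    which the bound reproduces itself.\<close>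
  define \<alpha> where "\<alpha> = (1 + \<delta>) / (1 - \<delta>)"
  have \<delta>0: "\<delta> \<ge> 0" using \<delta>(1) \<theta> by (meson divide_nonneg_nonneg dual_order.trans zero_le_one zero_le_power)
  have \<alpha>: "\<alpha> \<ge> 0" using \<delta> \<delta>0 by (simp add: \<alpha>_def)
  have m0: "mass p I \<Delta> \<ge> 0" for \<Delta> unfolding mass_def using p by (intro sum_nonneg restr_wt_nonneg) auto
  \<comment> \<open>\<open>long_paths\<close> is applied to differences of a member of
    \<open>Q0\<close> and a member of \<open>Q1\<close>. For fewer live variables their norm is at
    most \<open>\<alpha> * K + K\<close>, by the induction hypothesis and \<open>b1\<close>.\<close>
  define Q where "Q = (\<lambda>\<Delta> g. \<exists>h h1. Q0 \<Delta> h \<and> Q1 \<Delta> h1 \<and> g = (\<lambda>\<rho> x. h \<rho> x + - h1 \<rho> x))"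
  obtain ts h1 where ts: "\<And>t. t \<in> set ts \<Longrightarrow> dom t \<subseteq> I \<and> card (dom t) \<le> w" and h1: "Q1 \<Delta> h1"
    and f: "\<And>\<rho> x. \<rho> \<in> \<Delta> \<Longrightarrow> h \<rho> x \<noteq> h1 \<rho> x \<Longrightarrow> fail r ts \<rho> x 0"
    using step[OF less.prems(1)] by blast
  have diff: "mean_coeff_norm p I l \<Delta> (\<lambda>\<rho> x. h \<rho> x + - h1 \<rho> x) \<le> (\<alpha> * K + K) * (\<theta> ^ 0 / \<theta> ^ r) * mass p I \<Delta>"
  proof (rule long_paths[where Q = Q and L = "card (live \<Delta> I)" and w = w and ts = ts and c = 0 and r = r and \<theta> = \<theta>
        and B = "\<alpha> * K + K" and h = "\<lambda>\<rho> x. h \<rho> x + - h1 \<rho> x" and \<Delta> = \<Delta> and p = p and l = l and I = I])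
    show "Q \<Delta>' (chg V a g)" if "Q \<Delta>'' g" "V \<subseteq> I"
      "\<And>\<rho>. \<rho> \<in> \<Delta>' \<Longrightarrow> unfix V \<rho> \<in> \<Delta>'' \<and> (\<forall>i\<in>V. \<rho> i = Some (a i))" for \<Delta>'' g V a \<Delta>'
    proof -
      obtain h h1 where hh: "Q0 \<Delta>'' h" "Q1 \<Delta>'' h1" "g = (\<lambda>\<rho> x. h \<rho> x + - h1 \<rho> x)"
        using \<open>Q \<Delta>'' g\<close> unfolding Q_def by blast
      have "Q0 \<Delta>' (chg V a h)" "Q1 \<Delta>' (chg V a h1)"
        by (rule c0[unfolded chg_closed_def, rule_format, OF hh(1) that(2,3)]
            c1[unfolded chg_closed_def, rule_format, OF hh(2) that(2,3)], assumption)+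
      moreover have "chg V a g = (\<lambda>\<rho> x. chg V a h \<rho> x + - chg V a h1 \<rho> x)" by (simp add: hh(3) chg_def)
      ultimately show ?thesis unfolding Q_def by blast
    qed
    show "mean_coeff_norm p I l \<Delta>' g \<le> (\<alpha> * K + K) * mass p I \<Delta>'" if "Q \<Delta>' g" "\<Delta>' \<subseteq> restrs I" "dclosed I \<Delta>'"
      "card (live \<Delta>' I) < card (live \<Delta> I)" for \<Delta>' g
    proof -
      obtain h h1 where hh: "Q0 \<Delta>' h" "Q1 \<Delta>' h1" "g = (\<lambda>\<rho> x. h \<rho> x + - h1 \<rho> x)"
        using \<open>Q \<Delta>' g\<close> unfolding Q_def by blast
      have "mean_coeff_norm p I l \<Delta>' g \<le> mean_coeff_norm p I l \<Delta>' h + mean_coeff_norm p I l \<Delta>' (\<lambda>\<rho> x. - h1 \<rho> x)"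
        unfolding hh(3) using I p l by (intro mean_coeff_norm_triangle) auto
      also have "\<dots> \<le> \<alpha> * K * mass p I \<Delta>' + K * mass p I \<Delta>'"
        unfolding mean_coeff_norm_uminus \<alpha>_def using hh that by (intro add_mono less.hyps b1) auto
      finally show ?thesis by (simp add: distrib_right)
    qed
    show "Q \<Delta> (\<lambda>\<rho> x. h \<rho> x + - h1 \<rho> x)" unfolding Q_def using less.prems(1) h1 by blast
    show "fail r ts \<rho> x 0" if "\<rho> \<in> \<Delta>" "h \<rho> x + - h1 \<rho> x \<noteq> 0" for \<rho> x
      using f that by auto
  qed (use p l \<theta> w I K \<alpha> ts less.prems in auto)
  have "mean_coeff_norm p I l \<Delta> h = mean_coeff_norm p I l \<Delta> (\<lambda>\<rho> x. h1 \<rho> x + (h \<rho> x + - h1 \<rho> x))" by simp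
  also have "\<dots> \<le> mean_coeff_norm p I l \<Delta> h1 + mean_coeff_norm p I l \<Delta> (\<lambda>\<rho> x. h \<rho> x + - h1 \<rho> x)"
    using I p l by (intro mean_coeff_norm_triangle) auto
  also have "\<dots> \<le> K * mass p I \<Delta> + (\<alpha> * K + K) * \<delta> * mass p I \<Delta>"
  proof (rule add_mono)
    show "mean_coeff_norm p I l \<Delta> h1 \<le> K * mass p I \<Delta>" using h1 less.prems by (intro b1) auto
    have "(\<alpha> * K + K) * (\<theta> ^ 0 / \<theta> ^ r) * mass p I \<Delta> \<le> (\<alpha> * K + K) * \<delta> * mass p I \<Delta>"
      using \<delta> \<alpha> K m0 by (intro mult_right_mono mult_left_mono) auto
    then show "mean_coeff_norm p I l \<Delta> (\<lambda>\<rho> x. h \<rho> x + - h1 \<rho> x) \<le> (\<alpha> * K + K) * \<delta> * mass p I \<Delta>"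
      using diff by simp
  qed
  also have "\<dots> = (1 + (\<alpha> + 1) * \<delta>) * K * mass p I \<Delta>" by (simp add: algebra_simps)
  also have "1 + (\<alpha> + 1) * \<delta> = \<alpha>" using \<delta> unfolding \<alpha>_def by (simp add: field_simps)
  finally show ?case by (simp add: \<alpha>_def)
qed

section \<open>Bounded-depth circuits\<close>

text \<open>A semantic notion: a class of functions indexed by a depth bound rather than a datatype.
  A path may query a variable twice, which makes closure under substitutions a direct
  induction.\<close>

inductive dec_tree :: "nat set \<Rightarrow> nat \<Rightarrow> ((nat \<Rightarrow> bool) \<Rightarrow> bool) \<Rightarrow> bool" for I where
  dec_tree_const: "dec_tree I n (\<lambda>_. b)"
| dec_tree_node: "i \<in> I \<Longrightarrow> dec_tree I n (\<lambda>x. f (x(i := True))) \<Longrightarrow> dec_tree I n (\<lambda>x. f (x(i := False))) \<Longrightarrow> dec_tree I (Suc n) f"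

lemma dec_tree_mono: "dec_tree I n f \<Longrightarrow> n \<le> n' \<Longrightarrow> dec_tree I n' f"
proof (induction n f arbitrary: n' rule: dec_tree.induct)
  case (dec_tree_node i n f)
  then obtain k where "n' = Suc k" "n \<le> k" by (cases n') auto
  then show ?case using dec_tree_node by (auto intro: dec_tree.dec_tree_node)
qed (rule dec_tree_const)

lemma dec_tree_not: "dec_tree I n f \<Longrightarrow> dec_tree I n (\<lambda>x. \<not> f x)"
  by (induction n f rule: dec_tree.induct) (auto intro: dec_tree.intros)

lemma dec_tree_put: "dec_tree I n f \<Longrightarrow> dec_tree I n (\<lambda>x. f (put V a x))"
proof (induction n f rule: dec_tree.induct)
  case (dec_tree_node i n f)
  show ?case
  proof (cases "i \<in> V")
    case True
    have "(\<lambda>x. f ((put V a x)(i := a i))) = (\<lambda>x. f (put V a x))"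
      using True by (intro ext arg_cong[where f=f]) (auto simp: put_def fun_eq_iff)
    then have "dec_tree I n (\<lambda>x. f (put V a x))" using dec_tree_node.IH by (cases "a i") auto
    then show ?thesis by (rule dec_tree_mono) simp
  next
    case False
    have "(put V a x)(i := b) = put V a (x(i := b))" for x b using False by (auto simp: put_def fun_eq_iff)
    then have "(\<lambda>x. f ((put V a x)(i := b))) = (\<lambda>x. f (put V a (x(i := b))))" for b by (simp only:)
    then show ?thesis using dec_tree_node.IH by (intro dec_tree.dec_tree_node[OF dec_tree_node.hyps(1)]) (simp_all only:)
  qed
qed (rule dec_tree_const)

lemma comb_put: "comb \<rho> x = put (dom \<rho>) (\<lambda>i. the (\<rho> i)) x"
  by (auto simp: comb_def put_def fun_eq_iff split: option.splits)

lemma dec_tree_comb: "dec_tree I n f \<Longrightarrow> dec_tree I n (\<lambda>x. f (comb \<rho> x))"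
  unfolding comb_put by (rule dec_tree_put)

lemma dec_tree_var: "i \<in> I \<Longrightarrow> dec_tree I (Suc 0) (\<lambda>x. x i)"
  by (intro dec_tree.dec_tree_node[of i]) (auto intro: dec_tree_const)

lemma dec_tree_query_set:
  assumes "finite V" "V \<subseteq> I" "\<And>a. dec_tree I n (\<lambda>x. f (put V a x))"
  shows "dec_tree I (n + card V) f"
  using assms
proof (induction V arbitrary: f rule: finite_induct)
  case (insert i V)
  have e: "(put V a x)(i := b) = put (insert i V) (a(i := b)) x" for a x b
    using insert(2) by (auto simp: put_def fun_eq_iff)
  have "dec_tree I (n + card V) (\<lambda>x. f (x(i := b)))" for b
    using insert.prems by (intro insert.IH) (auto simp: e simp del: fun_upd_apply)
  then show ?case using insert by (auto intro!: dec_tree.dec_tree_node[of i])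
qed simp

lemma clip_dec_tree:
  assumes "\<And>t. t \<in> set ts \<Longrightarrow> dom t \<subseteq> I" "finite I" "c \<le> r"
  shows "dec_tree I (r - c) (\<lambda>x. clip r ts \<rho> x c)"
  using assms
proof (induction ts arbitrary: \<rho> c)
  case Nil
  then show ?case by (simp add: dec_tree_const)
next
  case (Cons t ts)
  let ?V = "stars t \<rho>"
  have V: "?V \<subseteq> I" using Cons.prems(1)[of t] by (auto simp: stars_def)
  then have fV: "finite ?V" using Cons.prems(2) finite_subset by blast
  consider "falsified t \<rho>" | "\<not> falsified t \<rho>" "c + card ?V > r" | "\<not> falsified t \<rho>" "c + card ?V \<le> r" by linarith
  then show ?case
  proof cases
    case 1
    then show ?thesis using Cons by auto
  next
    case 2
    then have "(\<lambda>x. clip r (t # ts) \<rho> x c) = (\<lambda>x. False)" by auto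
    then show ?thesis by (simp only: dec_tree_const)
  next
    case 3
    have "dec_tree I (r - (c + card ?V)) (\<lambda>x. clip r (t # ts) \<rho> (put ?V a x) c)" for a
    proof (cases "\<forall>i\<in>?V. t i = Some (a i)")
      case True
      then have "(\<lambda>x. clip r (t # ts) \<rho> (put ?V a x) c) = (\<lambda>x. True)" using 3 by (auto simp: put_def)
      then show ?thesis by (simp only: dec_tree_const)
    next
      case False
      have f: "fix_vars ?V (put ?V a x) \<rho> = fix_vars ?V a \<rho>" for x by (auto simp: fix_vars_def put_def fun_eq_iff)
      have "(\<lambda>x. clip r (t # ts) \<rho> (put ?V a x) c) =
          (\<lambda>x. clip r ts (fix_vars ?V a \<rho>) (put ?V a x) (c + card ?V))"
        using 3 False by (auto simp: f fun_eq_iff) (auto simp: put_def)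
      moreover have "dec_tree I (r - (c + card ?V)) (\<lambda>x. clip r ts (fix_vars ?V a \<rho>) (put ?V a x) (c + card ?V))"
        using Cons 3 by (intro dec_tree_put Cons.IH) auto
      ultimately show ?thesis by simp
    qed
    then have "dec_tree I (r - (c + card ?V) + card ?V) (\<lambda>x. clip r (t # ts) \<rho> x c)"
      by (intro dec_tree_query_set V fV)
    then show ?thesis by (rule dec_tree_mono) (use 3 in auto)
  qed
qed

definition terms_ok :: "nat set \<Rightarrow> nat \<Rightarrow> (nat \<rightharpoonup> bool) list \<Rightarrow> bool" where
  "terms_ok I w ts \<longleftrightarrow> (\<forall>t\<in>set ts. dom t \<subseteq> I \<and> card (dom t) \<le> w)"

lemma terms_ok_append: "terms_ok I w (ts @ us) \<longleftrightarrow> terms_ok I w ts \<and> terms_ok I w us"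
  unfolding terms_ok_def set_append ball_Un ..

text \<open>One term for each accepting path, hence width at most the depth.\<close>

lemma dec_tree_dnf:
  assumes "finite I" "dec_tree I n f"
  shows "\<exists>ts. terms_ok I n ts \<and> (\<forall>x. f x = dnf ts x)"
  using assms(2)
proof (induction n f rule: dec_tree.induct)
  case (dec_tree_const n b)
  show ?case
  proof (cases b)
    case True
    then show ?thesis by (intro exI[of _ "[Map.empty]"]) (auto simp: terms_ok_def dnf_def)
  next
    case False
    then show ?thesis by (intro exI[of _ "[]"]) (auto simp: terms_ok_def dnf_def)
  qed
next
  case (dec_tree_node i n f)
  obtain ts1 where t1: "terms_ok I n ts1" "\<And>x. f (x(i := True)) = dnf ts1 x" using dec_tree_node.IH(1) by blast
  obtain ts0 where t0: "terms_ok I n ts0" "\<And>x. f (x(i := False)) = dnf ts0 x" using dec_tree_node.IH(2) by blast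
  \<comment> \<open>Adds the literal \<open>x i = b\<close> to every term. A term containing the
    opposite literal, possible since a subtree may query \<open>i\<close> again, is dropped.\<close>
  define e where "e = (\<lambda>b ts. map (\<lambda>t. t(i \<mapsto> b)) (filter (\<lambda>t. t i \<noteq> Some (\<not> b)) ts) :: (nat \<rightharpoonup> bool) list)"
  have ed: "dnf (e b ts) x \<longleftrightarrow> x i = b \<and> dnf ts x" for b ts x
  proof
    assume "dnf (e b ts) x"
    then obtain t where t: "t \<in> set ts" "t i \<noteq> Some (\<not> b)" "\<forall>j\<in>dom (t(i \<mapsto> b)). (t(i \<mapsto> b)) j = Some (x j)"
      by (auto simp: dnf_def e_def simp del: fun_upd_apply dom_fun_upd)
    have "(t(i \<mapsto> b)) i = Some (x i)" using t(3) by (rule bspec) simp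
    then have xi: "x i = b" by simp
    have "t j = Some (x j)" if "j \<in> dom t" for j
    proof (cases "j = i")
      case True
      then show ?thesis using that t(2) xi by (cases b) auto
    next
      case False
      have "(t(i \<mapsto> b)) j = Some (x j)" using t(3) by (rule bspec) (use that in auto)
      then show ?thesis using False by simp
    qed
    then show "x i = b \<and> dnf ts x" using xi t(1) by (auto simp: dnf_def)
  next
    assume a: "x i = b \<and> dnf ts x"
    then obtain t where t: "t \<in> set ts" "\<forall>j\<in>dom t. t j = Some (x j)" by (auto simp: dnf_def)
    have "t i \<noteq> Some (\<not> b)"
    proof
      assume ti: "t i = Some (\<not> b)"
      then have "t i = Some (x i)" using t(2) by (intro bspec[OF t(2)]) auto
      then show False using ti a by simp
    qed
    then have "t(i \<mapsto> b) \<in> set (e b ts)" using t(1) by (auto simp: e_def)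
    moreover have "\<forall>j\<in>dom (t(i \<mapsto> b)). (t(i \<mapsto> b)) j = Some (x j)"
    proof
      fix j assume "j \<in> dom (t(i \<mapsto> b))"
      then show "(t(i \<mapsto> b)) j = Some (x j)" using bspec[OF t(2), of j] a by (cases "j = i") auto
    qed
    ultimately show "dnf (e b ts) x" unfolding dnf_def by blast
  qed
  have eo: "terms_ok I (Suc n) (e b ts)" if "terms_ok I n ts" for b ts
    unfolding terms_ok_def
  proof
    fix s assume "s \<in> set (e b ts)"
    then obtain t where t: "t \<in> set ts" "s = t(i \<mapsto> b)" by (auto simp: e_def)
    then have "dom t \<subseteq> I" "card (dom t) \<le> n" using that by (auto simp: terms_ok_def)
    moreover have "dom s = insert i (dom t)" using t by auto
    moreover have "card (insert i (dom t)) \<le> Suc (card (dom t))" by (rule card_insert_le_m1) auto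
    ultimately show "dom s \<subseteq> I \<and> card (dom s) \<le> Suc n" using dec_tree_node.hyps(1) by auto
  qed
  show ?case
  proof (intro exI conjI allI)
    show "terms_ok I (Suc n) (e True ts1 @ e False ts0)" unfolding terms_ok_append using eo[OF t1(1)] eo[OF t0(1)] by blast
    fix x
    have "dnf (e True ts1 @ e False ts0) x \<longleftrightarrow> dnf (e True ts1) x \<or> dnf (e False ts0) x" by (auto simp: dnf_def)
    also have "\<dots> \<longleftrightarrow> f (x(i := x i))" unfolding ed t1(2)[symmetric] t0(2)[symmetric] by (cases "x i") auto
    finally show "f x = dnf (e True ts1 @ e False ts0) x" by simp
  qed
qed

lemma dec_tree_Or_dnf:
  assumes "finite I" "finite J" "\<And>j. j \<in> J \<Longrightarrow> dec_tree I n (g j)"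
  shows "\<exists>ts. terms_ok I n ts \<and> (\<forall>x. (\<exists>j\<in>J. g j x) = dnf ts x)"
  using assms(2,3)
proof (induction J rule: finite_induct)
  case empty
  then show ?case by (intro exI[of _ "[]"]) (auto simp: terms_ok_def dnf_def)
next
  case (insert j J)
  obtain ts where ts: "terms_ok I n ts" "\<And>x. (\<exists>j\<in>J. g j x) = dnf ts x" using insert by auto
  obtain ts' where ts': "terms_ok I n ts'" "\<And>x. g j x = dnf ts' x" using dec_tree_dnf[OF assms(1)] insert.prems by blast
  have "dnf (ts' @ ts) x = (dnf ts' x \<or> dnf ts x)" for x by (auto simp: dnf_def)
  then show ?case using ts ts' by (intro exI[of _ "ts' @ ts"]) (simp add: terms_ok_append)
qed

lemma coeff_norm_const:
  assumes "finite I"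
  shows "coeff_norm I (\<lambda>_. 0) l (\<lambda>_. c) = \<bar>c\<bar>"
  using assms
proof (induction I rule: finite_induct)
  case empty
  show ?case by (simp add: coeff_norm_def mlin_coeff_def)
next
  case (insert i J)
  then show ?case using coeff_norm_upd[OF insert(1,2), of "\<lambda>_. 0" l "\<lambda>_. c" True] by (simp add: coeff_norm_def)
qed

lemma dec_tree_coeff_norm:
  assumes "finite I" "l \<ge> 0" "dec_tree I n f"
  shows "coeff_norm I (\<lambda>_. 0) (\<lambda>_. l) (\<lambda>x. sg (f x)) \<le> (1 + l) ^ n"
  using assms(3)
proof (induction n f rule: dec_tree.induct)
  case (dec_tree_const n b)
  then show ?case using assms by (simp add: coeff_norm_const sg_def)
next
  case (dec_tree_node i n f)
  have "coeff_norm I (\<lambda>_. 0) (\<lambda>_. l) (\<lambda>x. sg (f x)) \<le> (1 + l) / 2 * (coeff_norm I (\<lambda>_. 0) (\<lambda>_. l) (\<lambda>x. sg (f (x(i := False))))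
      + coeff_norm I (\<lambda>_. 0) (\<lambda>_. l) (\<lambda>x. sg (f (x(i := True)))))"
    using assms dec_tree_node.hyps(1) by (intro coeff_norm_query) auto
  also have "\<dots> \<le> (1 + l) / 2 * ((1 + l) ^ n + (1 + l) ^ n)"
    using dec_tree_node.IH assms by (intro mult_left_mono add_mono) auto
  finally show ?case by simp
qed

section \<open>Evaluating a circuit with some gates replaced by prescribed values\<close>

definition build :: "('b list \<Rightarrow> 'a \<Rightarrow> 'b) \<Rightarrow> 'a list \<Rightarrow> 'b list" where
  "build F C = foldl (\<lambda>vs g. vs @ [F vs g]) [] C"

lemma build_snoc: "build F (C @ [g]) = build F C @ [F (build F C) g]"
  by (simp add: build_def)

lemma length_build [simp]: "length (build F C) = length C"
  by (induction C rule: rev_induct) (simp add: build_def, simp add: build_snoc)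

lemma nth_build: "i < length C \<Longrightarrow> build F C ! i = F (take i (build F C)) (C ! i)"
  by (induction C rule: rev_induct) (auto simp: build_snoc nth_append less_Suc_eq)

text \<open>Evaluation of a circuit in which the gates in the domain of \<open>O'\<close> are overridden.\<close>

definition ovstep :: "(nat \<rightharpoonup> bool) \<Rightarrow> bool list \<Rightarrow> gate \<Rightarrow> bool" where
  "ovstep O' vs g = (case O' (length vs) of Some b \<Rightarrow> b | None \<Rightarrow> gate_value (\<lambda>_. False) vs g)"

locale wf_circ =
  fixes m :: nat and C :: circuit
  assumes wf: "wf_circuit m C"
begin

abbreviation "len \<equiv> length C"
definition "dep = build gate_depth C"
definition "val x = build (gate_value x) C"
definition "evl O' = build (ovstep O') C"

lemma wfg: "i < len \<Longrightarrow> wf_gate m i (C ! i)" using wf by (auto simp: wf_circuit_def)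
lemma C_ne: "C \<noteq> []" using wf by (auto simp: wf_circuit_def)

lemma gate_value_take:
  "wf_gate m i g \<Longrightarrow> i \<le> length vs \<Longrightarrow> gate_value x (take i vs) g = gate_value x vs g"
  by (cases g) (auto simp: subset_iff)

lemma gate_depth_take:
  assumes "wf_gate m i g" "i \<le> length vs"
  shows "gate_depth (take i vs) g = gate_depth vs g"
proof -
  have "(!) (take i vs) ` J = (!) vs ` J" if "J \<subseteq> {..<i}" for J
    using that assms(2) by (intro image_cong) auto
  then show ?thesis using assms by (cases g) auto
qed

lemma val_nth: "i < len \<Longrightarrow> val x ! i = gate_value x (val x) (C ! i)"
  unfolding val_def by (subst nth_build) (auto intro!: gate_value_take wfg)

lemma dep_nth: "i < len \<Longrightarrow> dep ! i = gate_depth dep (C ! i)"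
  unfolding dep_def by (subst nth_build) (auto intro!: gate_depth_take wfg)

lemma ev_nth: "i < len \<Longrightarrow> evl O' ! i = (case O' i of Some b \<Rightarrow> b | None \<Rightarrow> gate_value (\<lambda>_. False) (evl O') (C ! i))"
  unfolding evl_def by (subst nth_build) (auto simp: ovstep_def split: option.split intro!: gate_value_take wfg)

lemma length_ev [simp]: "length (evl O') = len" by (simp add: evl_def)
lemma length_val [simp]: "length (val x) = len" by (simp add: val_def)
lemma length_dep [simp]: "length dep = len" by (simp add: dep_def)

lemma gate_value_cong:
  assumes "wf_gate m i g" "\<And>j. j < i \<Longrightarrow> vs ! j = us ! j" "\<And>v. g \<noteq> InputG v"
  shows "gate_value x vs g = gate_value y us g"
  using assms by (cases g) (auto simp: subset_iff)

lemma dep_child: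
  assumes "i < len"
  shows "C ! i = NotG j \<Longrightarrow> dep ! j = dep ! i \<and> j < i"
    and "C ! i = AndG J \<or> C ! i = OrG J \<Longrightarrow> J \<subseteq> {..<i} \<and> (\<forall>j\<in>J. dep ! j < dep ! i)"
proof -
  show "dep ! j = dep ! i \<and> j < i" if "C ! i = NotG j"
    using dep_nth[OF assms] wfg[OF assms] that by simp
  assume a: "C ! i = AndG J \<or> C ! i = OrG J"
  then have J: "J \<subseteq> {..<i}" using wfg[OF assms] by auto
  then have "finite J" using finite_subset by blast
  then have "dep ! j \<le> Max (insert 0 ((!) dep ` J))" if "j \<in> J" for j using that by (intro Max_ge) auto
  then show "J \<subseteq> {..<i} \<and> (\<forall>j\<in>J. dep ! j < dep ! i)" using dep_nth[OF assms] a J by (auto simp: less_Suc_eq_le)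
qed

text \<open>Overriding further gates by the values that they have anyway changes nothing. This is
  how a gate is exchanged for a tree that agrees with it, and how a finished level is absorbed into
  the gates of small depth.\<close>

lemma ev_override:
  assumes "\<And>i. i < len \<Longrightarrow> O1 i = None \<Longrightarrow> O2 i = None"
    and "\<And>i b. i < len \<Longrightarrow> O1 i = Some b \<Longrightarrow> b = evl O2 ! i"
    and inp: "\<And>i v. i < len \<Longrightarrow> C ! i = InputG v \<Longrightarrow> O1 i \<noteq> None"
  shows "evl O1 = evl O2"
proof (rule nth_equalityI)
  have "evl O1 ! i = evl O2 ! i" if "i < len" for i
    using that
  proof (induction i rule: less_induct)
    case (less i)
    show ?case
    proof (cases "O1 i")
      case None
      have "gate_value (\<lambda>_. False) (evl O1) (C ! i) = gate_value (\<lambda>_. False) (evl O2) (C ! i)"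
        using less inp[OF less.prems] None by (intro gate_value_cong[OF wfg]) auto
      then show ?thesis using None assms(1)[OF less.prems None] less.prems by (simp add: ev_nth)
    next
      case (Some b)
      then show ?thesis using assms(2)[OF less.prems Some] less.prems by (simp add: ev_nth)
    qed
  qed
  then show "\<And>i. i < length (evl O1) \<Longrightarrow> evl O1 ! i = evl O2 ! i" by simp
qed simp

lemma dep_input: "i < len \<Longrightarrow> C ! i = InputG v \<Longrightarrow> dep ! i = 0"
  using dep_nth[of i] by simp

definition cov :: "nat \<Rightarrow> (nat \<Rightarrow> bool) \<Rightarrow> nat \<rightharpoonup> bool" where
  "cov e b i = (if i < len \<and> dep ! i \<le> e then Some (b i) else None)"

text \<open>The circuit with all gates of depth at most \<open>e\<close> replaced by decision trees of depth \<open>w\<close>.\<close>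

definition tree_class :: "nat set \<Rightarrow> nat \<Rightarrow> nat \<Rightarrow> ((nat \<Rightarrow> bool) \<Rightarrow> real) \<Rightarrow> bool" where
  "tree_class I e w f \<longleftrightarrow> (\<exists>\<phi>. (\<forall>i<len. dep ! i \<le> e \<longrightarrow> dec_tree I w (\<phi> i)) \<and>
     f = (\<lambda>x. sg (last (evl (cov e (\<lambda>i. \<phi> i x))))))"

definition Ext :: "nat \<Rightarrow> nat set \<Rightarrow> (nat \<Rightarrow> bool) \<Rightarrow> (nat \<Rightarrow> bool) \<Rightarrow> nat \<rightharpoonup> bool" where
  "Ext e S b g = (\<lambda>i. if i < len \<and> dep ! i \<le> e then Some (b i) else if i \<in> S then Some (g i) else None)"

text \<open>The intermediate stage in which, in addition, the gates in \<open>S\<close> have become trees of depth \<open>r\<close>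
  that depend on the restriction.\<close>

definition Q :: "nat set \<Rightarrow> nat \<Rightarrow> nat \<Rightarrow> (nat \<Rightarrow> (nat \<Rightarrow> bool) \<Rightarrow> bool) \<Rightarrow> nat set \<Rightarrow> (nat \<rightharpoonup> bool) set \<Rightarrow> family \<Rightarrow> bool" where
  "Q I e r \<phi> S \<Delta> h \<longleftrightarrow> (\<exists>G. (\<forall>\<rho>\<in>\<Delta>. \<forall>i\<in>S. dec_tree I r (\<lambda>x. G \<rho> x i)) \<and>
     (\<forall>\<rho>\<in>\<Delta>. \<forall>x. h \<rho> x = sg (last (evl (Ext e S (\<lambda>i. \<phi> i (comb \<rho> x)) (G \<rho> x))))))"

text \<open>Only the counted gates of a level are switched. The other gates of depth
  \<open>Suc e\<close> are negations and inherit the tree of their argument.\<close>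

definition lev :: "nat \<Rightarrow> nat set" where "lev e = {i. i < len \<and> counted_gate (C ! i) \<and> dep ! i = Suc e}"

lemma finite_lev: "finite (lev e)" by (auto simp: lev_def)

lemma card_lev: "card (lev e) \<le> circuit_size C"
proof -
  have "card (lev e) \<le> card {i. i < len \<and> counted_gate (C ! i)}" by (rule card_mono) (auto simp: lev_def)
  then show ?thesis by (simp add: circuit_size_def length_filter_conv_card)
qed

lemma comb_unfix_put: "(\<forall>i\<in>V. \<rho> i = Some (a i)) \<Longrightarrow> comb (unfix V \<rho>) (put V a x) = comb \<rho> x"
  by (auto simp: comb_def unfix_def put_def fun_eq_iff split: option.splits)

text \<open>The trees \<open>\<phi>\<close> see the assignment only through \<open>comb\<close>,
  which \<open>chg\<close> preserves; the trees \<open>G\<close> undergo a substitution, which keeps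
  their depth.\<close>

lemma Q_closed: "chg_closed I (Q I' e r \<phi> S)"
  unfolding chg_closed_def
proof (intro allI impI)
  fix \<Delta> h V a \<Delta>'
  assume q: "Q I' e r \<phi> S \<Delta> h" and V: "V \<subseteq> I" and D: "\<forall>\<rho>\<in>\<Delta>'. unfix V \<rho> \<in> \<Delta> \<and> (\<forall>i\<in>V. \<rho> i = Some (a i))"
  obtain G where G: "\<And>\<rho> i. \<rho> \<in> \<Delta> \<Longrightarrow> i \<in> S \<Longrightarrow> dec_tree I' r (\<lambda>x. G \<rho> x i)"
    "\<And>\<rho> x. \<rho> \<in> \<Delta> \<Longrightarrow> h \<rho> x = sg (last (evl (Ext e S (\<lambda>i. \<phi> i (comb \<rho> x)) (G \<rho> x))))"
    using q unfolding Q_def by blast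
  show "Q I' e r \<phi> S \<Delta>' (chg V a h)"
    unfolding Q_def
  proof (intro exI[of _ "\<lambda>\<rho> x. G (unfix V \<rho>) (put V a x)"] conjI ballI allI)
    fix \<rho> i assume "\<rho> \<in> \<Delta>'" "i \<in> S"
    then show "dec_tree I' r (\<lambda>x. G (unfix V \<rho>) (put V a x) i)" using G(1)[of "unfix V \<rho>" i] D by (intro dec_tree_put) auto
  next
    fix \<rho> x assume r: "\<rho> \<in> \<Delta>'"
    have "comb (unfix V \<rho>) (put V a x) = comb \<rho> x" using D r by (intro comb_unfix_put) auto
    then show "chg V a h \<rho> x = sg (last (evl (Ext e S (\<lambda>i. \<phi> i (comb \<rho> x)) (G (unfix V \<rho>) (put V a x)))))"
      unfolding chg_def using G(2)[of "unfix V \<rho>" "put V a x"] D r by simp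
  qed
qed

text \<open>A disjunction of trees is a DNF of the same width; a conjunction is the negation of one
  by De Morgan, recorded in \<open>pos\<close>.\<close>

lemma gate_dnf:
  assumes "finite I" "\<And>j. j < len \<Longrightarrow> dep ! j \<le> e \<Longrightarrow> dec_tree I w (\<phi> j)" "i \<in> lev e"
  shows "\<exists>ts pos. terms_ok I w ts \<and> (\<forall>y vs. (\<forall>j<i. dep ! j \<le> e \<longrightarrow> vs ! j = \<phi> j y) \<longrightarrow>
      gate_value (\<lambda>_. False) vs (C ! i) = (dnf ts y = pos))"
proof -
  have i: "i < len" "dep ! i = Suc e" "counted_gate (C ! i)" using assms(3) by (auto simp: lev_def)
  obtain J where J: "C ! i = AndG J \<or> C ! i = OrG J" using i(3) by (cases "C ! i") auto
  have Ji: "J \<subseteq> {..<i}" and Jd: "\<And>j. j \<in> J \<Longrightarrow> dep ! j \<le> e" using dep_child(2)[OF i(1) J] i(2) by (auto simp: less_Suc_eq_le)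
  have fJ: "finite J" using Ji finite_subset by blast
  have dtJ: "dec_tree I w (\<phi> j)" if "j \<in> J" for j using that Ji Jd i(1) by (intro assms(2)) auto
  show ?thesis
  proof (cases "C ! i = OrG J")
    case True
    obtain ts where ts: "terms_ok I w ts" "\<And>y. (\<exists>j\<in>J. \<phi> j y) = dnf ts y"
      using dec_tree_Or_dnf[OF assms(1) fJ, of w \<phi>] dtJ by blast
    show ?thesis using ts(1) Ji Jd
      by (intro exI[of _ ts] exI[of _ True] conjI) (auto simp: True ts(2)[symmetric] subset_iff)
  next
    case False
    then have A: "C ! i = AndG J" using J by auto
    obtain ts where ts: "terms_ok I w ts" "\<And>y. (\<exists>j\<in>J. \<not> \<phi> j y) = dnf ts y"
      using dec_tree_Or_dnf[OF assms(1) fJ, of w "\<lambda>j y. \<not> \<phi> j y"] dtJ dec_tree_not by blast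
    show ?thesis using ts(1) Ji Jd
      by (intro exI[of _ ts] exI[of _ False] conjI) (auto simp: A ts(2)[symmetric] subset_iff)
  qed
qed

text \<open>A restriction with star probability 1/(48 w) turns each gate of the next level, up to
  negation a DNF of width \<open>w\<close>, into a tree of depth \<open>r\<close> at the price of a
  factor \<open>1 + 3 * \<delta>\<close> with \<open>\<delta> = 1 / 3 ^ r\<close>. With at most
  \<open>3 ^ r\<close> gates the total factor stays below \<open>exp 3\<close>.\<close>

lemma stage:
  assumes I: "finite I" and wr: "w \<le> r" and r: "r \<ge> 1" "w \<ge> 1" and l: "0 \<le> l" "l \<le> 1" and M: "M \<ge> 0"
    and size: "circuit_size C \<le> 3 ^ r"
    and next_stage: "\<And>f. tree_class I (Suc e) r f \<Longrightarrow> coeff_norm I (\<lambda>_. 0) (\<lambda>_. l) f \<le> M"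
    and f: "tree_class I e w f"
  shows "coeff_norm I (\<lambda>_. 0) (\<lambda>_. 1 / (48 * real w) * l) f \<le> exp 3 * M"
proof -
  \<comment> \<open>With \<open>\<theta> = 3\<close> the width condition becomes (1 + 1/(2 w))^w
    \<le> exp (1/2) \<le> 2.\<close>
  define p :: real where "p = 1 / (48 * real w)"
  have p: "0 < p" "p \<le> 1 / 2" using r by (auto simp: p_def field_simps)
  have pw: "(1 + 8 * p * 3) ^ w \<le> 2"
  proof -
    have "(1 + 8 * p * 3) ^ w \<le> exp (8 * p * 3) ^ w" using p by (intro power_mono exp_ge_add_one_self) auto
    also have "\<dots> = exp (real w * (8 * p * 3))" by (simp add: exp_of_nat_mult)
    also have "real w * (8 * p * 3) = 1 / 2" using r by (simp add: p_def)
    also have "exp (1 / 2 :: real) \<le> 2" by (rule order_trans[OF exp_half_le2]) simp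
    finally show ?thesis .
  qed
  obtain \<phi> where \<phi>: "\<And>i. i < len \<Longrightarrow> dep ! i \<le> e \<Longrightarrow> dec_tree I w (\<phi> i)"
    and fe: "f = (\<lambda>x. sg (last (evl (cov e (\<lambda>i. \<phi> i x)))))" using f unfolding tree_class_def by blast
  define \<delta> :: real where "\<delta> = 1 / 3 ^ r"
  have \<delta>: "0 < \<delta>" "\<delta> \<le> 1 / 3"
  proof -
    have "(3::real) ^ 1 \<le> 3 ^ r" using r by (intro power_increasing) auto
    then show "0 < \<delta>" "\<delta> \<le> 1 / 3" by (auto simp: \<delta>_def field_simps)
  qed
  define \<alpha> where "\<alpha> = (1 + \<delta>) / (1 - \<delta>)"
  have \<alpha>: "0 \<le> \<alpha>" "\<alpha> \<le> 1 + 3 * \<delta>"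
  proof -
    show "0 \<le> \<alpha>" using \<delta> by (simp add: \<alpha>_def)
    have "\<delta> * \<delta> * 3 \<le> 1 * \<delta>" using \<delta> by (simp add: field_simps)
    then show "\<alpha> \<le> 1 + 3 * \<delta>" using \<delta> by (simp add: \<alpha>_def field_simps)
  qed
  \<comment> \<open>\<open>R\<close> contains the gates of the level that are not yet trees; adding
    one gate to it costs one factor \<open>\<alpha>\<close> by \<open>gate_switch\<close>.\<close>
  have bound: "\<forall>\<Delta> h. Q I e r \<phi> (lev e - R) \<Delta> h \<longrightarrow> \<Delta> \<subseteq> restrs I \<longrightarrow> dclosed I \<Delta> \<longrightarrow>
      mean_coeff_norm p I l \<Delta> h \<le> (\<alpha> ^ card R * M) * mass p I \<Delta>"
    if "finite R" "R \<subseteq> lev e" for R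
    using that
  proof (induction R rule: finite_induct)
    case empty
    show ?case
    proof (intro allI impI)
      fix \<Delta> h assume "Q I e r \<phi> (lev e - {}) \<Delta> h" and \<Delta>: "\<Delta> \<subseteq> restrs I" "dclosed I \<Delta>"
      then obtain G where G: "\<And>\<rho> i. \<rho> \<in> \<Delta> \<Longrightarrow> i \<in> lev e \<Longrightarrow> dec_tree I r (\<lambda>x. G \<rho> x i)"
        "\<And>\<rho> x. \<rho> \<in> \<Delta> \<Longrightarrow> h \<rho> x = sg (last (evl (Ext e (lev e) (\<lambda>i. \<phi> i (comb \<rho> x)) (G \<rho> x))))"
        unfolding Q_def Diff_empty by blast
      have "coeff_norm I (\<lambda>_. 0) (\<lambda>_. l) (h \<rho>) \<le> M" if \<rho>: "\<rho> \<in> \<Delta>" for \<rho>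
      proof (rule next_stage)
        \<comment> \<open>All counted gates of the level are trees now. For fixed
          \<open>\<rho>\<close> every gate of depth at most \<open>Suc e\<close> then computes a
          tree of depth \<open>r\<close>, which is the class handled by
          \<open>next_stage\<close>.\<close>
        define E where "E = (\<lambda>x. evl (Ext e (lev e) (\<lambda>i. \<phi> i (comb \<rho> x)) (G \<rho> x)))"
        have E: "E x ! i = (case Ext e (lev e) (\<lambda>i. \<phi> i (comb \<rho> x)) (G \<rho> x) i of Some b \<Rightarrow> b
            | None \<Rightarrow> gate_value (\<lambda>_. False) (E x) (C ! i))" if "i < len" for i x
          unfolding E_def by (rule ev_nth[OF that])
        have d: "dec_tree I r (\<lambda>x. E x ! i)" if "i < len" "dep ! i \<le> Suc e" for i
          using that
        proof (induction i rule: less_induct)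
          case (less i)
          consider "dep ! i \<le> e" | "dep ! i = Suc e" "i \<in> lev e" | "dep ! i = Suc e" "i \<notin> lev e"
            using less.prems by linarith
          then show ?case
          proof cases
            case 1
            then have "(\<lambda>x. E x ! i) = (\<lambda>x. \<phi> i (comb \<rho> x))" using less.prems by (simp add: E Ext_def)
            then show ?thesis using dec_tree_comb[OF dec_tree_mono[OF \<phi>[OF less.prems(1) 1] wr]] by simp
          next
            case 2
            then have "(\<lambda>x. E x ! i) = (\<lambda>x. G \<rho> x i)" using less.prems by (simp add: E Ext_def)
            then show ?thesis using G(1)[OF \<rho> 2(2)] by simp
          next
            case 3
            then have nc: "\<not> counted_gate (C ! i)" using less.prems by (auto simp: lev_def)
            moreover have "C ! i \<noteq> InputG v" for v using dep_input[OF less.prems(1)] 3(1) by auto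
            ultimately obtain j where j: "C ! i = NotG j" by (cases "C ! i") auto
            have jj: "dep ! j = Suc e" "j < i" using dep_child(1)[OF less.prems(1) j] 3(1) by auto
            have "(\<lambda>x. E x ! i) = (\<lambda>x. \<not> E x ! j)" using less.prems(1) 3 j by (simp add: E Ext_def)
            moreover have "dec_tree I r (\<lambda>x. E x ! j)" using less.IH[of j] jj less.prems(1) by auto
            ultimately show ?thesis using dec_tree_not by simp
          qed
        qed
        have o: "evl (cov (Suc e) (\<lambda>i. E x ! i)) = E x" for x
          unfolding E_def
          by (rule ev_override) (auto simp: cov_def Ext_def lev_def split: if_splits dest: dep_input)
        have "h \<rho> = (\<lambda>x. sg (last (evl (cov (Suc e) (\<lambda>i. E x ! i)))))"
          unfolding o using G(2)[OF \<rho>] by (simp add: E_def fun_eq_iff)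
        then show "tree_class I (Suc e) r (h \<rho>)" unfolding tree_class_def using d by (intro exI[of _ "\<lambda>i x. E x ! i"]) auto
      qed
      then have "mean_coeff_norm p I l \<Delta> h \<le> (\<Sum>\<rho>\<in>\<Delta>. restr_wt p I \<rho> * M)"
        unfolding mean_coeff_norm_def using p by (intro sum_mono mult_left_mono restr_wt_nonneg) auto
      then show "mean_coeff_norm p I l \<Delta> h \<le> (\<alpha> ^ card {} * M) * mass p I \<Delta>"
        by (simp add: mass_def sum_distrib_left mult.commute)
    qed
  next
    case (insert i R)
    have il: "i \<in> lev e" and IH: "\<And>\<Delta> h. Q I e r \<phi> (lev e - R) \<Delta> h \<Longrightarrow> \<Delta> \<subseteq> restrs I \<Longrightarrow> dclosed I \<Delta> \<Longrightarrow>
        mean_coeff_norm p I l \<Delta> h \<le> (\<alpha> ^ card R * M) * mass p I \<Delta>" using insert by auto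
    have i: "i < len" "dep ! i = Suc e" using il by (auto simp: lev_def)
    let ?S = "lev e - insert i R"
    have S: "lev e - R = insert i ?S" "i \<notin> ?S" using insert(2) il by auto
    obtain ts pos where ts: "terms_ok I w ts" and gv: "\<And>y vs. (\<forall>j<i. dep ! j \<le> e \<longrightarrow> vs ! j = \<phi> j y) \<Longrightarrow>
        gate_value (\<lambda>_. False) vs (C ! i) = (dnf ts y = pos)"
      using gate_dnf[of I e w \<phi> i, OF I \<phi> il] by blast
    show ?case
    proof (intro allI impI)
      fix \<Delta> h assume Qh: "Q I e r \<phi> ?S \<Delta> h" and \<Delta>: "\<Delta> \<subseteq> restrs I" "dclosed I \<Delta>"
      have "mean_coeff_norm p I l \<Delta> h \<le> (1 + \<delta>) / (1 - \<delta>) * (\<alpha> ^ card R * M) * mass p I \<Delta>"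
      proof (rule gate_switch[where ?Q0.0 = "Q I e r \<phi> ?S" and ?Q1.0 = "Q I e r \<phi> (lev e - R)" and w = w and r = r and \<theta> = 3])
        fix \<Delta> h assume "Q I e r \<phi> ?S \<Delta> h"
        then obtain G where G: "\<And>\<rho> i. \<rho> \<in> \<Delta> \<Longrightarrow> i \<in> ?S \<Longrightarrow> dec_tree I r (\<lambda>x. G \<rho> x i)"
          "\<And>\<rho> x. \<rho> \<in> \<Delta> \<Longrightarrow> h \<rho> x = sg (last (evl (Ext e ?S (\<lambda>i. \<phi> i (comb \<rho> x)) (G \<rho> x))))"
          unfolding Q_def by blast
        define G' where "G' = (\<lambda>\<rho> x. (G \<rho> x)(i := (clip r ts \<rho> x 0 = pos)))"
        define h1 where "h1 = (\<lambda>\<rho> x. sg (last (evl (Ext e (lev e - R) (\<lambda>i. \<phi> i (comb \<rho> x)) (G' \<rho> x)))))"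
        have "dec_tree I r (\<lambda>x. clip r ts \<rho> x 0 = pos)" for \<rho>
        proof -
          have "dec_tree I r (\<lambda>x. clip r ts \<rho> x 0)" using clip_dec_tree[of ts I 0 r \<rho>] ts I by (auto simp: terms_ok_def)
          then show ?thesis using dec_tree_not by (cases pos) auto
        qed
        then have "Q I e r \<phi> (lev e - R) \<Delta> h1"
          unfolding Q_def h1_def S(1) using G(1) by (intro exI[of _ G']) (auto simp: G'_def)
        moreover have "h \<rho> x = h1 \<rho> x" if \<rho>: "\<rho> \<in> \<Delta>" and nf: "\<not> fail r ts \<rho> x 0" for \<rho> x
        proof -
          let ?O2 = "Ext e ?S (\<lambda>i. \<phi> i (comb \<rho> x)) (G \<rho> x)"
          have n2: "?O2 i = None" using i by (simp add: Ext_def)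
          have "evl ?O2 ! j = \<phi> j (comb \<rho> x)" if "j < i" "dep ! j \<le> e" for j
            using that i by (simp add: ev_nth Ext_def)
          then have v: "evl ?O2 ! i = (dnf ts (comb \<rho> x) = pos)"
            using gv[of "evl ?O2" "comb \<rho> x"] i n2 by (simp add: ev_nth)
          have "evl (Ext e (lev e - R) (\<lambda>i. \<phi> i (comb \<rho> x)) (G' \<rho> x)) = evl ?O2"
          proof (rule ev_override)
            fix j b assume j: "j < len" "Ext e (lev e - R) (\<lambda>i. \<phi> i (comb \<rho> x)) (G' \<rho> x) j = Some b"
            show "b = evl ?O2 ! j"
            proof (cases "j = i")
              case True
              then show ?thesis using j i il insert(2) v clip_eq_dnf[OF nf] by (simp add: Ext_def G'_def)
            next
              case False
              then have "?O2 j = Some b" using j(2) S(1) by (auto simp: Ext_def G'_def split: if_splits)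
              then show ?thesis using j(1) by (simp add: ev_nth)
            qed
          qed (auto simp: Ext_def S(1) split: if_splits dest: dep_input)
          then show ?thesis using G(2)[OF \<rho>] by (simp add: h1_def)
        qed
        ultimately show "\<exists>ts h1. (\<forall>t\<in>set ts. dom t \<subseteq> I \<and> card (dom t) \<le> w) \<and> Q I e r \<phi> (lev e - R) \<Delta> h1 \<and>
            (\<forall>\<rho>\<in>\<Delta>. \<forall>x. h \<rho> x \<noteq> h1 \<rho> x \<longrightarrow> fail r ts \<rho> x 0)"
          using ts unfolding terms_ok_def by blast
      qed (use p l pw I M \<alpha> \<delta> IH Qh \<Delta> in \<open>auto simp: Q_closed \<delta>_def[symmetric]\<close>)
      then show "mean_coeff_norm p I l \<Delta> h \<le> (\<alpha> ^ card (insert i R) * M) * mass p I \<Delta>"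
        using insert(1,2) by (simp add: \<alpha>_def)
    qed
  qed
  have Q0: "Q I e r \<phi> (lev e - lev e) (restrs I) (\<lambda>\<rho> x. f (comb \<rho> x))"
  proof -
    have "Ext e {} b g = cov e b" for b g by (auto simp: Ext_def cov_def fun_eq_iff)
    then show ?thesis unfolding Q_def fe by simp
  qed
  have dcl: "dclosed I (restrs I)" by (auto simp: dclosed_def restrs_def)
  have "coeff_norm I (\<lambda>_. 0) (\<lambda>_. p * l) f \<le> mean_coeff_norm p I l (restrs I) (\<lambda>\<rho> x. f (comb \<rho> x))"
    unfolding mean_coeff_norm_def using p l I by (intro coeff_norm_restrict) auto
  also have "\<dots> \<le> (\<alpha> ^ card (lev e) * M) * mass p I (restrs I)"
    using bound[OF finite_lev order_refl] Q0 dcl by blast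
  also have "mass p I (restrs I) = 1" unfolding mass_def by (rule restr_wt_sum[OF I])
  also have "\<alpha> ^ card (lev e) * M * 1 \<le> exp 3 * M"
  proof -
    have "\<alpha> ^ card (lev e) \<le> exp (3 * \<delta>) ^ card (lev e)"
      using \<alpha> order_trans[OF \<alpha>(2) exp_ge_add_one_self[of "3 * \<delta>"]] by (intro power_mono) auto
    also have "\<dots> = exp (real (card (lev e)) * (3 * \<delta>))" by (simp add: exp_of_nat_mult)
    also have "\<dots> \<le> exp 3"
    proof -
      have "card (lev e) \<le> 3 ^ r" using card_lev[of e] size by simp
      then have "real (card (lev e)) \<le> real (3 ^ r)" by (rule of_nat_mono)
      then have "real (card (lev e)) \<le> 3 ^ r" by simp
      then have "real (card (lev e)) * (3 * \<delta>) \<le> 3 ^ r * (3 * \<delta>)" using \<delta> by (intro mult_right_mono) auto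
      also have "\<dots> = 3" by (simp add: \<delta>_def)
      finally show ?thesis by simp
    qed
    finally have "\<alpha> ^ card (lev e) * M \<le> exp 3 * M" using M by (intro mult_right_mono)
    then show ?thesis by simp
  qed
  finally show ?thesis unfolding p_def .
qed

lemma last_ev: "last (evl O') = evl O' ! (len - 1)" 
proof -
  have "evl O' \<noteq> []" using C_ne length_ev[of O'] by force
  then show ?thesis by (simp add: last_conv_nth)
qed

text \<open>The output is a DNF of width \<open>w\<close> up to negation. Clipping its tree at depth
  1 is enough: such trees have norm at most 2 at weight 1, and \<open>\<delta> = 1 / 3\<close> only
  doubles this.\<close>

lemma final_stage:
  assumes I: "finite I" and w: "w \<ge> 1" and d: "dep ! (len - 1) \<le> Suc e" and f: "tree_class I e w f"
  shows "coeff_norm I (\<lambda>_. 0) (\<lambda>_. 1 / (48 * real w)) f \<le> 4"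
proof -
  define p :: real where "p = 1 / (48 * real w)"
  have p: "0 < p" "p \<le> 1 / 2" using w by (auto simp: p_def field_simps)
  have pw: "(1 + 8 * p * 3) ^ w \<le> 2"
  proof -
    have "(1 + 8 * p * 3) ^ w \<le> exp (8 * p * 3) ^ w" using p by (intro power_mono exp_ge_add_one_self) auto
    also have "\<dots> = exp (real w * (8 * p * 3))" by (simp add: exp_of_nat_mult)
    also have "real w * (8 * p * 3) = 1 / 2" using w by (simp add: p_def)
    also have "exp (1 / 2 :: real) \<le> 2" by (rule order_trans[OF exp_half_le2]) simp
    finally show ?thesis .
  qed
  obtain \<phi> where \<phi>: "\<And>i. i < len \<Longrightarrow> dep ! i \<le> e \<Longrightarrow> dec_tree I w (\<phi> i)"
    and fe: "f = (\<lambda>x. sg (last (evl (cov e (\<lambda>i. \<phi> i x)))))" using f unfolding tree_class_def by blast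
  have "\<exists>ts pos. terms_ok I w ts \<and> (\<forall>x. evl (cov e (\<lambda>i. \<phi> i x)) ! i = (dnf ts x = pos))"
    if "i < len" "dep ! i \<le> Suc e" for i
    using that
  proof (induction i rule: less_induct)
    case (less i)
    show ?case
    proof (cases "dep ! i \<le> e")
      case True
      obtain ts where "terms_ok I w ts" "\<And>x. \<phi> i x = dnf ts x"
        using dec_tree_dnf[OF I \<phi>[OF less.prems(1) True]] by blast
      then show ?thesis using less.prems True
        by (intro exI[of _ ts] exI[of _ True]) (simp add: ev_nth cov_def)
    next
      case False
      then have n: "cov e b i = None" for b by (simp add: cov_def)
      have di: "dep ! i = Suc e" using False less.prems by simp
      show ?thesis
      proof (cases "i \<in> lev e")
        case True
        obtain ts pos where ts: "terms_ok I w ts" and gv: "\<And>y vs. (\<forall>j<i. dep ! j \<le> e \<longrightarrow> vs ! j = \<phi> j y) \<Longrightarrow>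
            gate_value (\<lambda>_. False) vs (C ! i) = (dnf ts y = pos)"
          using gate_dnf[of I e w \<phi> i, OF I \<phi> True] by blast
        have "evl (cov e (\<lambda>i. \<phi> i x)) ! j = \<phi> j x" if "j < i" "dep ! j \<le> e" for j x
          using that less.prems by (simp add: ev_nth cov_def)
        then show ?thesis using ts gv n less.prems(1)
          by (intro exI[of _ ts] exI[of _ pos]) (simp add: ev_nth)
      next
        case nl: False
        then have "\<not> counted_gate (C ! i)" using less.prems di by (auto simp: lev_def)
        moreover have "C ! i \<noteq> InputG v" for v using dep_input[OF less.prems(1)] di by auto
        ultimately obtain j where j: "C ! i = NotG j" by (cases "C ! i") auto
        have jj: "dep ! j = Suc e" "j < i" using dep_child(1)[OF less.prems(1) j] di by auto
        obtain ts pos where "terms_ok I w ts" "\<And>x. evl (cov e (\<lambda>i. \<phi> i x)) ! j = (dnf ts x = pos)"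
          using less.IH[of j] jj less.prems(1) by auto
        then show ?thesis using n less.prems(1) j
          by (intro exI[of _ ts] exI[of _ "\<not> pos"]) (auto simp: ev_nth)
      qed
    qed
  qed
  moreover have "len - 1 < len" using C_ne by simp
  ultimately obtain ts pos where ts: "terms_ok I w ts"
    and v: "\<And>x. evl (cov e (\<lambda>i. \<phi> i x)) ! (len - 1) = (dnf ts x = pos)"
    using d by blast
  have fd: "f = (\<lambda>x. sg (dnf ts x = pos))" unfolding fe last_ev v ..
  define Q0 :: "(nat \<rightharpoonup> bool) set \<Rightarrow> family \<Rightarrow> bool"
    where "Q0 = (\<lambda>\<Delta> h. \<forall>\<rho>\<in>\<Delta>. \<forall>x. h \<rho> x = sg (dnf ts (comb \<rho> x) = pos))"
  define Q1 :: "(nat \<rightharpoonup> bool) set \<Rightarrow> family \<Rightarrow> bool"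
    where "Q1 = (\<lambda>\<Delta> h. \<forall>\<rho>\<in>\<Delta>. \<exists>G. dec_tree I 1 G \<and> h \<rho> = (\<lambda>x. sg (G x)))"
  have "mean_coeff_norm p I 1 (restrs I) (\<lambda>\<rho> x. f (comb \<rho> x)) \<le> (1 + 1 / 3) / (1 - 1 / 3) * 2 * mass p I (restrs I)"
  proof (rule gate_switch[where ?Q0.0 = Q0 and ?Q1.0 = Q1 and w = w and r = 1 and \<theta> = 3])
    show "chg_closed I Q0" unfolding chg_closed_def Q0_def
      by (auto simp: chg_def comb_unfix_put)
    show "chg_closed I Q1" unfolding chg_closed_def Q1_def
    proof (intro allI impI ballI)
      fix \<Delta> and h :: family and V a \<Delta>' \<rho>
      assume "\<forall>\<rho>\<in>\<Delta>. \<exists>G. dec_tree I 1 G \<and> h \<rho> = (\<lambda>x. sg (G x))"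
        "\<forall>\<rho>\<in>\<Delta>'. unfix V \<rho> \<in> \<Delta> \<and> (\<forall>i\<in>V. \<rho> i = Some (a i))" "\<rho> \<in> \<Delta>'"
      then obtain G where "dec_tree I 1 G" "h (unfix V \<rho>) = (\<lambda>x. sg (G x))" by blast
      then show "\<exists>G. dec_tree I 1 G \<and> chg V a h \<rho> = (\<lambda>x. sg (G x))"
        by (intro exI[of _ "\<lambda>x. G (put V a x)"]) (auto simp: chg_def dec_tree_put)
    qed
    fix \<Delta> h assume h: "Q0 \<Delta> h"
    define h1 where "h1 = (\<lambda>\<rho> x. sg (clip 1 ts \<rho> x 0 = pos))"
    have "dec_tree I 1 (\<lambda>x. clip 1 ts \<rho> x 0 = pos)" for \<rho>
    proof -
      have "dec_tree I 1 (\<lambda>x. clip 1 ts \<rho> x 0)" using clip_dec_tree[of ts I 0 1 \<rho>] ts I by (auto simp: terms_ok_def)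
      then show ?thesis using dec_tree_not by (cases pos) auto
    qed
    then have "Q1 \<Delta> h1" unfolding Q1_def h1_def by blast
    moreover have "h \<rho> x = h1 \<rho> x" if "\<rho> \<in> \<Delta>" "\<not> fail 1 ts \<rho> x 0" for \<rho> x
      using h that clip_eq_dnf[OF that(2)] by (simp add: Q0_def h1_def)
    ultimately show "\<exists>ts h1. (\<forall>t\<in>set ts. dom t \<subseteq> I \<and> card (dom t) \<le> w) \<and> Q1 \<Delta> h1 \<and>
            (\<forall>\<rho>\<in>\<Delta>. \<forall>x. h \<rho> x \<noteq> h1 \<rho> x \<longrightarrow> fail 1 ts \<rho> x 0)"
      using ts unfolding terms_ok_def by blast
  next
    fix \<Delta> h assume h: "Q1 \<Delta> h"
    have "coeff_norm I (\<lambda>_. 0) (\<lambda>_. 1) (h \<rho>) \<le> 2" if \<rho>: "\<rho> \<in> \<Delta>" for \<rho>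
      using h \<rho> dec_tree_coeff_norm[OF I, of 1 1] unfolding Q1_def by fastforce
    then have "mean_coeff_norm p I 1 \<Delta> h \<le> (\<Sum>\<rho>\<in>\<Delta>. restr_wt p I \<rho> * 2)"
      unfolding mean_coeff_norm_def using p by (intro sum_mono mult_left_mono restr_wt_nonneg) auto
    then show "mean_coeff_norm p I 1 \<Delta> h \<le> 2 * mass p I \<Delta>" by (simp add: mass_def sum_distrib_left mult.commute)
  next
    show "dclosed I (restrs I)" by (auto simp: dclosed_def restrs_def)
    show "Q0 (restrs I) (\<lambda>\<rho> x. f (comb \<rho> x))" by (simp add: Q0_def fd)
  qed (use p pw I in auto)
  moreover have "coeff_norm I (\<lambda>_. 0) (\<lambda>_. p * 1) f \<le> mean_coeff_norm p I 1 (restrs I) (\<lambda>\<rho> x. f (comb \<rho> x))"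
    unfolding mean_coeff_norm_def using p I by (intro coeff_norm_restrict) auto
  moreover have "mass p I (restrs I) = 1" unfolding mass_def by (rule restr_wt_sum[OF I])
  ultimately show ?thesis by (simp add: p_def)
qed

text \<open>Gates of depth 0 are literals, also after a restriction, hence trees of depth 1.
  Starting from width 1 is what saves one factor \<open>r\<close>.\<close>

lemma initial_class: "tree_class {..<m} 0 1 (\<lambda>x. sg (circuit_value C (comb \<rho> x)))"
proof -
  have v: "circuit_value C y = last (val y)" for y by (simp add: circuit_value_def val_def build_def)
  have d: "dec_tree {..<m} 1 (\<lambda>x. val (comb \<rho> x) ! i)" if "i < len" "dep ! i \<le> 0" for i
    using that
  proof (induction i rule: less_induct)
    case (less i)
    show ?case
    proof (cases "C ! i")
      case (InputG v)
      then have "v < m" using wfg[OF less.prems(1)] by simp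
      then have "dec_tree {..<m} 1 (\<lambda>x. comb \<rho> x v)" using dec_tree_comb[OF dec_tree_var[of v "{..<m}"]] by simp
      then show ?thesis using less.prems by (simp add: val_nth InputG)
    next
      case (NotG j)
      then show ?thesis using less dep_child(1)[OF less.prems(1) NotG] by (simp add: val_nth dec_tree_not)
    next
      case (AndG J)
      then show ?thesis using dep_nth[OF less.prems(1)] less.prems(2) by simp
    next
      case (OrG J)
      then show ?thesis using dep_nth[OF less.prems(1)] less.prems(2) by simp
    qed
  qed
  have "evl (cov 0 (\<lambda>i. val y ! i)) = val y" for y
  proof (rule nth_equalityI)
    have "evl (cov 0 (\<lambda>i. val y ! i)) ! i = val y ! i" if "i < len" for i
      using that
    proof (induction i rule: less_induct)
      case (less i)
      show ?case
      proof (cases "dep ! i \<le> 0")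
        case True
        then show ?thesis using less.prems by (simp add: ev_nth cov_def)
      next
        case False
        have "gate_value (\<lambda>_. False) (evl (cov 0 (\<lambda>i. val y ! i))) (C ! i) = gate_value y (val y) (C ! i)"
          using less False dep_input[OF less.prems] by (intro gate_value_cong[OF wfg]) auto
        moreover have "cov 0 (\<lambda>i. val y ! i) i = None" using False by (simp add: cov_def)
        ultimately show ?thesis using less.prems by (simp add: ev_nth val_nth)
      qed
    qed
    then show "\<And>i. i < length (evl (cov 0 (\<lambda>i. val y ! i))) \<Longrightarrow> evl (cov 0 (\<lambda>i. val y ! i)) ! i = val y ! i" by simp
  qed simp
  then show ?thesis unfolding tree_class_def v using d
    by (intro exI[of _ "\<lambda>i x. val (comb \<rho> x) ! i"]) auto
qed

lemma dep_last: "dep ! (len - 1) = circuit_depth C"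
proof -
  have "circuit_depth C = last dep" by (simp add: circuit_depth_def dep_def build_def)
  moreover have "dep \<noteq> []" using C_ne length_dep by force
  ultimately show ?thesis by (simp add: last_conv_nth)
qed

text \<open>\<open>t\<close> counts the levels that have to be switched before
  \<open>final_stage\<close> applies; each costs a factor 1/(48 r) in the weight and
  \<open>exp 3\<close> in the bound.\<close>

lemma middle_stages:
  assumes "circuit_size C \<le> 3 ^ r" "r \<ge> 1" "circuit_depth C \<le> Suc (e + t)" "finite I" "tree_class I e r f"
  shows "coeff_norm I (\<lambda>_. 0) (\<lambda>_. (1 / (48 * real r)) ^ Suc t) f \<le> 4 * exp 3 ^ t"
  using assms(3,5)
proof (induction t arbitrary: e f)
  case 0
  show ?case using final_stage[of I r e f] 0 assms dep_last by simp
next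
  case (Suc t)
  have "coeff_norm I (\<lambda>_. 0) (\<lambda>_. 1 / (48 * real r) * (1 / (48 * real r)) ^ Suc t) f \<le> exp 3 * (4 * exp 3 ^ t)"
  proof (rule stage)
    show "(1 / (48 * real r)) ^ Suc t \<le> 1" using assms(2) by (intro power_le_one) auto
    show "coeff_norm I (\<lambda>_. 0) (\<lambda>_. (1 / (48 * real r)) ^ Suc t) f \<le> 4 * exp 3 ^ t" if "tree_class I (Suc e) r f" for f
      using Suc.prems that by (intro Suc.IH[of "Suc e"]) auto
  qed (use assms Suc.prems in auto)
  then show ?case by (simp add: mult_ac)
qed

end

text \<open>Of the \<open>Suc d\<close> levels the lowest has width 1 and costs only 1/48; the other
  \<open>d\<close> have width \<open>r\<close>. This is the source of the exponent 4(d - 1) at depth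
  d.\<close>

theorem ac0_coeff_norm:
  assumes "wf_circuit m C" "circuit_depth C \<le> Suc d" "d \<ge> 1 \<Longrightarrow> circuit_size C \<le> 3 ^ r" "r \<ge> 1"
  shows "coeff_norm {..<m} (\<lambda>_. 0) (\<lambda>_. 1 / 48 * (1 / (48 * real r)) ^ d) (\<lambda>x. sg (circuit_value C (comb \<rho> x))) \<le> 4 * exp 3 ^ d"
proof -
  interpret wf_circ m C by standard (rule assms)
  show ?thesis
  proof (cases d)
    case 0
    then have "dep ! (len - 1) \<le> Suc 0" using assms(2) dep_last by simp
    then have "coeff_norm {..<m} (\<lambda>_. 0) (\<lambda>_. 1 / (48 * real 1)) (\<lambda>x. sg (circuit_value C (comb \<rho> x))) \<le> 4"
      by (intro final_stage[OF _ _ _ initial_class]) auto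
    then show ?thesis using 0 by simp
  next
    case (Suc t)
    have "coeff_norm {..<m} (\<lambda>_. 0) (\<lambda>_. 1 / (48 * real 1) * (1 / (48 * real r)) ^ Suc t) (\<lambda>x. sg (circuit_value C (comb \<rho> x)))
        \<le> exp 3 * (4 * exp 3 ^ t)"
    proof (rule stage[OF _ _ _ _ _ _ _ _ _ initial_class])
      show "(1 / (48 * real r)) ^ Suc t \<le> 1" using assms(4) by (intro power_le_one) auto
      show "coeff_norm {..<m} (\<lambda>_. 0) (\<lambda>_. (1 / (48 * real r)) ^ Suc t) f \<le> 4 * exp 3 ^ t" if "tree_class {..<m} (Suc 0) r f" for f
        using that assms Suc by (intro middle_stages[of r "Suc 0"]) auto
    qed (use assms Suc in auto)
    then show ?thesis using Suc by (simp add: mult_ac)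
  qed
qed

section \<open>Gaussian moments\<close>

text \<open>\<open>e\<close> is the variance, whereas \<open>normal_density\<close> takes the
  standard deviation.\<close>

definition gauss_dist :: "real \<Rightarrow> real measure" where
  "gauss_dist e = density lborel (\<lambda>t. ennreal (normal_density 0 (sqrt e) t))"

lemma sets_gauss_dist [measurable_cong]: "sets (gauss_dist e) = sets borel" by (simp add: gauss_dist_def)
lemma space_gauss_dist [simp]: "space (gauss_dist e) = UNIV" by (simp add: gauss_dist_def)

lemma prob_gauss_dist: "e > 0 \<Longrightarrow> prob_space (gauss_dist e)"
  unfolding gauss_dist_def by (rule prob_space_normal_density) simp

lemma integrable_gauss_dist: "f \<in> borel_measurable borel \<Longrightarrow>
    integrable (gauss_dist e) f \<longleftrightarrow> integrable lborel (\<lambda>x. normal_density 0 (sqrt e) x * f x)"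
  for f :: "real \<Rightarrow> real"
  unfolding gauss_dist_def by (subst integrable_density) auto

lemma integral_gauss_dist: "f \<in> borel_measurable borel \<Longrightarrow>
    integral\<^sup>L (gauss_dist e) f = (\<integral>x. normal_density 0 (sqrt e) x * f x \<partial>lborel)"
  for f :: "real \<Rightarrow> real"
  unfolding gauss_dist_def by (subst integral_density) auto

lemma normal_density_exp_shift:
  assumes "e > 0"
  shows "normal_density 0 (sqrt e) x * exp (c * x) = exp (c\<^sup>2 * e / 2) * normal_density (c * e) (sqrt e) x"
proof -
  have "- (x\<^sup>2 / (2 * e)) + c * x = c\<^sup>2 * e / 2 + - ((x - c * e)\<^sup>2 / (2 * e))"
    using assms by (simp add: field_simps power2_eq_square)
  then have "exp (- (x\<^sup>2 / (2 * e))) * exp (c * x) = exp (c\<^sup>2 * e / 2) * exp (- ((x - c * e)\<^sup>2 / (2 * e)))"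
    by (simp add: exp_add[symmetric])
  then show ?thesis using assms by (simp add: normal_density_def)
qed

lemma gauss_dist_mgf:
  assumes "e > 0"
  shows "integrable (gauss_dist e) (\<lambda>x. exp (c * x))" "(\<integral>x. exp (c * x) \<partial>gauss_dist e) = exp (c\<^sup>2 * e / 2)"
proof -
  have s: "sqrt e > 0" using assms by simp
  show "integrable (gauss_dist e) (\<lambda>x. exp (c * x))"
    by (subst integrable_gauss_dist) (auto simp: normal_density_exp_shift[OF assms] integrable_normal_density[OF s])
  show "(\<integral>x. exp (c * x) \<partial>gauss_dist e) = exp (c\<^sup>2 * e / 2)"
    by (subst integral_gauss_dist) (auto simp: normal_density_exp_shift[OF assms] integral_normal_density[OF s])
qed

lemma gauss_dist_power_integrable: "e > 0 \<Longrightarrow> integrable (gauss_dist e) (\<lambda>x. x ^ j)"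
  using integrable_normal_moment[of "sqrt e" 0 j] by (subst integrable_gauss_dist) auto

text \<open>Stein's identity E (t g(t)) = e E g'(t) for a monomial g, read off the explicit even and
  odd moments. For \<open>j = 0\<close> the factor \<open>of_nat j\<close> makes the truncated
  \<open>j - 1\<close> harmless.\<close>

lemma gauss_dist_moment_Suc:
  assumes e: "e > 0"
  shows "(\<integral>x. x ^ Suc j \<partial>gauss_dist e) = e * (of_nat j * (\<integral>x. x ^ (j - 1) \<partial>gauss_dist e))"
proof -
  have s: "sqrt e > 0" using e by simp
  have ev: "(\<integral>x. x ^ (2 * i) \<partial>gauss_dist e) = fact (2 * i) / ((2 / e) ^ i * fact i)" for i
    using integral_normal_moment_even[OF s, of 0 i] e by (subst integral_gauss_dist) auto
  have od: "(\<integral>x. x ^ (2 * i + 1) \<partial>gauss_dist e) = 0" for i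
    using integral_normal_moment_odd[OF s, of 0 i] by (subst integral_gauss_dist) auto
  show ?thesis
  proof (cases "even j")
    case True
    then obtain i where i: "j = 2 * i" by (elim evenE)
    have "j = 0 \<or> j - 1 = 2 * (i - 1) + 1" using i by (cases i) auto
    then show ?thesis using od[of i] od[of "i - 1"] i by auto
  next
    case False
    then obtain i where i: "j = 2 * i + 1" by (elim oddE)
    have A: "fact (2 * Suc i) = (2 * real i + 2) * ((2 * real i + 1) * fact (2 * i))" by (simp add: algebra_simps)
    have B: "(2 / e) ^ Suc i * fact (Suc i) = 2 * (real i + 1) * ((2 / e) ^ i * fact i) / e" by (simp add: field_simps)
    have C: "((2 * real i + 2) * ((2 * real i + 1) * F)) / (2 * (real i + 1) * D / e) = e * ((2 * real i + 1) * (F / D))"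
      for F D :: real
    proof -
      have "(2 * real i + 2) * ((2 * real i + 1) * F) = 2 * (real i + 1) * ((2 * real i + 1) * F)" by simp
      then show ?thesis using e by (simp add: add_nonneg_pos less_imp_neq[symmetric])
    qed
    have "(\<integral>x. x ^ (2 * Suc i) \<partial>gauss_dist e) = e * ((2 * real i + 1) * (\<integral>x. x ^ (2 * i) \<partial>gauss_dist e))"
      unfolding ev A B by (rule C)
    then show ?thesis using i by (simp add: algebra_simps)
  qed
qed

lemma gauss_dist_poly_integrable:
  assumes e: "e > 0" and "finite B"
  shows "integrable (gauss_dist e) (\<lambda>s. s ^ j * (\<Prod>b\<in>B. c b + h b * s))"
  using assms(2)
proof (induction B arbitrary: j rule: finite_induct)
  case empty
  then show ?case using gauss_dist_power_integrable[OF e] by simp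
next
  case (insert b B)
  have "(\<lambda>s. s ^ j * (\<Prod>b\<in>insert b B. c b + h b * s)) =
      (\<lambda>s. c b * (s ^ j * (\<Prod>b\<in>B. c b + h b * s)) + h b * (s ^ Suc j * (\<Prod>b\<in>B. c b + h b * s)))"
    using insert by (auto simp: algebra_simps fun_eq_iff)
  then show ?case using insert.IH[of j] insert.IH[of "Suc j"] by simp
qed

text \<open>The additional power of \<open>s\<close> is needed for the induction on
  \<open>B\<close>: expanding one linear factor raises the exponent.\<close>

lemma gauss_dist_stein_aux:
  assumes e: "e > 0" and "finite B"
  shows "(\<integral>s. s ^ Suc j * (\<Prod>b\<in>B. c b + h b * s) \<partial>gauss_dist e) =
    e * (of_nat j * (\<integral>s. s ^ (j - 1) * (\<Prod>b\<in>B. c b + h b * s) \<partial>gauss_dist e)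
      + (\<Sum>b\<in>B. h b * (\<integral>s. s ^ j * (\<Prod>b'\<in>B - {b}. c b' + h b' * s) \<partial>gauss_dist e)))"
  using assms(2)
proof (induction B arbitrary: j rule: finite_induct)
  case empty
  then show ?case using gauss_dist_moment_Suc[OF e, of j] by simp
next
  case (insert b B)
  let ?P = "\<lambda>B s. \<Prod>b\<in>B. c b + h b * s"
  let ?I = "\<lambda>j B. (\<integral>s. s ^ j * ?P B s \<partial>gauss_dist e)"
  have int: "integrable (gauss_dist e) (\<lambda>s. s ^ j * ?P B s)" if "finite B" for j B
    by (rule gauss_dist_poly_integrable[OF e that])
  have ex: "?I j (insert d D) = c d * ?I j D + h d * ?I (Suc j) D" if "finite D" "d \<notin> D" for j d D
  proof -
    have "(\<lambda>s. s ^ j * ?P (insert d D) s) = (\<lambda>s. c d * (s ^ j * ?P D s) + h d * (s ^ Suc j * ?P D s))"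
      using that by (auto simp: algebra_simps fun_eq_iff)
    then show ?thesis using int[OF that(1), of j] int[OF that(1), of "Suc j"] by simp
  qed
  have rm: "insert b B - {b} = B" using insert by auto
  have rm2: "insert b B - {b'} = insert b (B - {b'})" "b \<notin> B - {b'}" "finite (B - {b'})" if "b' \<in> B" for b'
    using insert that by auto
  have "(\<Sum>b'\<in>B. h b' * ?I j (insert b B - {b'})) =
      (\<Sum>b'\<in>B. h b' * (c b * ?I j (B - {b'}) + h b * ?I (Suc j) (B - {b'})))"
  proof (intro sum.cong refl)
    fix b' assume b': "b' \<in> B"
    show "h b' * ?I j (insert b B - {b'}) = h b' * (c b * ?I j (B - {b'}) + h b * ?I (Suc j) (B - {b'}))"
      unfolding rm2(1)[OF b'] ex[OF rm2(3)[OF b'] rm2(2)[OF b']] ..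
  qed
  also have "\<dots> = c b * (\<Sum>b'\<in>B. h b' * ?I j (B - {b'})) + h b * (\<Sum>b'\<in>B. h b' * ?I (Suc j) (B - {b'}))"
    by (simp add: sum_distrib_left sum.distrib algebra_simps)
  finally have s: "(\<Sum>b'\<in>insert b B. h b' * ?I j (insert b B - {b'})) = h b * ?I j B +
     (c b * (\<Sum>b'\<in>B. h b' * ?I j (B - {b'})) + h b * (\<Sum>b'\<in>B. h b' * ?I (Suc j) (B - {b'})))"
    using insert(1,2) rm by simp
  have j1: "of_nat j * ?I (j - 1) (insert b B) = of_nat j * (c b * ?I (j - 1) B) + of_nat j * (h b * ?I j B)"
    using ex[OF insert(1,2), of "j - 1"] by (cases j) (simp_all add: algebra_simps)
  have "?I (Suc j) (insert b B) = c b * ?I (Suc j) B + h b * ?I (Suc (Suc j)) B"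
    by (rule ex[OF insert(1,2)])
  also have "\<dots> = c b * (e * (of_nat j * ?I (j - 1) B + (\<Sum>b'\<in>B. h b' * ?I j (B - {b'}))))
      + h b * (e * (of_nat (Suc j) * ?I j B + (\<Sum>b'\<in>B. h b' * ?I (Suc j) (B - {b'}))))"
    using insert.IH[of j] insert.IH[of "Suc j"] by simp
  also have "\<dots> = e * (of_nat j * ?I (j - 1) (insert b B) + (\<Sum>b'\<in>insert b B. h b' * ?I j (insert b B - {b'})))"
    unfolding s j1 by (simp add: algebra_simps)
  finally show ?case .
qed

lemma gauss_dist_stein:
  assumes "e > 0" "finite B"
  shows "(\<integral>s. s * (\<Prod>b\<in>B. c b + h b * s) \<partial>gauss_dist e) =
    e * (\<Sum>b\<in>B. h b * (\<integral>s. (\<Prod>b'\<in>B - {b}. c b' + h b' * s) \<partial>gauss_dist e))"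
  using gauss_dist_stein_aux[OF assms, of 0 c h] by simp

lemma gauss_dist_exp_abs_integrable:
  assumes "e > 0" shows "integrable (gauss_dist e) (\<lambda>x. exp (K * \<bar>x\<bar>))"
proof (rule Bochner_Integration.integrable_bound)
  show "integrable (gauss_dist e) (\<lambda>x. exp (K * x) + exp (- K * x))"
    using gauss_dist_mgf(1)[OF assms] by (intro Bochner_Integration.integrable_add) blast+
  show "AE x in gauss_dist e. norm (exp (K * \<bar>x\<bar>)) \<le> norm (exp (K * x) + exp (- K * x))"
  proof (intro AE_I2)
    fix x :: real
    have "exp (K * \<bar>x\<bar>) \<le> exp (K * x) + exp (- K * x)" by (cases "x \<ge> 0") auto
    then show "norm (exp (K * \<bar>x\<bar>)) \<le> norm (exp (K * x) + exp (- K * x))" by simp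
  qed
qed simp

text \<open>Of the Hadamard matrix the Gaussian computations use only symmetry and orthogonality, so
  they are carried out for an abstract \<open>H\<close>.\<close>

locale gauss =
  fixes N :: nat and e :: real and H :: "nat \<Rightarrow> nat \<Rightarrow> real"
  assumes e: "e > 0"
    and orth: "\<And>a b. a < N \<Longrightarrow> b < N \<Longrightarrow> (\<Sum>c<N. H a c * H b c) = (if a = b then 1 else 0)"
    and symm: "\<And>a b. H a b = H b a"
begin

sublocale D: prob_space "gauss_dist e" by (rule prob_gauss_dist[OF e])
sublocale PP: product_prob_space "\<lambda>_. gauss_dist e" I for I ..

definition "P = (\<Pi>\<^sub>M i\<in>{..<N}. gauss_dist e)"

sublocale P: prob_space P unfolding P_def by (rule prob_space_PiM) (rule D.prob_space_axioms)

lemma meas_comp: "i < N \<Longrightarrow> (\<lambda>x. x i) \<in> borel_measurable P"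
  unfolding P_def using measurable_component_singleton[of i "{..<N}" "\<lambda>_. gauss_dist e"]
  by (simp add: measurable_cong_sets[OF refl sets_gauss_dist])

definition lin :: "(nat \<Rightarrow> real) \<Rightarrow> (nat \<Rightarrow> real) \<Rightarrow> real" where "lin c x = (\<Sum>a<N. c a * x a)"

text \<open>A class closed under the operations below, in which integrability is automatic.\<close>

definition exp_growth :: "((nat \<Rightarrow> real) \<Rightarrow> real) \<Rightarrow> bool" where
  "exp_growth f \<longleftrightarrow> f \<in> borel_measurable P \<and> (\<exists>C K. C \<ge> 0 \<and> K \<ge> 0 \<and> (\<forall>x. \<bar>f x\<bar> \<le> C * (\<Prod>i<N. exp (K * \<bar>x i\<bar>))))"

lemma exp_growth_integrable: "exp_growth f \<Longrightarrow> integrable P f"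
proof -
  assume "exp_growth f"
  then obtain C K where f: "f \<in> borel_measurable P" "C \<ge> 0" "\<And>x. \<bar>f x\<bar> \<le> C * (\<Prod>i<N. exp (K * \<bar>x i\<bar>))"
    by (auto simp: exp_growth_def)
  have "integrable P (\<lambda>x. \<Prod>i<N. exp (K * \<bar>x i\<bar>))"
    unfolding P_def by (rule PP.product_integrable_prod) (auto intro: gauss_dist_exp_abs_integrable e)
  then have "integrable P (\<lambda>x. C * (\<Prod>i<N. exp (K * \<bar>x i\<bar>)))" by simp
  then show ?thesis
    by (rule Bochner_Integration.integrable_bound) (use f in \<open>auto intro!: AE_I2 order_trans[OF f(3)]\<close>)
qed

lemma exp_growth_bounded: "f \<in> borel_measurable P \<Longrightarrow> (\<And>x. \<bar>f x\<bar> \<le> C) \<Longrightarrow> exp_growth f"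
proof -
  assume f: "f \<in> borel_measurable P" "\<And>x. \<bar>f x\<bar> \<le> C"
  then have "C \<ge> 0" using abs_ge_zero order_trans by blast
  then show ?thesis unfolding exp_growth_def using f by (intro conjI exI[of _ C] exI[of _ 0]) auto
qed

lemma exp_growth_const: "exp_growth (\<lambda>_. c)" by (rule exp_growth_bounded[where C = "\<bar>c\<bar>"]) auto

lemma exp_growth_mult: "exp_growth f \<Longrightarrow> exp_growth g \<Longrightarrow> exp_growth (\<lambda>x. f x * g x)"
proof -
  assume "exp_growth f" "exp_growth g"
  then obtain C K C' K' where f: "f \<in> borel_measurable P" "C \<ge> 0" "K \<ge> 0" "\<And>x. \<bar>f x\<bar> \<le> C * (\<Prod>i<N. exp (K * \<bar>x i\<bar>))"
    and g: "g \<in> borel_measurable P" "C' \<ge> 0" "K' \<ge> 0" "\<And>x. \<bar>g x\<bar> \<le> C' * (\<Prod>i<N. exp (K' * \<bar>x i\<bar>))"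
    by (auto simp: exp_growth_def)
  have "\<bar>f x * g x\<bar> \<le> C * C' * (\<Prod>i<N. exp ((K + K') * \<bar>x i\<bar>))" for x
  proof -
    have "\<bar>f x\<bar> * \<bar>g x\<bar> \<le> (C * (\<Prod>i<N. exp (K * \<bar>x i\<bar>))) * (C' * (\<Prod>i<N. exp (K' * \<bar>x i\<bar>)))"
      using f g by (intro mult_mono) (auto intro!: mult_nonneg_nonneg prod_nonneg)
    also have "\<dots> = C * C' * (\<Prod>i<N. exp ((K + K') * \<bar>x i\<bar>))"
      by (simp add: prod.distrib[symmetric] exp_add[symmetric] algebra_simps)
    finally show ?thesis by (simp add: abs_mult)
  qed
  then show ?thesis unfolding exp_growth_def using f g
    by (intro conjI exI[of _ "C * C'"] exI[of _ "K + K'"]) auto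
qed

lemma exp_growth_add: "exp_growth f \<Longrightarrow> exp_growth g \<Longrightarrow> exp_growth (\<lambda>x. f x + g x)"
proof -
  assume "exp_growth f" "exp_growth g"
  then obtain C K C' K' where f: "f \<in> borel_measurable P" "C \<ge> 0" "K \<ge> 0" "\<And>x. \<bar>f x\<bar> \<le> C * (\<Prod>i<N. exp (K * \<bar>x i\<bar>))"
    and g: "g \<in> borel_measurable P" "C' \<ge> 0" "K' \<ge> 0" "\<And>x. \<bar>g x\<bar> \<le> C' * (\<Prod>i<N. exp (K' * \<bar>x i\<bar>))"
    by (auto simp: exp_growth_def)
  have "\<bar>f x + g x\<bar> \<le> (C + C') * (\<Prod>i<N. exp ((K + K') * \<bar>x i\<bar>))" for x
  proof -
    have m: "(\<Prod>i<N. exp (L * \<bar>x i\<bar>)) \<le> (\<Prod>i<N. exp ((K + K') * \<bar>x i\<bar>))" if "L \<le> K + K'" for L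
      using that by (intro prod_mono) (auto intro!: mult_right_mono)
    have "\<bar>f x + g x\<bar> \<le> C * (\<Prod>i<N. exp (K * \<bar>x i\<bar>)) + C' * (\<Prod>i<N. exp (K' * \<bar>x i\<bar>))"
      using f(4)[of x] g(4)[of x] by linarith
    also have "\<dots> \<le> C * (\<Prod>i<N. exp ((K + K') * \<bar>x i\<bar>)) + C' * (\<Prod>i<N. exp ((K + K') * \<bar>x i\<bar>))"
      using f g by (intro add_mono mult_left_mono m) auto
    finally show ?thesis by (simp add: distrib_right)
  qed
  then show ?thesis unfolding exp_growth_def using f g
    by (intro conjI exI[of _ "C + C'"] exI[of _ "K + K'"]) auto
qed

lemma exp_growth_sum: "(\<And>i. i \<in> A \<Longrightarrow> exp_growth (f i)) \<Longrightarrow> exp_growth (\<lambda>x. \<Sum>i\<in>A. f i x)"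
  by (induction A rule: infinite_finite_induct) (auto intro: exp_growth_const exp_growth_add)

lemma exp_growth_prod: "(\<And>i. i \<in> A \<Longrightarrow> exp_growth (f i)) \<Longrightarrow> exp_growth (\<lambda>x. \<Prod>i\<in>A. f i x)"
  by (induction A rule: infinite_finite_induct) (auto intro: exp_growth_const exp_growth_mult)

lemma exp_growth_dom: "exp_growth g \<Longrightarrow> f \<in> borel_measurable P \<Longrightarrow> (\<And>x. \<bar>f x\<bar> \<le> \<bar>g x\<bar>) \<Longrightarrow> exp_growth f"
  unfolding exp_growth_def using order_trans by blast

lemma exp_growth_exp_comp: "i < N \<Longrightarrow> exp_growth (\<lambda>x. exp (c * x i))"
proof -
  assume i: "i < N"
  have [measurable]: "(\<lambda>x. x i) \<in> borel_measurable P" by (rule meas_comp[OF i])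
  have "\<bar>exp (c * x i)\<bar> \<le> 1 * (\<Prod>j<N. exp (\<bar>c\<bar> * \<bar>x j\<bar>))" for x :: "nat \<Rightarrow> real"
  proof -
    have "exp (c * x i) \<le> exp (\<bar>c\<bar> * \<bar>x i\<bar>)" by (simp add: abs_mult[symmetric])
    also have "\<dots> \<le> (\<Prod>j<N. exp (\<bar>c\<bar> * \<bar>x j\<bar>))"
      using i by (subst prod.remove[of _ i]) (auto intro!: prod_ge_1 simp: mult_le_cancel_left1)
    finally show ?thesis by simp
  qed
  then show ?thesis unfolding exp_growth_def by (intro conjI exI[of _ 1] exI[of _ "\<bar>c\<bar>"]) auto
qed

lemma exp_growth_comp: "i < N \<Longrightarrow> exp_growth (\<lambda>x. x i)"
proof -
  assume i: "i < N"
  have [measurable]: "(\<lambda>x. x i) \<in> borel_measurable P" by (rule meas_comp[OF i])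
  have *: "\<bar>t\<bar> \<le> \<bar>exp t + exp (- t)\<bar>" for t :: real
    using exp_ge_add_one_self[of t] exp_ge_add_one_self[of "- t"] exp_gt_zero[of t] exp_gt_zero[of "- t"]
    by linarith
  have "\<bar>t\<bar> \<le> \<bar>exp (1 * t) + exp (- 1 * t)\<bar>" for t :: real using *[of t] by simp
  then show ?thesis
    by (intro exp_growth_dom[OF exp_growth_add[OF exp_growth_exp_comp[OF i, of 1] exp_growth_exp_comp[OF i, of "- 1"]]]) auto
qed

lemma exp_growth_lin: "exp_growth (lin c)"
  unfolding lin_def[abs_def] by (intro exp_growth_sum exp_growth_mult exp_growth_const exp_growth_comp) auto

lemma exp_growth_exp_lin: "exp_growth (\<lambda>x. exp (lin c x))"
  unfolding lin_def exp_sum[OF finite_lessThan] by (intro exp_growth_prod exp_growth_exp_comp) auto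

lemma mgf_lin: "(\<integral>x. exp (lin c x) \<partial>P) = exp (e / 2 * (\<Sum>a<N. (c a)\<^sup>2))"
proof -
  have "(\<integral>x. exp (lin c x) \<partial>P) = (\<integral>x. (\<Prod>a<N. exp (c a * x a)) \<partial>P)"
    unfolding lin_def by (simp add: exp_sum)
  also have "\<dots> = (\<Prod>a<N. \<integral>t. exp (c a * t) \<partial>gauss_dist e)"
    unfolding P_def by (rule PP.product_integral_prod) (auto intro: gauss_dist_mgf(1)[OF e])
  also have "\<dots> = exp (\<Sum>a<N. (c a)\<^sup>2 * e / 2)"
    unfolding gauss_dist_mgf(2)[OF e] by (simp add: exp_sum)
  finally show ?thesis by (simp add: sum_distrib_left mult_ac)
qed

definition gauss_mom :: "nat set \<Rightarrow> nat set \<Rightarrow> real" where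
  "gauss_mom A B = (\<integral>x. (\<Prod>a\<in>A. x a) * (\<Prod>b\<in>B. lin (H b) x) \<partial>P)"

lemma exp_growth_mon: "A \<subseteq> {..<N} \<Longrightarrow> exp_growth (\<lambda>x. (\<Prod>a\<in>A. x a) * (\<Prod>b\<in>B. lin (H b) x))"
  by (intro exp_growth_mult exp_growth_prod exp_growth_comp exp_growth_lin) auto

text \<open>Stein's identity in the single coordinate \<open>a\<close>: with the others fixed, each
  \<open>lin (H b)\<close> is affine in \<open>x a\<close> with slope \<open>H b a\<close>, and the
  product over \<open>A\<close> is constant because \<open>a \<notin> A\<close>.\<close>

lemma gauss_mom_stein:
  assumes "A \<subseteq> {..<N}" "a < N" "a \<notin> A" "finite B"
  shows "gauss_mom (insert a A) B = e * (\<Sum>b\<in>B. H b a * gauss_mom A (B - {b}))"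
proof -
  define J where "J = {..<N} - {a}"
  have J: "finite J" "a \<notin> J" "insert a J = {..<N}" using assms by (auto simp: J_def)
  have fA: "finite A" using assms finite_subset by blast
  let ?c = "\<lambda>x b. \<Sum>i\<in>J. H b i * x i"
  have lin: "lin (H b) (x(a := s)) = ?c x b + H b a * s" for b x s
  proof -
    have "lin (H b) (x(a := s)) = (\<Sum>i\<in>insert a J. H b i * (x(a := s)) i)" unfolding lin_def J(3) ..
    also have "\<dots> = H b a * s + (\<Sum>i\<in>J. H b i * (x(a := s)) i)"
      by (subst sum.insert[OF J(1,2)]) simp
    also have "(\<Sum>i\<in>J. H b i * (x(a := s)) i) = ?c x b" using J by (intro sum.cong) auto
    finally show ?thesis by (simp only: add.commute)
  qed
  have pA: "(\<Prod>i\<in>A. (x(a := s)) i) = (\<Prod>i\<in>A. x i)" for x :: "nat \<Rightarrow> real" and s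
    using assms(3) by (intro prod.cong) auto
  have ins: "(\<integral>x. f x \<partial>P) = (\<integral>x. (\<integral>s. f (x(a := s)) \<partial>gauss_dist e) \<partial>PiM J (\<lambda>_. gauss_dist e))" if "exp_growth f" for f
    using PP.product_integral_insert[OF J(1,2), of f] exp_growth_integrable[OF that] unfolding P_def J(3) by simp
  \<comment> \<open>The difference of the two sides is integrated as one function, so that
    coordinate \<open>a\<close> has to be split off only once.\<close>
  define F where "F = (\<lambda>x. (\<Prod>i\<in>insert a A. x i) * (\<Prod>b\<in>B. lin (H b) x)
      - (\<Sum>b\<in>B. (e * H b a) * ((\<Prod>i\<in>A. x i) * (\<Prod>b'\<in>B - {b}. lin (H b') x))))"
  have g1: "exp_growth (\<lambda>x. (\<Prod>i\<in>insert a A. x i) * (\<Prod>b\<in>B. lin (H b) x))" using assms by (intro exp_growth_mon) auto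
  have g2: "exp_growth (\<lambda>x. (e * H b a) * ((\<Prod>i\<in>A. x i) * (\<Prod>b'\<in>B - {b}. lin (H b') x)))" for b
    using assms by (intro exp_growth_mult exp_growth_const exp_growth_mon) auto
  have grF: "exp_growth F"
    using exp_growth_add[OF g1 exp_growth_mult[OF exp_growth_const[of "-1"] exp_growth_sum[of B, OF g2]]] by (simp add: F_def)
  have inner: "(\<integral>s. F (x(a := s)) \<partial>gauss_dist e) = 0" for x
  proof -
    let ?p = "\<Prod>i\<in>A. x i"
    have i1: "integrable (gauss_dist e) (\<lambda>s. s * (\<Prod>b\<in>B. ?c x b + H b a * s))"
      using gauss_dist_poly_integrable[OF e assms(4), of 1 "?c x" "\<lambda>b. H b a"] by simp
    have i2: "integrable (gauss_dist e) (\<lambda>s. (\<Prod>b'\<in>B - {b}. ?c x b' + H b' a * s))" for b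
      using gauss_dist_poly_integrable[OF e, of "B - {b}" 0 "?c x" "\<lambda>b. H b a"] assms(4) by simp
    have "(\<lambda>s. F (x(a := s))) = (\<lambda>s. ?p * (s * (\<Prod>b\<in>B. ?c x b + H b a * s))
        - (\<Sum>b\<in>B. (e * H b a * ?p) * (\<Prod>b'\<in>B - {b}. ?c x b' + H b' a * s)))"
      using assms(3) fA by (simp add: F_def lin pA mult_ac fun_eq_iff fun_upd_same del: fun_upd_apply)
    then have "(\<integral>s. F (x(a := s)) \<partial>gauss_dist e) = ?p * (\<integral>s. s * (\<Prod>b\<in>B. ?c x b + H b a * s) \<partial>gauss_dist e)
        - (\<Sum>b\<in>B. (e * H b a * ?p) * (\<integral>s. (\<Prod>b'\<in>B - {b}. ?c x b' + H b' a * s) \<partial>gauss_dist e))"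
      using i1 i2 by simp
    then show ?thesis unfolding gauss_dist_stein[OF e assms(4)] by (simp add: sum_distrib_left mult_ac)
  qed
  have "(\<integral>x. F x \<partial>P) = 0" unfolding ins[OF grF] inner by simp
  moreover have "(\<integral>x. F x \<partial>P) = gauss_mom (insert a A) B - (\<Sum>b\<in>B. (e * H b a) * gauss_mom A (B - {b}))"
    unfolding F_def gauss_mom_def
    using exp_growth_integrable[OF g1] exp_growth_integrable[OF g2] exp_growth_integrable[OF exp_growth_mon[OF assms(1)]] by simp
  ultimately show ?thesis by (simp add: sum_distrib_left mult_ac)
qed

text \<open>The forms \<open>lin (H b)\<close> for different \<open>b\<close> are uncorrelated.
  Expanding one of them and applying Stein in each coordinate leaves only their covariances, which
  vanish by \<open>orth\<close>.\<close>

lemma gauss_mom_empty_left: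
  assumes "finite B" "B \<subseteq> {..<N}" "B \<noteq> {}"
  shows "gauss_mom {} B = 0"
proof -
  obtain b where b: "b \<in> B" using assms by blast
  have bN: "b < N" using b assms by auto
  have "gauss_mom {} B = (\<integral>x. (\<Sum>a<N. H b a * ((\<Prod>i\<in>{a}. x i) * (\<Prod>b'\<in>B - {b}. lin (H b') x))) \<partial>P)"
    unfolding gauss_mom_def using assms(1) b
    by (simp add: prod.remove[OF assms(1) b] lin_def[of "H b"] sum_distrib_right mult_ac)
  also have "\<dots> = (\<Sum>a<N. H b a * gauss_mom {a} (B - {b}))"
  proof -
    have "integrable P (\<lambda>x. H b a * ((\<Prod>i\<in>{a}. x i) * (\<Prod>b'\<in>B - {b}. lin (H b') x)))" if "a < N" for a
      using that by (intro integrable_mult_right exp_growth_integrable exp_growth_mon) auto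
    then show ?thesis unfolding gauss_mom_def by (subst Bochner_Integration.integral_sum) auto
  qed
  also have "\<dots> = (\<Sum>a<N. H b a * (e * (\<Sum>b'\<in>B - {b}. H b' a * gauss_mom {} (B - {b} - {b'}))))"
    using assms(1) by (intro sum.cong refl) (simp add: gauss_mom_stein)
  also have "\<dots> = (\<Sum>b'\<in>B - {b}. e * gauss_mom {} (B - {b} - {b'}) * (\<Sum>a<N. H b a * H b' a))"
    unfolding sum_distrib_left by (subst sum.swap) (simp add: mult_ac)
  also have "\<dots> = 0"
    using assms(2) bN by (intro sum.neutral) (auto simp: orth)
  finally show ?thesis .
qed

text \<open>Stein removes one element from either side until one side is exhausted. Consequently
  scaling the Gaussian point by sqrt t yields a polynomial in t, not in sqrt t.\<close>

lemma gauss_mom_card_neq: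
  assumes "finite B" "B \<subseteq> {..<N}" "finite A" "A \<subseteq> {..<N}" "card A \<noteq> card B"
  shows "gauss_mom A B = 0"
  using assms(3,1,2,4,5)
proof (induction A arbitrary: B rule: finite_induct)
  case empty
  then show ?case by (intro gauss_mom_empty_left) auto
next
  case (insert a A)
  have "gauss_mom A (B - {b}) = 0" if "b \<in> B" for b
  proof -
    have "card B > 0" using insert.prems that card_gt_0_iff by blast
    then show ?thesis using insert that by (intro insert.IH) (auto simp: card_Diff_singleton_if)
  qed
  then show ?case using insert by (subst gauss_mom_stein) auto
qed

text \<open>Stein at every \<open>a\<close> in \<open>A\<close>, summed up. The left factor
  \<open>card A\<close> is the one produced by differentiating t^(card A); the right side is the
  operator of \<open>dker\<close> applied to a monomial.\<close>

lemma gauss_mom_card_mult: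
  assumes "finite B" "finite A" "A \<subseteq> {..<N}"
  shows "real (card A) * gauss_mom A B = e * (\<Sum>a\<in>A. \<Sum>b\<in>B. H a b * gauss_mom (A - {a}) (B - {b}))"
proof -
  have "gauss_mom A B = e * (\<Sum>b\<in>B. H a b * gauss_mom (A - {a}) (B - {b}))" if "a \<in> A" for a
    using gauss_mom_stein[of "A - {a}" a B] assms that by (auto simp: insert_absorb symm[of _ a])
  then have "(\<Sum>a\<in>A. gauss_mom A B) = (\<Sum>a\<in>A. e * (\<Sum>b\<in>B. H a b * gauss_mom (A - {a}) (B - {b})))"
    by (intro sum.cong) auto
  then show ?thesis by (simp add: sum_distrib_left)
qed

end

section \<open>Gaussian interpolation\<close>

lemma prod_lessThan_double: "(\<Prod>i<2 * N. f i) = (\<Prod>a<N. f a) * (\<Prod>b<N. f (N + b))" for f :: "nat \<Rightarrow> 'a :: comm_monoid_mult"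
proof -
  have "(\<Prod>i<2 * N. f i) = (\<Prod>i\<in>{..<N}. f i) * (\<Prod>i\<in>{N..<2 * N}. f i)"
    by (subst prod.union_disjoint[symmetric]) (auto intro!: prod.cong)
  also have "(\<Prod>i\<in>{N..<2 * N}. f i) = (\<Prod>b<N. f (N + b))"
    by (rule prod.reindex_bij_witness[of _ "\<lambda>b. N + b" "\<lambda>i. i - N"]) auto
  finally show ?thesis .
qed

lemma prod_one_plus:
  fixes f :: "nat \<Rightarrow> real"
  assumes "finite S" shows "(\<Prod>a\<in>S. 1 + f a) = (\<Sum>A\<in>Pow S. \<Prod>a\<in>A. f a)"
  using prod_add[OF assms, of f "\<lambda>_. 1"] by (simp add: add.commute)

lemma sum_insert_reindex:
  fixes g :: "nat set \<Rightarrow> nat \<Rightarrow> real"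
  assumes "finite S"
  shows "(\<Sum>a\<in>S. \<Sum>A\<in>Pow (S - {a}). g (insert a A) a) = (\<Sum>A\<in>Pow S. \<Sum>a\<in>A. g A a)"
proof -
  have "(\<Sum>a\<in>S. \<Sum>A\<in>Pow (S - {a}). g (insert a A) a) = (\<Sum>(a, A)\<in>(SIGMA a:S. Pow (S - {a})). g (insert a A) a)"
    using assms by (simp add: sum.Sigma)
  also have "\<dots> = (\<Sum>(A, a)\<in>(SIGMA A:Pow S. A). g A a)"
    by (rule sum.reindex_bij_witness[of _ "\<lambda>(A, a). (a, A - {a})" "\<lambda>(a, A). (insert a A, a)"]) auto
  also have "\<dots> = (\<Sum>A\<in>Pow S. \<Sum>a\<in>A. g A a)"
    using assms by (subst sum.Sigma) (auto dest: finite_subset)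
  finally show ?thesis .
qed

lemma sum_sign_cube_prod: "(\<Sum>u\<in>sign_cube M. \<Prod>i<M. f i (u i)) = (\<Prod>i<M. f i (- 1) + f i 1)" for f :: "nat \<Rightarrow> real \<Rightarrow> real"
proof -
  have "(\<Prod>i<M. f i (- 1) + f i 1) = (\<Prod>i<M. \<Sum>t\<in>{- 1, 1}. f i t)" by simp
  also have "\<dots> = (\<Sum>g\<in>PiE {..<M} (\<lambda>_. {- 1, 1}). \<Prod>i<M. f i (g i))"
    by (rule prod_sum_PiE) auto
  also have "\<dots> = (\<Sum>u\<in>sign_cube M. \<Prod>i<M. f i (u i))"
    by (rule sum.reindex_bij_witness[of _ "\<lambda>u. restrict u {..<M}" "\<lambda>g i. if i < M then g i else 0"])
       (auto simp: sign_cube_def PiE_dflt_def PiE_iff fun_eq_iff extensional_def split: if_splits)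
  finally show ?thesis ..
qed

context gauss
begin

definition gauss_pt :: "(nat \<Rightarrow> real) \<Rightarrow> nat \<Rightarrow> real" where
  "gauss_pt x i = (if i < N then x i else lin (H (i - N)) x)"

definition ker :: "(nat \<Rightarrow> real) \<Rightarrow> (nat \<Rightarrow> real) \<Rightarrow> real" where
  "ker v u = (\<Prod>i<2 * N. (1 + u i * v i) / 2)"

text \<open>\<open>ker v\<close> is the density of the rounding of \<open>v\<close>, and \<open>dker\<close> the operator
  $\sum_{a,b} e H_{ab} \partial_a \partial_{N+b}$ applied to it, which by Stein's identity is the
  derivative of $\mathbb{E}\, ker(\sqrt t z)$ in $t$.\<close>

definition dker :: "(nat \<Rightarrow> real) \<Rightarrow> (nat \<Rightarrow> real) \<Rightarrow> real" where
  "dker v u = (\<Sum>a<N. \<Sum>b<N. e * H a b *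
     (\<Prod>i<2 * N. if i = a \<or> i = N + b then u i / 2 else (1 + u i * v i) / 2))"

definition bad :: "(nat \<Rightarrow> real) \<Rightarrow> bool" where "bad x \<longleftrightarrow> (\<exists>i<2 * N. \<bar>gauss_pt x i\<bar> > 1 / 2)"

text \<open>The L1 norm of \<open>ker v\<close> over the cube, by
  \<open>sum_abs_ker\<close>.\<close>

definition max_prod :: "(nat \<Rightarrow> real) \<Rightarrow> real" where "max_prod v = (\<Prod>i<2 * N. max 1 \<bar>v i\<bar>)"

text \<open>Bounds the effect of truncation: points with a coordinate above \<open>1 / 2\<close>, weighted by the
  \<open>L1\<close> norm of the kernel there.\<close>

definition tau :: real where "tau = (\<integral>x. of_bool (bad x) * max_prod (gauss_pt x) \<partial>P)"

lemma exp_growth_gauss_pt: "i < 2 * N \<Longrightarrow> exp_growth (\<lambda>x. gauss_pt x i)"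
  unfolding gauss_pt_def by (cases "i < N") (auto intro: exp_growth_comp exp_growth_lin)

lemma meas_gauss_pt [measurable]: "i < 2 * N \<Longrightarrow> (\<lambda>x. gauss_pt x i) \<in> borel_measurable P"
  using exp_growth_gauss_pt by (auto simp: exp_growth_def)

lemma meas_bad [measurable]: "Measurable.pred P bad"
  unfolding bad_def by measurable

lemma exp_growth_max_prod: "exp_growth (\<lambda>x. max_prod (gauss_pt x))"
  unfolding max_prod_def
proof (intro exp_growth_prod)
  fix i assume "i \<in> {..<2 * N}"
  then have i: "i < 2 * N" by simp
  have g: "exp_growth (\<lambda>x. 1 + gauss_pt x i * gauss_pt x i)" using exp_growth_gauss_pt[OF i] by (intro exp_growth_add exp_growth_const exp_growth_mult)
  have b: "\<bar>max 1 \<bar>t\<bar>\<bar> \<le> \<bar>1 + t * t\<bar>" for t :: real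
  proof -
    have "0 \<le> (\<bar>t\<bar> - 1)\<^sup>2" by simp
    then have "2 * \<bar>t\<bar> \<le> 1 + t * t" by (simp add: power2_eq_square algebra_simps)
    moreover have "0 \<le> t * t" by simp
    ultimately show ?thesis by (simp add: max_def)
  qed
  have m: "(\<lambda>x. max 1 \<bar>gauss_pt x i\<bar>) \<in> borel_measurable P"
  proof -
    have [measurable]: "(\<lambda>x. gauss_pt x i) \<in> borel_measurable P" by (rule meas_gauss_pt[OF i])
    show ?thesis by measurable
  qed
  show "exp_growth (\<lambda>x. max 1 \<bar>gauss_pt x i\<bar>)" by (rule exp_growth_dom[OF g m b])
qed

lemma max_prod_ge_1: "1 \<le> max_prod v" unfolding max_prod_def by (intro prod_ge_1) auto

lemma exp_growth_bad_max_prod: "exp_growth (\<lambda>x. of_bool (bad x) * max_prod (gauss_pt x))"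
  by (intro exp_growth_mult exp_growth_max_prod exp_growth_bounded[where C = 1]) auto

lemma tau_nonneg: "tau \<ge> 0"
  unfolding tau_def using max_prod_ge_1 by (intro integral_nonneg_AE AE_I2 mult_nonneg_nonneg) (auto intro: order_trans[of 0 1])

lemma E_bad_le: "(\<integral>x. of_bool (bad x) \<partial>P) \<le> tau"
    unfolding tau_def
  proof (rule integral_mono)
    show "integrable P (\<lambda>x. of_bool (bad x) :: real)" by (intro exp_growth_integrable exp_growth_bounded[where C = 1]) auto
    show "integrable P (\<lambda>x. of_bool (bad x) * max_prod (gauss_pt x))" by (rule exp_growth_integrable[OF exp_growth_bad_max_prod])
    show "of_bool (bad x) \<le> of_bool (bad x) * max_prod (gauss_pt x)" for x using max_prod_ge_1[of "gauss_pt x"] by simp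
  qed

lemma sum_abs_ker: "(\<Sum>u\<in>sign_cube (2 * N). \<bar>ker v u\<bar>) = max_prod v"
proof -
  have "\<bar>(1 + - 1 * t) / 2\<bar> + \<bar>(1 + 1 * t) / 2\<bar> = max 1 \<bar>t\<bar>" for t :: real by (auto simp: max_def abs_if field_simps)
  then show ?thesis
    unfolding ker_def abs_prod max_prod_def using sum_sign_cube_prod[of "\<lambda>i t. \<bar>(1 + t * v i) / 2\<bar>" "2 * N"] by simp
qed

text \<open>The total weight of the second derivatives in \<open>dker\<close>. It enters only next
  to \<open>tau\<close>, where the crude bound N^2 is affordable.\<close>

definition Lam :: real where "Lam = (\<Sum>a<N. \<Sum>b<N. e * \<bar>H a b\<bar>)"

lemma Lam_nonneg: "Lam \<ge> 0" unfolding Lam_def using e by (intro sum_nonneg) auto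

lemma sum_abs_dker: "(\<Sum>u\<in>sign_cube (2 * N). \<bar>dker v u\<bar>) \<le> Lam * max_prod v"
proof -
  let ?p = "\<lambda>a b i t. if i = a \<or> i = N + b then t / 2 else (1 + t * v i) / 2"
  have "(\<Sum>u\<in>sign_cube (2 * N). \<bar>dker v u\<bar>) \<le> (\<Sum>u\<in>sign_cube (2 * N). \<Sum>a<N. \<Sum>b<N. e * \<bar>H a b\<bar> * (\<Prod>i<2 * N. \<bar>?p a b i (u i)\<bar>))"
    unfolding dker_def using e
    by (intro sum_mono order_trans[OF sum_abs]) (auto simp: abs_mult abs_prod intro!: order_trans[OF sum_abs] sum_mono)
  also have "\<dots> = (\<Sum>a<N. \<Sum>b<N. e * \<bar>H a b\<bar> * (\<Sum>u\<in>sign_cube (2 * N). \<Prod>i<2 * N. \<bar>?p a b i (u i)\<bar>))"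
    by (subst sum.swap, intro sum.cong refl, subst sum.swap) (simp add: sum_distrib_left)
  also have "\<dots> \<le> (\<Sum>a<N. \<Sum>b<N. e * \<bar>H a b\<bar> * max_prod v)"
  proof (intro sum_mono mult_left_mono)
    fix a b
    have "(\<Sum>u\<in>sign_cube (2 * N). \<Prod>i<2 * N. \<bar>?p a b i (u i)\<bar>) = (\<Prod>i<2 * N. \<bar>?p a b i (- 1)\<bar> + \<bar>?p a b i 1\<bar>)"
      by (rule sum_sign_cube_prod)
    also have "\<dots> \<le> max_prod v" unfolding max_prod_def by (intro prod_mono) (auto simp: max_def abs_if field_simps)
    finally show "(\<Sum>u\<in>sign_cube (2 * N). \<Prod>i<2 * N. \<bar>?p a b i (u i)\<bar>) \<le> max_prod v" .
  qed (use e in auto)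
  also have "\<dots> = Lam * max_prod v" unfolding Lam_def by (simp add: sum_distrib_right)
  finally show ?thesis .
qed

lemma exp_growth_ker: "exp_growth (\<lambda>x. ker (\<lambda>i. s * gauss_pt x i) u)"
  unfolding ker_def divide_inverse by (intro exp_growth_prod exp_growth_mult exp_growth_add exp_growth_const exp_growth_gauss_pt) auto

lemma exp_growth_ker_trnc: "exp_growth (\<lambda>x. ker (\<lambda>i. trnc (gauss_pt x i)) u)"
proof -
  have "exp_growth (\<lambda>x. trnc (gauss_pt x i))" if "i < 2 * N" for i
  proof (rule exp_growth_bounded[where C = 1])
    show "(\<lambda>x. trnc (gauss_pt x i)) \<in> borel_measurable P" unfolding trnc_def using that by measurable
  qed (auto simp: trnc_def)
  then show ?thesis unfolding ker_def divide_inverse by (intro exp_growth_prod exp_growth_mult exp_growth_add exp_growth_const) auto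
qed

lemma exp_growth_dker: "exp_growth (\<lambda>x. dker (\<lambda>i. s * gauss_pt x i) u)"
proof -
  have "exp_growth (\<lambda>x. if i = a \<or> i = N + b then u i / 2 else (1 + u i * (s * gauss_pt x i)) / 2)" if "i < 2 * N" for i a b
  proof (cases "i = a \<or> i = N + b")
    case False
    have "exp_growth (\<lambda>x. 1 / 2 * (1 + u i * (s * gauss_pt x i)))" by (intro exp_growth_mult exp_growth_add exp_growth_const exp_growth_gauss_pt that)
    then show ?thesis using False by simp
  qed (simp add: exp_growth_const)
  then show ?thesis unfolding dker_def by (intro exp_growth_sum exp_growth_mult exp_growth_const exp_growth_prod) auto
qed

definition al :: "(nat \<Rightarrow> real) \<Rightarrow> nat set \<Rightarrow> nat set \<Rightarrow> real" where
  "al u A B = (1 / 2) ^ (2 * N) * ((\<Prod>a\<in>A. u a) * (\<Prod>b\<in>B. u (N + b)))"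

lemma exp_growth_integral_sum: "(\<And>i. i \<in> S \<Longrightarrow> exp_growth (f i)) \<Longrightarrow> (\<integral>x. (\<Sum>i\<in>S. f i x) \<partial>P) = (\<Sum>i\<in>S. \<integral>x. f i x \<partial>P)"
  by (intro Bochner_Integration.integral_sum exp_growth_integrable)

lemma E_ker: "(\<integral>x. ker (\<lambda>i. s * gauss_pt x i) u \<partial>P) =
   (\<Sum>A\<in>Pow {..<N}. \<Sum>B\<in>Pow {..<N}. al u A B * s ^ (card A + card B) * gauss_mom A B)"
proof -
  have "ker (\<lambda>i. s * gauss_pt x i) u = (\<Sum>A\<in>Pow {..<N}. \<Sum>B\<in>Pow {..<N}. al u A B * s ^ (card A + card B) *
      ((\<Prod>a\<in>A. x a) * (\<Prod>b\<in>B. lin (H b) x)))" for x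
  proof -
    have "ker (\<lambda>i. s * gauss_pt x i) u = (1 / 2) ^ (2 * N) * ((\<Prod>a<N. 1 + u a * (s * x a)) * (\<Prod>b<N. 1 + u (N + b) * (s * lin (H b) x)))"
    proof -
      have "ker (\<lambda>i. s * gauss_pt x i) u = (\<Prod>a<N. 1 / 2 * (1 + u a * (s * x a))) * (\<Prod>b<N. 1 / 2 * (1 + u (N + b) * (s * lin (H b) x)))"
        unfolding ker_def prod_lessThan_double by (intro arg_cong2[where f="(*)"] prod.cong) (auto simp: gauss_pt_def)
      moreover have p2: "(1 / 2 :: real) ^ (2 * N) = (1 / 2) ^ N * (1 / 2) ^ N" by (simp only: mult_2 power_add)
      ultimately show ?thesis unfolding p2 by (simp only: prod.distrib prod_constant card_lessThan mult_ac)
    qed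
    also have "\<dots> = (1 / 2) ^ (2 * N) * (\<Sum>A\<in>Pow {..<N}. \<Sum>B\<in>Pow {..<N}. (\<Prod>a\<in>A. u a * (s * x a)) * (\<Prod>b\<in>B. u (N + b) * (s * lin (H b) x)))"
      unfolding prod_one_plus[OF finite_lessThan] by (simp add: sum_product)
    also have "\<dots> = (\<Sum>A\<in>Pow {..<N}. \<Sum>B\<in>Pow {..<N}. al u A B * s ^ (card A + card B) *
      ((\<Prod>a\<in>A. x a) * (\<Prod>b\<in>B. lin (H b) x)))"
      unfolding sum_distrib_left al_def by (intro sum.cong refl) (simp add: prod.distrib power_add mult_ac)
    finally show ?thesis .
  qed
  then show ?thesis unfolding gauss_mom_def
    using exp_growth_integrable[OF exp_growth_mon] by (simp add: Bochner_Integration.integral_sum)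
qed

text \<open>The two derivatives take one element from \<open>A\<close> and one from
  \<open>B\<close>, whence the division by \<open>s\<^sup>2\<close>. Reindexing by the monomial
  before differentiation turns the result into a sum over removed pairs, which
  \<open>gauss_mom_card_mult\<close> collapses.\<close>

lemma E_dker:
  assumes "s \<noteq> 0"
  shows "(\<integral>x. dker (\<lambda>i. s * gauss_pt x i) u \<partial>P) =
   (\<Sum>A\<in>Pow {..<N}. \<Sum>B\<in>Pow {..<N}. al u A B * (s ^ (card A + card B) / s\<^sup>2) * (real (card A) * gauss_mom A B))"
proof -
  let ?m = "\<lambda>A B x. (\<Prod>a\<in>A. x a) * (\<Prod>b\<in>B. lin (H b) x)"
  have "dker (\<lambda>i. s * gauss_pt x i) u = (\<Sum>A\<in>Pow {..<N}. \<Sum>B\<in>Pow {..<N}. al u A B * (s ^ (card A + card B) / s\<^sup>2) *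
      (\<Sum>a\<in>A. \<Sum>b\<in>B. e * H a b * ?m (A - {a}) (B - {b}) x))" for x
  proof -
    define G where "G = (\<lambda>A a B b. al u A B * (s ^ (card A + card B) / s\<^sup>2) * (e * H a b * ?m (A - {a}) (B - {b}) x))"
    have t: "e * H a b * (\<Prod>i<2 * N. if i = a \<or> i = N + b then u i / 2 else (1 + u i * (s * gauss_pt x i)) / 2) =
        (\<Sum>A\<in>Pow ({..<N} - {a}). \<Sum>B\<in>Pow ({..<N} - {b}). G (insert a A) a (insert b B) b)"
      if ab: "a < N" "b < N" for a b
    proof -
      have h1: "(\<Prod>i<N. if i = a \<or> i = N + b then u i / 2 else (1 + u i * (s * gauss_pt x i)) / 2) =
          (1 / 2) ^ N * (u a * (\<Prod>i\<in>{..<N} - {a}. 1 + u i * (s * x i)))"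
      proof -
        have "(\<Prod>i<N. if i = a \<or> i = N + b then u i / 2 else (1 + u i * (s * gauss_pt x i)) / 2) =
          (\<Prod>i<N. 1 / 2 * (if i = a then u i else 1 + u i * (s * x i)))"
          by (intro prod.cong) (auto simp: gauss_pt_def)
        also have "\<dots> = (1 / 2) ^ N * (\<Prod>i<N. if i = a then u i else 1 + u i * (s * x i))"
          by (subst prod.distrib) simp
        also have "(\<Prod>i<N. if i = a then u i else 1 + u i * (s * x i)) = u a * (\<Prod>i\<in>{..<N} - {a}. 1 + u i * (s * x i))"
          using ab(1) by (subst prod.remove[of _ a]) (auto intro!: arg_cong2[where f="(*)"] prod.cong)
        finally show ?thesis .
      qed
      have h2: "(\<Prod>i<N. if N + i = a \<or> N + i = N + b then u (N + i) / 2 else (1 + u (N + i) * (s * gauss_pt x (N + i))) / 2) =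
          (1 / 2) ^ N * (u (N + b) * (\<Prod>i\<in>{..<N} - {b}. 1 + u (N + i) * (s * lin (H i) x)))"
      proof -
        have "(\<Prod>i<N. if N + i = a \<or> N + i = N + b then u (N + i) / 2 else (1 + u (N + i) * (s * gauss_pt x (N + i))) / 2) =
          (\<Prod>i<N. 1 / 2 * (if i = b then u (N + i) else 1 + u (N + i) * (s * lin (H i) x)))"
          using ab by (intro prod.cong) (auto simp: gauss_pt_def)
        also have "\<dots> = (1 / 2) ^ N * (\<Prod>i<N. if i = b then u (N + i) else 1 + u (N + i) * (s * lin (H i) x))"
          by (subst prod.distrib) simp
        also have "(\<Prod>i<N. if i = b then u (N + i) else 1 + u (N + i) * (s * lin (H i) x)) =
            u (N + b) * (\<Prod>i\<in>{..<N} - {b}. 1 + u (N + i) * (s * lin (H i) x))"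
          using ab(2) by (subst prod.remove[of _ b]) (auto intro!: arg_cong2[where f="(*)"] prod.cong)
        finally show ?thesis .
      qed
      have "e * H a b * (\<Prod>i<2 * N. if i = a \<or> i = N + b then u i / 2 else (1 + u i * (s * gauss_pt x i)) / 2) =
         (\<Sum>A\<in>Pow ({..<N} - {a}). \<Sum>B\<in>Pow ({..<N} - {b}). e * H a b * ((1 / 2) ^ (2 * N) * (u a * u (N + b) *
            ((\<Prod>i\<in>A. u i * (s * x i)) * (\<Prod>i\<in>B. u (N + i) * (s * lin (H i) x))))))"
      proof -
        have fd: "finite ({..<N} - {c})" for c by simp
        have r: "e * H a b * (p * (ua * SA) * (p * (ub * SB))) = e * H a b * (p * p * (ua * ub * (SA * SB)))" for p ua SA ub SB :: real
          by (simp only: mult_ac)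
        have p2: "(1 / 2 :: real) ^ (2 * N) = (1 / 2) ^ N * (1 / 2) ^ N" by (simp only: mult_2 power_add)
        let ?SA = "\<Sum>A\<in>Pow ({..<N} - {a}). \<Prod>i\<in>A. u i * (s * x i)"
        let ?SB = "\<Sum>B\<in>Pow ({..<N} - {b}). \<Prod>i\<in>B. u (N + i) * (s * lin (H i) x)"
        have "e * H a b * (\<Prod>i<2 * N. if i = a \<or> i = N + b then u i / 2 else (1 + u i * (s * gauss_pt x i)) / 2) =
          e * H a b * ((1 / 2) ^ (2 * N) * (u a * u (N + b) * (?SA * ?SB)))"
          unfolding prod_lessThan_double h1 h2 prod_one_plus[OF fd] p2 by (rule r)
        also have "?SA * ?SB = (\<Sum>A\<in>Pow ({..<N} - {a}). \<Sum>B\<in>Pow ({..<N} - {b}).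
            (\<Prod>i\<in>A. u i * (s * x i)) * (\<Prod>i\<in>B. u (N + i) * (s * lin (H i) x)))" by (rule sum_product)
        finally show ?thesis by (simp only: sum_distrib_left)
      qed
      also have "\<dots> = (\<Sum>A\<in>Pow ({..<N} - {a}). \<Sum>B\<in>Pow ({..<N} - {b}). G (insert a A) a (insert b B) b)"
      proof (intro sum.cong refl)
        fix A B assume "A \<in> Pow ({..<N} - {a})" "B \<in> Pow ({..<N} - {b})"
        then have AB: "finite A" "finite B" "a \<notin> A" "b \<notin> B" by (auto dest: finite_subset)
        have d: "insert a A - {a} = A" "insert b B - {b} = B" using AB by auto
        have p: "s ^ (card (insert a A) + card (insert b B)) / s\<^sup>2 = s ^ (card A + card B)"
          using AB assms by (simp add: power2_eq_square)
        show "e * H a b * ((1 / 2) ^ (2 * N) * (u a * u (N + b) *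
            ((\<Prod>i\<in>A. u i * (s * x i)) * (\<Prod>i\<in>B. u (N + i) * (s * lin (H i) x))))) = G (insert a A) a (insert b B) b"
          unfolding G_def p d al_def using AB by (simp add: prod.distrib power_add mult_ac)
      qed
      finally show ?thesis .
    qed
    have "dker (\<lambda>i. s * gauss_pt x i) u = (\<Sum>a<N. \<Sum>b<N. \<Sum>A\<in>Pow ({..<N} - {a}). \<Sum>B\<in>Pow ({..<N} - {b}). G (insert a A) a (insert b B) b)"
      unfolding dker_def by (intro sum.cong refl t) auto
    also have "\<dots> = (\<Sum>a<N. \<Sum>A\<in>Pow ({..<N} - {a}). \<Sum>b<N. \<Sum>B\<in>Pow ({..<N} - {b}). G (insert a A) a (insert b B) b)"
      by (intro sum.cong refl sum.swap)
    also have "\<dots> = (\<Sum>a<N. \<Sum>A\<in>Pow ({..<N} - {a}). \<Sum>B\<in>Pow {..<N}. \<Sum>b\<in>B. G (insert a A) a B b)"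
      by (intro sum.cong refl sum_insert_reindex finite_lessThan)
    also have "\<dots> = (\<Sum>A\<in>Pow {..<N}. \<Sum>a\<in>A. \<Sum>B\<in>Pow {..<N}. \<Sum>b\<in>B. G A a B b)"
      by (rule sum_insert_reindex[OF finite_lessThan, of "\<lambda>A a. \<Sum>B\<in>Pow {..<N}. \<Sum>b\<in>B. G A a B b"])
    also have "\<dots> = (\<Sum>A\<in>Pow {..<N}. \<Sum>B\<in>Pow {..<N}. \<Sum>a\<in>A. \<Sum>b\<in>B. G A a B b)"
      by (intro sum.cong refl sum.swap)
    finally show ?thesis unfolding G_def by (simp add: sum_distrib_left)
  qed
  then have "(\<integral>x. dker (\<lambda>i. s * gauss_pt x i) u \<partial>P) = (\<integral>x. (\<Sum>A\<in>Pow {..<N}. \<Sum>B\<in>Pow {..<N}. al u A B * (s ^ (card A + card B) / s\<^sup>2) *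
      (\<Sum>a\<in>A. \<Sum>b\<in>B. e * H a b * ?m (A - {a}) (B - {b}) x)) \<partial>P)" by (simp only:)
  also have "\<dots> = (\<Sum>A\<in>Pow {..<N}. \<integral>x. (\<Sum>B\<in>Pow {..<N}. al u A B * (s ^ (card A + card B) / s\<^sup>2) *
      (\<Sum>a\<in>A. \<Sum>b\<in>B. e * H a b * ?m (A - {a}) (B - {b}) x)) \<partial>P)"
    by (rule exp_growth_integral_sum, intro exp_growth_sum exp_growth_mult exp_growth_prod exp_growth_const exp_growth_comp exp_growth_lin) auto
  also have "\<dots> = (\<Sum>A\<in>Pow {..<N}. \<Sum>B\<in>Pow {..<N}. \<integral>x. al u A B * (s ^ (card A + card B) / s\<^sup>2) *
      (\<Sum>a\<in>A. \<Sum>b\<in>B. e * H a b * ?m (A - {a}) (B - {b}) x) \<partial>P)"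
    by (intro sum.cong refl exp_growth_integral_sum exp_growth_sum exp_growth_mult exp_growth_prod exp_growth_const exp_growth_comp exp_growth_lin) auto
  also have "\<dots> = (\<Sum>A\<in>Pow {..<N}. \<Sum>B\<in>Pow {..<N}. al u A B * (s ^ (card A + card B) / s\<^sup>2) * (real (card A) * gauss_mom A B))"
  proof (intro sum.cong refl)
    fix A B assume AB: "A \<in> Pow {..<N}" "B \<in> Pow {..<N}"
    then have f: "finite A" "finite B" using finite_subset by blast+
    have "(\<integral>x. (\<Sum>a\<in>A. \<Sum>b\<in>B. e * H a b * ?m (A - {a}) (B - {b}) x) \<partial>P) =
        (\<Sum>a\<in>A. \<integral>x. (\<Sum>b\<in>B. e * H a b * ?m (A - {a}) (B - {b}) x) \<partial>P)"
      by (rule exp_growth_integral_sum, intro exp_growth_sum exp_growth_mult exp_growth_prod exp_growth_const exp_growth_comp exp_growth_lin) (use AB in auto)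
    also have "\<dots> = (\<Sum>a\<in>A. \<Sum>b\<in>B. \<integral>x. e * H a b * ?m (A - {a}) (B - {b}) x \<partial>P)"
      by (intro sum.cong refl exp_growth_integral_sum exp_growth_sum exp_growth_mult exp_growth_prod exp_growth_const exp_growth_comp exp_growth_lin) (use AB in auto)
    also have "\<dots> = (\<Sum>a\<in>A. \<Sum>b\<in>B. e * H a b * gauss_mom (A - {a}) (B - {b}))"
      unfolding gauss_mom_def by (intro sum.cong refl integral_mult_right_zero)
    also have "\<dots> = real (card A) * gauss_mom A B"
      using gauss_mom_card_mult[OF f(2,1)] AB by (simp add: sum_distrib_left mult_ac)
    finally show "(\<integral>x. al u A B * (s ^ (card A + card B) / s\<^sup>2) *
      (\<Sum>a\<in>A. \<Sum>b\<in>B. e * H a b * ?m (A - {a}) (B - {b}) x) \<partial>P) =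
       al u A B * (s ^ (card A + card B) / s\<^sup>2) * (real (card A) * gauss_mom A B)"
      unfolding integral_mult_right_zero by (rule arg_cong)
  qed
  finally show ?thesis .
qed

text \<open>Here \<open>c\<close> stands for the test function with all other blocks summed out. The
  Gaussian and the uniform block are joined by the kernels at sqrt t times the Gaussian point, whose
  derivative in t is the mean of \<open>dker\<close>. Points with all coordinates at most 1/2 are
  covered by \<open>M\<close>; at bad points only |c u| \<le> R and the L1 norms of the kernels are
  available, and \<open>tau\<close> integrates these.\<close>

lemma block_bound:
  assumes R: "\<And>u. u \<in> sign_cube (2 * N) \<Longrightarrow> \<bar>c u\<bar> \<le> R"
    and M: "\<And>v. (\<And>i. i < 2 * N \<Longrightarrow> \<bar>v i\<bar> \<le> 1 / 2) \<Longrightarrow> \<bar>\<Sum>u\<in>sign_cube (2 * N). c u * dker v u\<bar> \<le> M"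
  shows "\<bar>\<Sum>u\<in>sign_cube (2 * N). c u * ((\<integral>x. ker (\<lambda>i. trnc (gauss_pt x i)) u \<partial>P) - (1 / 2) ^ (2 * N))\<bar> \<le> M + (2 + Lam) * tau * R"
proof -
  let ?W = "sign_cube (2 * N)"
  have R0: "R \<ge> 0"
  proof -
    have "(\<lambda>i. if i < 2 * N then 1 else 0) \<in> ?W" by (auto simp: sign_cube_def PiE_dflt_def)
    then show ?thesis using R abs_ge_zero order_trans by blast
  qed
  have sumc: "\<bar>\<Sum>u\<in>?W. c u * f u\<bar> \<le> R * (\<Sum>u\<in>?W. \<bar>f u\<bar>)" for f :: "_ \<Rightarrow> real"
  proof -
    have "\<bar>\<Sum>u\<in>?W. c u * f u\<bar> \<le> (\<Sum>u\<in>?W. \<bar>c u\<bar> * \<bar>f u\<bar>)" by (rule order_trans[OF sum_abs]) (simp add: abs_mult)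
    also have "\<dots> \<le> (\<Sum>u\<in>?W. R * \<bar>f u\<bar>)" by (intro sum_mono mult_right_mono R) auto
    finally show ?thesis by (simp add: sum_distrib_left)
  qed
  define D where "D = (\<lambda>A B. if card A = card B then gauss_mom A B else 0)"
  have Dm: "gauss_mom A B = D A B" if "A \<subseteq> {..<N}" "B \<subseteq> {..<N}" for A B
  proof -
    have "finite A" "finite B" using that finite_subset by blast+
    then show ?thesis using gauss_mom_card_neq[of B A] that by (auto simp: D_def)
  qed
  define C where "C = (\<lambda>A B. \<Sum>u\<in>?W. c u * al u A B)"
  \<comment> \<open>The expected sum of \<open>c u\<close> times the kernel at sqrt t times the
    Gaussian point. Only terms with \<open>card A = card B\<close> survive, so it is a polynomial in
    \<open>t\<close> and differentiable also at 0.\<close>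
  define \<phi> where "\<phi> = (\<lambda>t. \<Sum>A\<in>Pow {..<N}. \<Sum>B\<in>Pow {..<N}. C A B * D A B * t ^ card A)"
  define \<phi>' where "\<phi>' = (\<lambda>t. \<Sum>A\<in>Pow {..<N}. \<Sum>B\<in>Pow {..<N}. C A B * D A B * (real (card A) * t ^ (card A - Suc 0)))"
  have "(\<phi> has_real_derivative \<phi>' t) (at t)" for t
    unfolding \<phi>_def \<phi>'_def by (auto intro!: derivative_eq_intros sum.cong)
  \<comment> \<open>One intermediate \<open>t\<close> suffices, so no average over \<open>t\<close>
    has to be formed.\<close>
  then obtain t where t: "0 < t" "t < 1" "\<phi> 1 - \<phi> 0 = (1 - 0) * \<phi>' t"
    using MVT2[of 0 1 \<phi> \<phi>'] by auto
  have k1: "(\<Sum>u\<in>?W. c u * (\<integral>x. ker (\<lambda>i. 1 * gauss_pt x i) u \<partial>P)) = \<phi> 1"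
  proof -
    have "(\<Sum>u\<in>?W. c u * (\<integral>x. ker (\<lambda>i. 1 * gauss_pt x i) u \<partial>P)) =
      (\<Sum>u\<in>?W. \<Sum>A\<in>Pow {..<N}. \<Sum>B\<in>Pow {..<N}. c u * al u A B * D A B)"
      unfolding E_ker sum_distrib_left by (intro sum.cong refl) (auto simp: Dm)
    also have "\<dots> = \<phi> 1" unfolding \<phi>_def C_def
      by (subst sum.swap, intro sum.cong refl, subst sum.swap) (simp add: sum_distrib_right)
    finally show ?thesis .
  qed
  have k0: "\<phi> 0 = (\<Sum>u\<in>?W. c u * (1 / 2) ^ (2 * N))"
  proof -
    have "\<phi> 0 = (\<Sum>A\<in>Pow {..<N}. \<Sum>B\<in>Pow {..<N}. if A = {} then (if B = {} then C {} {} else 0) else 0)"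
      unfolding \<phi>_def
    proof (intro sum.cong refl)
      fix A B assume "A \<in> Pow {..<N}" "B \<in> Pow {..<N}"
      then have "finite A" "finite B" using finite_subset by blast+
      moreover have "gauss_mom {} {} = 1" by (simp add: gauss_mom_def P.prob_space)
      ultimately show "C A B * D A B * 0 ^ card A = (if A = {} then (if B = {} then C {} {} else 0) else 0)"
        by (auto simp: D_def)
    qed
    also have "\<dots> = (\<Sum>A\<in>Pow {..<N}. if A = {} then C {} {} else 0)"
      by (intro sum.cong refl) (auto simp: sum.delta)
    also have "\<dots> = C {} {}" by (simp add: sum.delta)
    finally show ?thesis by (simp add: C_def al_def)
  qed
  define s where "s = sqrt t"
  have s: "0 < s" "s \<le> 1" "s\<^sup>2 = t" using t by (auto simp: s_def)
  have k': "(\<Sum>u\<in>?W. c u * (\<integral>x. dker (\<lambda>i. s * gauss_pt x i) u \<partial>P)) = \<phi>' t"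
  proof -
    have pw: "s ^ (card A + card B) / s\<^sup>2 * (real (card A) * gauss_mom A B) = D A B * (real (card A) * t ^ (card A - Suc 0))"
      if "A \<subseteq> {..<N}" "B \<subseteq> {..<N}" for A B
    proof (cases "card A = card B \<and> card A \<noteq> 0")
      case True
      then obtain j where "card A = Suc j" using not0_implies_Suc by blast
      then have j: "card A = Suc j" "card B = Suc j" using True by auto
      have "s ^ (Suc j + Suc j) / s\<^sup>2 = t ^ j"
        using s(1) unfolding s(3)[symmetric] by (simp add: power_add power2_eq_square power_mult_distrib)
      then show ?thesis using Dm[OF that] j by simp
    next
      case False
      then have "card A = 0 \<or> D A B = 0" by (auto simp: D_def)
      then show ?thesis unfolding Dm[OF that] by auto
    qed
    have "(\<Sum>u\<in>?W. c u * (\<integral>x. dker (\<lambda>i. s * gauss_pt x i) u \<partial>P)) =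
      (\<Sum>u\<in>?W. \<Sum>A\<in>Pow {..<N}. \<Sum>B\<in>Pow {..<N}. c u * al u A B * (D A B * (real (card A) * t ^ (card A - Suc 0))))"
    proof (intro sum.cong refl)
      fix u
      have "s \<noteq> 0" using s by simp
      then show "c u * (\<integral>x. dker (\<lambda>i. s * gauss_pt x i) u \<partial>P) =
        (\<Sum>A\<in>Pow {..<N}. \<Sum>B\<in>Pow {..<N}. c u * al u A B * (D A B * (real (card A) * t ^ (card A - Suc 0))))"
        unfolding E_dker[OF \<open>s \<noteq> 0\<close>] sum_distrib_left
        by (intro sum.cong refl) (simp add: pw[symmetric] mult_ac)
    qed
    also have "\<dots> = \<phi>' t" unfolding \<phi>'_def C_def
      by (subst sum.swap, intro sum.cong refl, subst sum.swap, intro sum.cong refl) (simp only: sum_distrib_right mult.assoc)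
    finally show ?thesis .
  qed
  have main: "\<bar>\<phi>' t\<bar> \<le> M + Lam * tau * R"
  proof -
    let ?g = "\<lambda>x. \<Sum>u\<in>?W. c u * dker (\<lambda>i. s * gauss_pt x i) u"
    have grg: "exp_growth ?g" by (intro exp_growth_sum exp_growth_mult exp_growth_const exp_growth_dker)
    have eq: "\<phi>' t = (\<integral>x. ?g x \<partial>P)"
    proof -
      have "(\<integral>x. ?g x \<partial>P) = (\<Sum>u\<in>?W. \<integral>x. c u * dker (\<lambda>i. s * gauss_pt x i) u \<partial>P)"
        by (rule exp_growth_integral_sum) (intro exp_growth_mult exp_growth_const exp_growth_dker)
      then show ?thesis unfolding k'[symmetric] by (simp only: integral_mult_right_zero)
    qed
    have "\<bar>\<integral>x. ?g x \<partial>P\<bar> \<le> (\<integral>x. \<bar>?g x\<bar> \<partial>P)" by (rule integral_abs_bound)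
    also have "\<dots> \<le> (\<integral>x. M + R * Lam * (of_bool (bad x) * max_prod (gauss_pt x)) \<partial>P)"
    proof (rule integral_mono)
      show "integrable P (\<lambda>x. \<bar>?g x\<bar>)" using exp_growth_integrable[OF grg] by simp
      show "integrable P (\<lambda>x. M + R * Lam * (of_bool (bad x) * max_prod (gauss_pt x)))"
        using exp_growth_integrable[OF exp_growth_bad_max_prod] by simp
      fix x
      have M0: "0 \<le> M" using M[of "\<lambda>_. 0"] by (simp add: order_trans[OF abs_ge_zero])
      show "\<bar>?g x\<bar> \<le> M + R * Lam * (of_bool (bad x) * max_prod (gauss_pt x))"
      proof (cases "bad x")
        case False
        then have "\<bar>s * gauss_pt x i\<bar> \<le> 1 / 2" if "i < 2 * N" for i
        proof -
          have "\<bar>gauss_pt x i\<bar> \<le> 1 / 2" using False that unfolding bad_def by (meson not_less)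
          then have "s * \<bar>gauss_pt x i\<bar> \<le> 1 * (1 / 2)" using s by (intro mult_mono) auto
          then show ?thesis using s by (simp add: abs_mult)
        qed
        then show ?thesis using M[of "\<lambda>i. s * gauss_pt x i"] False by simp
      next
        case True
        have "\<bar>?g x\<bar> \<le> R * (Lam * max_prod (\<lambda>i. s * gauss_pt x i))"
          by (rule order_trans[OF sumc mult_left_mono[OF sum_abs_dker R0]])
        also have "\<dots> \<le> R * (Lam * max_prod (gauss_pt x))"
        proof (intro mult_left_mono R0 Lam_nonneg)
          show "max_prod (\<lambda>i. s * gauss_pt x i) \<le> max_prod (gauss_pt x)" unfolding max_prod_def
          proof (intro prod_mono conjI)
            fix i
            have "s * \<bar>gauss_pt x i\<bar> \<le> 1 * \<bar>gauss_pt x i\<bar>" using s by (intro mult_right_mono) auto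
            then show "max 1 \<bar>s * gauss_pt x i\<bar> \<le> max 1 \<bar>gauss_pt x i\<bar>" using s by (simp add: abs_mult)
          qed auto
        qed
        finally show ?thesis using True M0 by simp
      qed
    qed
    also have "\<dots> = M + R * Lam * tau" unfolding tau_def
      using exp_growth_integrable[OF exp_growth_bad_max_prod] by (simp add: P.prob_space)
    also have "\<dots> = M + Lam * tau * R" by simp
    finally have fin: "\<bar>\<integral>x. ?g x \<partial>P\<bar> \<le> M + Lam * tau * R" .
    show ?thesis by (rule ord_eq_le_trans[OF arg_cong[OF eq, of abs] fin])
  qed
  \<comment> \<open>Truncation acts only at bad points, where the two kernels have L1 norms 1 and
    \<open>max_prod\<close>, together at most twice \<open>max_prod\<close>.\<close>
  have trunc: "\<bar>\<Sum>u\<in>?W. c u * ((\<integral>x. ker (\<lambda>i. trnc (gauss_pt x i)) u \<partial>P) - (\<integral>x. ker (\<lambda>i. 1 * gauss_pt x i) u \<partial>P))\<bar> \<le> 2 * tau * R"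
  proof -
    let ?g = "\<lambda>x. \<Sum>u\<in>?W. c u * (ker (\<lambda>i. trnc (gauss_pt x i)) u - ker (\<lambda>i. 1 * gauss_pt x i) u)"
    have grd: "exp_growth (\<lambda>x. ker (\<lambda>i. trnc (gauss_pt x i)) u - ker (\<lambda>i. 1 * gauss_pt x i) u)" for u
      using exp_growth_add[OF exp_growth_ker_trnc exp_growth_mult[OF exp_growth_const[of "-1"] exp_growth_ker[of 1]]] by simp
    have grg: "exp_growth ?g" by (intro exp_growth_sum exp_growth_mult exp_growth_const grd)
    have eq: "(\<integral>x. ?g x \<partial>P) = (\<Sum>u\<in>?W. c u * ((\<integral>x. ker (\<lambda>i. trnc (gauss_pt x i)) u \<partial>P) - (\<integral>x. ker (\<lambda>i. 1 * gauss_pt x i) u \<partial>P)))"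
    proof -
      have "(\<integral>x. ?g x \<partial>P) = (\<Sum>u\<in>?W. \<integral>x. c u * (ker (\<lambda>i. trnc (gauss_pt x i)) u - ker (\<lambda>i. 1 * gauss_pt x i) u) \<partial>P)"
        by (rule exp_growth_integral_sum) (intro exp_growth_mult exp_growth_const grd)
      also have "\<dots> = (\<Sum>u\<in>?W. c u * ((\<integral>x. ker (\<lambda>i. trnc (gauss_pt x i)) u \<partial>P) - (\<integral>x. ker (\<lambda>i. 1 * gauss_pt x i) u \<partial>P)))"
        unfolding integral_mult_right_zero
        by (intro sum.cong refl arg_cong2[where f="(*)"] Bochner_Integration.integral_diff exp_growth_integrable exp_growth_ker_trnc exp_growth_ker)
      finally show ?thesis .
    qed
    have "\<bar>\<integral>x. ?g x \<partial>P\<bar> \<le> (\<integral>x. \<bar>?g x\<bar> \<partial>P)" by (rule integral_abs_bound)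
    also have "\<dots> \<le> (\<integral>x. 2 * R * (of_bool (bad x) * max_prod (gauss_pt x)) \<partial>P)"
    proof (rule integral_mono)
      show "integrable P (\<lambda>x. \<bar>?g x\<bar>)" using exp_growth_integrable[OF grg] by simp
      show "integrable P (\<lambda>x. 2 * R * (of_bool (bad x) * max_prod (gauss_pt x)))"
        using exp_growth_integrable[OF exp_growth_bad_max_prod] by simp
      fix x
      show "\<bar>?g x\<bar> \<le> 2 * R * (of_bool (bad x) * max_prod (gauss_pt x))"
      proof (cases "bad x")
        case False
        then have "trnc (gauss_pt x i) = 1 * gauss_pt x i" if "i < 2 * N" for i
        proof -
          have "\<bar>gauss_pt x i\<bar> \<le> 1 / 2" using False that unfolding bad_def by (meson not_less)
          then show ?thesis by (auto simp: trnc_def)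
        qed
        then have "ker (\<lambda>i. trnc (gauss_pt x i)) u = ker (\<lambda>i. 1 * gauss_pt x i) u" for u
          unfolding ker_def by (intro prod.cong) auto
        then show ?thesis using False by simp
      next
        case True
        have "\<bar>?g x\<bar> \<le> R * (\<Sum>u\<in>?W. \<bar>ker (\<lambda>i. trnc (gauss_pt x i)) u - ker (\<lambda>i. 1 * gauss_pt x i) u\<bar>)" by (rule sumc)
        also have "\<dots> \<le> R * (\<Sum>u\<in>?W. \<bar>ker (\<lambda>i. trnc (gauss_pt x i)) u\<bar> + \<bar>ker (\<lambda>i. 1 * gauss_pt x i) u\<bar>)"
          by (intro mult_left_mono sum_mono R0 abs_triangle_ineq4)
        also have "\<dots> = R * (max_prod (\<lambda>i. trnc (gauss_pt x i)) + max_prod (gauss_pt x))" by (simp add: sum.distrib sum_abs_ker)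
        also have "max_prod (\<lambda>i. trnc (gauss_pt x i)) = 1" unfolding max_prod_def by (intro prod.neutral) (auto simp: trnc_def)
        also have "R * (1 + max_prod (gauss_pt x)) \<le> R * (2 * max_prod (gauss_pt x))" using max_prod_ge_1 R0 by (intro mult_left_mono) auto
        finally show ?thesis using True by simp
      qed
    qed
    also have "\<dots> = 2 * R * tau" unfolding tau_def by (rule integral_mult_right_zero)
    also have "\<dots> = 2 * tau * R" by simp
    finally have fin: "\<bar>\<integral>x. ?g x \<partial>P\<bar> \<le> 2 * tau * R" .
    show ?thesis by (rule ord_eq_le_trans[OF arg_cong[OF eq[symmetric], of abs] fin])
  qed
  let ?T = "\<Sum>u\<in>?W. c u * ((\<integral>x. ker (\<lambda>i. trnc (gauss_pt x i)) u \<partial>P) - (\<integral>x. ker (\<lambda>i. 1 * gauss_pt x i) u \<partial>P))"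
  have alg: "c * (A - B) = c * (A - E) + (c * E - c * B)" for c A B E :: real by (simp add: algebra_simps)
  have eq: "(\<Sum>u\<in>?W. c u * ((\<integral>x. ker (\<lambda>i. trnc (gauss_pt x i)) u \<partial>P) - (1 / 2) ^ (2 * N))) = ?T + (\<phi> 1 - \<phi> 0)"
  proof -
    have "?T + ((\<Sum>u\<in>?W. c u * (\<integral>x. ker (\<lambda>i. 1 * gauss_pt x i) u \<partial>P)) - (\<Sum>u\<in>?W. c u * (1 / 2) ^ (2 * N))) =
       (\<Sum>u\<in>?W. c u * ((\<integral>x. ker (\<lambda>i. trnc (gauss_pt x i)) u \<partial>P) - (\<integral>x. ker (\<lambda>i. 1 * gauss_pt x i) u \<partial>P)) +
          (c u * (\<integral>x. ker (\<lambda>i. 1 * gauss_pt x i) u \<partial>P) - c u * (1 / 2) ^ (2 * N)))"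
      by (simp only: sum_subtractf sum.distrib)
    also have "\<dots> = (\<Sum>u\<in>?W. c u * ((\<integral>x. ker (\<lambda>i. trnc (gauss_pt x i)) u \<partial>P) - (1 / 2) ^ (2 * N)))"
      by (intro sum.cong refl) (rule alg[symmetric])
    finally show ?thesis unfolding k1 k0 by (rule sym)
  qed
  have pd: "\<phi> 1 - \<phi> 0 = \<phi>' t" by (rule trans[OF t(3)]) simp
  have tri: "\<bar>a + b\<bar> \<le> p + q" if "\<bar>a\<bar> \<le> p" "\<bar>b\<bar> \<le> q" for a b p q :: real using that by linarith
  have "\<bar>?T + (\<phi> 1 - \<phi> 0)\<bar> \<le> 2 * tau * R + (M + Lam * tau * R)"
    unfolding pd by (rule tri[OF trunc main])
  also have "\<dots> = M + (2 + Lam) * tau * R" by (simp add: distrib_right)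
  finally have fin: "\<bar>?T + (\<phi> 1 - \<phi> 0)\<bar> \<le> M + (2 + Lam) * tau * R" .
  show ?thesis by (rule ord_eq_le_trans[OF arg_cong[OF eq, of abs] fin])
qed

end

section \<open>Tail bounds and concentration\<close>

text \<open>Hoeffding's lemma for a random sign of mean \<open>t\<close>; negative \<open>h\<close>
  is reduced to positive \<open>h\<close> by changing both signs.\<close>

lemma two_point_mgf:
  fixes t h :: real
  assumes "\<bar>t\<bar> \<le> 1"
  shows "(1 - t) / 2 * exp (- h) + (1 + t) / 2 * exp h \<le> exp (t * h + h\<^sup>2 / 2)"
proof -
  have main: "(1 - t) / 2 * exp (- h) + (1 + t) / 2 * exp h \<le> exp (t * h + h\<^sup>2 / 2)" if "\<bar>t\<bar> \<le> 1" "h \<ge> 0" for t h :: real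
  proof -
    define p where "p = (1 + t) / 2"
    have p: "0 \<le> p" "p \<le> 1" using that by (auto simp: p_def)
    have pos: "1 + p * (exp (2 * h) - 1) > 0" using p that by (simp add: add_pos_nonneg)
    have "- (2 * h) * p + ln (1 + p * (exp (2 * h) - 1)) \<le> (2 * h)\<^sup>2 / 8"
      by (rule Hoeffdings_lemma_aux) (use that p in auto)
    then have "ln (1 + p * (exp (2 * h) - 1)) \<le> 2 * h * p + h\<^sup>2 / 2" by (simp add: power_mult_distrib)
    then have "exp (ln (1 + p * (exp (2 * h) - 1))) \<le> exp (2 * h * p + h\<^sup>2 / 2)" by (simp only: exp_le_cancel_iff)
    then have "1 + p * (exp (2 * h) - 1) \<le> exp (2 * h * p + h\<^sup>2 / 2)" using pos by simp
    then have "exp (- h) * (1 + p * (exp (2 * h) - 1)) \<le> exp (- h) * exp (2 * h * p + h\<^sup>2 / 2)" by simp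
    also have "exp (- h) * exp (2 * h * p + h\<^sup>2 / 2) = exp (t * h + h\<^sup>2 / 2)"
      unfolding exp_add[symmetric] p_def by (simp add: field_simps)
    also have "exp (- h) * (1 + p * (exp (2 * h) - 1)) = (1 - p) * exp (- h) + p * (exp (- h) * exp (2 * h))"
      by (simp add: algebra_simps)
    also have "exp (- h) * exp (2 * h) = exp h" unfolding exp_add[symmetric] by simp
    finally show ?thesis by (simp add: p_def field_simps)
  qed
  show ?thesis
  proof (cases "h \<ge> 0")
    case False
    then show ?thesis using main[of "- t" "- h"] assms by (simp add: add.commute)
  qed (use main assms in simp)
qed

lemma sum_lessThan_double: "(\<Sum>i<2 * N. f i) = (\<Sum>a<N. f a) + (\<Sum>b<N. f (N + b))" for f :: "nat \<Rightarrow> real"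
proof -
  have "(\<Sum>i<2 * N. f i) = (\<Sum>i\<in>{..<N}. f i) + (\<Sum>i\<in>{N..<2 * N}. f i)"
    by (subst sum.union_disjoint[symmetric]) (auto intro!: sum.cong)
  also have "(\<Sum>i\<in>{N..<2 * N}. f i) = (\<Sum>b<N. f (N + b))"
    by (rule sum.reindex_bij_witness[of _ "\<lambda>b. N + b" "\<lambda>i. i - N"]) auto
  finally show ?thesis .
qed

lemma sign_cube_iff: "u \<in> sign_cube M \<longleftrightarrow> (\<forall>i<M. u i = 1 \<or> u i = - 1) \<and> (\<forall>i\<ge>M. u i = 0)"
proof -
  have "u \<in> sign_cube M \<longleftrightarrow> (\<forall>i. if i < M then u i \<in> {- 1, 1} else u i = 0)"
    by (auto simp: sign_cube_def PiE_dflt_def)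
  also have "\<dots> \<longleftrightarrow> (\<forall>i<M. u i = 1 \<or> u i = - 1) \<and> (\<forall>i\<ge>M. u i = 0)"
    by (metis insert_iff not_less singletonD)
  finally show ?thesis .
qed

context gauss
begin

lemma sum_sq_H: "(\<Sum>a<N. (\<Sum>b<N. g b * H b a)\<^sup>2) = (\<Sum>b<N. (g b)\<^sup>2)"
proof -
  have "(\<Sum>a<N. (\<Sum>b<N. g b * H b a)\<^sup>2) = (\<Sum>a<N. \<Sum>b<N. \<Sum>c<N. g b * g c * (H b a * H c a))"
    unfolding power2_eq_square sum_product by (simp add: mult_ac)
  also have "\<dots> = (\<Sum>b<N. \<Sum>c<N. \<Sum>a<N. g b * g c * (H b a * H c a))"
    by (rule trans[OF sum.swap]) (intro sum.cong refl sum.swap)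
  also have "\<dots> = (\<Sum>b<N. \<Sum>c<N. if b = c then g b * g c else 0)"
    unfolding sum_distrib_left[symmetric] by (intro sum.cong refl) (simp add: orth)
  finally show ?thesis by (simp add: power2_eq_square)
qed

text \<open>The function \<open>q\<close> exceeds 1 beyond 1/2 and \<open>1 + q\<close> dominates
  \<open>max 1 \<bar>t\<bar>\<close>, so the product of \<open>1 + q\<close> controls the bad event
  and the norm together. This product expands into exponentials of linear forms in the Gaussian
  coordinates, whose expectations are explicit; in this way the dependence between the two halves of
  the point does no harm.\<close>

lemma tau_le:
  assumes e16: "e \<le> 1 / 16"
  shows "tau \<le> 2 * ((1 + 2 * exp (- 1 / (16 * e))) ^ (2 * N) - 1)"
proof -
  \<comment> \<open>Minimises \<open>e * \<beta>\<^sup>2 - \<beta> / 2\<close>; the minimum is the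
    exponent \<open>- 1 / (16 * e)\<close>.\<close>
  define \<beta> where "\<beta> = 1 / (4 * e)"
  define ch where "ch = cosh (\<beta> / 2)"
  define q where "q = (\<lambda>t. cosh (\<beta> * t) / ch)"
  have \<beta>: "\<beta> \<ge> 4" using e e16 by (simp add: \<beta>_def field_simps)
  have ch: "ch > 0" "ch \<ge> exp (\<beta> / 2) / 2" "ch \<le> exp (\<beta> / 2)"
  proof -
    show "ch > 0" unfolding ch_def by (rule cosh_real_pos)
    show "ch \<ge> exp (\<beta> / 2) / 2" "ch \<le> exp (\<beta> / 2)" using \<beta> by (auto simp: ch_def cosh_field_def)
  qed
  have q0: "q t \<ge> 0" for t using ch by (simp add: q_def)
  have q1: "q t \<ge> 1" if "\<bar>t\<bar> > 1 / 2" for t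
  proof -
    have "cosh (\<beta> / 2) \<le> cosh (\<beta> * \<bar>t\<bar>)" using that \<beta> by (subst cosh_real_nonneg_le_iff) auto
    moreover have "cosh (\<beta> * \<bar>t\<bar>) = cosh (\<beta> * t)" using \<beta> by (simp add: abs_if)
    ultimately show ?thesis using ch by (simp add: q_def ch_def)
  qed
  have mq: "max 1 \<bar>t\<bar> \<le> 1 + q t" for t
  proof (cases "\<bar>t\<bar> \<le> 1")
    case True
    then show ?thesis using q0[of t] by simp
  next
    case False
    have "exp (\<beta> * \<bar>t\<bar>) / 2 \<le> cosh (\<beta> * \<bar>t\<bar>)" by (simp add: cosh_field_def)
    moreover have "cosh (\<beta> * \<bar>t\<bar>) = cosh (\<beta> * t)" using \<beta> by (simp add: abs_if)
    ultimately have "exp (\<beta> * \<bar>t\<bar>) / 2 / exp (\<beta> / 2) \<le> q t"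
      unfolding q_def using ch by (intro frac_le) auto
    moreover have "exp (\<beta> * \<bar>t\<bar>) / 2 / exp (\<beta> / 2) = exp (\<beta> * \<bar>t\<bar> - \<beta> / 2) / 2" by (simp add: exp_diff)
    moreover have "1 + (\<beta> * \<bar>t\<bar> - \<beta> / 2) \<le> exp (\<beta> * \<bar>t\<bar> - \<beta> / 2)" by (rule exp_ge_add_one_self)
    moreover have "4 * (\<bar>t\<bar> - 1 / 2) \<le> \<beta> * (\<bar>t\<bar> - 1 / 2)" using \<beta> False by (intro mult_right_mono) auto
    ultimately show ?thesis using False by (simp add: algebra_simps max_def)
  qed
  \<comment> \<open>At a bad point one factor is at least 2, so the product Y satisfies Y \<le> 2 (Y
    - 1); elsewhere Y \<ge> 1 is enough.\<close>
  have pt: "of_bool (bad x) * max_prod (gauss_pt x) \<le> 2 * ((\<Prod>i<2 * N. 1 + q (gauss_pt x i)) - 1)" for x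
  proof (cases "bad x")
    case True
    then obtain i where i: "i < 2 * N" "\<bar>gauss_pt x i\<bar> > 1 / 2" by (auto simp: bad_def)
    have "2 \<le> (1 + q (gauss_pt x i)) * 1" using q1[OF i(2)] by simp
    also have "\<dots> \<le> (1 + q (gauss_pt x i)) * (\<Prod>j\<in>{..<2 * N} - {i}. 1 + q (gauss_pt x j))"
      using q0 by (intro mult_left_mono prod_ge_1) (auto simp: add_nonneg_nonneg)
    also have "\<dots> = (\<Prod>j<2 * N. 1 + q (gauss_pt x j))" using i by (subst prod.remove[of _ i, symmetric]) auto
    finally have "2 \<le> (\<Prod>j<2 * N. 1 + q (gauss_pt x j))" .
    moreover have "max_prod (gauss_pt x) \<le> (\<Prod>j<2 * N. 1 + q (gauss_pt x j))" unfolding max_prod_def using mq by (intro prod_mono) auto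
    ultimately show ?thesis using True by simp
  next
    case False
    have "1 \<le> (\<Prod>j<2 * N. 1 + q (gauss_pt x j))" using q0 by (intro prod_ge_1) auto
    then show ?thesis using False by simp
  qed
  \<comment> \<open>The weights in \<open>1 + q t\<close> as a sum of the exponentials of
    \<open>\<beta> * j * t\<close> for j = -1, 0, 1.\<close>
  define w :: "real \<Rightarrow> real" where "w = (\<lambda>j. if j = 0 then 1 else 1 / (2 * ch))"
  let ?S = "{- 1, 0, 1 :: real}"
  let ?G = "PiE {..<2 * N} (\<lambda>_. ?S)"
  define cc where "cc = (\<lambda>g a. \<beta> * (g a + (\<Sum>b<N. g (N + b) * H b a)))"
  have lincc: "(\<Sum>i<2 * N. \<beta> * g i * gauss_pt x i) = lin (cc g) x" for g x
  proof -
    have "(\<Sum>i<2 * N. \<beta> * g i * gauss_pt x i) = (\<Sum>a<N. \<beta> * g a * x a) + (\<Sum>b<N. \<beta> * g (N + b) * (\<Sum>a<N. H b a * x a))"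
      unfolding sum_lessThan_double by (simp add: gauss_pt_def lin_def)
    also have "(\<Sum>b<N. \<beta> * g (N + b) * (\<Sum>a<N. H b a * x a)) = (\<Sum>a<N. \<Sum>b<N. \<beta> * g (N + b) * (H b a * x a))"
      unfolding sum_distrib_left by (rule sum.swap)
    finally show ?thesis unfolding lin_def cc_def
      by (simp add: sum.distrib sum_distrib_left sum_distrib_right algebra_simps)
  qed
  have expand: "(\<Prod>i<2 * N. 1 + q (gauss_pt x i)) = (\<Sum>g\<in>?G. (\<Prod>i<2 * N. w (g i)) * exp (lin (cc g) x))" for x
  proof -
    have "1 + q t = (\<Sum>j\<in>?S. w j * exp (\<beta> * j * t))" for t
      using ch by (simp add: q_def w_def cosh_field_def field_simps)
    then have "(\<Prod>i<2 * N. 1 + q (gauss_pt x i)) = (\<Prod>i<2 * N. \<Sum>j\<in>?S. w j * exp (\<beta> * j * gauss_pt x i))" by (simp only:)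
    also have "\<dots> = (\<Sum>g\<in>?G. \<Prod>i<2 * N. w (g i) * exp (\<beta> * g i * gauss_pt x i))"
      by (rule prod_sum_PiE) auto
    also have "\<dots> = (\<Sum>g\<in>?G. (\<Prod>i<2 * N. w (g i)) * exp (lin (cc g) x))"
      unfolding lincc[symmetric] by (simp add: prod.distrib exp_sum)
    finally show ?thesis .
  qed
  have w0: "w j \<ge> 0" for j using ch by (simp add: w_def)
  \<comment> \<open>The halves are correlated through \<open>H\<close>. The inequality (y + z)^2
    \<le> 2 y^2 + 2 z^2 separates them, which turns \<open>e / 2\<close> into
    \<open>e\<close>.\<close>
  have Elin: "(\<integral>x. exp (lin (cc g) x) \<partial>P) \<le> (\<Prod>i<2 * N. exp (e * \<beta>\<^sup>2 * (g i)\<^sup>2))" for g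
  proof -
    have "(\<Sum>a<N. (cc g a)\<^sup>2) \<le> (\<Sum>a<N. \<beta>\<^sup>2 * (2 * (g a)\<^sup>2 + 2 * (\<Sum>b<N. g (N + b) * H b a)\<^sup>2))"
    proof (intro sum_mono)
      fix a
      have "(y + z)\<^sup>2 \<le> 2 * y\<^sup>2 + 2 * z\<^sup>2" for y z :: real
        using zero_le_power2[of "y - z"] by (simp add: power2_sum power2_diff)
      then show "(cc g a)\<^sup>2 \<le> \<beta>\<^sup>2 * (2 * (g a)\<^sup>2 + 2 * (\<Sum>b<N. g (N + b) * H b a)\<^sup>2)"
        unfolding cc_def power_mult_distrib by (intro mult_left_mono) auto
    qed
    also have "\<dots> = \<beta>\<^sup>2 * (2 * (\<Sum>i<2 * N. (g i)\<^sup>2))"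
      unfolding sum_lessThan_double sum_sq_H[of "\<lambda>b. g (N + b)", symmetric]
      by (simp add: sum.distrib sum_distrib_left algebra_simps)
    finally have "e / 2 * (\<Sum>a<N. (cc g a)\<^sup>2) \<le> e / 2 * (\<beta>\<^sup>2 * (2 * (\<Sum>i<2 * N. (g i)\<^sup>2)))"
      using e by (intro mult_left_mono) auto
    then have "exp (e / 2 * (\<Sum>a<N. (cc g a)\<^sup>2)) \<le> exp (\<Sum>i<2 * N. e * \<beta>\<^sup>2 * (g i)\<^sup>2)"
      by (simp add: sum_distrib_left mult_ac)
    then show ?thesis unfolding mgf_lin by (simp add: exp_sum)
  qed
  have grp: "exp_growth (\<lambda>x. \<Prod>i<2 * N. 1 + q (gauss_pt x i))"
    unfolding expand by (intro exp_growth_sum exp_growth_mult exp_growth_const exp_growth_exp_lin)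
  have "(\<integral>x. (\<Prod>i<2 * N. 1 + q (gauss_pt x i)) \<partial>P) = (\<Sum>g\<in>?G. (\<Prod>i<2 * N. w (g i)) * (\<integral>x. exp (lin (cc g) x) \<partial>P))"
    unfolding expand using exp_growth_integrable[OF exp_growth_exp_lin] by simp
  also have "\<dots> \<le> (\<Sum>g\<in>?G. (\<Prod>i<2 * N. w (g i)) * (\<Prod>i<2 * N. exp (e * \<beta>\<^sup>2 * (g i)\<^sup>2)))"
    using w0 by (intro sum_mono mult_left_mono Elin prod_nonneg) auto
  also have "\<dots> = (\<Prod>i<2 * N. \<Sum>j\<in>?S. w j * exp (e * \<beta>\<^sup>2 * j\<^sup>2))"
    unfolding prod.distrib[symmetric] by (rule prod_sum_PiE[symmetric]) auto
  also have "\<dots> = (1 + exp (e * \<beta>\<^sup>2) / ch) ^ (2 * N)" 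
  proof -
    have "(\<Sum>j\<in>?S. w j * exp (e * \<beta>\<^sup>2 * j\<^sup>2)) = 1 + exp (e * \<beta>\<^sup>2) / ch"
      using ch by (simp add: w_def field_simps)
    then show ?thesis by simp
  qed
  also have "\<dots> \<le> (1 + 2 * exp (- 1 / (16 * e))) ^ (2 * N)"
  proof (intro power_mono add_left_mono)
    have "exp (e * \<beta>\<^sup>2) / ch \<le> exp (e * \<beta>\<^sup>2) / (exp (\<beta> / 2) / 2)" using ch by (intro divide_left_mono) auto
    also have "\<dots> = 2 * exp (e * \<beta>\<^sup>2 - \<beta> / 2)" by (simp add: exp_diff)
    also have "e * \<beta>\<^sup>2 - \<beta> / 2 = - 1 / (16 * e)" using e by (simp add: \<beta>_def field_simps power2_eq_square)
    finally show "exp (e * \<beta>\<^sup>2) / ch \<le> 2 * exp (- 1 / (16 * e))" .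
  qed (use ch in auto)
  finally have E: "(\<integral>x. (\<Prod>i<2 * N. 1 + q (gauss_pt x i)) \<partial>P) \<le> (1 + 2 * exp (- 1 / (16 * e))) ^ (2 * N)" .
  have "tau \<le> (\<integral>x. 2 * ((\<Prod>i<2 * N. 1 + q (gauss_pt x i)) - 1) \<partial>P)"
    unfolding tau_def using exp_growth_integrable[OF exp_growth_bad_max_prod] exp_growth_integrable[OF grp]
    by (intro integral_mono pt) auto
  also have "\<dots> = 2 * ((\<integral>x. (\<Prod>i<2 * N. 1 + q (gauss_pt x i)) \<partial>P) - 1)"
    using exp_growth_integrable[OF grp] by (simp add: P.prob_space)
  finally show ?thesis using E by simp
qed

text \<open>The estimate exp(-y) \<le> 1 - y + y^2/2 for y \<ge> 0 at
  \<open>y = s * t\<^sup>2\<close>, together with the second moment e and the fourth moment 3 e^2.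
  It controls the lower tail of the squared length of the Gaussian.\<close>

lemma gauss_dist_exp_neg_sq:
  assumes "s \<ge> 0"
  shows "(\<integral>t. exp (- s * t\<^sup>2) \<partial>gauss_dist e) \<le> exp (- s * e + 3 / 2 * s\<^sup>2 * e\<^sup>2)" "integrable (gauss_dist e) (\<lambda>t. exp (- s * t\<^sup>2))"
proof -
  have ex: "exp (- y) \<le> 1 - y + y\<^sup>2 / 2" if "y \<ge> 0" for y :: real
  proof -
    have "1 + y + y\<^sup>2 / 2 \<le> exp y" by (rule exp_lower_Taylor_quadratic[OF that])
    moreover have "1 \<le> (1 - y + y\<^sup>2 / 2) * (1 + y + y\<^sup>2 / 2)"
    proof -
      have "(1 - y + y\<^sup>2 / 2) * (1 + y + y\<^sup>2 / 2) = 1 + (y\<^sup>2)\<^sup>2 / 4" by (simp add: algebra_simps power2_eq_square)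
      then show ?thesis by simp
    qed
    moreover have "0 \<le> 1 - y + y\<^sup>2 / 2" using zero_le_power2[of "y - 1"] by (simp add: power2_diff)
    ultimately have "1 \<le> (1 - y + y\<^sup>2 / 2) * exp y" by (meson mult_left_mono order_trans)
    then show ?thesis by (simp add: exp_minus field_simps)
  qed
  show int: "integrable (gauss_dist e) (\<lambda>t. exp (- s * t\<^sup>2))"
    using assms by (intro D.integrable_const_bound[where B = 1]) auto
  have m0: "(\<integral>t. t ^ 0 \<partial>gauss_dist e) = 1" using D.prob_space by simp
  have m2: "(\<integral>t. t\<^sup>2 \<partial>gauss_dist e) = e" using gauss_dist_moment_Suc[OF e, of 1] m0 by (simp add: numeral_2_eq_2)
  have m4: "(\<integral>t. t ^ 4 \<partial>gauss_dist e) = 3 * e\<^sup>2" using gauss_dist_moment_Suc[OF e, of 3] m2 by (simp add: power2_eq_square)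
  have "(\<integral>t. exp (- s * t\<^sup>2) \<partial>gauss_dist e) \<le> (\<integral>t. 1 - s * t\<^sup>2 + s\<^sup>2 / 2 * t ^ 4 \<partial>gauss_dist e)"
  proof (rule integral_mono)
    show "integrable (gauss_dist e) (\<lambda>t. 1 - s * t\<^sup>2 + s\<^sup>2 / 2 * t ^ 4)" using gauss_dist_power_integrable[OF e] by auto
    show "exp (- s * t\<^sup>2) \<le> 1 - s * t\<^sup>2 + s\<^sup>2 / 2 * t ^ 4" for t
      using ex[of "s * t\<^sup>2"] assms by (simp add: power_mult_distrib power_mult[symmetric])
  qed (rule int)
  also have "\<dots> = 1 + (- s * e + 3 / 2 * s\<^sup>2 * e\<^sup>2)"
    using gauss_dist_power_integrable[OF e] m2 m4 D.prob_space by simp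
  also have "\<dots> \<le> exp (- s * e + 3 / 2 * s\<^sup>2 * e\<^sup>2)" by (rule exp_ge_add_one_self)
  finally show "(\<integral>t. exp (- s * t\<^sup>2) \<partial>gauss_dist e) \<le> exp (- s * e + 3 / 2 * s\<^sup>2 * e\<^sup>2)" .
qed

lemma E_exp_neg_sq:
  assumes "s \<ge> 0"
  shows "(\<integral>x. exp (- s * (\<Sum>a<N. (x a)\<^sup>2)) \<partial>P) \<le> exp (real N * (- s * e + 3 / 2 * s\<^sup>2 * e\<^sup>2))"
proof -
  have "(\<integral>x. exp (- s * (\<Sum>a<N. (x a)\<^sup>2)) \<partial>P) = (\<integral>x. (\<Prod>a<N. exp (- s * (x a)\<^sup>2)) \<partial>P)"
    by (simp add: exp_sum[symmetric] sum_distrib_left sum_negf)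
  also have "\<dots> = (\<Prod>a<N. \<integral>t. exp (- s * t\<^sup>2) \<partial>gauss_dist e)"
    unfolding P_def by (rule PP.product_integral_prod) (use gauss_dist_exp_neg_sq(2)[OF assms] in auto)
  also have "\<dots> \<le> (\<Prod>a<N. exp (- s * e + 3 / 2 * s\<^sup>2 * e\<^sup>2))"
    by (intro prod_mono conjI gauss_dist_exp_neg_sq(1)[OF assms] integral_nonneg_AE AE_I2) auto
  finally show ?thesis by (simp add: exp_of_nat_mult)
qed

text \<open>N times the forrelation, without the normalisation.\<close>

definition bil :: "(nat \<Rightarrow> real) \<Rightarrow> real" where
  "bil v = (\<Sum>a<N. v a * (\<Sum>b<N. H a b * v (N + b)))"

lemma sum_sign_cube_double:
  "(\<Sum>u\<in>sign_cube (2 * N). f u) = (\<Sum>y\<in>sign_cube N. \<Sum>p\<in>sign_cube N.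
     f (\<lambda>i. if i < N then p i else if i < 2 * N then y (i - N) else 0))" for f :: "_ \<Rightarrow> real"
proof -
  let ?j = "\<lambda>y p i. if i < N then p i else if i < 2 * N then y (i - N) else 0 :: real"
  have m: "?j y p \<in> sign_cube (2 * N)" if y: "y \<in> sign_cube N" and p: "p \<in> sign_cube N" for y p
    unfolding sign_cube_iff
  proof (intro conjI allI impI)
    fix i assume i: "i < 2 * N"
    show "?j y p i = 1 \<or> ?j y p i = - 1"
    proof (cases "i < N")
      case True
      then show ?thesis using p by (simp add: sign_cube_iff)
    next
      case False
      then have "i - N < N" using i by simp
      then have "y (i - N) = 1 \<or> y (i - N) = - 1" using y unfolding sign_cube_iff by blast
      then show ?thesis using False i by simp
    qed
  qed auto
  have "(\<Sum>u\<in>sign_cube (2 * N). f u) = (\<Sum>(y, p)\<in>sign_cube N \<times> sign_cube N. f (?j y p))"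
  proof (rule sum.reindex_bij_witness[of _ "\<lambda>(y, p). ?j y p"
          "\<lambda>u. (\<lambda>i. if i < N then u (N + i) else 0, \<lambda>i. if i < N then u i else 0)"])
    fix u assume u: "u \<in> sign_cube (2 * N)"
    show e: "(case (\<lambda>i. if i < N then u (N + i) else 0, \<lambda>i. if i < N then u i else 0) of (y, p) \<Rightarrow> ?j y p) = u"
    proof
      fix i
      have "i \<ge> 2 * N \<Longrightarrow> u i = 0" using u unfolding sign_cube_iff by blast
      then show "(case (\<lambda>i. if i < N then u (N + i) else 0, \<lambda>i. if i < N then u i else 0) of (y, p) \<Rightarrow> ?j y p) i = u i"
        by (cases "i < 2 * N") auto
    qed
    show "(\<lambda>i. if i < N then u (N + i) else 0, \<lambda>i. if i < N then u i else 0) \<in> sign_cube N \<times> sign_cube N"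
      using u by (simp add: sign_cube_iff)
    show "(case (\<lambda>i. if i < N then u (N + i) else 0, \<lambda>i. if i < N then u i else 0) of (y, p) \<Rightarrow> f (?j y p)) = f u"
      using arg_cong[OF e, of f] by simp
  next
    fix yp assume "yp \<in> sign_cube N \<times> sign_cube N"
    then obtain y p where yp: "yp = (y, p)" "y \<in> sign_cube N" "p \<in> sign_cube N" by auto
    show "(case yp of (y, p) \<Rightarrow> ?j y p) \<in> sign_cube (2 * N)" using m[OF yp(2,3)] yp(1) by simp
    have "y i = 0" "p i = 0" if "i \<ge> N" for i using yp(2,3) that unfolding sign_cube_iff by blast+
    then show "(\<lambda>i. if i < N then (case yp of (y, p) \<Rightarrow> ?j y p) (N + i) else 0, \<lambda>i. if i < N then (case yp of (y, p) \<Rightarrow> ?j y p) i else 0) = yp"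
      unfolding yp(1) by (auto simp: fun_eq_iff)
  qed
  then show ?thesis by (simp add: sum.cartesian_product)
qed

text \<open>Given the second half \<open>y\<close>, the exponent is linear in the signs of the first
  half, with coefficients \<open>H y\<close> of squared length N. After averaging over these it is
  linear in \<open>y\<close>, with coefficients \<open>H t\<close> of squared length at most N. By
  \<open>two_point_mgf\<close> each half adds \<open>s\<^sup>2 * N / 2\<close>.\<close>

lemma round_mgf:
  assumes "\<And>i. i < 2 * N \<Longrightarrow> \<bar>t i\<bar> \<le> 1"
  shows "(\<Sum>u\<in>sign_cube (2 * N). ker t u * exp (s * bil u)) \<le> exp (s * bil t + s\<^sup>2 * real N)"
proof -
  have two: "(\<Sum>p\<in>sign_cube N. (\<Prod>a<N. (1 + p a * t' a) / 2) * exp (s * (\<Sum>a<N. p a * h a)))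
      \<le> exp (s * (\<Sum>a<N. t' a * h a) + s\<^sup>2 / 2 * (\<Sum>a<N. (h a)\<^sup>2))"
    if "\<And>a. a < N \<Longrightarrow> \<bar>t' a\<bar> \<le> 1" for t' h
  proof -
    have "(\<Sum>p\<in>sign_cube N. (\<Prod>a<N. (1 + p a * t' a) / 2) * exp (s * (\<Sum>a<N. p a * h a))) =
        (\<Sum>p\<in>sign_cube N. \<Prod>a<N. (1 + p a * t' a) / 2 * exp (p a * (s * h a)))"
    proof (intro sum.cong refl)
      fix p :: "nat \<Rightarrow> real"
      have "exp (s * (\<Sum>a<N. p a * h a)) = (\<Prod>a<N. exp (p a * (s * h a)))"
        by (simp add: exp_sum[symmetric] sum_distrib_left mult_ac)
      then show "(\<Prod>a<N. (1 + p a * t' a) / 2) * exp (s * (\<Sum>a<N. p a * h a)) =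
          (\<Prod>a<N. (1 + p a * t' a) / 2 * exp (p a * (s * h a)))" by (simp only: prod.distrib)
    qed
    also have "\<dots> = (\<Prod>a<N. (1 + - 1 * t' a) / 2 * exp (- 1 * (s * h a)) + (1 + 1 * t' a) / 2 * exp (1 * (s * h a)))"
      by (rule sum_sign_cube_prod)
    also have "\<dots> \<le> (\<Prod>a<N. exp (t' a * (s * h a) + (s * h a)\<^sup>2 / 2))"
    proof (rule prod_mono)
      fix a assume "a \<in> {..<N}"
      then have "\<bar>t' a\<bar> \<le> 1" using that by simp
      then show "0 \<le> (1 + - 1 * t' a) / 2 * exp (- 1 * (s * h a)) + (1 + 1 * t' a) / 2 * exp (1 * (s * h a)) \<and>
          (1 + - 1 * t' a) / 2 * exp (- 1 * (s * h a)) + (1 + 1 * t' a) / 2 * exp (1 * (s * h a))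
          \<le> exp (t' a * (s * h a) + (s * h a)\<^sup>2 / 2)"
        using two_point_mgf[of "t' a" "s * h a"] by (auto intro!: add_nonneg_nonneg mult_nonneg_nonneg)
    qed
    also have "\<dots> = exp (s * (\<Sum>a<N. t' a * h a) + s\<^sup>2 / 2 * (\<Sum>a<N. (h a)\<^sup>2))"
      by (simp add: exp_sum[symmetric] sum.distrib sum_distrib_left power_mult_distrib mult_ac)
    finally show ?thesis .
  qed
  let ?t2 = "\<lambda>b. t (N + b)"
  let ?h = "\<lambda>y a. \<Sum>b<N. H a b * y b"
  let ?g = "\<lambda>b. \<Sum>a<N. t a * H a b"
  have hy: "(\<Sum>a<N. (?h y a)\<^sup>2) = real N" if "y \<in> sign_cube N" for y
  proof -
    have "(\<Sum>a<N. (?h y a)\<^sup>2) = (\<Sum>b<N. (y b)\<^sup>2)"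
    proof -
      have "(\<Sum>b<N. H a b * y b) = (\<Sum>b<N. y b * H b a)" for a
        by (intro sum.cong refl) (simp add: symm[of a] mult.commute)
      then show ?thesis using sum_sq_H[of y] by simp
    qed
    also have "\<dots> = (\<Sum>b<N. 1)" using that by (intro sum.cong refl) (auto simp: sign_cube_iff)
    finally show ?thesis by simp
  qed
  have "(\<Sum>u\<in>sign_cube (2 * N). ker t u * exp (s * bil u)) = (\<Sum>y\<in>sign_cube N. (\<Prod>b<N. (1 + y b * ?t2 b) / 2) *
      (\<Sum>p\<in>sign_cube N. (\<Prod>a<N. (1 + p a * t a) / 2) * exp (s * (\<Sum>a<N. p a * ?h y a))))"
    unfolding sum_sign_cube_double sum_distrib_left ker_def prod_lessThan_double bil_def
    by (intro sum.cong refl) (simp add: mult_ac)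
  also have "\<dots> \<le> (\<Sum>y\<in>sign_cube N. (\<Prod>b<N. (1 + y b * ?t2 b) / 2) *
      exp (s * (\<Sum>a<N. t a * ?h y a) + s\<^sup>2 / 2 * real N))"
  proof (intro sum_mono mult_left_mono)
    fix y assume y: "y \<in> sign_cube N"
    show "(\<Sum>p\<in>sign_cube N. (\<Prod>a<N. (1 + p a * t a) / 2) * exp (s * (\<Sum>a<N. p a * ?h y a)))
        \<le> exp (s * (\<Sum>a<N. t a * ?h y a) + s\<^sup>2 / 2 * real N)"
      using two[of t "?h y"] assms hy[OF y] by simp
    show "0 \<le> (\<Prod>b<N. (1 + y b * ?t2 b) / 2)"
    proof (intro prod_nonneg)
      fix b assume "b \<in> {..<N}"
      then have "\<bar>?t2 b\<bar> \<le> 1" "y b = 1 \<or> y b = - 1" using assms[of "N + b"] y by (auto simp: sign_cube_iff)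
      then show "0 \<le> (1 + y b * ?t2 b) / 2" by auto
    qed
  qed
  also have "\<dots> = exp (s\<^sup>2 / 2 * real N) * (\<Sum>y\<in>sign_cube N. (\<Prod>b<N. (1 + y b * ?t2 b) / 2) * exp (s * (\<Sum>b<N. y b * ?g b)))"
  proof -
    have "(\<Sum>a<N. t a * ?h y a) = (\<Sum>b<N. y b * ?g b)" for y
    proof -
      have "(\<Sum>a<N. t a * ?h y a) = (\<Sum>a<N. \<Sum>b<N. y b * (t a * H a b))" by (simp add: sum_distrib_left mult_ac)
      also have "\<dots> = (\<Sum>b<N. \<Sum>a<N. y b * (t a * H a b))" by (rule sum.swap)
      finally show ?thesis by (simp add: sum_distrib_left)
    qed
    then show ?thesis by (simp add: exp_add sum_distrib_left mult_ac)
  qed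
  also have "\<dots> \<le> exp (s\<^sup>2 / 2 * real N) * exp (s * (\<Sum>b<N. ?t2 b * ?g b) + s\<^sup>2 / 2 * (\<Sum>b<N. (?g b)\<^sup>2))"
    using assms by (intro mult_left_mono two) auto
  also have "\<dots> \<le> exp (s\<^sup>2 / 2 * real N) * exp (s * bil t + s\<^sup>2 / 2 * real N)"
  proof -
    have "(\<Sum>b<N. ?t2 b * ?g b) = bil t"
    proof -
      have "(\<Sum>b<N. ?t2 b * ?g b) = (\<Sum>b<N. \<Sum>a<N. t a * (H a b * ?t2 b))" by (simp add: sum_distrib_left mult_ac)
      also have "\<dots> = (\<Sum>a<N. \<Sum>b<N. t a * (H a b * ?t2 b))" by (rule sum.swap)
      finally show ?thesis by (simp add: bil_def sum_distrib_left)
    qed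
    moreover have "(\<Sum>b<N. (?g b)\<^sup>2) = (\<Sum>a<N. (t a)\<^sup>2)" using sum_sq_H[of t] by simp
    moreover have "(\<Sum>a<N. (t a)\<^sup>2) \<le> (\<Sum>a<N. 1)" using assms by (intro sum_mono) (simp add: abs_square_le_1)
    ultimately show ?thesis by (simp add: mult_left_mono)
  qed
  also have "\<dots> = exp (s * bil t + s\<^sup>2 * real N)" by (simp add: exp_add[symmetric])
  finally show ?thesis .
qed

text \<open>As \<open>H\<close> is symmetric and orthogonal, pairing x with H (H x) gives the
  squared length of x, which concentrates around \<open>N * e\<close>.\<close>

lemma bil_gauss_pt: "bil (gauss_pt x) = (\<Sum>a<N. (x a)\<^sup>2)"
proof -
  have "bil (gauss_pt x) = (\<Sum>a<N. \<Sum>b<N. \<Sum>c<N. x a * x c * (H a b * H c b))"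
  proof -
    have "x a * (H a b * lin (H b) x) = (\<Sum>c<N. x a * x c * (H a b * H c b))" for a b
      unfolding lin_def sum_distrib_left by (intro sum.cong refl) (simp add: symm[of b] mult_ac)
    then show ?thesis unfolding bil_def gauss_pt_def by (simp add: sum_distrib_left)
  qed
  also have "\<dots> = (\<Sum>a<N. \<Sum>c<N. x a * x c * (\<Sum>b<N. H a b * H c b))"
    unfolding sum_distrib_left by (intro sum.cong refl sum.swap)
  also have "\<dots> = (\<Sum>a<N. \<Sum>c<N. if a = c then x a * x c else 0)"
    by (intro sum.cong refl) (simp add: orth)
  finally show ?thesis by (simp add: power2_eq_square)
qed

text \<open>One Chernoff bound for the rounding and for the squared length of the Gaussian: where no
  coordinate is bad, truncation is the identity and \<open>bil\<close> of the point is this squared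
  length. Bad points are paid by \<open>tau\<close>.\<close>

lemma concentration_gauss:
  assumes e1: "e \<le> 1"
  shows "(\<Sum>u\<in>sign_cube (2 * N). (\<integral>x. ker (\<lambda>i. trnc (gauss_pt x i)) u \<partial>P) * of_bool (bil u < real N * e / 2))
    \<le> exp (- (real N * e\<^sup>2 / 64)) + tau"
proof -
  let ?W = "sign_cube (2 * N)"
  define s where "s = e / 8"
  have s: "0 < s" using e by (simp add: s_def)
  let ?k = "\<lambda>x u. ker (\<lambda>i. trnc (gauss_pt x i)) u"
  let ?b = "\<lambda>u. of_bool (bil u < real N * e / 2) :: real"
  have t1: "\<bar>trnc y\<bar> \<le> 1" for y by (auto simp: trnc_def)
  have k0: "0 \<le> ?k x u" if "u \<in> ?W" for x u
    unfolding ker_def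
  proof (intro prod_nonneg)
    fix i assume "i \<in> {..<2 * N}"
    then have "u i = 1 \<or> u i = - 1" using that by (auto simp: sign_cube_iff)
    then show "0 \<le> (1 + u i * trnc (gauss_pt x i)) / 2" using t1[of "gauss_pt x i"] by auto
  qed
  have k1: "(\<Sum>u\<in>?W. ?k x u) \<le> 1" for x
  proof -
    have "(\<Sum>u\<in>?W. ?k x u) \<le> (\<Sum>u\<in>?W. \<bar>?k x u\<bar>)" by (intro sum_mono) simp
    also have "\<dots> = 1" unfolding sum_abs_ker max_prod_def by (intro prod.neutral) (auto simp: trnc_def)
    finally show ?thesis .
  qed
  let ?f = "\<lambda>x. exp (s * (real N * e / 2) + s\<^sup>2 * real N) * exp (- s * (\<Sum>a<N. (x a)\<^sup>2)) + of_bool (bad x)"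
  have pt: "(\<Sum>u\<in>?W. ?k x u * ?b u) \<le> ?f x" for x
  proof (cases "bad x")
    case True
    have "(\<Sum>u\<in>?W. ?k x u * ?b u) \<le> (\<Sum>u\<in>?W. ?k x u * 1)" by (intro sum_mono mult_left_mono k0) auto
    then show ?thesis using k1[of x] True by (simp add: add_increasing)
  next
    case False
    then have z: "trnc (gauss_pt x i) = gauss_pt x i" if "i < 2 * N" for i
    proof -
      have "\<bar>gauss_pt x i\<bar> \<le> 1 / 2" using False that unfolding bad_def by (meson not_less)
      then show ?thesis by (auto simp: trnc_def)
    qed
    have bl: "bil (\<lambda>i. trnc (gauss_pt x i)) = (\<Sum>a<N. (x a)\<^sup>2)"
      unfolding bil_gauss_pt[symmetric] unfolding bil_def by (intro sum.cong refl arg_cong2[where f="(*)"] z) auto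
    have "(\<Sum>u\<in>?W. ?k x u * ?b u) \<le> (\<Sum>u\<in>?W. ?k x u * (exp (s * (real N * e / 2)) * exp (- s * bil u)))"
    proof (intro sum_mono mult_left_mono k0)
      fix u
      show "?b u \<le> exp (s * (real N * e / 2)) * exp (- s * bil u)"
        using s by (auto simp: exp_add[symmetric] algebra_simps)
    qed
    also have "\<dots> = exp (s * (real N * e / 2)) * (\<Sum>u\<in>?W. ?k x u * exp (- s * bil u))" by (simp add: sum_distrib_left mult_ac)
    also have "\<dots> \<le> exp (s * (real N * e / 2)) * exp (- s * bil (\<lambda>i. trnc (gauss_pt x i)) + (- s)\<^sup>2 * real N)"
      by (intro mult_left_mono round_mgf t1) auto
    also have "\<dots> = ?f x" using False by (simp add: bl exp_add[symmetric] algebra_simps)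
    finally show ?thesis .
  qed
  have g1: "exp_growth (\<lambda>x. exp (- s * (\<Sum>a<N. (x a)\<^sup>2)))"
  proof (rule exp_growth_bounded[where C = 1])
    show "(\<lambda>x. exp (- s * (\<Sum>a<N. (x a)\<^sup>2))) \<in> borel_measurable P"
    proof -
      have "(\<lambda>x. \<Sum>a<N. (x a)\<^sup>2) \<in> borel_measurable P" using meas_comp by (intro borel_measurable_sum borel_measurable_power) auto
      then show ?thesis by measurable
    qed
    show "\<bar>exp (- s * (\<Sum>a<N. (x a)\<^sup>2))\<bar> \<le> 1" for x using s by (simp add: sum_nonneg)
  qed
  have g2: "exp_growth (\<lambda>x. of_bool (bad x))" by (rule exp_growth_bounded[where C = 1]) auto
  have "(\<Sum>u\<in>?W. (\<integral>x. ?k x u \<partial>P) * ?b u) = (\<integral>x. (\<Sum>u\<in>?W. ?k x u * ?b u) \<partial>P)"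
    using exp_growth_integrable[OF exp_growth_ker_trnc] by simp
  also have "\<dots> \<le> (\<integral>x. ?f x \<partial>P)"
    using exp_growth_integrable[OF exp_growth_ker_trnc] exp_growth_integrable[OF g1] exp_growth_integrable[OF g2]
    by (intro integral_mono pt) auto
  also have "\<dots> = exp (s * (real N * e / 2) + s\<^sup>2 * real N) * (\<integral>x. exp (- s * (\<Sum>a<N. (x a)\<^sup>2)) \<partial>P) + (\<integral>x. of_bool (bad x) \<partial>P)"
    using exp_growth_integrable[OF g1] exp_growth_integrable[OF g2] by simp
  also have "\<dots> \<le> exp (s * (real N * e / 2) + s\<^sup>2 * real N) * exp (real N * (- s * e + 3 / 2 * s\<^sup>2 * e\<^sup>2)) + tau"
    using s by (intro add_mono mult_left_mono E_exp_neg_sq E_bad_le) auto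
  also have "\<dots> \<le> exp (- (real N * e\<^sup>2 / 64)) + tau"
  proof -
    have "s * (real N * e / 2) + s\<^sup>2 * real N + real N * (- s * e + 3 / 2 * s\<^sup>2 * e\<^sup>2) =
        real N * e\<^sup>2 * (- 3 / 64 + 3 / 128 * e\<^sup>2)" unfolding s_def by (simp add: field_simps power2_eq_square)
    also have "\<dots> \<le> real N * e\<^sup>2 * (- 1 / 64)"
    proof (intro mult_left_mono)
      have "e\<^sup>2 \<le> 1" using e e1 by (simp add: power_le_one)
      then show "- 3 / 64 + 3 / 128 * e\<^sup>2 \<le> - 1 / 64" by simp
    qed auto
    finally show ?thesis unfolding exp_add[symmetric] by simp
  qed
  finally show ?thesis .
qed

lemma concentration_unif:
  "(\<Sum>u\<in>sign_cube (2 * N). (1 / 2) ^ (2 * N) * of_bool (bil u > real N * e / 4)) \<le> exp (- (real N * e\<^sup>2 / 64))"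
proof -
  let ?W = "sign_cube (2 * N)"
  \<comment> \<open>The minimiser of \<open>s\<^sup>2 * N - s * N * e / 4\<close>; the same value is
    good enough in \<open>concentration_gauss\<close>.\<close>
  define s where "s = e / 8"
  have k: "ker (\<lambda>_. 0) u = (1 / 2) ^ (2 * N)" for u by (simp add: ker_def)
  have "(\<Sum>u\<in>?W. (1 / 2) ^ (2 * N) * of_bool (bil u > real N * e / 4)) \<le>
      (\<Sum>u\<in>?W. ker (\<lambda>_. 0) u * (exp (- s * (real N * e / 4)) * exp (s * bil u)))"
    unfolding k
  proof (intro sum_mono mult_left_mono)
    fix u
    show "of_bool (bil u > real N * e / 4) \<le> exp (- s * (real N * e / 4)) * exp (s * bil u)"
    proof (cases "bil u > real N * e / 4")
      case True
      then have "s * (real N * e / 4) \<le> s * bil u" using e by (intro mult_left_mono) (auto simp: s_def)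
      then show ?thesis using True by (simp add: exp_add[symmetric])
    qed simp
  qed auto
  also have "\<dots> = exp (- s * (real N * e / 4)) * (\<Sum>u\<in>?W. ker (\<lambda>_. 0) u * exp (s * bil u))" by (simp add: sum_distrib_left mult_ac)
  also have "\<dots> \<le> exp (- s * (real N * e / 4)) * exp (s * bil (\<lambda>_. 0) + s\<^sup>2 * real N)"
    by (intro mult_left_mono round_mgf) auto
  also have "\<dots> = exp (- (real N * e\<^sup>2 / 64))"
    unfolding exp_add[symmetric] by (simp add: bil_def s_def field_simps power2_eq_square)
  finally show ?thesis .
qed

end

section \<open>The Hadamard matrix and the rounded Gaussian\<close>

lemma bit_add_power: "i < n \<Longrightarrow> bit (c + 2 ^ n :: nat) i \<longleftrightarrow> bit c i"
proof -
  assume i: "i < n"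
  have "(2::nat) ^ n = 2 ^ i * 2 ^ (n - i)" using i by (simp add: power_add[symmetric])
  then have "(c + 2 ^ n) div 2 ^ i = c div 2 ^ i + 2 ^ (n - i)" by simp
  moreover have "even (2 ^ (n - i) :: nat)" using i by simp
  ultimately show ?thesis by (simp add: bit_iff_odd)
qed

lemma sum_bits:
  fixes f :: "nat \<Rightarrow> bool \<Rightarrow> real"
  shows "(\<Sum>c<(2::nat) ^ n. \<Prod>i<n. f i (bit c i)) = (\<Prod>i<n. f i False + f i True)"
proof (induction n)
  case (Suc n)
  have "(\<Sum>c<(2::nat) ^ Suc n. \<Prod>i<Suc n. f i (bit c i)) =
      (\<Sum>c<(2::nat) ^ n. \<Prod>i<Suc n. f i (bit c i)) + (\<Sum>c<(2::nat) ^ n. \<Prod>i<Suc n. f i (bit (c + 2 ^ n) i))"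
    using sum_lessThan_double[of "\<lambda>c. \<Prod>i<Suc n. f i (bit c i)" "2 ^ n"] by (simp add: add.commute)
  also have "(\<Sum>c<(2::nat) ^ n. \<Prod>i<Suc n. f i (bit c i)) = (\<Sum>c<(2::nat) ^ n. \<Prod>i<n. f i (bit c i)) * f n False"
    unfolding sum_distrib_right
  proof (intro sum.cong refl)
    fix c :: nat assume "c \<in> {..<2 ^ n}"
    then have "\<not> bit c n" by (simp add: bit_iff_odd)
    then show "(\<Prod>i<Suc n. f i (bit c i)) = (\<Prod>i<n. f i (bit c i)) * f n False" by simp
  qed
  also have "(\<Sum>c<(2::nat) ^ n. \<Prod>i<Suc n. f i (bit (c + 2 ^ n) i)) = (\<Sum>c<(2::nat) ^ n. \<Prod>i<n. f i (bit c i)) * f n True"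
    unfolding sum_distrib_right
  proof (intro sum.cong refl)
    fix c :: nat assume "c \<in> {..<2 ^ n}"
    then have "bit (c + 2 ^ n) n" by (simp add: bit_iff_odd)
    moreover have "(\<Prod>i<n. f i (bit (c + 2 ^ n) i)) = (\<Prod>i<n. f i (bit c i))"
      by (intro prod.cong refl) (simp add: bit_add_power)
    ultimately show "(\<Prod>i<Suc n. f i (bit (c + 2 ^ n) i)) = (\<Prod>i<n. f i (bit c i)) * f n True" by simp
  qed
  finally show ?case using Suc.IH by (simp add: algebra_simps)
qed simp

lemma hadamard_symm: "hadamard n a b = hadamard n b a"
  unfolding hadamard_def by (simp add: mult.commute)

lemma abs_hadamard: "\<bar>hadamard n a b\<bar> = 1 / sqrt (2 ^ n)"
  unfolding hadamard_def by (simp add: abs_mult power_abs)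

lemma bit_eq_lessThan:
  fixes a b :: nat
  assumes "a < 2 ^ n" "b < 2 ^ n" "\<And>i. i < n \<Longrightarrow> bit a i = bit b i"
  shows "a = b"
proof (rule bit_eqI)
  fix i
  show "bit a i = bit b i"
  proof (cases "i < n")
    case False
    then have "(2::nat) ^ n \<le> 2 ^ i" by (intro power_increasing) auto
    then have "a < 2 ^ i" "b < 2 ^ i" using less_le_trans[OF assms(1)] less_le_trans[OF assms(2)] by blast+
    then show ?thesis by (simp add: bit_iff_odd)
  qed (use assms in simp)
qed

text \<open>The sum over \<open>c\<close> factorises over its binary digits, and a digit in which
  \<open>a\<close> and \<open>b\<close> differ contributes 1 - 1.\<close>

lemma hadamard_orth:
  assumes "a < 2 ^ n" "b < 2 ^ n"
  shows "(\<Sum>c<2 ^ n. hadamard n a c * hadamard n b c) = (if a = b then 1 else 0)"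
proof -
  define f where "f = (\<lambda>i t. (- 1 :: real) ^ (of_bool (bit a i) * of_bool t) * (- 1) ^ (of_bool (bit b i) * of_bool t))"
  have "hadamard n a c * hadamard n b c = 1 / 2 ^ n * (\<Prod>i<n. f i (bit c i))" for c
  proof -
    have "hadamard n a c * hadamard n b c = (1 / sqrt (2 ^ n) * (1 / sqrt (2 ^ n))) *
        ((\<Prod>i<n. (- 1) ^ (of_bool (bit a i) * of_bool (bit c i))) * (\<Prod>i<n. (- 1) ^ (of_bool (bit b i) * of_bool (bit c i))))"
      unfolding hadamard_def power_sum by (simp only: mult_ac)
    also have "1 / sqrt (2 ^ n) * (1 / sqrt (2 ^ n)) = 1 / (2 ^ n :: real)" by simp
    finally show ?thesis unfolding f_def prod.distrib .
  qed
  then have "(\<Sum>c<2 ^ n. hadamard n a c * hadamard n b c) = 1 / 2 ^ n * (\<Prod>i<n. f i False + f i True)"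
    by (simp only: sum_distrib_left[symmetric] sum_bits)
  also have "\<dots> = (if a = b then 1 else 0)"
  proof (cases "a = b")
    case True
    then have "f i False + f i True = 2" for i by (simp add: f_def)
    then show ?thesis using True by simp
  next
    case False
    then obtain i where i: "i < n" "bit a i \<noteq> bit b i" using bit_eq_lessThan assms by blast
    then have "f i False + f i True = 0" by (cases "bit a i") (auto simp: f_def)
    then have "(\<Prod>i<n. f i False + f i True) = 0" using i(1) by (intro prod_zero) auto
    then show ?thesis using False by simp
  qed
  finally show ?thesis .
qed

lemma eps_pos: "n \<ge> 1 \<Longrightarrow> k \<ge> 1 \<Longrightarrow> eps n k > 0"
  by (auto simp: eps_def ln_realpow)

lemma gauss_hadamard: "n \<ge> 1 \<Longrightarrow> k \<ge> 1 \<Longrightarrow> gauss (2 ^ n) (eps n k) (hadamard n)"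
  by unfold_locales (auto simp: eps_pos hadamard_orth hadamard_symm)

lemma card_sign_cube: "card (sign_cube M) = 2 ^ M"
proof -
  have "real (card (sign_cube M)) = (\<Sum>u\<in>sign_cube M. \<Prod>i<M. 1)" by simp
  also have "\<dots> = 2 ^ M" by (subst sum_sign_cube_prod[of "\<lambda>_ _. 1"]) simp
  finally show ?thesis by (metis of_nat_eq_iff of_nat_numeral of_nat_power)
qed

lemma pmf_round_point:
  assumes "u \<in> sign_cube M"
  shows "pmf (round_point M z) u = (\<Prod>i<M. (1 + u i * trnc (z i)) / 2)"
proof -
  have "pmf (round_point M z) u = (\<Prod>i<M. pmf (map_pmf (\<lambda>b. if b then 1 else - 1) (bernoulli_pmf ((1 + trnc (z i)) / 2))) (u i))"
    unfolding round_point_def using assms by (intro pmf_Pi') (auto simp: sign_cube_iff)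
  also have "\<dots> = (\<Prod>i<M. (1 + u i * trnc (z i)) / 2)"
  proof (intro prod.cong refl)
    fix i assume "i \<in> {..<M}"
    then have "u i = 1 \<or> u i = - 1" using assms unfolding sign_cube_iff by blast
    then show "pmf (map_pmf (\<lambda>b. if b then 1 else - 1) (bernoulli_pmf ((1 + trnc (z i)) / 2))) (u i) = (1 + u i * trnc (z i)) / 2"
      unfolding pmf_round_coord by auto
  qed
  finally show ?thesis .
qed

lemma pmf_rounding_gauss:
  assumes "n \<ge> 1" "k \<ge> 1" "u \<in> sign_cube (2 * 2 ^ n)"
  shows "pmf (rounding (2 * 2 ^ n) (gaussian_forr n k)) u =
    (\<integral>x. gauss.ker (2 ^ n) (\<lambda>i. trnc (gauss.gauss_pt (2 ^ n) (hadamard n) x i)) u \<partial>gauss.P (2 ^ n) (eps n k))"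
proof -
  interpret gauss "2 ^ n" "eps n k" "hadamard n" by (rule gauss_hadamard[OF assms(1,2)])
  let ?M = "2 * 2 ^ n :: nat"
  let ?T = "\<lambda>x. \<lambda>i\<in>{..<?M}. if i < 2 ^ n then x i else hadamard_vec n x (i - 2 ^ n)"
  have G: "gaussian_forr n k = distr P (\<Pi>\<^sub>M i\<in>{..<?M}. borel) ?T"
    unfolding gaussian_forr_def P_def gauss_dist_def ..
  have hv: "hadamard_vec n x a = lin (hadamard n a) x" for x a by (simp add: hadamard_vec_def lin_def)
  have T: "?T \<in> measurable P (\<Pi>\<^sub>M i\<in>{..<?M}. borel)"
  proof (rule measurable_restrict)
    fix i assume i: "i \<in> {..<?M}"
    have "(\<lambda>x. gauss_pt x i) \<in> borel_measurable P" using i by (intro meas_gauss_pt) simp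
    then show "(\<lambda>x. if i < 2 ^ n then x i else hadamard_vec n x (i - 2 ^ n)) \<in> borel_measurable P"
      unfolding hv gauss_pt_def .
  qed
  have "(\<lambda>z. pmf (round_point ?M z) u) \<in> borel_measurable (\<Pi>\<^sub>M i\<in>{..<?M}. borel)"
    unfolding pmf_round_point[OF assms(3)] trnc_def by measurable
  then have "(\<integral>z. pmf (round_point ?M z) u \<partial>gaussian_forr n k) = (\<integral>x. pmf (round_point ?M (?T x)) u \<partial>P)"
    unfolding G by (intro integral_distr T)
  also have "\<dots> = (\<integral>x. ker (\<lambda>i. trnc (gauss_pt x i)) u \<partial>P)"
  proof (intro Bochner_Integration.integral_cong refl)
    fix x
    show "pmf (round_point ?M (?T x)) u = ker (\<lambda>i. trnc (gauss_pt x i)) u"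
      unfolding pmf_round_point[OF assms(3)] ker_def by (intro prod.cong refl) (auto simp: gauss_pt_def hv)
  qed
  finally show ?thesis
    by (subst pmf_rounding[OF prob_space_gaussian_forr[OF assms(1,2)]]) (simp_all add: gaussian_forr_def)
qed

lemma set_rounding:
  assumes "n \<ge> 1" "k \<ge> 1"
  shows "set_pmf (rounding (2 * 2 ^ n) (gaussian_forr n k)) \<subseteq> sign_cube (2 * 2 ^ n)"
proof
  fix u assume "u \<in> set_pmf (rounding (2 * 2 ^ n) (gaussian_forr n k))"
  then have ne: "pmf (rounding (2 * 2 ^ n) (gaussian_forr n k)) u \<noteq> 0" by (simp add: set_pmf_iff)
  show "u \<in> sign_cube (2 * 2 ^ n)"
  proof (rule ccontr)
    assume "u \<notin> sign_cube (2 * 2 ^ n)"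
    then have "pmf (round_point (2 * 2 ^ n) z) u = 0" for z
      using set_round_point[of "2 * 2 ^ n" z] by (auto simp: set_pmf_eq)
    then show False using ne
      by (subst (asm) pmf_rounding[OF prob_space_gaussian_forr[OF assms]]) (simp_all add: gaussian_forr_def)
  qed
qed

text \<open>Outside \<open>J\<close> a block is the zero vector, the default value given to
  \<open>Pi_pmf\<close> in \<open>mixed_product\<close>.\<close>

definition tup :: "nat set \<Rightarrow> (nat \<Rightarrow> real) set \<Rightarrow> (nat \<Rightarrow> nat \<Rightarrow> real) set" where
  "tup J W = PiE_dflt J (\<lambda>_. 0) (\<lambda>_. W)"

lemma finite_tup: "finite J \<Longrightarrow> finite W \<Longrightarrow> finite (tup J W)"
  unfolding tup_def by (intro finite_PiE_dflt) auto

lemma tup_iff: "w \<in> tup J W \<longleftrightarrow> (\<forall>j\<in>J. w j \<in> W) \<and> (\<forall>j. j \<notin> J \<longrightarrow> w j = (\<lambda>_. 0))"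
  unfolding tup_def PiE_dflt_def by auto

lemma tup_empty: "tup {} W = {\<lambda>_ _. 0}"
  by (auto simp: tup_iff fun_eq_iff)

lemma sum_tup_insert:
  assumes "i \<notin> J" "finite J" "finite W"
  shows "(\<Sum>w\<in>tup (insert i J) W. g w) = (\<Sum>u\<in>W. \<Sum>w\<in>tup J W. g (w(i := u)))"
proof -
  have "(\<Sum>w\<in>tup (insert i J) W. g w) = (\<Sum>(u, w)\<in>W \<times> tup J W. g (w(i := u)))"
  proof (rule sum.reindex_bij_witness[of _ "\<lambda>(u, w). w(i := u)" "\<lambda>w. (w i, w(i := (\<lambda>_. 0)))"])
    fix p assume "p \<in> W \<times> tup J W"
    then obtain u w where p: "p = (u, w)" "u \<in> W" "w \<in> tup J W" by auto
    have "w i = (\<lambda>_. 0)" using p(3) assms(1) by (simp add: tup_iff)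
    then show "((case p of (u, w) \<Rightarrow> w(i := u)) i, (case p of (u, w) \<Rightarrow> w(i := u))(i := (\<lambda>_. 0))) = p"
      unfolding p(1) by (auto simp: fun_eq_iff)
    show "(case p of (u, w) \<Rightarrow> w(i := u)) \<in> tup (insert i J) W" using p by (auto simp: tup_iff)
  next
    fix w assume w: "w \<in> tup (insert i J) W"
    show "(case (w i, w(i := (\<lambda>_. 0))) of (u, w) \<Rightarrow> w(i := u)) = w" by auto
    show "(w i, w(i := (\<lambda>_. 0))) \<in> W \<times> tup J W" using w assms(1) by (auto simp: tup_iff)
  qed auto
  then show ?thesis by (simp add: sum.cartesian_product)
qed

lemma sum_tup_prod:
  fixes h :: "nat \<Rightarrow> (nat \<Rightarrow> real) \<Rightarrow> real"
  assumes "finite J" "finite W"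
  shows "(\<Sum>w\<in>tup J W. \<Prod>j\<in>J. h j (w j)) = (\<Prod>j\<in>J. \<Sum>u\<in>W. h j u)"
  using assms(1)
proof (induction J rule: finite_induct)
  case (insert i J)
  have eq: "(\<Prod>j\<in>insert i J. h j ((w(i := u)) j)) = h i u * (\<Prod>j\<in>J. h j (w j))" for u w
  proof -
    have "(\<Prod>j\<in>J. h j ((w(i := u)) j)) = (\<Prod>j\<in>J. h j (w j))" using insert(2) by (intro prod.cong) auto
    then show ?thesis using insert(1,2) by simp
  qed
  show ?case
    unfolding sum_tup_insert[OF insert(2,1) assms(2)] eq sum_distrib_left[symmetric] sum_distrib_right[symmetric]
    using insert by simp
qed (simp add: tup_empty)

text \<open>Replacing \<open>\<Theta>\<close> by the kernels \<open>\<theta> v\<close> one block at a time, with the point \<open>v\<close> chosen anew for each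
  block, avoids integrating over all blocks at once.\<close>

lemma hybrid_blocks:
  fixes f :: "(nat \<Rightarrow> nat \<Rightarrow> real) \<Rightarrow> real" and \<Theta> :: "(nat \<Rightarrow> real) \<Rightarrow> real" and \<theta> :: "'v \<Rightarrow> (nat \<Rightarrow> real) \<Rightarrow> real"
  assumes J: "finite J" and W: "finite W" and f: "\<And>w. \<bar>f w\<bar> \<le> 1" and \<tau>: "\<tau> \<ge> 0"
    and step: "\<And>c R M. (\<And>u. u \<in> W \<Longrightarrow> \<bar>c u\<bar> \<le> R) \<Longrightarrow> (\<And>v. v \<in> V \<Longrightarrow> \<bar>\<Sum>u\<in>W. c u * \<theta> v u\<bar> \<le> M) \<Longrightarrow>
        \<bar>\<Sum>u\<in>W. c u * \<Theta> u\<bar> \<le> M + \<tau> * R"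
    and L1: "(\<Sum>u\<in>W. \<bar>\<Theta> u\<bar>) \<le> L" "\<And>v. v \<in> V \<Longrightarrow> (\<Sum>u\<in>W. \<bar>\<theta> v u\<bar>) \<le> L"
    and base: "\<And>v. (\<And>j. j \<in> J \<Longrightarrow> v j \<in> V) \<Longrightarrow> \<bar>\<Sum>w\<in>tup J W. f w * (\<Prod>j\<in>J. \<theta> (v j) (w j))\<bar> \<le> Bd"
    and "S \<subseteq> J" "\<And>j. j \<in> J \<Longrightarrow> v j \<in> V"
  shows "\<bar>\<Sum>w\<in>tup J W. f w * (\<Prod>j\<in>J. if j \<in> S then \<Theta> (w j) else \<theta> (v j) (w j))\<bar> \<le> Bd + real (card S) * \<tau> * L ^ (card J - 1)"
proof -
  have "finite S" using assms finite_subset by blast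
  then show ?thesis using assms(9,10)
  proof (induction S arbitrary: v rule: finite_induct)
    case empty
    then show ?case using base[of v] by simp
  next
    case (insert i S)
    define K where "K = J - {i}"
    have K: "finite K" "i \<notin> K" "J = insert i K" "card K = card J - 1" using insert J by (auto simp: K_def)
    define \<kappa> where "\<kappa> = (\<lambda>j. if j \<in> S then \<Theta> else \<theta> (v j))"
    \<comment> \<open>All blocks except \<open>i\<close> are summed out, so \<open>c\<close> depends
      on block \<open>i\<close> alone and \<open>step\<close> applies, with
      \<open>R = L ^ card K\<close>.\<close>
    define c where "c = (\<lambda>u. \<Sum>w\<in>tup K W. f (w(i := u)) * (\<Prod>j\<in>K. \<kappa> j (w j)))"
    have ex: "(\<Sum>w\<in>tup J W. f w * (\<Prod>j\<in>J. \<kappa>' j (w j))) = (\<Sum>u\<in>W. c u * \<kappa>' i u)"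
      if "\<And>j. j \<in> K \<Longrightarrow> \<kappa>' j = \<kappa> j" for \<kappa>' :: "nat \<Rightarrow> (nat \<Rightarrow> real) \<Rightarrow> real"
    proof -
      have "(\<Prod>j\<in>insert i K. \<kappa>' j ((w(i := u)) j)) = \<kappa>' i u * (\<Prod>j\<in>K. \<kappa> j (w j))" for w u
      proof -
        have "(\<Prod>j\<in>K. \<kappa>' j ((w(i := u)) j)) = (\<Prod>j\<in>K. \<kappa> j (w j))"
          using K(2) that by (intro prod.cong refl) auto
        then show ?thesis using K(1,2) by simp
      qed
      then show ?thesis unfolding K(3) sum_tup_insert[OF K(2,1) W] c_def
        by (simp add: sum_distrib_left sum_distrib_right mult_ac)
    qed
    have R: "\<bar>c u\<bar> \<le> L ^ card K" for u
    proof -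
      have "\<bar>c u\<bar> \<le> (\<Sum>w\<in>tup K W. \<bar>f (w(i := u))\<bar> * (\<Prod>j\<in>K. \<bar>\<kappa> j (w j)\<bar>))"
        unfolding c_def by (rule order_trans[OF sum_abs]) (simp add: abs_mult abs_prod)
      also have "\<dots> \<le> (\<Sum>w\<in>tup K W. 1 * (\<Prod>j\<in>K. \<bar>\<kappa> j (w j)\<bar>))"
        by (intro sum_mono mult_right_mono f prod_nonneg) auto
      also have "\<dots> = (\<Prod>j\<in>K. \<Sum>u\<in>W. \<bar>\<kappa> j u\<bar>)" using sum_tup_prod[OF K(1) W, of "\<lambda>j u. \<bar>\<kappa> j u\<bar>"] by simp
      also have "\<dots> \<le> (\<Prod>j\<in>K. L)"
      proof (intro prod_mono conjI sum_nonneg)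
        fix j assume "j \<in> K"
        then have "v j \<in> V" using insert.prems(2) K(3) by auto
        then show "(\<Sum>u\<in>W. \<bar>\<kappa> j u\<bar>) \<le> L" using L1 by (simp add: \<kappa>_def)
      qed auto
      finally show ?thesis by simp
    qed
    have "\<bar>\<Sum>u\<in>W. c u * \<Theta> u\<bar> \<le> (Bd + real (card S) * \<tau> * L ^ (card J - 1)) + \<tau> * L ^ card K"
    proof (rule step)
      fix v' assume v': "v' \<in> V"
      \<comment> \<open>The induction hypothesis holds for every family of points, in particular
        with \<open>v'\<close> at block \<open>i\<close>; this supplies the bound \<open>M\<close>
        of \<open>step\<close> uniformly in \<open>v'\<close>.\<close>
      let ?v = "v(i := v')"
      have "\<bar>\<Sum>w\<in>tup J W. f w * (\<Prod>j\<in>J. if j \<in> S then \<Theta> (w j) else \<theta> (?v j) (w j))\<bar> \<le> Bd + real (card S) * \<tau> * L ^ (card J - 1)"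
        using insert.prems v' by (intro insert.IH) auto
      moreover have "(\<Sum>w\<in>tup J W. f w * (\<Prod>j\<in>J. (if j \<in> S then \<Theta> else \<theta> (?v j)) (w j))) = (\<Sum>u\<in>W. c u * \<theta> v' u)"
        by (subst ex) (use K(2) insert(2) in \<open>auto simp: \<kappa>_def\<close>)
      ultimately show "\<bar>\<Sum>u\<in>W. c u * \<theta> v' u\<bar> \<le> Bd + real (card S) * \<tau> * L ^ (card J - 1)"
        by (simp add: if_distrib[where f = "\<lambda>h. h _"])
    qed (rule R)
    moreover have "(\<Sum>w\<in>tup J W. f w * (\<Prod>j\<in>J. (if j \<in> insert i S then \<Theta> else \<theta> (v j)) (w j))) = (\<Sum>u\<in>W. c u * \<Theta> u)"
      by (subst ex) (use K(2) in \<open>auto simp: \<kappa>_def\<close>)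
    ultimately show ?case using insert(1,2) K(4)
      by (simp add: if_distrib[where f = "\<lambda>h. h _"] algebra_simps)
  qed
qed

section \<open>The mixtures and their conditioned versions\<close>

abbreviation (input) blk :: "nat \<Rightarrow> (nat \<Rightarrow> real) set" where "blk n \<equiv> sign_cube (2 * 2 ^ n)"

definition pG :: "nat \<Rightarrow> nat \<Rightarrow> (nat \<Rightarrow> real) \<Rightarrow> real" where
  "pG n k u = pmf (rounding (2 * 2 ^ n) (gaussian_forr n k)) u"

lemma pmf_uniform_cube: "u \<in> sign_cube M \<Longrightarrow> pmf (uniform_cube M) u = (1 / 2) ^ M"
proof -
  assume u: "u \<in> sign_cube M"
  then have "sign_cube M \<noteq> {}" by blast
  then show ?thesis unfolding uniform_cube_def
    using u by (simp add: finite_sign_cube card_sign_cube power_one_over)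
qed

lemma set_uniform_cube: "set_pmf (uniform_cube M) = sign_cube M"
proof -
  have "(\<lambda>i. if i < M then 1 else 0) \<in> sign_cube M" by (auto simp: sign_cube_iff)
  then show ?thesis unfolding uniform_cube_def by (intro set_pmf_of_set finite_sign_cube) auto
qed

lemma set_mixed_product:
  assumes "n \<ge> 1" "k \<ge> 1"
  shows "set_pmf (mixed_product n k S) \<subseteq> tup {..<k} (blk n)"
proof
  fix w assume "w \<in> set_pmf (mixed_product n k S)"
  then have w: "w \<in> PiE_dflt {..<k} (\<lambda>_. 0) (\<lambda>j. set_pmf (if j \<in> S then rounding (2 * 2 ^ n) (gaussian_forr n k) else uniform_cube (2 * 2 ^ n)))"
    unfolding mixed_product_def by (subst (asm) set_Pi_pmf) (auto simp: o_def)
  have "w j \<in> blk n" if "j < k" for j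
  proof -
    have "w j \<in> set_pmf (if j \<in> S then rounding (2 * 2 ^ n) (gaussian_forr n k) else uniform_cube (2 * 2 ^ n))"
      using w that by (auto simp: PiE_dflt_def)
    then show ?thesis using set_rounding[OF assms] by (auto simp: set_uniform_cube split: if_splits)
  qed
  moreover have "w j = (\<lambda>_. 0)" if "\<not> j < k" for j using w that by (auto simp: PiE_dflt_def)
  ultimately show "w \<in> tup {..<k} (blk n)" by (simp add: tup_iff)
qed

lemma E_mixed:
  assumes "n \<ge> 1" "k \<ge> 1"
  shows "measure_pmf.expectation (mixed_product n k S) f =
    (\<Sum>w\<in>tup {..<k} (blk n). f w * (\<Prod>j<k. if j \<in> S then pG n k (w j) else (1 / 2) ^ (2 * 2 ^ n)))"
proof -
  have "measure_pmf.expectation (mixed_product n k S) f = (\<Sum>w\<in>tup {..<k} (blk n). f w * pmf (mixed_product n k S) w)"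
    using set_mixed_product[OF assms] by (intro integral_measure_pmf_real finite_tup finite_sign_cube) auto
  also have "\<dots> = (\<Sum>w\<in>tup {..<k} (blk n). f w * (\<Prod>j<k. if j \<in> S then pG n k (w j) else (1 / 2) ^ (2 * 2 ^ n)))"
  proof (intro sum.cong refl arg_cong2[where f="(*)"])
    fix w assume w: "w \<in> tup {..<k} (blk n)"
    have "pmf (mixed_product n k S) w = (\<Prod>j<k. pmf (if j \<in> S then rounding (2 * 2 ^ n) (gaussian_forr n k) else uniform_cube (2 * 2 ^ n)) (w j))"
      unfolding mixed_product_def using w by (intro pmf_Pi') (auto simp: tup_iff)
    also have "\<dots> = (\<Prod>j<k. if j \<in> S then pG n k (w j) else (1 / 2) ^ (2 * 2 ^ n))"
      using w by (intro prod.cong refl) (auto simp: pG_def pmf_uniform_cube tup_iff)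
    finally show "pmf (mixed_product n k S) w = (\<Prod>j<k. if j \<in> S then pG n k (w j) else (1 / 2) ^ (2 * 2 ^ n))" .
  qed
  finally show ?thesis .
qed

definition par :: "nat \<Rightarrow> bool \<Rightarrow> nat set set" where "par k b = {S. S \<subseteq> {..<k} \<and> even (card S) = b}"

lemma finite_par: "finite (par k b)" unfolding par_def by (rule finite_subset[of _ "Pow {..<k}"]) auto

lemma sum_par: "(\<Sum>S\<in>Pow {..<k}. g S) = (\<Sum>S\<in>par k True. g S) + (\<Sum>S\<in>par k False. g S)" for g :: "_ \<Rightarrow> real"
proof -
  have "Pow {..<k} = par k True \<union> par k False" by (auto simp: par_def)
  then show ?thesis using finite_par by (subst sum.union_disjoint[symmetric]) (auto simp: par_def)
qed

text \<open>The alternating sum over all subsets vanishes for \<open>k \<ge> 1\<close>, so both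
  parities are equally frequent.\<close>

lemma card_par:
  assumes "k \<ge> 1"
  shows "real (card (par k b)) = 2 ^ (k - 1)"
proof -
  have "(\<Sum>S\<in>Pow {..<k}. (- 1) ^ card S) = (0 :: real)"
    using sum_Pow_power_card[of "{..<k}" "- 1"] assms by simp
  moreover have "(\<Sum>S\<in>par k True. (- 1) ^ card S) = (\<Sum>S\<in>par k True. 1 :: real)" by (intro sum.cong refl) (simp add: par_def)
  moreover have "(\<Sum>S\<in>par k False. (- 1) ^ card S) = (\<Sum>S\<in>par k False. - 1 :: real)" by (intro sum.cong refl) (simp add: par_def)
  ultimately have eq: "real (card (par k True)) = real (card (par k False))" unfolding sum_par by simp
  have "(\<Sum>S\<in>Pow {..<k}. 1 :: real) = 2 ^ k" by (simp add: card_Pow)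
  then have "real (card (par k True)) + real (card (par k False)) = 2 ^ k" unfolding sum_par by simp
  moreover have "(2 :: real) ^ k = 2 * 2 ^ (k - 1)" using assms by (cases k) auto
  ultimately show ?thesis using eq by (cases b) auto
qed

lemma par_nonempty: "k \<ge> 1 \<Longrightarrow> par k b \<noteq> {}"
  using card_par[of k b] by (metis card.empty of_nat_0 power_not_zero zero_neq_numeral)

lemma mu_par: "mu0 n k = bind_pmf (pmf_of_set (par k True)) (mixed_product n k)"
  "mu1 n k = bind_pmf (pmf_of_set (par k False)) (mixed_product n k)"
  by (simp_all add: mu0_def mu1_def par_def)

lemma E_bind_par:
  fixes f :: "(nat \<Rightarrow> nat \<Rightarrow> real) \<Rightarrow> real"
  assumes "n \<ge> 1" "k \<ge> 1"
  shows "measure_pmf.expectation (bind_pmf (pmf_of_set (par k b)) (mixed_product n k)) f =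
    (\<Sum>S\<in>par k b. measure_pmf.expectation (mixed_product n k S) f) / 2 ^ (k - 1)"
proof -
  have "finite (set_pmf (mixed_product n k S))" for S
    by (rule finite_subset[OF set_mixed_product[OF assms] finite_tup]) (auto simp: finite_sign_cube)
  then have "measure_pmf.expectation (bind_pmf (pmf_of_set (par k b)) (mixed_product n k)) f =
      (\<Sum>S\<in>par k b. measure_pmf.expectation (mixed_product n k S) f /\<^sub>R real (card (par k b)))"
    by (intro pmf_expectation_bind_pmf_of_set par_nonempty finite_par assms) auto
  then show ?thesis by (simp add: card_par[OF assms(2)] divide_inverse_commute sum_distrib_left)
qed

text \<open>The sum over \<open>S\<close> with sign (-1)^(card S) is the expansion of a product of
  differences, one for each block. Reversing the differences costs (-1)^k, which the absolute value
  removes.\<close>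

lemma E_mu_diff:
  assumes "n \<ge> 1" "k \<ge> 1"
  shows "\<bar>measure_pmf.expectation (mu0 n k) f - measure_pmf.expectation (mu1 n k) f\<bar> =
    \<bar>\<Sum>w\<in>tup {..<k} (blk n). f w * (\<Prod>j<k. pG n k (w j) - (1 / 2) ^ (2 * 2 ^ n))\<bar> / 2 ^ (k - 1)"
proof -
  let ?U = "(1 / 2) ^ (2 * 2 ^ n) :: real"
  let ?E = "\<lambda>S. measure_pmf.expectation (mixed_product n k S) f"
  have "(\<Sum>S\<in>par k True. ?E S) - (\<Sum>S\<in>par k False. ?E S) = (\<Sum>S\<in>Pow {..<k}. (- 1) ^ card S * ?E S)"
  proof -
    have "(\<Sum>S\<in>par k True. (- 1) ^ card S * ?E S) = (\<Sum>S\<in>par k True. ?E S)" by (intro sum.cong refl) (simp add: par_def)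
    moreover have "(\<Sum>S\<in>par k False. (- 1) ^ card S * ?E S) = (\<Sum>S\<in>par k False. - ?E S)" by (intro sum.cong refl) (simp add: par_def)
    ultimately show ?thesis unfolding sum_par by (simp add: sum_negf)
  qed
  also have "\<dots> = (\<Sum>w\<in>tup {..<k} (blk n). f w * (\<Sum>S\<in>Pow {..<k}. (\<Prod>j\<in>S. - pG n k (w j)) * (\<Prod>j\<in>{..<k} - S. ?U)))"
  proof -
    have e: "(- 1) ^ card S * (\<Prod>j<k. if j \<in> S then pG n k (w j) else ?U) = (\<Prod>j\<in>S. - pG n k (w j)) * (\<Prod>j\<in>{..<k} - S. ?U)"
      if "S \<in> Pow {..<k}" for S w
    proof -
      have "{..<k} \<inter> {j. j \<in> S} = S" "{..<k} \<inter> - {j. j \<in> S} = {..<k} - S" using that by auto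
      then have "(\<Prod>j<k. if j \<in> S then pG n k (w j) else ?U) = (\<Prod>j\<in>S. pG n k (w j)) * (\<Prod>j\<in>{..<k} - S. ?U)"
        by (subst prod.If_cases) auto
      moreover have "(\<Prod>j\<in>S. - pG n k (w j)) = (- 1) ^ card S * (\<Prod>j\<in>S. pG n k (w j))"
        using prod.distrib[of "\<lambda>_. - 1" "\<lambda>j. pG n k (w j)" S] by simp
      ultimately show ?thesis by (simp only: mult.assoc)
    qed
    have "(\<Sum>S\<in>Pow {..<k}. (- 1) ^ card S * ?E S) =
        (\<Sum>S\<in>Pow {..<k}. \<Sum>w\<in>tup {..<k} (blk n). f w * ((- 1) ^ card S * (\<Prod>j<k. if j \<in> S then pG n k (w j) else ?U)))"
      unfolding E_mixed[OF assms] sum_distrib_left by (simp only: mult.left_commute)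
    also have "\<dots> = (\<Sum>w\<in>tup {..<k} (blk n). \<Sum>S\<in>Pow {..<k}. f w * ((\<Prod>j\<in>S. - pG n k (w j)) * (\<Prod>j\<in>{..<k} - S. ?U)))"
      by (rule trans[OF sum.swap]) (intro sum.cong refl arg_cong2[where f="(*)"] e)
    finally show ?thesis by (simp only: sum_distrib_left)
  qed
  also have "\<dots> = (\<Sum>w\<in>tup {..<k} (blk n). f w * (\<Prod>j<k. - pG n k (w j) + ?U))"
    by (intro sum.cong refl arg_cong2[where f="(*)"] prod_add[symmetric]) auto
  also have "\<dots> = (- 1) ^ k * (\<Sum>w\<in>tup {..<k} (blk n). f w * (\<Prod>j<k. pG n k (w j) - ?U))"
  proof -
    have "(\<Prod>j<k. - pG n k (w j) + ?U) = (- 1) ^ k * (\<Prod>j<k. pG n k (w j) - ?U)" for w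
      using prod.distrib[of "\<lambda>_. - 1" "\<lambda>j. pG n k (w j) - ?U" "{..<k}"] by simp
    then show ?thesis by (simp only: sum_distrib_left mult.left_commute)
  qed
  finally have "(\<Sum>S\<in>par k True. ?E S) - (\<Sum>S\<in>par k False. ?E S) =
      (- 1) ^ k * (\<Sum>w\<in>tup {..<k} (blk n). f w * (\<Prod>j<k. pG n k (w j) - ?U))" .
  then show ?thesis unfolding mu_par E_bind_par[OF assms]
    by (simp add: diff_divide_distrib[symmetric] abs_mult power_abs)
qed

text \<open>With m the probability of \<open>A\<close>, conditioning removes mass 1 - m outside of
  \<open>A\<close> and adds the same mass inside, so the L1 distance is 2 (1 - m).\<close>

lemma cond_expectation_close:
  fixes p :: "'a pmf" and f :: "'a \<Rightarrow> real"
  assumes fin: "finite (set_pmf p)" and f: "\<And>x. \<bar>f x\<bar> \<le> 1"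
    and \<delta>: "measure_pmf.prob p (- A) \<le> \<delta>" "\<delta> < 1"
  shows "\<bar>measure_pmf.expectation (cond_pmf p A) f - measure_pmf.expectation p f\<bar> \<le> 2 * \<delta>"
    and "set_pmf p \<inter> A \<noteq> {}"
proof -
  define m where "m = measure_pmf.prob p A"
  have m1: "measure_pmf.prob p (- A) = 1 - m" unfolding m_def using measure_pmf.prob_compl[of A p] by (simp add: Compl_eq_Diff_UNIV)
  then have m: "m > 0" "m \<le> 1" using \<delta> by (auto simp: m_def)
  show ne: "set_pmf p \<inter> A \<noteq> {}" using m(1) by (auto simp: m_def measure_pmf_zero_iff[symmetric])
  let ?S = "set_pmf p"
  have Ep: "measure_pmf.expectation p f = (\<Sum>x\<in>?S. f x * pmf p x)"
    by (rule integral_measure_pmf_real) (use fin in auto)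
  have Ec: "measure_pmf.expectation (cond_pmf p A) f = (\<Sum>x\<in>?S. f x * (if x \<in> A then pmf p x / m else 0))"
  proof -
    have "measure_pmf.expectation (cond_pmf p A) f = (\<Sum>x\<in>?S. f x * pmf (cond_pmf p A) x)"
      by (rule integral_measure_pmf_real) (use fin ne in \<open>auto simp: set_cond_pmf\<close>)
    then show ?thesis unfolding pmf_cond[OF ne] m_def .
  qed
  have sA: "(\<Sum>x\<in>?S. if x \<in> A then pmf p x else 0) = m"
  proof -
    have "m = (\<Sum>x\<in>?S. indicator A x * pmf p x)"
      unfolding m_def using integral_measure_pmf_real[OF fin, of p "indicator A"] by simp
    also have "\<dots> = (\<Sum>x\<in>?S. if x \<in> A then pmf p x else 0)" by (intro sum.cong refl) (simp add: indicator_def)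
    finally show ?thesis by simp
  qed
  have s1: "(\<Sum>x\<in>?S. pmf p x) = 1" by (rule sum_pmf_eq_1[OF fin]) simp
  have "\<bar>measure_pmf.expectation (cond_pmf p A) f - measure_pmf.expectation p f\<bar> =
      \<bar>\<Sum>x\<in>?S. f x * ((if x \<in> A then pmf p x / m else 0) - pmf p x)\<bar>"
    unfolding Ep Ec by (simp add: sum_subtractf right_diff_distrib)
  also have "\<dots> \<le> (\<Sum>x\<in>?S. \<bar>f x\<bar> * \<bar>(if x \<in> A then pmf p x / m else 0) - pmf p x\<bar>)"
    by (rule order_trans[OF sum_abs]) (simp add: abs_mult)
  also have "\<dots> \<le> (\<Sum>x\<in>?S. 1 * \<bar>(if x \<in> A then pmf p x / m else 0) - pmf p x\<bar>)"
    by (intro sum_mono mult_right_mono f) auto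
  also have "\<dots> = (\<Sum>x\<in>?S. (if x \<in> A then pmf p x else 0) * (1 / m - 1) + (pmf p x - (if x \<in> A then pmf p x else 0)))"
  proof (intro sum.cong refl)
    fix x
    have "pmf p x \<le> pmf p x / m" using m by (simp add: le_divide_eq mult_left_le)
    then show "1 * \<bar>(if x \<in> A then pmf p x / m else 0) - pmf p x\<bar> =
        (if x \<in> A then pmf p x else 0) * (1 / m - 1) + (pmf p x - (if x \<in> A then pmf p x else 0))"
      by (auto simp: algebra_simps)
  qed
  also have "\<dots> = m * (1 / m - 1) + (1 - m)"
    by (simp only: sum.distrib sum_distrib_right[symmetric] sum_subtractf sA s1)
  also have "\<dots> = 2 * (1 - m)" using m by (simp add: field_simps)
  also have "\<dots> \<le> 2 * \<delta>" using \<delta>(1) m1 by simp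
  finally show "\<bar>measure_pmf.expectation (cond_pmf p A) f - measure_pmf.expectation p f\<bar> \<le> 2 * \<delta>" .
qed

lemma forr_bil:
  fixes n k :: nat
  assumes "n \<ge> 1" "k \<ge> 1"
  shows "forr n u = gauss.bil (2 ^ n) (hadamard n) u / 2 ^ n"
proof -
  interpret gauss "2 ^ n" "eps n k" "hadamard n" by (rule gauss_hadamard[OF assms])
  show ?thesis by (simp add: forr_def bil_def hadamard_vec_def)
qed

definition err1 :: "nat \<Rightarrow> nat \<Rightarrow> real" where
  "err1 n k = exp (- (2 ^ n * (eps n k)\<^sup>2 / 64)) + gauss.tau (2 ^ n) (eps n k) (hadamard n)"

lemma prob_block_bad:
  assumes "n \<ge> 1" "k \<ge> 1" "eps n k \<le> 1"
  shows "measure_pmf.prob (rounding (2 * 2 ^ n) (gaussian_forr n k)) {u. forr n u < eps n k / 2} \<le> err1 n k"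
    and "measure_pmf.prob (uniform_cube (2 * 2 ^ n)) {u. forr n u > eps n k / 4} \<le> err1 n k"
proof -
  interpret gauss "2 ^ n" "eps n k" "hadamard n" by (rule gauss_hadamard[OF assms(1,2)])
  have pr: "measure_pmf.prob p A = (\<Sum>u\<in>blk n. of_bool (u \<in> A) * pmf p u)" if "set_pmf p \<subseteq> blk n" for p A
  proof -
    have "measure_pmf.prob p A = measure_pmf.expectation p (indicator A)" by simp
    also have "\<dots> = (\<Sum>u\<in>blk n. indicator A u * pmf p u)"
      by (rule integral_measure_pmf_real[OF finite_sign_cube]) (use that in auto)
    finally show ?thesis by (simp add: indicator_def)
  qed
  have N0: "(0 :: real) < 2 ^ n" by simp
  have "measure_pmf.prob (rounding (2 * 2 ^ n) (gaussian_forr n k)) {u. forr n u < eps n k / 2} =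
      (\<Sum>u\<in>blk n. (\<integral>x. ker (\<lambda>i. trnc (gauss_pt x i)) u \<partial>P) * of_bool (bil u < real (2 ^ n) * eps n k / 2))"
    unfolding pr[OF set_rounding[OF assms(1,2)]]
    by (intro sum.cong refl) (simp add: pmf_rounding_gauss[OF assms(1,2)] forr_bil[OF assms(1,2)] field_simps)
  also have "\<dots> \<le> err1 n k" using concentration_gauss[OF assms(3)] by (simp add: err1_def)
  finally show "measure_pmf.prob (rounding (2 * 2 ^ n) (gaussian_forr n k)) {u. forr n u < eps n k / 2} \<le> err1 n k" .
  have "measure_pmf.prob (uniform_cube (2 * 2 ^ n)) {u. forr n u > eps n k / 4} =
      (\<Sum>u\<in>blk n. (1 / 2) ^ (2 * 2 ^ n) * of_bool (bil u > real (2 ^ n) * eps n k / 4))"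
    unfolding pr[OF equalityD1[OF set_uniform_cube]]
    by (intro sum.cong refl) (simp add: pmf_uniform_cube forr_bil[OF assms(1,2)] field_simps)
  also have "\<dots> \<le> err1 n k" using concentration_unif tau_nonneg by (simp add: err1_def)
  finally show "measure_pmf.prob (uniform_cube (2 * 2 ^ n)) {u. forr n u > eps n k / 4} \<le> err1 n k" .
qed

text \<open>If every block lies on its expected side, all factors are defined and exactly those in
  \<open>S\<close> equal -1. What remains is a union bound over the blocks.\<close>

lemma prob_mixed_bad:
  assumes "n \<ge> 1" "k \<ge> 1" "eps n k \<le> 1" "S \<subseteq> {..<k}"
  shows "measure_pmf.prob (mixed_product n k S) (- {z. forr_xor n k z = Some ((- 1) ^ card S)}) \<le> real k * err1 n k"
proof -
  let ?p = "\<lambda>j. if j \<in> S then rounding (2 * 2 ^ n) (gaussian_forr n k) else uniform_cube (2 * 2 ^ n)"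
  let ?b = "\<lambda>j. if j \<in> S then {u. forr n u < eps n k / 2} else {u. forr n u > eps n k / 4}"
  have e0: "eps n k > 0" by (rule eps_pos[OF assms(1,2)])
  have sub: "- {z. forr_xor n k z = Some ((- 1) ^ card S)} \<subseteq> (\<Union>j\<in>{..<k}. {z. z j \<in> ?b j})"
  proof (rule ccontr)
    assume "\<not> ?thesis"
    then obtain z where z: "forr_xor n k z \<noteq> Some ((- 1) ^ card S)" "\<And>j. j < k \<Longrightarrow> z j \<notin> ?b j" by blast
    have v: "forr_fun n k (z j) = Some (if j \<in> S then - 1 else 1)" if "j < k" for j
      using z(2)[OF that] e0 by (auto simp: forr_fun_def split: if_splits)
    then have "forr_xor n k z = Some (\<Prod>j<k. if j \<in> S then - 1 else 1)"
      unfolding forr_xor_def by (auto intro!: prod.cong)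
    moreover have "(\<Prod>j<k. if j \<in> S then - 1 else 1 :: real) = (- 1) ^ card S"
    proof -
      have "{..<k} \<inter> {j. j \<in> S} = S" using assms(4) by auto
      then show ?thesis by (subst prod.If_cases) auto
    qed
    ultimately show False using z(1) by simp
  qed
  have "measure_pmf.prob (mixed_product n k S) (- {z. forr_xor n k z = Some ((- 1) ^ card S)}) \<le>
      measure_pmf.prob (mixed_product n k S) (\<Union>j\<in>{..<k}. {z. z j \<in> ?b j})"
    by (intro measure_pmf.finite_measure_mono sub) auto
  also have "\<dots> \<le> (\<Sum>j\<in>{..<k}. measure_pmf.prob (mixed_product n k S) {z. z j \<in> ?b j})"
    by (intro measure_pmf.finite_measure_subadditive_finite) auto
  also have "\<dots> \<le> (\<Sum>j\<in>{..<k}. err1 n k)"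
  proof (intro sum_mono)
    fix j assume j: "j \<in> {..<k}"
    have "map_pmf (\<lambda>z. z j) (mixed_product n k S) = ?p j"
      unfolding mixed_product_def using j by (subst Pi_pmf_component) auto
    then have "measure_pmf.prob (?p j) (?b j) = measure_pmf.prob (mixed_product n k S) {z. z j \<in> ?b j}"
      using measure_map_pmf[of "\<lambda>z. z j" "mixed_product n k S" "?b j"] by (simp only: vimage_def)
    moreover have "measure_pmf.prob (?p j) (?b j) \<le> err1 n k"
      using prob_block_bad[OF assms(1-3)] by simp
    ultimately show "measure_pmf.prob (mixed_product n k S) {z. z j \<in> ?b j} \<le> err1 n k" by simp
  qed
  finally show ?thesis by simp
qed

lemma prob_mu_bad:
  assumes "n \<ge> 1" "k \<ge> 1" "eps n k \<le> 1"
  shows "measure_pmf.prob (bind_pmf (pmf_of_set (par k b)) (mixed_product n k))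
     (- {z. forr_xor n k z = Some (if b then 1 else - 1)}) \<le> real k * err1 n k"
proof -
  define A where "A = - {z. forr_xor n k z = Some (if b then 1 else - 1)}"
  have "measure_pmf.prob (bind_pmf (pmf_of_set (par k b)) (mixed_product n k)) A =
      (\<Sum>S\<in>par k b. measure_pmf.expectation (mixed_product n k S) (indicator A)) / 2 ^ (k - 1)"
    using E_bind_par[OF assms(1,2), of b "indicator A"] by simp
  also have "\<dots> \<le> (\<Sum>S\<in>par k b. real k * err1 n k) / 2 ^ (k - 1)"
  proof (intro divide_right_mono sum_mono)
    fix S assume S: "S \<in> par k b"
    then have "(- 1) ^ card S = (if b then 1 else - 1 :: real)" by (auto simp: par_def)
    then show "measure_pmf.expectation (mixed_product n k S) (indicator A) \<le> real k * err1 n k"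
      using prob_mixed_bad[OF assms, of S] S unfolding A_def by (simp add: par_def)
  qed simp
  also have "\<dots> = real k * err1 n k" using card_par[OF assms(2), of b] by simp
  finally show ?thesis unfolding A_def .
qed

lemma finite_set_mu:
  assumes "n \<ge> 1" "k \<ge> 1"
  shows "finite (set_pmf (bind_pmf (pmf_of_set (par k b)) (mixed_product n k)))"
    "set_pmf (bind_pmf (pmf_of_set (par k b)) (mixed_product n k)) \<subseteq> tup {..<k} (blk n)"
proof -
  show s: "set_pmf (bind_pmf (pmf_of_set (par k b)) (mixed_product n k)) \<subseteq> tup {..<k} (blk n)"
    using set_mixed_product[OF assms] by auto
  show "finite (set_pmf (bind_pmf (pmf_of_set (par k b)) (mixed_product n k)))"
    by (rule finite_subset[OF s finite_tup]) (auto simp: finite_sign_cube)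
qed

lemma advantage_le:
  assumes "n \<ge> 1" "k \<ge> 1" "eps n k \<le> 1" "real k * err1 n k < 1" "\<And>z. \<bar>f z\<bar> \<le> 1"
  shows "advantage n k f \<le> \<bar>measure_pmf.expectation (mu0 n k) f - measure_pmf.expectation (mu1 n k) f\<bar> + 4 * (real k * err1 n k)"
proof -
  have "\<bar>measure_pmf.expectation (sigma0 n k) f - measure_pmf.expectation (mu0 n k) f\<bar> \<le> 2 * (real k * err1 n k)"
    unfolding sigma0_def mu_par
    using prob_mu_bad[OF assms(1-3), of True] assms(4,5)
    by (intro cond_expectation_close finite_set_mu assms(1,2)) auto
  moreover have "\<bar>measure_pmf.expectation (sigma1 n k) f - measure_pmf.expectation (mu1 n k) f\<bar> \<le> 2 * (real k * err1 n k)"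
    unfolding sigma1_def mu_par
    using prob_mu_bad[OF assms(1-3), of False] assms(4,5)
    by (intro cond_expectation_close finite_set_mu assms(1,2)) auto
  ultimately show ?thesis unfolding advantage_def by linarith
qed

lemma set_sigma:
  assumes "n \<ge> 1" "k \<ge> 1" "eps n k \<le> 1" "real k * err1 n k < 1"
  shows "set_pmf (sigma0 n k) \<subseteq> tup {..<k} (blk n) \<inter> {z. forr_xor n k z = Some 1}"
    "set_pmf (sigma1 n k) \<subseteq> tup {..<k} (blk n) \<inter> {z. forr_xor n k z = Some (- 1)}"
proof -
  have ne: "set_pmf (bind_pmf (pmf_of_set (par k b)) (mixed_product n k)) \<inter> {z. forr_xor n k z = Some (if b then 1 else - 1)} \<noteq> {}" for b
    by (rule cond_expectation_close(2)[OF finite_set_mu(1)[OF assms(1,2)] _ prob_mu_bad[OF assms(1-3)] assms(4), of "\<lambda>_. 0"]) simp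
  show "set_pmf (sigma0 n k) \<subseteq> tup {..<k} (blk n) \<inter> {z. forr_xor n k z = Some 1}"
    unfolding sigma0_def mu_par using ne[of True] finite_set_mu(2)[OF assms(1,2), of True] by (subst set_cond_pmf) auto
  show "set_pmf (sigma1 n k) \<subseteq> tup {..<k} (blk n) \<inter> {z. forr_xor n k z = Some (- 1)}"
    unfolding sigma1_def mu_par using ne[of False] finite_set_mu(2)[OF assms(1,2), of False] by (subst set_cond_pmf) auto
qed

section \<open>Level-$2k$ coefficients\<close>

lemma div_mod_block: "i < B \<Longrightarrow> (j * B + i) div B = j" "i < B \<Longrightarrow> (j * B + i) mod B = i" for B :: nat
  by simp_all

lemma block_less: "j < k \<Longrightarrow> i < B \<Longrightarrow> j * B + i < k * B" for B :: nat
proof -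
  assume "j < k" "i < B"
  then have "j * B + i < (j + 1) * B" "(j + 1) * B \<le> k * B" by (simp, intro mult_le_mono1) simp
  then show ?thesis by linarith
qed

lemma prod_blocks:
  fixes g :: "nat \<Rightarrow> nat \<Rightarrow> real"
  assumes "B > 0"
  shows "(\<Prod>j<k. \<Prod>i<B. g j i) = (\<Prod>m<k * B. g (m div B) (m mod B))"
proof -
  have "(\<Prod>j<k. \<Prod>i<B. g j i) = (\<Prod>(j, i)\<in>{..<k} \<times> {..<B}. g j i)"
    by (simp add: prod.cartesian_product)
  also have "\<dots> = (\<Prod>m<k * B. g (m div B) (m mod B))"
    by (rule prod.reindex_bij_witness[of _ "\<lambda>m. (m div B, m mod B)" "\<lambda>(j, i). j * B + i"])
       (use assms block_less in \<open>auto simp: div_mod_block less_mult_imp_div_less\<close>)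
  finally show ?thesis .
qed

text \<open>A tuple of sign vectors corresponds to the set of positions \<open>j * B + i\<close>
  carrying -1. Beyond the last block \<open>w\<close> is 0, so the predicate \<open>w = - 1\<close>
  is false there, in agreement with membership in \<open>X\<close>.\<close>

lemma sum_tup_Pow:
  fixes F :: "(nat \<Rightarrow> bool) \<Rightarrow> real" and h :: "nat \<Rightarrow> nat \<Rightarrow> real \<Rightarrow> real"
  assumes B: "B > 0"
  shows "(\<Sum>w\<in>tup {..<k} (sign_cube B). F (\<lambda>m. w (m div B) (m mod B) = - 1) * (\<Prod>j<k. \<Prod>i<B. h j i (w j i))) =
    (\<Sum>X\<in>Pow {..<k * B}. F (\<lambda>m. m \<in> X) * (\<Prod>m<k * B. h (m div B) (m mod B) (sg (m \<in> X))))"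
proof (rule sum.reindex_bij_witness[of _ "\<lambda>X j i. if j < k \<and> i < B then sg (j * B + i \<in> X) else 0"
      "\<lambda>w. {m. m < k * B \<and> w (m div B) (m mod B) = - 1}"])
  have dk: "m div B < k" "m mod B < B" if "m < k * B" for m using that B by (auto simp: less_mult_imp_div_less)
  {
    fix X assume X: "X \<in> Pow {..<k * B}"
    show "{m. m < k * B \<and> (\<lambda>j i. if j < k \<and> i < B then sg (j * B + i \<in> X) else 0) (m div B) (m mod B) = - 1} = X"
      using X dk by (auto simp: sg_def split: if_splits)
    show "(\<lambda>j i. if j < k \<and> i < B then sg (j * B + i \<in> X) else 0) \<in> tup {..<k} (sign_cube B)"
      by (auto simp: tup_iff sign_cube_iff sg_def)
  next
    fix w assume w: "w \<in> tup {..<k} (sign_cube B)"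
    let ?X = "{m. m < k * B \<and> w (m div B) (m mod B) = - 1}"
    have wv: "w j i = 1 \<or> w j i = - 1" if "j < k" "i < B" for j i
      using w that by (auto simp: tup_iff sign_cube_iff)
    have w0: "w j i = 0" if "\<not> (j < k \<and> i < B)" for j i
      using w that by (cases "j < k") (auto simp: tup_iff sign_cube_iff)
    show "(\<lambda>j i. if j < k \<and> i < B then sg (j * B + i \<in> ?X) else 0) = w"
    proof (intro ext)
      fix j i
      show "(if j < k \<and> i < B then sg (j * B + i \<in> ?X) else 0) = w j i"
        using w0[of j i] wv[of j i] block_less[of j k i B] by (auto simp: sg_def)
    qed
    show "?X \<in> Pow {..<k * B}" by auto
    have mem: "(w (m div B) (m mod B) = - 1) = (m \<in> ?X)" for m
    proof -
      have "w (m div B) (m mod B) = 0" if "\<not> m < k * B"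
      proof -
        have "k \<le> m div B" using that B by (simp add: less_eq_div_iff_mult_less_eq)
        then show ?thesis by (intro w0) simp
      qed
      then show ?thesis by (cases "m < k * B") simp_all
    qed
    have "sg (m \<in> ?X) = w (m div B) (m mod B)" if "m < k * B" for m
      using wv[OF dk[OF that]] that unfolding sg_def by (elim disjE) simp_all
    then show "F (\<lambda>m. m \<in> ?X) * (\<Prod>m<k * B. h (m div B) (m mod B) (sg (m \<in> ?X))) =
        F (\<lambda>m. w (m div B) (m mod B) = - 1) * (\<Prod>j<k. \<Prod>i<B. h j i (w j i))"
      unfolding prod_blocks[OF B]
      by (intro arg_cong2[where f="(*)"] prod.cong refl arg_cong[where f=F] ext mem[symmetric]) (simp only: lessThan_iff)
  }
qed

context gauss
begin

text \<open>Expanding the product of the sums in \<open>dker\<close> chooses a pair (a, b) in every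
  block. A choice \<open>g\<close> yields a set \<open>T g\<close> of exactly \<open>2 * k\<close>
  directions and different choices yield different sets, so the sum is bounded by the part of level
  2k of the coefficient norm at the point \<open>V\<close>, each term with weight at most
  \<open>(e * h) ^ k\<close>.\<close>

lemma dker_base_bound:
  fixes F :: "(nat \<Rightarrow> bool) \<Rightarrow> real"
  assumes N: "N > 0" and h: "\<And>a b. \<bar>H a b\<bar> \<le> h" and l: "l > 0"
    and v: "\<And>j i. j < k \<Longrightarrow> i < 2 * N \<Longrightarrow> \<bar>v j i\<bar> \<le> 1 / 2"
    and K: "\<And>\<rho>. coeff_norm {..<k * (2 * N)} (\<lambda>_. 0) (\<lambda>_. l) (\<lambda>x. F (comb \<rho> x)) \<le> K"
  shows "\<bar>\<Sum>w\<in>tup {..<k} (sign_cube (2 * N)). F (\<lambda>m. w (m div (2 * N)) (m mod (2 * N)) = - 1) * (\<Prod>j<k. dker (v j) (w j))\<bar>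
    \<le> (e * h) ^ k * ((2 / l) ^ (2 * k) * K)"
proof -
  define B where "B = 2 * N"
  have B: "B > 0" using N by (simp add: B_def)
  define G where "G = PiE {..<k} (\<lambda>_. {..<N} \<times> {..<N})"
  define p where "p = (\<lambda>g :: nat \<Rightarrow> nat \<times> nat. \<lambda>j i. i = fst (g j) \<or> i = N + snd (g j))"
  define T where "T = (\<lambda>g. {m. m < k * B \<and> p g (m div B) (m mod B)})"
  define C where "C = (\<lambda>g :: nat \<Rightarrow> nat \<times> nat. \<Prod>j<k. e * H (fst (g j)) (snd (g j)))"
  define V where "V = (\<lambda>m. v (m div B) (m mod B))"
  let ?I = "{..<k * B}"
  have finG: "finite G" unfolding G_def by (intro finite_PiE) auto
  have gj: "fst (g j) < N" "snd (g j) < N" if "g \<in> G" "j < k" for g j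
    using that unfolding G_def by (auto simp: PiE_iff mem_Times_iff)
  have dk: "m div B < k" "m mod B < B" if "m < k * B" for m using that B by (auto simp: less_mult_imp_div_less)
  have ex: "(\<Prod>j<k. dker (v j) (w j)) = (\<Sum>g\<in>G. C g * (\<Prod>j<k. \<Prod>i<B. if p g j i then w j i / 2 else (1 + w j i * v j i) / 2))" for w
  proof -
    have "(\<Prod>j<k. dker (v j) (w j)) = (\<Prod>j<k. \<Sum>(a, b)\<in>{..<N} \<times> {..<N}. e * H a b *
        (\<Prod>i<B. if i = a \<or> i = N + b then w j i / 2 else (1 + w j i * v j i) / 2))"
      unfolding dker_def B_def by (simp add: sum.cartesian_product)
    also have "\<dots> = (\<Sum>g\<in>G. \<Prod>j<k. case g j of (a, b) \<Rightarrow> e * H a b *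
        (\<Prod>i<B. if i = a \<or> i = N + b then w j i / 2 else (1 + w j i * v j i) / 2))"
      unfolding G_def by (rule prod_sum_PiE) auto
    also have "\<dots> = (\<Sum>g\<in>G. C g * (\<Prod>j<k. \<Prod>i<B. if p g j i then w j i / 2 else (1 + w j i * v j i) / 2))"
      unfolding C_def p_def prod.distrib[symmetric] by (intro sum.cong prod.cong refl) (simp add: case_prod_unfold)
    finally show ?thesis .
  qed
  have mlcT: "(\<Sum>w\<in>tup {..<k} (sign_cube B). F (\<lambda>m. w (m div B) (m mod B) = - 1) *
      (\<Prod>j<k. \<Prod>i<B. if p g j i then w j i / 2 else (1 + w j i * v j i) / 2)) = mlin_coeff ?I V (T g) F" for g
    unfolding mlin_coeff_def V_def
    by (subst sum_tup_Pow[OF B, where F = F and k = k and h = "\<lambda>j i t. if p g j i then t / 2 else (1 + t * v j i) / 2"])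
       (intro sum.cong arg_cong2[where f="(*)"] prod.cong refl, auto simp: T_def mult.commute)
  have eq: "(\<Sum>w\<in>tup {..<k} (sign_cube B). F (\<lambda>m. w (m div B) (m mod B) = - 1) * (\<Prod>j<k. dker (v j) (w j))) =
      (\<Sum>g\<in>G. C g * mlin_coeff ?I V (T g) F)"
    unfolding mlcT[symmetric] ex sum_distrib_left by (subst sum.swap) (simp only: mult.left_commute)
  have injT: "inj_on T G"
  proof (rule inj_onI)
    fix g g' assume g: "g \<in> G" "g' \<in> G" and eqT: "T g = T g'"
    have pe: "p g j i = p g' j i" if "j < k" "i < B" for j i
    proof -
      have "j * B + i \<in> T g \<longleftrightarrow> j * B + i \<in> T g'" using eqT by simp
      then show ?thesis using block_less[OF that] that by (simp add: T_def)
    qed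
    have "g j = g' j" if j: "j < k" for j
    proof -
      note a = gj[OF g(1) j] gj[OF g(2) j]
      have "fst (g j) = fst (g' j)" using pe[OF j, of "fst (g j)"] a by (auto simp: p_def B_def)
      moreover have "snd (g j) = snd (g' j)" using pe[OF j, of "N + snd (g j)"] a by (auto simp: p_def B_def)
      ultimately show ?thesis by (simp add: prod_eq_iff)
    qed
    then show "g = g'" using g unfolding G_def by (intro PiE_ext) auto
  qed
  have cardT: "card (T g) = 2 * k" if g: "g \<in> G" for g
  proof -
    let ?a = "\<lambda>j. j * B + fst (g j)" and ?b = "\<lambda>j. j * B + (N + snd (g j))"
    have lt: "fst (g j) < B" "N + snd (g j) < B" if "j < k" for j using gj[OF g that] by (auto simp: B_def)
    have ia: "inj_on ?a {..<k}"
      by (rule inj_on_inverseI[where g = "\<lambda>m. m div B"]) (use lt in \<open>auto simp: div_mod_block\<close>)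
    have ib: "inj_on ?b {..<k}"
      by (rule inj_on_inverseI[where g = "\<lambda>m. m div B"]) (use lt in \<open>simp add: div_mod_block\<close>)
    have T: "T g = ?a ` {..<k} \<union> ?b ` {..<k}"
    proof (intro equalityI subsetI)
      fix m assume m: "m \<in> T g"
      then have k: "m div B \<in> {..<k}" and c: "m mod B = fst (g (m div B)) \<or> m mod B = N + snd (g (m div B))"
        using dk by (auto simp: T_def p_def)
      have m: "m = (m div B) * B + m mod B" by simp
      from c show "m \<in> ?a ` {..<k} \<union> ?b ` {..<k}"
      proof
        assume "m mod B = fst (g (m div B))"
        with m have "m = ?a (m div B)" by metis
        then show ?thesis using k by (intro UnI1 image_eqI)
      next
        assume "m mod B = N + snd (g (m div B))"
        with m have "m = ?b (m div B)" by metis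
        then show ?thesis using k by (intro UnI2 image_eqI)
      qed
    next
      fix m assume "m \<in> ?a ` {..<k} \<union> ?b ` {..<k}"
      then obtain j where j: "j < k" "m = j * B + fst (g j) \<or> m = j * B + (N + snd (g j))" by auto
      then obtain i where i: "m = j * B + i" "i < B" "p g j i" using lt[OF j(1)] by (auto simp: p_def)
      then show "m \<in> T g" using j(1) block_less[of j k i B] by (simp add: T_def)
    qed
    have disj: "?a ` {..<k} \<inter> ?b ` {..<k} = {}"
    proof (rule ccontr)
      assume "\<not> ?thesis"
      then obtain j j' where j: "j < k" "j' < k" "?a j = ?b j'" by auto
      have "(?a j) mod B = fst (g j)" "(?b j') mod B = N + snd (g j')"
        using div_mod_block(2)[OF lt(1)[OF j(1)]] div_mod_block(2)[OF lt(2)[OF j(2)]] by auto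
      then show False using j(3) gj(1)[OF g j(1)] by simp
    qed
    show ?thesis unfolding T using card_image[OF ia] card_image[OF ib] disj by (subst card_Un_disjoint) auto
  qed
  have C: "\<bar>C g\<bar> \<le> (e * h) ^ k" for g
  proof -
    have "\<bar>C g\<bar> \<le> (\<Prod>j<k. e * h)"
      unfolding C_def abs_prod abs_mult using e h by (intro prod_mono) (auto intro!: mult_mono)
    then show ?thesis by simp
  qed
  have h0: "h \<ge> 0" using h[of 0 0] abs_ge_zero order_trans by blast
  have "\<bar>\<Sum>g\<in>G. C g * mlin_coeff ?I V (T g) F\<bar> \<le> (\<Sum>g\<in>G. (e * h) ^ k * \<bar>mlin_coeff ?I V (T g) F\<bar>)"
    by (rule order_trans[OF sum_abs]) (auto simp: abs_mult intro!: sum_mono mult_right_mono C)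
  also have "\<dots> = (e * h) ^ k * (\<Sum>t\<in>T ` G. \<bar>mlin_coeff ?I V t F\<bar>)"
    by (simp add: sum.reindex[OF injT] sum_distrib_left)
  also have "\<dots> \<le> (e * h) ^ k * ((2 / l) ^ (2 * k) * K)"
  proof (intro mult_left_mono sum_mlin_coeff_point_le)
    show "\<bar>V m\<bar> \<le> 1 / 2" if "m \<in> ?I" for m using v dk that by (simp add: V_def B_def)
    show "T ` G \<subseteq> Pow ?I" by (auto simp: T_def)
    show "coeff_norm ?I (\<lambda>_. 0) (\<lambda>_. l) (\<lambda>x. F (comb \<rho> x)) \<le> K" for \<rho> using K by (simp add: B_def)
  qed (use l cardT e h0 in auto)
  finally show ?thesis using eq unfolding B_def by simp
qed

end

lemma Lam_hadamard_le:
  assumes "n \<ge> 1" "k \<ge> 1" "eps n k \<le> 1"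
  shows "gauss.Lam (2 ^ n) (eps n k) (hadamard n) \<le> (2 ^ n)\<^sup>2"
proof -
  interpret gauss "2 ^ n" "eps n k" "hadamard n" by (rule gauss_hadamard[OF assms(1,2)])
  have "eps n k * \<bar>hadamard n a b\<bar> \<le> 1 * 1" for a b
    using assms(3) e by (intro mult_mono) (auto simp: abs_hadamard)
  then have "Lam \<le> (\<Sum>a<(2::nat) ^ n. \<Sum>b<(2::nat) ^ n. 1 :: real)"
    unfolding Lam_def by (intro sum_mono) simp
  then show ?thesis by (simp add: power2_eq_square)
qed

lemma sum_abs_pG_diff:
  assumes "n \<ge> 1" "k \<ge> 1"
  shows "(\<Sum>u\<in>blk n. \<bar>pG n k u - (1 / 2) ^ (2 * 2 ^ n)\<bar>) \<le> 2"
proof -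
  have "(\<Sum>u\<in>blk n. \<bar>pG n k u - (1 / 2) ^ (2 * 2 ^ n)\<bar>) \<le> (\<Sum>u\<in>blk n. pG n k u + (1 / 2) ^ (2 * 2 ^ n))"
    by (intro sum_mono) (auto simp: pG_def abs_le_iff)
  also have "\<dots> = 1 + 1"
  proof -
    have "(\<Sum>u\<in>blk n. pG n k u) = 1"
      unfolding pG_def by (rule sum_pmf_eq_1[OF finite_sign_cube set_rounding[OF assms]])
    moreover have "(\<Sum>u\<in>blk n. (1 / 2) ^ (2 * 2 ^ n) :: real) = 1"
      by (simp add: card_sign_cube power_one_over)
    ultimately show ?thesis by (simp only: sum.distrib)
  qed
  finally show ?thesis by simp
qed

text \<open>\<open>hybrid_blocks\<close> with \<open>dker\<close> in the role of
  \<open>\<theta>\<close>, \<open>block_bound\<close> as its step and N^2 as common bound of the L1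
  norms. The error of the k exchanges is collected with \<open>2 + Lam \<le> 2 * N\<^sup>2\<close>,
  which completes the power N^(2k).\<close>

lemma circuit_mu_diff:
  fixes F :: "(nat \<Rightarrow> bool) \<Rightarrow> real"
  assumes nk: "n \<ge> 1" "k \<ge> 1" "eps n k \<le> 1" and l: "l > 0" and F: "\<And>x. \<bar>F x\<bar> \<le> 1"
    and K: "\<And>\<rho>. coeff_norm {..<num_inputs n k} (\<lambda>_. 0) (\<lambda>_. l) (\<lambda>x. F (comb \<rho> x)) \<le> K"
  shows "\<bar>\<Sum>w\<in>tup {..<k} (blk n). F (\<lambda>m. concat_input n w m = - 1) * (\<Prod>j<k. pG n k (w j) - (1 / 2) ^ (2 * 2 ^ n))\<bar>
    \<le> (eps n k / sqrt (2 ^ n)) ^ k * ((2 / l) ^ (2 * k) * K) +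
       2 * real k * gauss.tau (2 ^ n) (eps n k) (hadamard n) * (2 ^ n) ^ (2 * k)"
proof -
  interpret gauss "2 ^ n" "eps n k" "hadamard n" by (rule gauss_hadamard[OF nk(1,2)])
  define Bd where "Bd = (eps n k / sqrt (2 ^ n)) ^ k * ((2 / l) ^ (2 * k) * K)"
  define V where "V = {v :: nat \<Rightarrow> real. \<forall>i<2 * 2 ^ n. \<bar>v i\<bar> \<le> 1 / 2}"
  define f where "f = (\<lambda>w. F (\<lambda>m. concat_input n w m = - 1))"
  let ?L = "(2 ^ n)\<^sup>2 :: real" and ?\<Theta> = "\<lambda>u. pG n k u - (1 / 2) ^ (2 * 2 ^ n)"
  have two: "(2 :: real) \<le> 2 ^ n" using nk(1) power_increasing[of 1 n "2 :: real"] by simp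
  then have L2: "2 \<le> ?L" using power_mono[of 2 "2 ^ n :: real" 2] by simp
  have LL: "Lam \<le> ?L" by (rule Lam_hadamard_le[OF nk])
  \<comment> \<open>All blocks carry the true difference at the start, so the family of points is a
    placeholder; zero lies in \<open>V\<close>.\<close>
  have "\<bar>\<Sum>w\<in>tup {..<k} (blk n). f w * (\<Prod>j\<in>{..<k}. if j \<in> {..<k} then ?\<Theta> (w j) else dker ((\<lambda>_ _. 0) j) (w j))\<bar> \<le>
      Bd + real (card {..<k}) * ((2 + Lam) * tau) * ?L ^ (card {..<k} - 1)"
  proof (rule hybrid_blocks[where V = V])
    show "\<bar>f w\<bar> \<le> 1" for w by (simp add: f_def F)
    show "0 \<le> (2 + Lam) * tau" using Lam_nonneg tau_nonneg by simp
    show "(\<Sum>u\<in>blk n. \<bar>?\<Theta> u\<bar>) \<le> ?L" using sum_abs_pG_diff[OF nk(1,2)] L2 by linarith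
    show "(\<Sum>u\<in>blk n. \<bar>dker v u\<bar>) \<le> ?L" if "v \<in> V" for v
    proof -
      have "max 1 \<bar>v i\<bar> = 1" if "i < 2 * 2 ^ n" for i using \<open>v \<in> V\<close> that by (auto simp: V_def max_def)
      then have "max_prod v = 1" unfolding max_prod_def by simp
      then show ?thesis using sum_abs_dker[of v] LL by simp
    qed
    show "\<bar>\<Sum>u\<in>blk n. c u * ?\<Theta> u\<bar> \<le> M + (2 + Lam) * tau * R"
      if c: "\<And>u. u \<in> blk n \<Longrightarrow> \<bar>c u\<bar> \<le> R" and M: "\<And>v. v \<in> V \<Longrightarrow> \<bar>\<Sum>u\<in>blk n. c u * dker v u\<bar> \<le> M" for c R M
    proof -
      have "(\<Sum>u\<in>blk n. c u * ?\<Theta> u) = (\<Sum>u\<in>blk n. c u * ((\<integral>x. ker (\<lambda>i. trnc (gauss_pt x i)) u \<partial>P) - (1 / 2) ^ (2 * 2 ^ n)))"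
        by (intro sum.cong refl) (simp add: pG_def pmf_rounding_gauss[OF nk(1,2)])
      moreover have "\<bar>\<Sum>u\<in>blk n. c u * ((\<integral>x. ker (\<lambda>i. trnc (gauss_pt x i)) u \<partial>P) - (1 / 2) ^ (2 * 2 ^ n))\<bar> \<le> M + (2 + Lam) * tau * R"
        by (rule block_bound[OF c M]) (auto simp: V_def)
      ultimately show ?thesis by simp
    qed
    show "\<bar>\<Sum>w\<in>tup {..<k} (blk n). f w * (\<Prod>j\<in>{..<k}. dker (v j) (w j))\<bar> \<le> Bd"
      if "\<And>j. j \<in> {..<k} \<Longrightarrow> v j \<in> V" for v
    proof -
      have "\<bar>\<Sum>w\<in>tup {..<k} (blk n). F (\<lambda>m. w (m div (2 * 2 ^ n)) (m mod (2 * 2 ^ n)) = - 1) * (\<Prod>j<k. dker (v j) (w j))\<bar>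
          \<le> (eps n k * (1 / sqrt (2 ^ n))) ^ k * ((2 / l) ^ (2 * k) * K)"
      proof (rule dker_base_bound)
        show "\<bar>v j i\<bar> \<le> 1 / 2" if "j < k" "i < 2 * 2 ^ n" for j i
          using \<open>\<And>j. j \<in> {..<k} \<Longrightarrow> v j \<in> V\<close>[of j] that by (simp add: V_def)
        show "coeff_norm {..<k * (2 * 2 ^ n)} (\<lambda>_. 0) (\<lambda>_. l) (\<lambda>x. F (comb \<rho> x)) \<le> K" for \<rho>
          using K by (simp add: num_inputs_def)
      qed (use l in \<open>auto simp: abs_hadamard\<close>)
      then show ?thesis by (simp add: Bd_def f_def concat_input_def)
    qed
    show "(\<lambda>_ _. 0) j \<in> V" for j :: nat by (simp add: V_def)
  qed (auto simp: finite_sign_cube)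
  also have "\<dots> \<le> Bd + 2 * real k * tau * (2 ^ n) ^ (2 * k)"
  proof -
    have "real k * ((2 + Lam) * tau) * ?L ^ (k - 1) \<le> real k * ((2 * ?L) * tau) * ?L ^ (k - 1)"
      using LL L2 tau_nonneg by (intro mult_right_mono mult_left_mono) auto
    also have "\<dots> = 2 * real k * tau * (?L * ?L ^ (k - 1))" by simp
    also have "?L * ?L ^ (k - 1) = (2 ^ n) ^ (2 * k)"
      using nk(2) by (simp only: power_Suc[symmetric] power_mult) simp
    finally show ?thesis by simp
  qed
  also have "(\<lambda>w. \<Prod>j\<in>{..<k}. if j \<in> {..<k} then ?\<Theta> (w j) else dker ((\<lambda>_ _. 0) j) (w j)) = (\<lambda>w. \<Prod>j<k. ?\<Theta> (w j))"
    by (intro ext prod.cong) auto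
  finally show ?thesis unfolding Bd_def f_def .
qed

lemma circuit_advantage:
  assumes nk: "n \<ge> 1" "k \<ge> 1" "eps n k \<le> 1" "real k * err1 n k < 1"
    and C: "wf_circuit (num_inputs n k) C" "circuit_depth C \<le> Suc d" "d \<ge> 1 \<Longrightarrow> circuit_size C \<le> 3 ^ r" "r \<ge> 1"
  shows "advantage n k (\<lambda>z. circuit_sign C (concat_input n z)) \<le>
    ((eps n k / sqrt (2 ^ n)) ^ k * ((96 * (48 * real r) ^ d) ^ (2 * k) * (4 * exp 3 ^ d)) +
       2 * real k * gauss.tau (2 ^ n) (eps n k) (hadamard n) * (2 ^ n) ^ (2 * k)) / 2 ^ (k - 1) + 4 * (real k * err1 n k)"
proof -
  let ?f = "\<lambda>z. circuit_sign C (concat_input n z)"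
  let ?l = "1 / 48 * (1 / (48 * real r)) ^ d"
  have l: "?l > 0" using C(4) by simp
  have l2: "2 / ?l = 96 * (48 * real r) ^ d" using C(4) by (simp add: field_simps)
  have cs: "?f z = sg (circuit_value C (\<lambda>m. concat_input n z m = - 1))" for z
    by (simp add: circuit_sign_def sg_def)
  have "\<bar>measure_pmf.expectation (mu0 n k) ?f - measure_pmf.expectation (mu1 n k) ?f\<bar> \<le>
      ((eps n k / sqrt (2 ^ n)) ^ k * ((2 / ?l) ^ (2 * k) * (4 * exp 3 ^ d)) +
       2 * real k * gauss.tau (2 ^ n) (eps n k) (hadamard n) * (2 ^ n) ^ (2 * k)) / 2 ^ (k - 1)"
    unfolding E_mu_diff[OF nk(1,2)] cs
  proof (intro divide_right_mono circuit_mu_diff[OF nk(1-3) l])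
    show "\<bar>sg (circuit_value C x)\<bar> \<le> 1" for x by (simp add: sg_def)
    show "coeff_norm {..<num_inputs n k} (\<lambda>_. 0) (\<lambda>_. ?l) (\<lambda>x. sg (circuit_value C (comb \<rho> x))) \<le> 4 * exp 3 ^ d" for \<rho>
      by (rule ac0_coeff_norm[OF C])
  qed simp
  moreover have "advantage n k ?f \<le> \<bar>measure_pmf.expectation (mu0 n k) ?f - measure_pmf.expectation (mu1 n k) ?f\<bar> + 4 * (real k * err1 n k)"
    by (rule advantage_le[OF nk]) (simp add: circuit_sign_def)
  ultimately show ?thesis unfolding l2 by linarith
qed

section \<open>Advantage of circuits\<close>

text \<open>Here the shape of \<open>eps\<close> is used: exp(-1/(16 eps)) = N^(-15 k^2/4). After 2N
  coordinates and the factor N^(2k) the exponent is 1 - 15 k^2/4 + 2k, which is at most -3k/4 for k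
  \<ge> 1, with equality at k = 1.\<close>

lemma tau_power_bound:
  assumes "n \<ge> 1" "k \<ge> 1" "eps n k \<le> 1 / 16"
  shows "gauss.tau (2 ^ n) (eps n k) (hadamard n) * (2 ^ n) ^ (2 * k) \<le> 16 * (2 ^ n) powr (- (3 / 4) * real k)"
proof -
  interpret gauss "2 ^ n" "eps n k" "hadamard n" by (rule gauss_hadamard[OF assms(1,2)])
  let ?N = "2 ^ n :: real"
  have N2: "?N \<ge> 2" using assms(1) power_increasing[of 1 n "2 :: real"] by simp
  have k1: "real k \<ge> 1" "real k \<le> (real k)\<^sup>2" using assms(2) self_le_power[of "real k" 2] by auto
  have lnN: "ln ?N > 0" using N2 by simp
  define x where "x = exp (- 1 / (16 * eps n k))"
  have x: "x = ?N powr (- (15 / 4) * (real k)\<^sup>2)"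
  proof -
    have "- 1 / (16 * eps n k) = - (15 / 4) * (real k)\<^sup>2 * ln ?N" using lnN k1 by (simp add: eps_def field_simps)
    then show ?thesis unfolding x_def by (simp add: powr_def)
  qed
  have y: "?N * x = ?N powr (1 - (15 / 4) * (real k)\<^sup>2)" unfolding x using N2 by (simp add: powr_mult_base)
  have "4 * (?N * x) \<le> 4 * ?N powr (- 2)" unfolding y
  proof (intro mult_left_mono powr_mono)
    show "1 - (15 / 4) * (real k)\<^sup>2 \<le> - 2" using k1 by linarith
  qed (use N2 in auto)
  also have "\<dots> \<le> 4 * 2 powr (- 2)" using N2 by (intro mult_left_mono powr_mono2') auto
  also have "\<dots> = 1" by (simp add: powr_minus powr_numeral)
  finally have small: "4 * (?N * x) \<le> 1" .
  have x0: "x \<ge> 0" by (simp add: x_def)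
  have "(1 + 2 * x) ^ (2 * 2 ^ n) \<le> exp (2 * x) ^ (2 * 2 ^ n)"
    using x0 by (intro power_mono exp_ge_add_one_self) auto
  also have "\<dots> = exp (4 * (?N * x))" by (simp add: exp_of_nat_mult[symmetric] mult_ac)
  also have "\<dots> \<le> 1 + 2 * (4 * (?N * x))"
    using exp_bound[of "4 * (?N * x)"] small x0 power_le_one_iff
    by (smt (verit) mult_left_le mult_nonneg_nonneg power2_eq_square zero_le_power)
  finally have "tau \<le> 16 * (?N * x)" using tau_le[OF assms(3)] unfolding x_def[symmetric] by simp
  then have "tau * ?N ^ (2 * k) \<le> 16 * (?N * x) * ?N ^ (2 * k)" by (intro mult_right_mono) auto
  also have "\<dots> = 16 * ?N powr (1 - (15 / 4) * (real k)\<^sup>2 + real (2 * k))"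
    unfolding y using N2 powr_realpow[of ?N "2 * k"] by (simp add: powr_add)
  also have "\<dots> \<le> 16 * ?N powr (- (3 / 4) * real k)"
  proof (intro mult_left_mono powr_mono)
    show "1 - (15 / 4) * (real k)\<^sup>2 + real (2 * k) \<le> - (3 / 4) * real k"
      using k1 unfolding of_nat_mult of_nat_numeral by linarith
  qed (use N2 in auto)
  finally show ?thesis .
qed

lemma filterlim_two_power: "filterlim (\<lambda>n. 2 ^ n :: real) at_top sequentially"
  by real_asymp

lemma eventually_eps_le:
  fixes k :: "nat \<Rightarrow> nat"
  assumes "\<And>n. k n \<ge> 1" "\<delta> > 0"
  shows "\<forall>\<^sub>F n in sequentially. eps n (k n) \<le> \<delta>"
proof -
  have "\<forall>\<^sub>F x :: real in at_top. 1 / (60 * ln x) \<le> \<delta> \<and> x > 1"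
    using assms(2) by (intro eventually_conj; real_asymp)
  then have "\<forall>\<^sub>F n in sequentially. 1 / (60 * ln (2 ^ n)) \<le> \<delta> \<and> (2 ^ n :: real) > 1"
    by (rule eventually_compose_filterlim[OF _ filterlim_two_power])
  then show ?thesis
  proof eventually_elim
    case (elim n)
    have "(1 :: real) \<le> (real (k n))\<^sup>2" using assms(1)[of n] by simp
    then have "60 * ln (2 ^ n) \<le> 60 * (real (k n))\<^sup>2 * ln (2 ^ n :: real)" using elim by simp
    moreover have "0 < 60 * ln (2 ^ n :: real)" using elim by simp
    ultimately have "eps n (k n) \<le> 1 / (60 * ln (2 ^ n))" unfolding eps_def
      by (intro divide_left_mono mult_pos_pos[of "60 * (real (k n))\<^sup>2 * ln (2 ^ n)"]) linarith+
    then show ?case using elim by simp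
  qed
qed

text \<open>The factors \<open>k\<close> in front of the errors are absorbed by
  \<open>k \<le> exp k\<close>, so every error is first bounded with an additional factor
  exp(-2k).\<close>

lemma eventually_parameters:
  fixes k :: "nat \<Rightarrow> nat"
  assumes k1: "\<And>n. k n \<ge> 1" and ko: "(\<lambda>n. real (k n)) \<in> o(\<lambda>n. (2 ^ n) powr (1 / 50))"
  shows "\<forall>\<^sub>F n in sequentially. n \<ge> 1 \<and> eps n (k n) \<le> 1 / 16 \<and>
     4 * real (k n) * (gauss.tau (2 ^ n) (eps n (k n)) (hadamard n) * (2 ^ n) ^ (2 * k n)) \<le> exp (- real (k n)) / 4 \<and>
     4 * real (k n) * err1 n (k n) \<le> exp (- real (k n)) / 2"
proof -
  have kN: "\<forall>\<^sub>F n in sequentially. real (k n) \<le> (2 ^ n) powr (1 / 50)"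
    using landau_o.smallD[OF ko, of 1] by simp
  have "\<forall>\<^sub>F x :: real in at_top. x powr (- (3 / 4)) * exp 2 \<le> 1 / 256 \<and> x > 1 \<and>
      6 * x powr (1 / 50) \<le> x / (64 * (60 * (x powr (1 / 50))\<^sup>2 * ln x)\<^sup>2)"
    by (intro eventually_conj; real_asymp)
  then have "\<forall>\<^sub>F n in sequentially. (2 ^ n) powr (- (3 / 4)) * exp 2 \<le> (1 / 256 :: real) \<and> (2 ^ n :: real) > 1 \<and>
      6 * (2 ^ n) powr (1 / 50) \<le> (2 ^ n :: real) / (64 * (60 * ((2 ^ n) powr (1 / 50))\<^sup>2 * ln (2 ^ n))\<^sup>2)"
    by (rule eventually_compose_filterlim[OF _ filterlim_two_power])
  moreover have "\<forall>\<^sub>F n in sequentially. eps n (k n) \<le> 1 / 16" by (rule eventually_eps_le[OF k1]) simp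
  ultimately show ?thesis using kN eventually_ge_at_top[of 1]
  proof eventually_elim
    case (elim n)
    let ?N = "2 ^ n :: real" and ?k = "real (k n)"
    interpret gauss "2 ^ n" "eps n (k n)" "hadamard n" by (rule gauss_hadamard[OF elim(4) k1])
    have e16: "eps n (k n) \<le> 1 / 16" using elim(2) by simp
    have k: "?k \<ge> 1" using k1[of n] by simp
    have ek: "?k \<le> exp ?k" using exp_ge_add_one_self[of ?k] by linarith
    have T: "4 * ?k * (tau * ?N ^ (2 * k n)) \<le> exp (- ?k) / 4"
    proof -
      have "4 * ?k * (tau * ?N ^ (2 * k n)) \<le> 4 * exp ?k * (16 * ?N powr (- (3 / 4) * ?k))"
        using ek tau_nonneg by (intro mult_mono tau_power_bound[OF elim(4) k1 e16]) auto
      also have "\<dots> = 64 * exp (- ?k) * (?N powr (- (3 / 4)) * exp 2) ^ k n"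
        using powr_realpow[of "?N powr (- (3 / 4))" "k n"]
        by (simp add: power_mult_distrib powr_powr exp_of_nat_mult[symmetric] mult_exp_exp)
      also have "\<dots> \<le> 64 * exp (- ?k) * (1 / 256) ^ k n"
        using elim(1) by (intro mult_left_mono power_mono) auto
      also have "\<dots> \<le> 64 * exp (- ?k) * (1 / 256) ^ 1"
        using k1[of n] by (intro mult_left_mono power_decreasing) auto
      finally show ?thesis by simp
    qed
    have "tau \<le> tau * ?N ^ (2 * k n)" using mult_left_mono[of 1 "?N ^ (2 * k n)" tau] tau_nonneg by simp
    then have t4: "4 * ?k * tau \<le> exp (- ?k) / 4" using T mult_left_mono[of tau "tau * ?N ^ (2 * k n)" "4 * ?k"] by linarith
    \<comment> \<open>The place where the growth of \<open>k\<close> is limited: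
      \<open>N * eps\<^sup>2\<close> is of order N/(k^4 ln^2 N), which exceeds any multiple of k for
      k up to N^(1/50).\<close>
    have "2 * ?k + 4 \<le> ?N * (eps n (k n))\<^sup>2 / 64"
    proof -
      have "2 * ?k + 4 \<le> 6 * ?k" using k by simp
      also have "\<dots> \<le> 6 * ?N powr (1 / 50)" using elim(3) by simp
      also have "\<dots> \<le> ?N / (64 * (60 * (?N powr (1 / 50))\<^sup>2 * ln ?N)\<^sup>2)" using elim(1) by simp
      also have "\<dots> \<le> ?N / (64 * (60 * ?k\<^sup>2 * ln ?N)\<^sup>2)"
      proof -
        have "60 * ?k\<^sup>2 * ln ?N \<le> 60 * (?N powr (1 / 50))\<^sup>2 * ln ?N" "0 < 60 * ?k\<^sup>2 * ln ?N"
          using elim(1,3) k by (auto intro!: mult_right_mono mult_left_mono power_mono)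
        then have "(60 * ?k\<^sup>2 * ln ?N)\<^sup>2 \<le> (60 * (?N powr (1 / 50))\<^sup>2 * ln ?N)\<^sup>2" "0 < (60 * ?k\<^sup>2 * ln ?N)\<^sup>2"
          by (intro power_mono zero_less_power; linarith)+
        then show ?thesis by (intro divide_left_mono mult_left_mono) (auto intro!: mult_pos_pos)
      qed
      also have "\<dots> = ?N * (eps n (k n))\<^sup>2 / 64" by (simp add: eps_def power_divide)
      finally show ?thesis .
    qed
    then have "exp (- (?N * (eps n (k n))\<^sup>2 / 64)) \<le> exp (- (2 * ?k + 4))" by simp
    also have "\<dots> = exp (- ?k) * exp (- ?k) * exp (- 4)" by (simp add: mult_exp_exp)
    also have "\<dots> \<le> exp (- ?k) * exp (- ?k) * (1 / 16)"
    proof -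
      have "(2 :: real) ^ 4 \<le> exp 1 ^ 4" using exp_ge_add_one_self[of 1] by (intro power_mono) auto
      then have "exp (- 4 :: real) \<le> 1 / 16" by (simp add: exp_of_nat_mult[symmetric] exp_minus field_simps)
      then show ?thesis by simp
    qed
    finally have "4 * ?k * exp (- (?N * (eps n (k n))\<^sup>2 / 64)) \<le> 4 * exp ?k * (exp (- ?k) * exp (- ?k) * (1 / 16))"
      using ek by (intro mult_mono) auto
    also have "\<dots> = exp (- ?k) / 4" by (simp add: exp_minus field_simps)
    finally have "4 * ?k * err1 n (k n) \<le> exp (- ?k) / 2" using t4 unfolding err1_def by (simp add: distrib_left)
    then show ?case using elim(4) e16 T by blast
  qed
qed

text \<open>\<open>d\<close> is the depth minus one, the number of levels that cost a factor
  \<open>r\<close>.\<close>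

lemma circuit_part:
  fixes k s :: "nat \<Rightarrow> nat" and d :: nat
  assumes k1: "\<And>n. k n \<ge> 1" and ko: "(\<lambda>n. real (k n)) \<in> o(\<lambda>n. (2 ^ n) powr (1 / 50))"
    and s: "d \<ge> 1 \<Longrightarrow> (\<lambda>n. real (s n)) \<in> o(\<lambda>n. exp ((2 ^ n) powr (1 / (4 * real d))))"
  shows "\<forall>\<^sub>F n in sequentially. \<forall>C.
     wf_circuit (num_inputs n (k n)) C \<and> circuit_depth C \<le> Suc d \<and> circuit_size C \<le> s n \<longrightarrow>
     advantage n (k n) (\<lambda>z. circuit_sign C (concat_input n z)) \<le> exp (- (1 * real (k n)))"
proof -
  define K :: real where "K = 4 * exp 3 ^ d"
  have K1: "K \<ge> 1" using one_le_power[of "exp 3 :: real" d] one_le_exp_iff[of "3 :: real"] unfolding K_def by linarith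
  \<comment> \<open>Below this threshold a block contributes at most
    \<open>exp (- 1) / (4 * K)\<close>. The square of 96 comes from the bottom level and the factor
    2 in \<open>2 / l\<close>, the power \<open>96 ^ (2 * d)\<close> from the other levels.\<close>
  define \<delta> :: real where "\<delta> = exp (- 1) / (4 * K) / (96\<^sup>2 * 96 ^ (2 * d))"
  have \<delta>: "\<delta> > 0" using K1 by (simp add: \<delta>_def)
  have sz: "\<forall>\<^sub>F n in sequentially. d \<ge> 1 \<longrightarrow> real (s n) \<le> exp ((2 ^ n) powr (1 / (4 * real d)))"
  proof (cases "d \<ge> 1")
    case True
    have "\<forall>\<^sub>F n in sequentially. norm (real (s n)) \<le> 1 * norm (exp ((2 ^ n :: real) powr (1 / (4 * real d))))"
      by (rule landau_o.smallD[OF s[OF True]]) simp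
    then show ?thesis by eventually_elim simp
  qed simp
  from sz eventually_eps_le[where k = k, OF k1 \<delta>] eventually_parameters[OF k1 ko]
  show ?thesis
  proof eventually_elim
    case (elim n)
    let ?N = "2 ^ n :: real" and ?k = "real (k n)"
    have n1: "n \<ge> 1" and e16: "eps n (k n) \<le> 1 / 16" using elim(3) by auto
    interpret gauss "2 ^ n" "eps n (k n)" "hadamard n" by (rule gauss_hadamard[OF n1 k1])
    have N1: "?N \<ge> 1" by simp
    \<comment> \<open>Rounding up makes \<open>3 ^ r\<close> dominate the allowed size and at most
      doubles a number that is at least 1; hence 48 becomes 96.\<close>
    define r where "r = (if d = 0 then 1 else nat \<lceil>?N powr (1 / (4 * real d))\<rceil>)"
    have r1: "r \<ge> 1" and rle: "real r \<le> 2 * ?N powr (1 / (4 * real d))" and rge: "d \<noteq> 0 \<Longrightarrow> ?N powr (1 / (4 * real d)) \<le> real r"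
    proof -
      have p: "?N powr (1 / (4 * real d)) \<ge> 1" using N1 by (intro ge_one_powr_ge_zero) auto
      then show "r \<ge> 1" "real r \<le> 2 * ?N powr (1 / (4 * real d))" "d \<noteq> 0 \<Longrightarrow> ?N powr (1 / (4 * real d)) \<le> real r"
        unfolding r_def by (cases "d = 0"; simp; linarith)+
    qed
    have rd: "(48 * real r) ^ (2 * d) \<le> 96 ^ (2 * d) * sqrt ?N"
    proof (cases "d = 0")
      case False
      have "(48 * real r) ^ (2 * d) \<le> (96 * ?N powr (1 / (4 * real d))) ^ (2 * d)" using rle by (intro power_mono) auto
      also have "\<dots> = 96 ^ (2 * d) * ?N powr (1 / 2)"
        using powr_realpow[of "?N powr (1 / (4 * real d))" "2 * d"] False by (simp add: power_mult_distrib powr_powr)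
      finally show ?thesis by (simp add: powr_half_sqrt)
    qed (use N1 in simp)
    \<comment> \<open>The \<open>k n\<close> blocks give the power exp(-k), and one of the factors
      \<open>1 / (4 * K)\<close> cancels the norm bound \<open>K\<close> of the circuit.\<close>
    have main: "(eps n (k n) / sqrt ?N) ^ k n * ((96 * (48 * real r) ^ d) ^ (2 * k n) * K) \<le> exp (- ?k) / 4"
    proof -
      have "(eps n (k n) / sqrt ?N) * (96 * (48 * real r) ^ d)\<^sup>2 = (eps n (k n) / sqrt ?N) * (96\<^sup>2 * (48 * real r) ^ (2 * d))"
        by (simp add: power_mult_distrib power_even_eq)
      also have "\<dots> \<le> (eps n (k n) / sqrt ?N) * (96\<^sup>2 * (96 ^ (2 * d) * sqrt ?N))"
        using e by (intro mult_left_mono rd) auto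
      also have "\<dots> = eps n (k n) * (96\<^sup>2 * 96 ^ (2 * d))" by simp
      also have "\<dots> \<le> \<delta> * (96\<^sup>2 * 96 ^ (2 * d))" using elim(2) by (intro mult_right_mono) auto
      also have "\<dots> = exp (- 1) / (4 * K)" by (simp add: \<delta>_def)
      finally have le: "(eps n (k n) / sqrt ?N) * (96 * (48 * real r) ^ d)\<^sup>2 \<le> exp (- 1) / (4 * K)" .
      have "(eps n (k n) / sqrt ?N) ^ k n * ((96 * (48 * real r) ^ d) ^ (2 * k n) * K) =
          ((eps n (k n) / sqrt ?N) * (96 * (48 * real r) ^ d)\<^sup>2) ^ k n * K"
        by (simp only: power_mult_distrib power_mult mult.assoc)
      also have "\<dots> \<le> (exp (- 1) / (4 * K)) ^ k n * K"
        using le K1 e by (intro mult_right_mono power_mono) auto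
      also have "\<dots> = exp (- ?k) * ((1 / (4 * K)) ^ k n * K)"
        by (simp add: power_divide exp_of_nat_mult[symmetric])
      also have "\<dots> \<le> exp (- ?k) * ((1 / (4 * K)) ^ 1 * K)"
        using k1[of n] K1 by (intro mult_left_mono mult_right_mono power_decreasing) auto
      also have "\<dots> = exp (- ?k) / 4" using K1 by simp
      finally show ?thesis .
    qed
    have err: "4 * (?k * err1 n (k n)) \<le> exp (- ?k) / 2" using elim(3) by (simp only: mult.assoc)
    have tt: "2 * ?k * tau * ?N ^ (2 * k n) \<le> exp (- ?k) / 4"
    proof -
      have "0 \<le> 2 * ?k * tau * ?N ^ (2 * k n)" using tau_nonneg by simp
      moreover have "4 * ?k * (tau * ?N ^ (2 * k n)) = 2 * (2 * ?k * tau * ?N ^ (2 * k n))" by simp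
      ultimately show ?thesis using elim(3) by linarith
    qed
    show ?case
    proof (intro allI impI)
      fix C assume C: "wf_circuit (num_inputs n (k n)) C \<and> circuit_depth C \<le> Suc d \<and> circuit_size C \<le> s n"
      have size: "circuit_size C \<le> 3 ^ r" if "d \<ge> 1"
      proof -
        have "real (circuit_size C) \<le> exp (?N powr (1 / (4 * real d)))" using C elim(1) that by (meson of_nat_mono order_trans)
        also have "\<dots> \<le> exp (real r)" using rge that by simp
        also have "\<dots> = exp 1 ^ r" by (simp add: exp_of_nat_mult[symmetric])
        also have "\<dots> \<le> 3 ^ r" using exp_le by (intro power_mono) auto
        finally show ?thesis by (metis of_nat_le_iff of_nat_numeral of_nat_power)
      qed
      have "exp (- ?k) < 1" using k1[of n] by simp
      then have small: "?k * err1 n (k n) < 1" using err by linarith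
      have "advantage n (k n) (\<lambda>z. circuit_sign C (concat_input n z)) \<le>
          ((eps n (k n) / sqrt ?N) ^ k n * ((96 * (48 * real r) ^ d) ^ (2 * k n) * K) + 2 * ?k * tau * ?N ^ (2 * k n)) / 2 ^ (k n - 1)
          + 4 * (?k * err1 n (k n))"
        unfolding K_def using C e16 size by (intro circuit_advantage n1 k1 small r1) auto
      also have "\<dots> \<le> (exp (- ?k) / 4 + exp (- ?k) / 4) / 2 ^ (k n - 1) + exp (- ?k) / 2"
        using main tt err by (intro add_mono divide_right_mono) auto
      also have "\<dots> \<le> (exp (- ?k) / 4 + exp (- ?k) / 4) / 1 + exp (- ?k) / 2"
        by (intro add_mono divide_left_mono order_refl) auto
      finally show "advantage n (k n) (\<lambda>z. circuit_sign C (concat_input n z)) \<le> exp (- (1 * ?k))" by simp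
    qed
  qed
qed

section \<open>Product states of query algorithms\<close>

text \<open>A basis state of \<open>T\<close> registers of dimension \<open>D\<close> is a number in
  base \<open>D\<close>. The most significant digit, number \<open>T - 1\<close>, is the query
  register, since the basis state of indices i and j has number \<open>i * w + j\<close> with
  \<open>w = D ^ (T - 1)\<close>.\<close>

definition dig :: "nat \<Rightarrow> nat \<Rightarrow> nat \<Rightarrow> nat" where "dig D s t = (s div D ^ t) mod D"

lemma dig_less: "D > 0 \<Longrightarrow> dig D s t < D" by (simp add: dig_def)

lemma dig_mod:
  assumes "t < T"
  shows "dig D (s mod D ^ T) t = dig D s t"
proof -
  have T: "D ^ T = D ^ t * D ^ (T - t)" using assms by (simp add: power_add[symmetric])
  show ?thesis
  proof (cases "D = 0")
    case False
    have "(s mod D ^ T) div D ^ t = s div D ^ t mod D ^ (T - t)"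
      unfolding T mod_mult2_eq using False by simp
    moreover have "D dvd D ^ (T - t)" using assms by (intro dvd_power) auto
    ultimately show ?thesis unfolding dig_def by (simp add: mod_mod_cancel)
  qed (use assms in \<open>simp add: dig_def power_0_left\<close>)
qed

lemma dig_top: "s < D ^ Suc T \<Longrightarrow> dig D s T = s div D ^ T"
  unfolding dig_def by (simp add: less_mult_imp_div_less mult.commute)

lemma sum_blocks:
  fixes g :: "nat \<Rightarrow> nat \<Rightarrow> real"
  assumes "B > 0"
  shows "(\<Sum>m<k * B. g (m div B) (m mod B)) = (\<Sum>j<k. \<Sum>i<B. g j i)"
proof -
  have "(\<Sum>j<k. \<Sum>i<B. g j i) = (\<Sum>(j, i)\<in>{..<k} \<times> {..<B}. g j i)"
    by (simp add: sum.cartesian_product)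
  also have "\<dots> = (\<Sum>m<k * B. g (m div B) (m mod B))"
    by (rule sum.reindex_bij_witness[of _ "\<lambda>m. (m div B, m mod B)" "\<lambda>(j, i). j * B + i"])
       (use assms block_less in \<open>auto simp: div_mod_block less_mult_imp_div_less\<close>)
  finally show ?thesis ..
qed

lemma sum_dig:
  fixes h :: "nat \<Rightarrow> nat \<Rightarrow> real"
  assumes D: "D > 0"
  shows "(\<Sum>s<D ^ T. \<Prod>t<T. h t (dig D s t)) = (\<Prod>t<T. \<Sum>a<D. h t a)"
proof (induction T)
  case (Suc T)
  have "(\<Sum>s<D ^ Suc T. \<Prod>t<Suc T. h t (dig D s t)) =
      (\<Sum>s<D * D ^ T. (\<lambda>a u. h T a * (\<Prod>t<T. h t (dig D u t))) (s div D ^ T) (s mod D ^ T))"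
    using dig_top[of _ D T] by (intro sum.cong) (auto simp: dig_mod mult.commute intro!: prod.cong)
  also have "\<dots> = (\<Sum>a<D. \<Sum>u<D ^ T. h T a * (\<Prod>t<T. h t (dig D u t)))"
    using D by (intro sum_blocks) simp
  also have "\<dots> = (\<Prod>t<Suc T. \<Sum>a<D. h t a)"
    by (simp add: sum_distrib_left[symmetric] sum_distrib_right[symmetric] Suc.IH mult.commute)
  finally show ?case .
qed simp

lemma dig_inj:
  assumes "s < D ^ T" "s' < D ^ T" "\<And>t. t < T \<Longrightarrow> dig D s t = dig D s' t"
  shows "s = s'"
  using assms
proof (induction T arbitrary: s s')
  case (Suc T)
  have D: "D > 0" using Suc.prems(1) by (cases "D = 0") auto
  have "s mod D ^ T = s' mod D ^ T"
  proof (rule Suc.IH)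
    show "dig D (s mod D ^ T) t = dig D (s' mod D ^ T) t" if "t < T" for t
      using Suc.prems(3)[of t] that by (simp add: dig_mod)
  qed (use D in auto)
  moreover have "s div D ^ T = s' div D ^ T"
    using Suc.prems(3)[of T] dig_top[OF Suc.prems(1)] dig_top[OF Suc.prems(2)] by simp
  ultimately show ?case by (metis div_mult_mod_eq)
qed simp

definition orth :: "nat \<Rightarrow> (nat \<Rightarrow> nat \<Rightarrow> real) \<Rightarrow> bool" where
  "orth D V \<longleftrightarrow> (\<forall>a<D. \<forall>b<D. (\<Sum>c<D. V a c * V b c) = of_bool (a = b))"

text \<open>Permutes the registers and then acts on each: the new register \<open>t\<close> is
  \<open>V t\<close> applied to the old register \<open>\<sigma> t\<close>. Product states stay
  product states, so the final state never has to be expanded.\<close>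

definition tens_mat :: "nat \<Rightarrow> nat \<Rightarrow> (nat \<Rightarrow> nat) \<Rightarrow> (nat \<Rightarrow> nat \<Rightarrow> nat \<Rightarrow> real) \<Rightarrow> complex mat" where
  "tens_mat D T \<sigma> V = Matrix.mat (D ^ T) (D ^ T)
     (\<lambda>(s, u). complex_of_real (\<Prod>t<T. V t (dig D s t) (dig D u (\<sigma> t))))"

definition tens_vec :: "nat \<Rightarrow> nat \<Rightarrow> (nat \<Rightarrow> nat \<Rightarrow> real) \<Rightarrow> complex Matrix.vec" where
  "tens_vec D T \<Phi> = Matrix.vec (D ^ T) (\<lambda>s. complex_of_real (\<Prod>t<T. \<Phi> t (dig D s t)))"

lemma prod_permute: "\<sigma> permutes {..<T} \<Longrightarrow> (\<Prod>t<T. g t) = (\<Prod>t<T. g (\<sigma> t))" for g :: "nat \<Rightarrow> real"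
  using prod.permute[of \<sigma> "{..<T}" g] by (simp add: o_def)

lemma sum_dig_permute:
  fixes h :: "nat \<Rightarrow> nat \<Rightarrow> real"
  assumes D: "D > 0" and \<sigma>: "\<sigma> permutes {..<T}"
  shows "(\<Sum>s<D ^ T. \<Prod>t<T. h t (dig D s (\<sigma> t))) = (\<Prod>t<T. \<Sum>a<D. h t a)"
proof -
  let ?\<tau> = "inv_into UNIV \<sigma>"
  have \<tau>: "?\<tau> permutes {..<T}" by (rule permutes_inv[OF \<sigma>])
  have "(\<Prod>t<T. h t (dig D s (\<sigma> t))) = (\<Prod>t<T. h (?\<tau> t) (dig D s t))" for s
    by (subst prod_permute[OF \<tau>]) (simp add: permutes_inverses(1)[OF \<sigma>])
  then have "(\<Sum>s<D ^ T. \<Prod>t<T. h t (dig D s (\<sigma> t))) = (\<Prod>t<T. \<Sum>a<D. h (?\<tau> t) a)"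
    using sum_dig[OF D, where h = "\<lambda>t. h (?\<tau> t)"] by simp
  then show ?thesis using prod_permute[OF \<tau>, of "\<lambda>t. \<Sum>a<D. h t a"] by simp
qed

lemma tens_mat_vec:
  assumes D: "D > 0" and \<sigma>: "\<sigma> permutes {..<T}"
  shows "tens_mat D T \<sigma> V *\<^sub>v tens_vec D T \<Phi> = tens_vec D T (\<lambda>t a. \<Sum>b<D. V t a b * \<Phi> (\<sigma> t) b)"
proof (rule eq_vecI)
  fix s assume "s < dim_vec (tens_vec D T (\<lambda>t a. \<Sum>b<D. V t a b * \<Phi> (\<sigma> t) b))"
  then have s: "s < D ^ T" by (simp add: tens_vec_def)
  have "(tens_mat D T \<sigma> V *\<^sub>v tens_vec D T \<Phi>) $ s =
      complex_of_real (\<Sum>u<D ^ T. (\<Prod>t<T. V t (dig D s t) (dig D u (\<sigma> t))) * (\<Prod>t<T. \<Phi> t (dig D u t)))"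
    using s by (simp add: tens_mat_def tens_vec_def scalar_prod_def atLeast0LessThan)
  also have "(\<Sum>u<D ^ T. (\<Prod>t<T. V t (dig D s t) (dig D u (\<sigma> t))) * (\<Prod>t<T. \<Phi> t (dig D u t))) =
      (\<Sum>u<D ^ T. \<Prod>t<T. V t (dig D s t) (dig D u (\<sigma> t)) * \<Phi> (\<sigma> t) (dig D u (\<sigma> t)))"
    by (intro sum.cong refl) (simp add: prod.distrib prod_permute[OF \<sigma>, of "\<lambda>t. \<Phi> t (dig D _ t)"])
  also have "\<dots> = (\<Prod>t<T. \<Sum>a<D. V t (dig D s t) a * \<Phi> (\<sigma> t) a)"
    by (rule sum_dig_permute[OF D \<sigma>])
  finally show "(tens_mat D T \<sigma> V *\<^sub>v tens_vec D T \<Phi>) $ s = tens_vec D T (\<lambda>t a. \<Sum>b<D. V t a b * \<Phi> (\<sigma> t) b) $ s"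
    using s by (simp add: tens_vec_def)
qed (simp add: tens_mat_def tens_vec_def)

text \<open>The inner product of two rows factorises over the digits, whatever the permutation; the
  second identity follows because the matrix is square.\<close>

lemma tens_mat_unitary:
  assumes D: "D > 0" and \<sigma>: "\<sigma> permutes {..<T}" and V: "\<And>t. t < T \<Longrightarrow> orth D (V t)"
  shows "unitary_mat (D ^ T) (tens_mat D T \<sigma> V)"
proof -
  let ?U = "tens_mat D T \<sigma> V"
  have c: "?U \<in> carrier_mat (D ^ T) (D ^ T)" by (simp add: tens_mat_def)
  have ca: "mat_adjoint ?U \<in> carrier_mat (D ^ T) (D ^ T)" by (rule carrier_matI) (use c in \<open>simp_all add: mat_adjoint_def\<close>)
  have "?U * mat_adjoint ?U = 1\<^sub>m (D ^ T)"
  proof (rule eq_matI)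
    fix s s' assume "s < dim_row (1\<^sub>m (D ^ T) :: complex mat)" "s' < dim_col (1\<^sub>m (D ^ T) :: complex mat)"
    then have s: "s < D ^ T" "s' < D ^ T" by auto
    have "(?U * mat_adjoint ?U) $$ (s, s') = (\<Sum>u<D ^ T. ?U $$ (s, u) * cnj (?U $$ (s', u)))"
      using s c ca by (simp add: mat_adjoint_def scalar_prod_def atLeast0LessThan mat_of_rows_def)
    also have "\<dots> = complex_of_real (\<Sum>u<D ^ T. \<Prod>t<T. V t (dig D s t) (dig D u (\<sigma> t)) * V t (dig D s' t) (dig D u (\<sigma> t)))"
      using s by (simp add: tens_mat_def prod.distrib)
    also have "(\<Sum>u<D ^ T. \<Prod>t<T. V t (dig D s t) (dig D u (\<sigma> t)) * V t (dig D s' t) (dig D u (\<sigma> t))) =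
        (\<Prod>t<T. \<Sum>a<D. V t (dig D s t) a * V t (dig D s' t) a)"
      by (rule sum_dig_permute[OF D \<sigma>])
    also have "\<dots> = (\<Prod>t<T. of_bool (dig D s t = dig D s' t))"
      using V dig_less[OF D] by (intro prod.cong refl) (simp add: orth_def)
    also have "\<dots> = of_bool (s = s')"
    proof (cases "s = s'")
      case False
      then obtain t where "t < T" "dig D s t \<noteq> dig D s' t" using dig_inj[OF s] by blast
      then have "(\<Prod>t<T. of_bool (dig D s t = dig D s' t) :: real) = 0" by (intro prod_zero) auto
      then show ?thesis using False by simp
    qed simp
    finally show "(?U * mat_adjoint ?U) $$ (s, s') = 1\<^sub>m (D ^ T) $$ (s, s')" using s by simp
  qed (use c ca in auto)
  moreover from mat_mult_left_right_inverse[OF c ca this] have "mat_adjoint ?U * ?U = 1\<^sub>m (D ^ T)" .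
  ultimately show ?thesis using c by (simp add: unitary_mat_def)
qed

lemma oracle_tens_vec:
  assumes T: "T \<ge> 1" and D: "D = m + 1"
  shows "oracle_mat m (D ^ (T - 1)) x *\<^sub>v tens_vec D T \<Phi> =
    tens_vec D T (\<Phi>(T - 1 := (\<lambda>a. (if a < m then x a else 1) * \<Phi> (T - 1) a)))"
proof (rule eq_vecI)
  let ?\<Phi> = "\<Phi>(T - 1 := (\<lambda>a. (if a < m then x a else 1) * \<Phi> (T - 1) a))"
  have DT: "(m + 1) * D ^ (T - 1) = D ^ T" unfolding D using T by (cases T) auto
  show "dim_vec (oracle_mat m (D ^ (T - 1)) x *\<^sub>v tens_vec D T \<Phi>) = dim_vec (tens_vec D T ?\<Phi>)"
    using DT by (simp add: oracle_mat_def tens_vec_def)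
  fix s assume "s < dim_vec (tens_vec D T ?\<Phi>)"
  then have s: "s < D ^ T" by (simp add: tens_vec_def)
  define y where "y = (if s div D ^ (T - 1) < m then complex_of_real (x (s div D ^ (T - 1))) else 1)"
  have top: "dig D s (T - 1) = s div D ^ (T - 1)" using dig_top[of s D "T - 1"] s T by simp
  have "(oracle_mat m (D ^ (T - 1)) x *\<^sub>v tens_vec D T \<Phi>) $ s =
      (\<Sum>u<D ^ T. (if s \<noteq> u then 0 else y) * tens_vec D T \<Phi> $ u)"
    unfolding oracle_mat_def y_def using s DT
    by (simp add: scalar_prod_def atLeast0LessThan tens_vec_def cong: if_cong)
  also have "\<dots> = (\<Sum>u<D ^ T. if u = s then y * tens_vec D T \<Phi> $ u else 0)"
    by (intro sum.cong) auto
  also have "\<dots> = y * tens_vec D T \<Phi> $ s" using s by simp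
  also have "\<dots> = tens_vec D T ?\<Phi> $ s"
  proof -
    have "{..<T} = insert (T - 1) {..<T - 1}" using T by auto
    then have sp: "(\<Prod>t<T. g t) = g (T - 1) * (\<Prod>t<T - 1. g t)" for g :: "nat \<Rightarrow> real" by simp
    have "(\<Prod>t<T. ?\<Phi> t (dig D s t)) = (if s div D ^ (T - 1) < m then x (s div D ^ (T - 1)) else 1) * (\<Prod>t<T. \<Phi> t (dig D s t))"
      using top unfolding sp by simp
    then show ?thesis using s by (simp add: tens_vec_def y_def del: of_real_prod fun_upd_apply)
  qed
  finally show "(oracle_mat m (D ^ (T - 1)) x *\<^sub>v tens_vec D T \<Phi>) $ s = tens_vec D T ?\<Phi> $ s" .
qed

lemma unit_vec_tens:
  assumes D: "D > 0"
  shows "unit_vec (D ^ T) 0 = tens_vec D T (\<lambda>_ a. of_bool (a = 0))"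
proof (rule eq_vecI)
  fix s assume "s < dim_vec (tens_vec D T (\<lambda>_ a. of_bool (a = 0)))"
  then have s: "s < D ^ T" by (simp add: tens_vec_def)
  have "(\<Prod>t<T. of_bool (dig D s t = 0) :: real) = of_bool (s = 0)"
  proof (cases "s = 0")
    case True
    then show ?thesis by (simp add: dig_def)
  next
    case False
    then obtain t where "t < T" "dig D s t \<noteq> dig D 0 t" using dig_inj[OF s, of 0] D by auto
    then have "(\<Prod>t<T. of_bool (dig D s t = 0) :: real) = 0" by (intro prod_zero) (auto simp: dig_def)
    then show ?thesis using False by simp
  qed
  then show "unit_vec (D ^ T) 0 $ s = tens_vec D T (\<lambda>_ a. of_bool (a = 0)) $ s"
    using s by (simp add: tens_vec_def unit_vec_def del: of_real_prod)
qed (simp add: tens_vec_def)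

text \<open>Every step queries the top register, applies \<open>A\<close> to it and rotates the registers; after
  \<open>T\<close> steps each register has been queried once.\<close>

definition rot :: "nat \<Rightarrow> nat \<Rightarrow> nat" where
  "rot T t = (if t < T then if t = 0 then T - 1 else t - 1 else t)"

lemma rot_permutes: "rot T permutes {..<T}"
proof (rule bij_imp_permutes)
  show "bij_betw (rot T) {..<T} {..<T}"
    by (rule bij_betwI[where g = "\<lambda>t. if t = T - 1 then 0 else t + 1"]) (auto simp: rot_def)
qed (simp add: rot_def)

definition idm :: "nat \<Rightarrow> nat \<Rightarrow> real" where "idm a b = of_bool (a = b)"

lemma orth_idm: "orth D idm"
  unfolding orth_def idm_def by (auto simp: of_bool_def if_distrib cong: if_cong)

text \<open>In step \<open>i\<close> the top position holds the register that started at
  \<open>T - 1 - i\<close>, whence the index of \<open>A\<close>. The rotation then puts it at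
  position 0, which is why \<open>A\<close> acts there.\<close>

definition product_alg :: "nat \<Rightarrow> nat \<Rightarrow> (nat \<Rightarrow> nat \<Rightarrow> nat \<Rightarrow> real) \<Rightarrow> (nat \<Rightarrow> nat \<Rightarrow> nat \<Rightarrow> real) \<Rightarrow> nat set \<Rightarrow> query_alg" where
  "product_alg m T P A M = \<lparr>work_dim = (m + 1) ^ (T - 1), init_op = tens_mat (m + 1) T id P,
     step_ops = map (\<lambda>i. tens_mat (m + 1) T (rot T) (\<lambda>t. if t = 0 then A (T - 1 - i) else idm)) [0..<T],
     minus_set = M\<rparr>"

lemma alg_dim_product: "T \<ge> 1 \<Longrightarrow> alg_dim m (product_alg m T P A M) = (m + 1) ^ T"
  unfolding alg_dim_def product_alg_def by (cases T) auto

lemma wf_product_alg: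
  assumes "T \<ge> 1" "\<And>t. t < T \<Longrightarrow> orth (m + 1) (P t)" "\<And>t. t < T \<Longrightarrow> orth (m + 1) (A t)"
  shows "wf_query_alg m (product_alg m T P A M)" "num_queries (product_alg m T P A M) = T"
proof -
  show "num_queries (product_alg m T P A M) = T" by (simp add: num_queries_def product_alg_def)
  have "unitary_mat ((m + 1) ^ T) (tens_mat (m + 1) T id P)"
    using assms by (intro tens_mat_unitary permutes_id) auto
  moreover have "unitary_mat ((m + 1) ^ T) (tens_mat (m + 1) T (rot T) (\<lambda>t. if t = 0 then A (T - 1 - i) else idm))" for i
    using assms orth_idm by (intro tens_mat_unitary rot_permutes) auto
  ultimately show "wf_query_alg m (product_alg m T P A M)"
    unfolding wf_query_alg_def alg_dim_product[OF assms(1)] by (auto simp: product_alg_def)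
qed

lemma tens_vec_cong: "(\<And>t a. t < T \<Longrightarrow> a < D \<Longrightarrow> \<Phi> t a = \<Psi> t a) \<Longrightarrow> D > 0 \<Longrightarrow> tens_vec D T \<Phi> = tens_vec D T \<Psi>"
  unfolding tens_vec_def using dig_less by (intro eq_vecI) (auto intro!: prod.cong)

lemma final_state_product:
  assumes T: "T \<ge> 1"
  shows "final_state m (product_alg m T P A M) x = tens_vec (m + 1) T
    (\<lambda>t a. \<Sum>b<m + 1. A t a b * ((if b < m then x b else 1) * P t b 0))"
proof -
  let ?D = "m + 1"
  have D: "?D > 0" by simp
  define fin where "fin = (\<lambda>t a. \<Sum>b<?D. A t a b * ((if b < m then x b else 1) * P t b 0))"
  \<comment> \<open>After \<open>i\<close> steps the positions below \<open>i\<close> hold finished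
    registers, the one at \<open>t\<close> being number \<open>t + T - i\<close>; a position
    \<open>t \<ge> i\<close> still holds the prepared register \<open>t - i\<close>.\<close>
  define \<Phi> where "\<Phi> = (\<lambda>i t. if t < i then fin (t + T - i) else (\<lambda>a. P (t - i) a 0))"
  define stp where "stp = (\<lambda>i. tens_mat ?D T (rot T) (\<lambda>t. if t = 0 then A (T - 1 - i) else idm))"
  have st: "foldl (\<lambda>v U. U *\<^sub>v (oracle_mat m (?D ^ (T - 1)) x *\<^sub>v v)) (tens_vec ?D T (\<Phi> 0)) (map stp [0..<i]) = tens_vec ?D T (\<Phi> i)"
    if "i \<le> T" for i
    using that
  proof (induction i)
    case (Suc i)
    then have i: "i < T" by simp
    let ?\<Phi> = "(\<Phi> i)(T - 1 := (\<lambda>a. (if a < m then x a else 1) * \<Phi> i (T - 1) a))"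
    have "foldl (\<lambda>v U. U *\<^sub>v (oracle_mat m (?D ^ (T - 1)) x *\<^sub>v v)) (tens_vec ?D T (\<Phi> 0)) (map stp [0..<Suc i]) =
        stp i *\<^sub>v (oracle_mat m (?D ^ (T - 1)) x *\<^sub>v tens_vec ?D T (\<Phi> i))"
      using Suc by simp
    also have "\<dots> = tens_vec ?D T (\<lambda>t a. \<Sum>b<?D. (if t = 0 then A (T - 1 - i) else idm) a b * ?\<Phi> (rot T t) b)"
      unfolding oracle_tens_vec[OF T refl] stp_def by (rule tens_mat_vec[OF D rot_permutes])
    also have "\<dots> = tens_vec ?D T (\<Phi> (Suc i))"
    proof (rule tens_vec_cong[OF _ D])
      fix t a assume t: "t < T" and a: "a < ?D"
      show "(\<Sum>b<?D. (if t = 0 then A (T - 1 - i) else idm) a b * ?\<Phi> (rot T t) b) = \<Phi> (Suc i) t a"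
      proof (cases "t = 0")
        case True
        have "\<not> T - 1 < i" "T - 1 - i = T - Suc i" using i by auto
        then show ?thesis using True t by (simp add: rot_def \<Phi>_def fin_def)
      next
        case False
        then have r: "rot T t = t - 1" "t - 1 \<noteq> T - 1" using t by (auto simp: rot_def)
        have "(\<Sum>b<?D. idm a b * \<Phi> i (t - 1) b) = \<Phi> i (t - 1) a"
          using a by (simp add: idm_def of_bool_def if_distrib[where f = "\<lambda>y. y * _"] cong: if_cong)
        also have "\<dots> = \<Phi> (Suc i) t a"
        proof -
          have "t - 1 < i \<longleftrightarrow> t < Suc i" "t - 1 + T - i = t + T - Suc i" "t - 1 - i = t - Suc i" using False by auto
          then show ?thesis by (simp only: \<Phi>_def)
        qed
        finally show ?thesis using False r by simp
      qed
    qed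
    finally show ?case .
  qed simp
  have "final_state m (product_alg m T P A M) x =
      foldl (\<lambda>v U. U *\<^sub>v (oracle_mat m (?D ^ (T - 1)) x *\<^sub>v v)) (tens_mat ?D T id P *\<^sub>v unit_vec (?D ^ T) 0) (map stp [0..<T])"
    unfolding final_state_def alg_dim_product[OF T] by (simp add: product_alg_def stp_def)
  also have "tens_mat ?D T id P *\<^sub>v unit_vec (?D ^ T) 0 = tens_vec ?D T (\<Phi> 0)"
    unfolding unit_vec_tens[OF D] tens_mat_vec[OF D permutes_id]
    by (intro tens_vec_cong D) (simp add: \<Phi>_def of_bool_def if_distrib cong: if_cong)
  also have "foldl (\<lambda>v U. U *\<^sub>v (oracle_mat m (?D ^ (T - 1)) x *\<^sub>v v)) (tens_vec ?D T (\<Phi> 0)) (map stp [0..<T]) = tens_vec ?D T (\<Phi> T)"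
    by (rule st) simp
  also have "\<dots> = tens_vec ?D T fin" by (intro tens_vec_cong D) (simp add: \<Phi>_def)
  finally show ?thesis unfolding fin_def .
qed

section \<open>One-query forrelation sampling\<close>

lemma sum_idm: "a < D \<Longrightarrow> (\<Sum>b<D. idm a b * f b) = f a" "a < D \<Longrightarrow> (\<Sum>b<D. f b * idm a b) = f a"
  by (simp_all add: idm_def of_bool_def if_distrib[where f = "\<lambda>y. y * _"] if_distrib[where f = "\<lambda>y. _ * y"] cong: if_cong)

text \<open>The reflection along e_0 - g exchanges the unit vectors e_0 and g, so it prepares the
  state g from basis state 0. The hypothesis \<open>g 0 \<noteq> 1\<close> makes the direction
  nonzero.\<close>

lemma householder:
  assumes g: "(\<Sum>a<D. (g a)\<^sup>2) = 1" "g 0 \<noteq> 1" and D: "D > 0"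
  shows "\<exists>V. orth D V \<and> (\<forall>a<D. V a 0 = g a)"
proof -
  define h where "h = (\<lambda>a. idm 0 a - g a)"
  define c where "c = 1 - g 0"
  define V where "V = (\<lambda>a b. idm a b - h a * h b / c)"
  have c: "c \<noteq> 0" using g(2) by (simp add: c_def)
  have h2: "(\<Sum>a<D. h a * h a) = 2 * c"
  proof -
    have "(\<Sum>a<D. h a * h a) = (\<Sum>a<D. idm 0 a * (1 - 2 * g a) + (g a)\<^sup>2)"
      by (intro sum.cong refl) (auto simp: h_def idm_def algebra_simps power2_eq_square)
    then show ?thesis using g(1) D by (simp add: sum.distrib sum_idm c_def)
  qed
  have "orth D V" unfolding orth_def
  proof (intro allI impI)
    fix a b assume ab: "a < D" "b < D"
    have "(\<Sum>i<D. V a i * V b i) = (\<Sum>i<D. idm a i * (idm b i - h b * h i / c) - idm b i * (h a * h i / c) + h a * h b / c\<^sup>2 * (h i * h i))"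
      by (intro sum.cong refl) (simp add: V_def algebra_simps power2_eq_square)
    also have "\<dots> = idm b a - h b * h a / c - h a * h b / c + h a * h b / c\<^sup>2 * (2 * c)"
      using ab by (simp only: sum.distrib sum_subtractf sum_idm sum_distrib_left[symmetric] h2)
    also have "\<dots> = of_bool (a = b)" using c by (auto simp: idm_def power2_eq_square)
    finally show "(\<Sum>i<D. V a i * V b i) = of_bool (a = b)" .
  qed
  moreover have "V a 0 = g a" for a using c by (auto simp: V_def h_def c_def idm_def)
  ultimately show ?thesis by blast
qed

definition embm :: "nat \<Rightarrow> nat \<Rightarrow> (nat \<Rightarrow> nat \<Rightarrow> real) \<Rightarrow> nat \<Rightarrow> nat \<Rightarrow> real" where
  "embm p B Q a b = (if a \<in> {p..<p + B} then if b \<in> {p..<p + B} then Q (a - p) (b - p) else 0 else idm a b)"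

lemma embm_outside: "a \<notin> {p..<p + B} \<Longrightarrow> embm p B Q a b = idm a b"
  by (simp only: embm_def if_False)

lemma sum_range:
  fixes f :: "nat \<Rightarrow> real"
  assumes "p + B \<le> D" "\<And>b. b < D \<Longrightarrow> b \<notin> {p..<p + B} \<Longrightarrow> f b = 0"
  shows "(\<Sum>b<D. f b) = (\<Sum>i<B. f (p + i))"
proof -
  have "(\<Sum>b<D. f b) = (\<Sum>b\<in>{p..<p + B}. f b)" using assms by (intro sum.mono_neutral_right) auto
  also have "\<dots> = (\<Sum>i<B. f (p + i))"
    by (rule sum.reindex_bij_witness[of _ "\<lambda>i. p + i" "\<lambda>b. b - p"]) auto
  finally show ?thesis .
qed

lemma orth_embm:
  assumes "orth B Q" "p + B \<le> D"
  shows "orth D (embm p B Q)"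
  unfolding orth_def
proof (intro allI impI)
  fix a b assume ab: "a < D" "b < D"
  let ?R = "{p..<p + B}"
  consider "a \<in> ?R" "b \<in> ?R" | "a \<notin> ?R" | "b \<notin> ?R" by blast
  then show "(\<Sum>c<D. embm p B Q a c * embm p B Q b c) = of_bool (a = b)"
  proof cases
    case 1
    have "(\<Sum>c<D. embm p B Q a c * embm p B Q b c) = (\<Sum>i<B. embm p B Q a (p + i) * embm p B Q b (p + i))"
      using 1 assms(2) by (intro sum_range) (auto simp: embm_def)
    also have "\<dots> = (\<Sum>i<B. Q (a - p) i * Q (b - p) i)" using 1 by (simp add: embm_def)
    also have "\<dots> = of_bool (a - p = b - p)" using assms(1) 1 unfolding orth_def by (auto simp del: of_bool_eq_iff)
    also have "\<dots> = of_bool (a = b)" using 1 by (auto simp: of_bool_def)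
    finally show ?thesis .
  next
    case 2
    have "(\<Sum>c<D. embm p B Q a c * embm p B Q b c) = (\<Sum>c<D. idm a c * embm p B Q b c)" unfolding embm_outside[OF 2] ..
    also have "\<dots> = embm p B Q b a" using ab by (simp only: sum_idm)
    finally show ?thesis using 2 by (auto simp: embm_def idm_def)
  next
    case 3
    have "(\<Sum>c<D. embm p B Q a c * embm p B Q b c) = (\<Sum>c<D. embm p B Q a c * idm b c)" unfolding embm_outside[OF 3] ..
    also have "\<dots> = embm p B Q a b" using ab by (simp only: sum_idm)
    finally show ?thesis using 3 by (auto simp: embm_def idm_def)
  qed
qed

text \<open>H_N applied to the second half of a block, followed by a Hadamard gate on the bit that
  selects the half: the outcome \<open>p\<close> has amplitude proportional to x + H y or x - H y at
  \<open>p mod 2 ^ n\<close>.\<close>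

definition forr_mat :: "nat \<Rightarrow> nat \<Rightarrow> nat \<Rightarrow> real" where
  "forr_mat n p q = (1 / sqrt 2) *
     (if q < 2 ^ n then idm (p mod 2 ^ n) q else (if p < 2 ^ n then 1 else - 1) * hadamard n (p mod 2 ^ n) (q - 2 ^ n))"

lemma orth_forr_mat: "orth (2 * 2 ^ n) (forr_mat n)"
  unfolding orth_def
proof (intro allI impI)
  let ?N = "2 ^ n :: nat"
  fix p q assume pq: "p < 2 * ?N" "q < 2 * ?N"
  define sp sq :: real where "sp = (if p < ?N then 1 else - 1)" and "sq = (if q < ?N then 1 else - 1)"
  let ?p = "p mod ?N" and ?q = "q mod ?N"
  have lt: "?p < ?N" "?q < ?N" by auto
  have s2: "(1 / sqrt 2) * x * ((1 / sqrt 2) * y) = x * y / 2" for x y :: real by (simp add: field_simps)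
  have "(\<Sum>c<2 * ?N. forr_mat n p c * forr_mat n q c) =
      (\<Sum>c<?N. idm ?p c * idm ?q c / 2) + (\<Sum>c<?N. sp * sq / 2 * (hadamard n ?p c * hadamard n ?q c))"
    unfolding sum_lessThan_double forr_mat_def sp_def[symmetric] sq_def[symmetric] s2
    by (intro arg_cong2[where f="(+)"] sum.cong refl) auto
  also have "\<dots> = idm ?q ?p / 2 + sp * sq / 2 * (if ?p = ?q then 1 else 0)"
    using lt by (simp only: sum_distrib_left[symmetric] hadamard_orth sum_idm sum_divide_distrib[symmetric])
  also have "\<dots> = of_bool (p = q)"
  proof (cases "?p = ?q")
    case True
    have "p = q \<longleftrightarrow> (p < ?N) = (q < ?N)"
      using True pq by (auto simp: mod_if le_mod_geq split: if_splits)
    then show ?thesis using True by (auto simp: idm_def sp_def sq_def)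
  qed (auto simp: idm_def)
  finally show "(\<Sum>c<2 * ?N. forr_mat n p c * forr_mat n q c) = of_bool (p = q)" .
qed

lemma hadamard_vec_parseval: "(\<Sum>a<2 ^ n. (hadamard_vec n y a)\<^sup>2) = (\<Sum>b<2 ^ n. (y b)\<^sup>2)"
proof -
  have "(\<Sum>a<2 ^ n. (hadamard_vec n y a)\<^sup>2) = (\<Sum>a<2 ^ n. \<Sum>b<2 ^ n. \<Sum>c<2 ^ n. y b * y c * (hadamard n b a * hadamard n c a))"
    unfolding hadamard_vec_def power2_eq_square sum_product
    by (intro sum.cong refl) (simp add: hadamard_symm[of n _ _] mult_ac)
  also have "\<dots> = (\<Sum>b<2 ^ n. \<Sum>c<2 ^ n. y b * y c * (\<Sum>a<2 ^ n. hadamard n b a * hadamard n c a))"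
    unfolding sum_distrib_left by (rule trans[OF sum.swap], rule sum.cong[OF refl], rule sum.swap)
  also have "\<dots> = (\<Sum>b<2 ^ n. \<Sum>c<2 ^ n. if c = b then y b * y c else 0)"
    by (intro sum.cong refl) (simp add: hadamard_orth)
  also have "\<dots> = (\<Sum>b<2 ^ n. (y b)\<^sup>2)" by (simp add: power2_eq_square)
  finally show ?thesis .
qed

text \<open>The amplitudes after preparing the uniform superposition of block \<open>j\<close>, one query, and the
  measurement basis change; the first half of the block is then observed with probability
  \<open>(1 + forr n (z j)) / 2\<close>.\<close>

definition amp :: "nat \<Rightarrow> (nat \<Rightarrow> nat \<Rightarrow> real) \<Rightarrow> nat \<Rightarrow> nat \<Rightarrow> nat \<Rightarrow> real" where
  "amp n z k j a = (\<Sum>b<num_inputs n k + 1. embm (j * (2 * 2 ^ n)) (2 * 2 ^ n) (forr_mat n) a b *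
     ((if b < num_inputs n k then concat_input n z b else 1) *
      (if b \<in> {j * (2 * 2 ^ n)..<j * (2 * 2 ^ n) + 2 * 2 ^ n} then 1 / sqrt (2 * 2 ^ n) else 0)))"

text \<open>The measured half as a sign, of mean \<open>forr\<close>. Indices outside the block get
  -1, but they have amplitude 0.\<close>

definition half_sign :: "nat \<Rightarrow> nat \<Rightarrow> nat \<Rightarrow> real" where
  "half_sign n j a = (if a \<in> {j * (2 * 2 ^ n)..<j * (2 * 2 ^ n) + 2 ^ n} then 1 else - 1)"

text \<open>On the first half the squared amplitudes are (x_a + (H y)_a)^2 / (4N). Both vectors have
  squared length N and their inner product is N forr, which gives (1 + forr)/2. A general
  \<open>E\<close> serves normalisation, the bound on \<open>forr\<close> and the generating
  function of the vote alike.\<close>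

lemma amp_distribution:
  fixes E :: "real \<Rightarrow> real"
  assumes j: "j < k" and z: "z j \<in> sign_cube (2 * 2 ^ n)"
  shows "(\<Sum>a<num_inputs n k + 1. (amp n z k j a)\<^sup>2 * E (half_sign n j a)) =
    (1 + forr n (z j)) / 2 * E 1 + (1 - forr n (z j)) / 2 * E (- 1)"
proof -
  let ?N = "2 ^ n :: nat"
  define B where "B = 2 * ?N"
  define p where "p = j * B"
  define D where "D = num_inputs n k + 1"
  have pD: "p + B \<le> num_inputs n k"
  proof -
    have "(j + 1) * B \<le> k * B" using j by (intro mult_le_mono1) simp
    then show ?thesis by (simp add: p_def B_def num_inputs_def)
  qed
  let ?R = "{p..<p + B}"
  define x where "x = z j"
  define w where "w = hadamard_vec n (\<lambda>b. x (?N + b))"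
  have amp_R: "amp n z k j (p + q) = (1 / sqrt (real B)) * (\<Sum>i<B. forr_mat n q i * x i)" if q: "q < B" for q
  proof -
    have "amp n z k j (p + q) = (\<Sum>i<B. embm p B (forr_mat n) (p + q) (p + i) *
       ((if p + i < num_inputs n k then concat_input n z (p + i) else 1) * (if p + i \<in> ?R then 1 / sqrt (real B) else 0)))"
    proof -
      have "sqrt (real B) = sqrt (2 * 2 ^ n)" by (simp add: B_def)
      then show ?thesis unfolding amp_def B_def[symmetric] p_def[symmetric] using pD by (subst sum_range[of p B]) auto
    qed
    also have "\<dots> = (\<Sum>i<B. (1 / sqrt (real B)) * (forr_mat n q i * x i))"
    proof (intro sum.cong refl)
      fix i assume i: "i \<in> {..<B}"
      have "concat_input n z (p + i) = x i"
        using div_mod_block[of i B j] i unfolding concat_input_def B_def[symmetric] p_def x_def by simp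
      moreover have "p + i < num_inputs n k" using pD i by simp
      ultimately show "embm p B (forr_mat n) (p + q) (p + i) *
         ((if p + i < num_inputs n k then concat_input n z (p + i) else 1) * (if p + i \<in> ?R then 1 / sqrt (real B) else 0))
         = (1 / sqrt (real B)) * (forr_mat n q i * x i)"
        using i q by (simp add: embm_def)
    qed
    finally show ?thesis by (simp only: sum_distrib_left)
  qed
  have fm: "(\<Sum>i<B. forr_mat n q i * x i) = (1 / sqrt 2) * (x (q mod ?N) + (if q < ?N then 1 else - 1) * w (q mod ?N))" for q
  proof -
    let ?s = "if q < ?N then 1 else - 1 :: real"
    have "(\<Sum>i<B. forr_mat n q i * x i) = (\<Sum>i<?N. (1 / sqrt 2) * (idm (q mod ?N) i * x i)) +
        (\<Sum>b<?N. (1 / sqrt 2) * (?s * (hadamard n (q mod ?N) b * x (?N + b))))"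
      unfolding B_def sum_lessThan_double
      by (intro arg_cong2[where f="(+)"] sum.cong refl) (simp_all add: forr_mat_def mult.assoc)
    also have "\<dots> = (1 / sqrt 2) * x (q mod ?N) + (1 / sqrt 2) * (?s * w (q mod ?N))"
      by (simp only: sum_distrib_left[symmetric] w_def hadamard_vec_def) (simp add: sum_idm)
    finally show ?thesis by (simp only: distrib_left)
  qed
  have sq: "(amp n z k j (p + q))\<^sup>2 = (x (q mod ?N) + (if q < ?N then 1 else - 1) * w (q mod ?N))\<^sup>2 / (4 * 2 ^ n)" if "q < B" for q
    unfolding amp_R[OF that] fm by (simp add: power_mult_distrib power_divide B_def)
  have out: "amp n z k j a = 0" if "a < D" "a \<notin> ?R" for a
  proof -
    have "amp n z k j a = (\<Sum>b<D. idm a b * ((if b < num_inputs n k then concat_input n z b else 1) * (if b \<in> ?R then 1 / sqrt (2 * 2 ^ n) else 0)))"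
      unfolding amp_def B_def[symmetric] p_def[symmetric] D_def[symmetric] embm_outside[OF that(2)] ..
    also have "\<dots> = 0" using that by (simp only: sum_idm) simp
    finally show ?thesis .
  qed
  have xs: "(x a)\<^sup>2 = 1" if "a < 2 * ?N" for a
    using z that by (auto simp: x_def sign_cube_iff)
  have x2: "(\<Sum>a<?N. (x a)\<^sup>2) = 2 ^ n" using xs by simp
  have w2: "(\<Sum>a<?N. (w a)\<^sup>2) = 2 ^ n" unfolding w_def hadamard_vec_parseval using xs by simp
  have xw: "(\<Sum>a<?N. x a * w a) = 2 ^ n * forr n x" unfolding forr_def w_def by simp
  have half: "(\<Sum>a<?N. (x a + s * w a)\<^sup>2 / (4 * 2 ^ n)) = (1 + s * forr n x) / 2" if "s\<^sup>2 = 1" for s :: real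
  proof -
    have "(\<Sum>a<?N. (x a + s * w a)\<^sup>2) = (\<Sum>a<?N. (x a)\<^sup>2 + s\<^sup>2 * (w a)\<^sup>2 + 2 * s * (x a * w a))"
      by (intro sum.cong refl) (simp add: power2_eq_square algebra_simps)
    also have "\<dots> = 2 ^ n + s\<^sup>2 * 2 ^ n + 2 * s * (2 ^ n * forr n x)"
      by (simp only: sum.distrib sum_distrib_left[symmetric] x2 w2 xw)
    finally show ?thesis by (simp only: sum_divide_distrib[symmetric] that) (simp add: field_simps)
  qed
  have hs: "half_sign n j (p + q) = (if q < ?N then 1 else - 1)" for q
    by (simp add: half_sign_def p_def B_def)
  have "(\<Sum>a<D. (amp n z k j a)\<^sup>2 * E (half_sign n j a)) = (\<Sum>q<B. (amp n z k j (p + q))\<^sup>2 * E (half_sign n j (p + q)))"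
    using pD out by (intro sum_range) (auto simp: D_def)
  also have "\<dots> = (\<Sum>q<?N. (x q + 1 * w q)\<^sup>2 / (4 * 2 ^ n) * E 1) + (\<Sum>q<?N. (x q + (- 1) * w q)\<^sup>2 / (4 * 2 ^ n) * E (- 1))"
  proof -
    have "(\<Sum>q<B. (amp n z k j (p + q))\<^sup>2 * E (half_sign n j (p + q))) =
       (\<Sum>q<B. (x (q mod ?N) + (if q < ?N then 1 else - 1) * w (q mod ?N))\<^sup>2 / (4 * 2 ^ n) * E (if q < ?N then 1 else - 1))"
      by (intro sum.cong refl) (simp only: sq hs lessThan_iff)
    also have "\<dots> = (\<Sum>q<?N. (x q + 1 * w q)\<^sup>2 / (4 * 2 ^ n) * E 1) + (\<Sum>q<?N. (x q + (- 1) * w q)\<^sup>2 / (4 * 2 ^ n) * E (- 1))"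
      unfolding B_def sum_lessThan_double by (intro arg_cong2[where f="(+)"] sum.cong refl) auto
    finally show ?thesis .
  qed
  also have "\<dots> = (1 + 1 * forr n x) / 2 * E 1 + (1 + (- 1) * forr n x) / 2 * E (- 1)"
    by (subst half[symmetric], simp, subst half[symmetric], simp, simp only: sum_distrib_right)
  finally show ?thesis unfolding D_def x_def by simp
qed

text \<open>(1 + forr)/2 and (1 - forr)/2 are probabilities of the measurement, here for a single
  block.\<close>

lemma forr_abs_le_1:
  assumes "u \<in> sign_cube (2 * 2 ^ n)"
  shows "\<bar>forr n u\<bar> \<le> 1"
proof -
  have d: "(\<Sum>a<num_inputs n 1 + 1. (amp n (\<lambda>_. u) 1 0 a)\<^sup>2 * E (half_sign n 0 a)) =
    (1 + forr n u) / 2 * E 1 + (1 - forr n u) / 2 * E (- 1)" for E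
    using amp_distribution[of 0 1 "\<lambda>_. u" n E] assms by simp
  have "0 \<le> (1 + forr n u) / 2 * of_bool ((1::real) = 1) + (1 - forr n u) / 2 * of_bool ((- 1::real) = 1)"
    unfolding d[of "\<lambda>t. of_bool (t = 1)", symmetric] by (intro sum_nonneg) auto
  moreover have "0 \<le> (1 + forr n u) / 2 * of_bool ((1::real) = - 1) + (1 - forr n u) / 2 * of_bool ((- 1::real) = - 1)"
    unfolding d[of "\<lambda>t. of_bool (t = - 1)", symmetric] by (intro sum_nonneg) auto
  ultimately show ?thesis by simp
qed

section \<open>Amplification and parity\<close>

definition vote :: "nat \<Rightarrow> nat \<Rightarrow> nat \<Rightarrow> nat \<Rightarrow> nat \<Rightarrow> real" where
  "vote n k r j s = (\<Sum>i<r. half_sign n j (dig (num_inputs n k + 1) s (j * r + i)))"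

text \<open>The threshold per run is the midpoint of the two promised values eps/4 and eps/2 of the
  bias.\<close>

definition guess :: "nat \<Rightarrow> nat \<Rightarrow> nat \<Rightarrow> nat \<Rightarrow> nat \<Rightarrow> real" where
  "guess n k r j s = (if vote n k r j s \<ge> 3 / 8 * eps n k * real r then - 1 else 1)"

definition weight :: "nat \<Rightarrow> nat \<Rightarrow> nat \<Rightarrow> (nat \<Rightarrow> nat \<Rightarrow> real) \<Rightarrow> nat \<Rightarrow> real" where
  "weight n k r z s = (\<Prod>t<k * r. (amp n z k (t div r) (dig (num_inputs n k + 1) s t))\<^sup>2)"

lemma weight_nonneg: "weight n k r z s \<ge> 0"
  unfolding weight_def by (intro prod_nonneg) simp

text \<open>The measured digits are independent: registers of other blocks sum to 1, and each of the
  \<open>r\<close> registers of block \<open>j\<close> gives the generating function of a sign of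
  mean \<open>forr n (z j)\<close>.\<close>

lemma sum_weight_exp_vote:
  assumes r: "r \<ge> 1" and z: "\<And>j. j < k \<Longrightarrow> z j \<in> sign_cube (2 * 2 ^ n)" and j: "j < k"
  shows "(\<Sum>s<(num_inputs n k + 1) ^ (k * r). weight n k r z s * exp (h * vote n k r j s)) \<le>
    exp (real r * (forr n (z j) * h + h\<^sup>2 / 2))"
proof -
  define D where "D = num_inputs n k + 1"
  have D: "D > 0" by (simp add: D_def)
  have r0: "r > 0" using r by simp
  let ?e = "\<lambda>j' a. if j' = j then exp (h * half_sign n j a) else 1"
  let ?g = "\<lambda>j' a. (amp n z k j' a)\<^sup>2 * ?e j' a"
  have dm: "(j' * r + i) div r = j'" if "i < r" for j' i using that by simp
  have ev: "exp (h * vote n k r j s) = (\<Prod>t<k * r. ?e (t div r) (dig D s t))" for s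
  proof -
    have "(\<Prod>t<k * r. ?e (t div r) (dig D s t)) =
        (\<Prod>t<k * r. (\<lambda>j' i. ?e j' (dig D s (j' * r + i))) (t div r) (t mod r))"
      by (intro prod.cong refl) (simp only: div_mult_mod_eq)
    also have "\<dots> = (\<Prod>j'<k. \<Prod>i<r. ?e j' (dig D s (j' * r + i)))" by (rule prod_blocks[OF r0, symmetric])
    also have "\<dots> = (\<Prod>j'<k. if j' = j then \<Prod>i<r. exp (h * half_sign n j (dig D s (j * r + i))) else 1)"
      by (intro prod.cong refl) auto
    also have "\<dots> = (\<Prod>i<r. exp (h * half_sign n j (dig D s (j * r + i))))" using j by simp
    finally show ?thesis by (simp only: vote_def D_def[symmetric] sum_distrib_left exp_sum[OF finite_lessThan])
  qed
  have "(\<Sum>s<D ^ (k * r). weight n k r z s * exp (h * vote n k r j s)) =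
      (\<Sum>s<D ^ (k * r). \<Prod>t<k * r. ?g (t div r) (dig D s t))"
    unfolding ev weight_def D_def[symmetric] prod.distrib ..
  also have "\<dots> = (\<Prod>t<k * r. \<Sum>a<D. ?g (t div r) a)" by (rule sum_dig[OF D])
  also have "\<dots> = (\<Prod>j'<k. \<Prod>i<r. \<Sum>a<D. ?g j' a)"
    using prod_blocks[OF r0, of "\<lambda>j' i. \<Sum>a<D. ?g j' a" k] by simp
  also have "\<dots> = (\<Prod>j'<k. if j' = j then ((1 + forr n (z j)) / 2 * exp h + (1 - forr n (z j)) / 2 * exp (- h)) ^ r else 1)"
  proof (intro prod.cong refl)
    fix j' assume j': "j' \<in> {..<k}"
    then have d: "(\<Sum>a<D. (amp n z k j' a)\<^sup>2 * E (half_sign n j' a)) = (1 + forr n (z j')) / 2 * E 1 + (1 - forr n (z j')) / 2 * E (- 1)" for E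
      unfolding D_def using z by (intro amp_distribution) auto
    show "(\<Prod>i<r. \<Sum>a<D. ?g j' a) = (if j' = j then ((1 + forr n (z j)) / 2 * exp h + (1 - forr n (z j)) / 2 * exp (- h)) ^ r else 1)"
    proof (cases "j' = j")
      case True
      then show ?thesis using d[of "\<lambda>t. exp (h * t)"] by simp
    next
      case False
      have "(1 + forr n (z j')) / 2 * 1 + (1 - forr n (z j')) / 2 * 1 = 1" by (simp add: field_simps)
      then show ?thesis using False d[of "\<lambda>_. 1"] by simp
    qed
  qed
  also have "\<dots> = ((1 - forr n (z j)) / 2 * exp (- h) + (1 + forr n (z j)) / 2 * exp h) ^ r" using j by (simp add: add.commute)
  also have "\<dots> \<le> exp (forr n (z j) * h + h\<^sup>2 / 2) ^ r"
  proof (intro power_mono two_point_mgf forr_abs_le_1 z j)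
    have "\<bar>forr n (z j)\<bar> \<le> 1" by (intro forr_abs_le_1 z j)
    then show "0 \<le> (1 - forr n (z j)) / 2 * exp (- h) + (1 + forr n (z j)) / 2 * exp h"
      by (intro add_nonneg_nonneg mult_nonneg_nonneg) auto
  qed
  also have "\<dots> = exp (real r * (forr n (z j) * h + h\<^sup>2 / 2))" by (simp only: exp_of_nat_mult)
  finally show ?thesis unfolding D_def .
qed

lemma sum_weight:
  assumes r: "r \<ge> 1" and k: "k \<ge> 1" and z: "\<And>j. j < k \<Longrightarrow> z j \<in> sign_cube (2 * 2 ^ n)"
  shows "(\<Sum>s<(num_inputs n k + 1) ^ (k * r). weight n k r z s) = 1"
proof -
  define D where "D = num_inputs n k + 1"
  have "(\<Sum>s<D ^ (k * r). weight n k r z s) = (\<Prod>t<k * r. \<Sum>a<D. (amp n z k (t div r) a)\<^sup>2)"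
    unfolding weight_def D_def[symmetric] by (rule sum_dig) (simp add: D_def)
  also have "\<dots> = (\<Prod>t<k * r. 1)"
  proof (intro prod.cong refl)
    fix t assume "t \<in> {..<k * r}"
    then have "t div r < k" by (simp add: less_mult_imp_div_less)
    then show "(\<Sum>a<D. (amp n z k (t div r) a)\<^sup>2) = 1"
      using amp_distribution[of "t div r" k z n "\<lambda>_. 1"] z unfolding D_def by (simp add: field_simps)
  qed
  finally show ?thesis by (simp add: D_def)
qed

lemma sum_weight_wrong:
  assumes r: "r \<ge> 1" and e: "eps n k > 0" and z: "\<And>j. j < k \<Longrightarrow> z j \<in> sign_cube (2 * 2 ^ n)" and j: "j < k"
    and c: "forr_fun n k (z j) = Some c"
  shows "(\<Sum>s<(num_inputs n k + 1) ^ (k * r). of_bool (guess n k r j s \<noteq> c) * weight n k r z s) \<le> exp (- (real r * (eps n k)\<^sup>2 / 128))"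
proof -
  define \<theta> where "\<theta> = 3 / 8 * eps n k * real r"
  let ?v = "vote n k r j" and ?f = "forr n (z j)" and ?e = "eps n k"
  let ?S = "{..<(num_inputs n k + 1) ^ (k * r)}"
  \<comment> \<open>The Chernoff exponent, signed towards the wrong side. The bias is at least eps/8
    away from the threshold, and |h| = eps/8 minimises h^2/2 - |h| eps/8.\<close>
  obtain h where h: "h\<^sup>2 = (?e / 8)\<^sup>2" "\<And>s. guess n k r j s \<noteq> c \<Longrightarrow> 0 \<le> h * (?v s - \<theta>)"
     "?f * h - 3 / 8 * ?e * h \<le> - (?e\<^sup>2 / 64)"
  proof (cases "?f \<ge> ?e / 2")
    case True
    then have c: "c = - 1" using c by (simp add: forr_fun_def)
    show ?thesis
    proof (rule that[of "- ?e / 8"])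
      show "0 \<le> - ?e / 8 * (?v s - \<theta>)" if "guess n k r j s \<noteq> c" for s
        using that e unfolding c guess_def \<theta>_def[symmetric] by (auto simp: mult_le_0_iff split: if_splits)
      have "?f * (- ?e / 8) \<le> ?e / 2 * (- ?e / 8)" using True e by (intro mult_right_mono_neg) auto
      then show "?f * (- ?e / 8) - 3 / 8 * ?e * (- ?e / 8) \<le> - (?e\<^sup>2 / 64)" by (simp add: power2_eq_square)
    qed (simp add: power2_eq_square)
  next
    case False
    then have c: "c = 1" "?f \<le> ?e / 4" using c by (auto simp: forr_fun_def split: if_splits)
    show ?thesis
    proof (rule that[of "?e / 8"])
      show "0 \<le> ?e / 8 * (?v s - \<theta>)" if "guess n k r j s \<noteq> c" for s
        using that e unfolding c guess_def \<theta>_def[symmetric] by (auto split: if_splits)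
      have "?f * (?e / 8) \<le> ?e / 4 * (?e / 8)" using c(2) e by (intro mult_right_mono) auto
      moreover have "?e / 4 * (?e / 8) - 3 / 8 * ?e * (?e / 8) = - (?e\<^sup>2 / 64)" by (simp add: power2_eq_square)
      ultimately show "?f * (?e / 8) - 3 / 8 * ?e * (?e / 8) \<le> - (?e\<^sup>2 / 64)" by linarith
    qed simp
  qed
  have "(\<Sum>s\<in>?S. of_bool (guess n k r j s \<noteq> c) * weight n k r z s) \<le> (\<Sum>s\<in>?S. exp (- (h * \<theta>)) * (weight n k r z s * exp (h * ?v s)))"
  proof (intro sum_mono)
    fix s
    have "of_bool (guess n k r j s \<noteq> c) \<le> exp (h * (?v s - \<theta>))" using h(2)[of s] by simp
    then have "of_bool (guess n k r j s \<noteq> c) * weight n k r z s \<le> exp (h * (?v s - \<theta>)) * weight n k r z s"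
      by (intro mult_right_mono weight_nonneg)
    also have "exp (h * (?v s - \<theta>)) = exp (- (h * \<theta>)) * exp (h * ?v s)" by (simp add: mult_exp_exp algebra_simps)
    finally show "of_bool (guess n k r j s \<noteq> c) * weight n k r z s \<le> exp (- (h * \<theta>)) * (weight n k r z s * exp (h * ?v s))"
      by (simp only: mult_ac)
  qed
  also have "\<dots> \<le> exp (- (h * \<theta>)) * exp (real r * (?f * h + h\<^sup>2 / 2))"
    unfolding sum_distrib_left[symmetric] by (intro mult_left_mono sum_weight_exp_vote r z j) auto
  also have "\<dots> = exp (real r * (?f * h - 3 / 8 * ?e * h + h\<^sup>2 / 2))" by (simp add: mult_exp_exp \<theta>_def algebra_simps)
  also have "\<dots> \<le> exp (- (real r * ?e\<^sup>2 / 128))"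
  proof -
    have "h\<^sup>2 / 2 = ?e\<^sup>2 / 128" unfolding h(1) by (simp add: power2_eq_square)
    then have "?f * h - 3 / 8 * ?e * h + h\<^sup>2 / 2 \<le> - (?e\<^sup>2 / 128)" using h(3) by linarith
    then have "real r * (?f * h - 3 / 8 * ?e * h + h\<^sup>2 / 2) \<le> real r * (- (?e\<^sup>2 / 128))" by (intro mult_left_mono) auto
    then show ?thesis by simp
  qed
  finally show ?thesis .
qed

text \<open>All \<open>k * r\<close> runs use separate registers, each queried once. The product of
  the guesses is right unless some block is misjudged, and the assumption on \<open>r\<close> bounds
  each of these \<open>k\<close> events by 1/(3k).\<close>

lemma forr_algorithm:
  assumes n: "n \<ge> 1" and k: "k \<ge> 1" and r: "real r * (eps n k)\<^sup>2 / 128 \<ge> ln (3 * real k)" "r \<ge> 1"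
  shows "\<exists>A. wf_query_alg (num_inputs n k) A \<and> num_queries A = k * r \<and>
    (\<forall>z. (\<forall>j<k. z j \<in> sign_cube (2 * 2 ^ n)) \<longrightarrow>
       output_prob (num_inputs n k) A (concat_input n z) 1 + output_prob (num_inputs n k) A (concat_input n z) (- 1) = 1 \<and>
       (\<forall>b. forr_xor n k z = Some b \<longrightarrow> output_prob (num_inputs n k) A (concat_input n z) b \<ge> 2 / 3))"
proof -
  define m where "m = num_inputs n k"
  define D where "D = m + 1"
  define T where "T = k * r"
  define B where "B = (2 * 2 ^ n :: nat)"
  have T: "T \<ge> 1" using k r(2) by (simp add: T_def)
  have D: "D > 0" by (simp add: D_def)
  have jm: "j * B + B \<le> m" if "j < k" for j
  proof -
    have "(j + 1) * B \<le> k * B" using that by (intro mult_le_mono1) simp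
    then show ?thesis by (simp add: m_def B_def num_inputs_def)
  qed
  let ?g = "\<lambda>j b. if b \<in> {j * B..<j * B + B} then 1 / sqrt (2 * 2 ^ n) else 0"
  have "\<forall>j\<in>{..<k}. \<exists>V. orth D V \<and> (\<forall>a<D. V a 0 = ?g j a)"
  proof
    fix j assume "j \<in> {..<k}"
    then have le: "j * B + B \<le> D" using jm[of j] by (simp add: D_def)
    have "(\<Sum>a<D. (?g j a)\<^sup>2) = (\<Sum>i<B. (?g j (j * B + i))\<^sup>2)" using le by (intro sum_range) auto
    also have "\<dots> = (\<Sum>i<B. 1 / (2 * 2 ^ n))" by (intro sum.cong refl) (auto simp: power_divide)
    also have "\<dots> = 1" by (simp add: B_def)
    finally have "(\<Sum>a<D. (?g j a)\<^sup>2) = 1" .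
    moreover have "?g j 0 \<noteq> 1"
    proof -
      have "(2 :: real) * 2 ^ n \<noteq> 1" using one_le_power[of "2 :: real" n] by linarith
      then have "1 / sqrt (2 * 2 ^ n) \<noteq> (1 :: real)" by simp
      then show ?thesis by (simp only: split: if_splits) simp
    qed
    ultimately show "\<exists>V. orth D V \<and> (\<forall>a<D. V a 0 = ?g j a)" by (rule householder[OF _ _ D])
  qed
  from bchoice[OF this] obtain P where P0: "\<forall>j\<in>{..<k}. orth D (P j) \<and> (\<forall>a<D. P j a 0 = ?g j a)" ..
  have P: "orth D (P j)" "\<And>a. a < D \<Longrightarrow> P j a 0 = ?g j a" if "j < k" for j
    using bspec[OF P0, of j] that by (simp_all only: lessThan_iff)
  define G where "G = (\<lambda>s. \<Prod>j<k. guess n k r j s)"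
  have pm: "G s = 1 \<or> G s = - 1" for s
  proof -
    have "(\<Prod>j<i. guess n k r j s) = 1 \<or> (\<Prod>j<i. guess n k r j s) = - 1" for i
      by (induction i) (auto simp: guess_def)
    then show ?thesis unfolding G_def .
  qed
  define M where "M = {s. G s = - 1}"
  define A where "A = product_alg m T (\<lambda>t. P (t div r)) (\<lambda>t. embm ((t div r) * B) B (forr_mat n)) M"
  have tk: "t div r < k" if "t < T" for t using that by (simp add: T_def less_mult_imp_div_less)
  have oP: "orth (m + 1) (P (t div r))" if "t < T" for t
    using P(1)[OF tk[OF that]] by (simp only: D_def)
  have oA: "orth (m + 1) (embm (t div r * B) B (forr_mat n))" if "t < T" for t
    using orth_forr_mat[of n] jm[OF tk[OF that]] unfolding B_def by (intro orth_embm) auto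
  have wf: "wf_query_alg m A" "num_queries A = T"
    unfolding A_def by (rule wf_product_alg[OF T oP oA]; assumption)+
  have out: "output_prob m A (concat_input n z) b = (\<Sum>s<D ^ T. of_bool (G s = b) * weight n k r z s)" 
    if b: "b = 1 \<or> b = - 1" for z b
  proof -
    have fs: "final_state m A (concat_input n z) = tens_vec D T (\<lambda>t a. amp n z k (t div r) a)"
      unfolding A_def final_state_product[OF T] D_def[symmetric]
    proof (intro tens_vec_cong D)
      fix t a assume t: "t < T"
      show "(\<Sum>b<D. embm (t div r * B) B (forr_mat n) a b * ((if b < m then concat_input n z b else 1) * P (t div r) b 0)) = amp n z k (t div r) a"
        unfolding amp_def m_def[symmetric] D_def[symmetric] B_def[symmetric]
        using P(2)[OF tk[OF t]] by (intro sum.cong refl) simp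
    qed
    have w: "(cmod (final_state m A (concat_input n z) $ s))\<^sup>2 = weight n k r z s" if "s < D ^ T" for s
      unfolding fs weight_def using that
      by (simp add: tens_vec_def prod_power_distrib m_def[symmetric] D_def T_def[symmetric] del: of_real_prod)
    have sg: "(if s \<in> minus_set A then - 1 else 1) = b \<longleftrightarrow> G s = b" for s
      using pm[of s] b by (auto simp: A_def product_alg_def M_def)
    have "output_prob m A (concat_input n z) b = (\<Sum>s | s < D ^ T \<and> G s = b. weight n k r z s)"
      unfolding output_prob_def sg alg_dim_product[OF T, of m, folded A_def D_def]
    proof (intro sum.cong)
      show "{s. s < alg_dim m A \<and> G s = b} = {s. s < D ^ T \<and> G s = b}"
        using alg_dim_product[OF T] by (simp add: A_def D_def)
    qed (use w in auto)
    also have "\<dots> = (\<Sum>s\<in>{..<D ^ T} \<inter> {s. G s = b}. weight n k r z s)"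
      by (intro sum.cong) auto
    also have "\<dots> = (\<Sum>s<D ^ T. if s \<in> {s. G s = b} then weight n k r z s else 0)"
      by (rule sum.inter_restrict) simp
    also have "\<dots> = (\<Sum>s<D ^ T. of_bool (G s = b) * weight n k r z s)"
      by (intro sum.cong refl) simp
    finally show ?thesis .
  qed
  have sw: "(\<Sum>s<D ^ T. weight n k r z s) = 1" if "\<And>j. j < k \<Longrightarrow> z j \<in> sign_cube (2 * 2 ^ n)" for z
    unfolding D_def m_def T_def by (rule sum_weight[OF r(2) k that])
  have tot: "output_prob m A (concat_input n z) 1 + output_prob m A (concat_input n z) (- 1) = 1"
    if z: "\<And>j. j < k \<Longrightarrow> z j \<in> sign_cube (2 * 2 ^ n)" for z
  proof -
    have "output_prob m A (concat_input n z) 1 + output_prob m A (concat_input n z) (- 1) = (\<Sum>s<D ^ T. weight n k r z s)"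
      unfolding out[OF disjI1[OF refl]] out[OF disjI2[OF refl]] sum.distrib[symmetric]
    proof (intro sum.cong refl)
      fix s
      show "of_bool (G s = 1) * weight n k r z s + of_bool (G s = - 1) * weight n k r z s = weight n k r z s"
        using pm[of s] by (elim disjE) simp_all
    qed
    then show ?thesis using sw[OF z] by simp
  qed
  have big: "output_prob m A (concat_input n z) b \<ge> 2 / 3"
    if z: "\<And>j. j < k \<Longrightarrow> z j \<in> sign_cube (2 * 2 ^ n)" and xb: "forr_xor n k z = Some b" for z b
  proof -
    have nn: "forr_fun n k (z j) \<noteq> None" if "j < k" for j using xb that by (auto simp: forr_xor_def split: if_splits)
    define c where "c = (\<lambda>j. the (forr_fun n k (z j)))"
    have c: "forr_fun n k (z j) = Some (c j)" if "j < k" for j using nn[OF that] by (simp add: c_def)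
    then have bc: "b = (\<Prod>j<k. c j)" using xb by (auto simp: forr_xor_def split: if_splits intro!: prod.cong)
    have cpm: "c j = 1 \<or> c j = - 1" if "j < k" for j using c[OF that] by (auto simp: forr_fun_def split: if_splits)
    have "(\<Prod>j<i. c j) = 1 \<or> (\<Prod>j<i. c j) = - 1" if "i \<le> k" for i
      using that
    proof (induction i)
      case (Suc i)
      then show ?case using cpm[of i] by auto
    qed simp
    then have b: "b = 1 \<or> b = - 1" using bc by blast
    have "1 - output_prob m A (concat_input n z) b = (\<Sum>s<D ^ T. of_bool (G s \<noteq> b) * weight n k r z s)"
    proof -
      have "1 - output_prob m A (concat_input n z) b =
          (\<Sum>s<D ^ T. weight n k r z s - of_bool (G s = b) * weight n k r z s)"
        by (simp only: sum_subtractf out[OF b] sw[OF z])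
      also have "\<dots> = (\<Sum>s<D ^ T. of_bool (G s \<noteq> b) * weight n k r z s)" by (intro sum.cong refl) simp
      finally show ?thesis .
    qed
    also have "\<dots> \<le> (\<Sum>s<D ^ T. \<Sum>j<k. of_bool (guess n k r j s \<noteq> c j) * weight n k r z s)"
    proof (intro sum_mono)
      fix s
      have nn: "0 \<le> (\<Sum>j<k. of_bool (guess n k r j s \<noteq> c j) * weight n k r z s)"
        by (intro sum_nonneg mult_nonneg_nonneg weight_nonneg) auto
      show "of_bool (G s \<noteq> b) * weight n k r z s \<le> (\<Sum>j<k. of_bool (guess n k r j s \<noteq> c j) * weight n k r z s)"
      proof (cases "G s = b")
        case False
        have "\<exists>i<k. guess n k r i s \<noteq> c i"
        proof (rule ccontr)
          assume "\<not> (\<exists>i<k. guess n k r i s \<noteq> c i)"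
          then have "G s = b" unfolding bc G_def by (intro prod.cong) auto
          then show False using False by simp
        qed
        then obtain i where i: "i < k" "guess n k r i s \<noteq> c i" by blast
        have "of_bool (guess n k r i s \<noteq> c i) * weight n k r z s \<le> (\<Sum>j<k. of_bool (guess n k r j s \<noteq> c j) * weight n k r z s)"
          using i(1) by (intro member_le_sum mult_nonneg_nonneg weight_nonneg) auto
        then show ?thesis using False i(2) by simp
      qed (use nn in simp)
    qed
    also have "\<dots> = (\<Sum>j<k. \<Sum>s<D ^ T. of_bool (guess n k r j s \<noteq> c j) * weight n k r z s)" by (rule sum.swap)
    also have "\<dots> \<le> (\<Sum>j<k. 1 / (3 * real k))"
    proof (intro sum_mono)
      fix j assume "j \<in> {..<k}"
      then have j: "j < k" by simp
      have "(\<Sum>s<D ^ T. of_bool (guess n k r j s \<noteq> c j) * weight n k r z s) \<le> exp (- (real r * (eps n k)\<^sup>2 / 128))"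
        unfolding D_def m_def T_def by (rule sum_weight_wrong[where z = z and c = "c j", OF r(2) eps_pos[OF n k] z j c[OF j]])
      also have "\<dots> \<le> exp (- ln (3 * real k))" using r(1) by simp
      also have "\<dots> = 1 / (3 * real k)" using k by (simp only: exp_minus exp_ln inverse_eq_divide zero_less_mult_iff) simp
      finally show "(\<Sum>s<D ^ T. of_bool (guess n k r j s \<noteq> c j) * weight n k r z s) \<le> 1 / (3 * real k)" .
    qed
    also have "\<dots> = 1 / 3" using k by simp
    finally show ?thesis by simp
  qed
  show ?thesis unfolding m_def[symmetric] T_def[symmetric]
    using wf tot big by (intro exI[of _ A] conjI allI impI) simp_all
qed

text \<open>Being correct with probability 2/3 on the supports of the conditioned distributions
  gives expectations at least 1/3 and at most -1/3.\<close>

lemma expected_output_advantage: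
  assumes nk: "n \<ge> 1" "k \<ge> 1" "eps n k \<le> 1" "real k * err1 n k < 1"
    and A: "\<And>z. (\<forall>j<k. z j \<in> sign_cube (2 * 2 ^ n)) \<Longrightarrow>
       output_prob m A (concat_input n z) 1 + output_prob m A (concat_input n z) (- 1) = 1"
      "\<And>z b. (\<forall>j<k. z j \<in> sign_cube (2 * 2 ^ n)) \<Longrightarrow> forr_xor n k z = Some b \<Longrightarrow>
       output_prob m A (concat_input n z) b \<ge> 2 / 3"
  shows "advantage n k (\<lambda>z. expected_output m A (concat_input n z)) \<ge> 2 / 3"
proof -
  let ?f = "\<lambda>z. expected_output m A (concat_input n z)"
  note S = set_sigma[OF nk]
  have fin: "finite (tup {..<k} (blk n))" by (intro finite_tup) (auto simp: finite_sign_cube)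
  have int: "integrable (measure_pmf (sigma0 n k)) ?f" "integrable (measure_pmf (sigma1 n k)) ?f"
    using S fin by (auto intro!: integrable_measure_pmf_finite dest: finite_subset)
  have cube: "\<forall>j<k. z j \<in> sign_cube (2 * 2 ^ n)" if "z \<in> tup {..<k} (blk n)" for z
    using that by (simp add: tup_iff)
  have "measure_pmf.expectation (sigma0 n k) ?f \<ge> 1 / 3"
  proof (rule measure_pmf.integral_ge_const[OF int(1)], unfold AE_measure_pmf_iff, rule ballI)
    fix z assume "z \<in> set_pmf (sigma0 n k)"
    then have z: "\<forall>j<k. z j \<in> sign_cube (2 * 2 ^ n)" "forr_xor n k z = Some 1" using S(1) cube by auto
    show "1 / 3 \<le> ?f z" using A(1)[OF z(1)] A(2)[OF z] unfolding expected_output_def by linarith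
  qed
  moreover have "measure_pmf.expectation (sigma1 n k) ?f \<le> - 1 / 3"
  proof (rule measure_pmf.integral_le_const[OF int(2)], unfold AE_measure_pmf_iff, rule ballI)
    fix z assume "z \<in> set_pmf (sigma1 n k)"
    then have z: "\<forall>j<k. z j \<in> sign_cube (2 * 2 ^ n)" "forr_xor n k z = Some (- 1)" using S(2) cube by auto
    show "?f z \<le> - 1 / 3" using A(1)[OF z(1)] A(2)[OF z] unfolding expected_output_def by linarith
  qed
  ultimately show ?thesis unfolding advantage_def by linarith
qed

text \<open>\<open>ln 3 \<le> 2\<close> and \<open>ln k \<le> log 2 k\<close>; the maximum with 1
  covers \<open>k = 1\<close>, where the logarithm vanishes.\<close>

lemma ln_3k_le: "k \<ge> 1 \<Longrightarrow> ln (3 * real k) \<le> 3 * max 1 (log 2 (real k))"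
proof -
  assume k: "k \<ge> 1"
  have "ln (3 :: real) \<le> 2" using ln_le_minus_one[of "3 :: real"] by simp
  moreover have "ln (real k) \<le> log 2 (real k)"
  proof -
    have "ln (2 :: real) \<le> 1" using ln_le_minus_one[of "2 :: real"] by simp
    moreover have "0 \<le> log 2 (real k)" using k by simp
    ultimately have "log 2 (real k) * ln 2 \<le> log 2 (real k)" by (rule mult_left_le)
    then show ?thesis by (simp add: log_def)
  qed
  ultimately show ?thesis using k by (simp add: ln_mult)
qed

lemma quantum_part:
  fixes k :: "nat \<Rightarrow> nat"
  assumes k1: "\<And>n. k n \<ge> 1" and ko: "(\<lambda>n. real (k n)) \<in> o(\<lambda>n. (2 ^ n) powr (1 / 50))"
  shows "\<exists>q :: nat \<Rightarrow> nat.
        (\<lambda>n. real (q n)) \<in> O(\<lambda>n. real (k n) ^ 5 * (log 2 (2 ^ n))\<^sup>2 * max 1 (log 2 (real (k n)))) \<and>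
        (\<forall>\<^sub>F n in sequentially. \<exists>A.
           wf_query_alg (num_inputs n (k n)) A \<and>
           num_queries A \<le> q n \<and>
           (\<forall>z b. (\<forall>j<k n. z j \<in> sign_cube (2 * 2 ^ n)) \<longrightarrow> forr_xor n (k n) z = Some b \<longrightarrow>
              output_prob (num_inputs n (k n)) A (concat_input n z) b \<ge> 2 / 3) \<and>
           advantage n (k n)
             (\<lambda>z. expected_output (num_inputs n (k n)) A (concat_input n z)) \<ge> 2 / 3)"
proof -
  \<comment> \<open>The number of runs per block demanded by \<open>forr_algorithm\<close>, of order
    k^4 log^2 N log k; the k blocks supply the fifth power of k.\<close>
  define X where "X = (\<lambda>n. 128 * ln (3 * real (k n)) / (eps n (k n))\<^sup>2)"
  define r where "r = (\<lambda>n. nat \<lceil>X n\<rceil> + 1)"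
  have X0: "X n \<ge> 0" for n unfolding X_def using k1[of n] by simp
  have r: "X n \<le> real (r n)" "real (r n) \<le> X n + 2" "r n \<ge> 1" for n
    using X0[of n] unfolding r_def by (auto, linarith+)
  show ?thesis
  proof (intro exI[of _ "\<lambda>n. k n * r n"] conjI)
    show "(\<lambda>n. real (k n * r n)) \<in> O(\<lambda>n. real (k n) ^ 5 * (log 2 (2 ^ n))\<^sup>2 * max 1 (log 2 (real (k n))))"
    proof (rule bigoI[where c = 1400000], use eventually_ge_at_top[of 1] in eventually_elim)
      case (elim n)
      let ?k = "real (k n)" and ?L = "max 1 (log 2 (real (k n)))"
      have kk: "?k \<ge> 1" using k1[of n] by simp
      have n1: "real n \<ge> 1" using elim by simp
      have lnN: "0 \<le> ln (2 ^ n :: real)" "ln (2 ^ n :: real) \<le> real n"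
        using ln_le_minus_one[of "2 :: real"] by (auto simp: ln_realpow mult_left_le)
      have "X n = 128 * ln (3 * ?k) * (60 * ?k\<^sup>2 * ln (2 ^ n))\<^sup>2" by (simp add: X_def eps_def power_divide)
      also have "\<dots> \<le> 128 * (3 * ?L) * (60 * ?k\<^sup>2 * real n)\<^sup>2"
        using lnN kk by (intro mult_mono power_mono ln_3k_le k1) auto
      also have "\<dots> = 1382400 * (?k ^ 4 * (real n)\<^sup>2 * ?L)" by (simp add: power_mult_distrib power_mult[symmetric] mult_ac)
      finally have X: "X n \<le> 1382400 * (?k ^ 4 * (real n)\<^sup>2 * ?L)" .
      \<comment> \<open>128 * 3 * 60^2 = 1382400; as the product is at least 1, the rest of the
        constant absorbs the \<open>+ 2\<close> from rounding.\<close>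
      have "1 * 1 * 1 \<le> ?k ^ 4 * (real n)\<^sup>2 * ?L"
        using kk n1 by (intro mult_mono one_le_power) auto
      then have "real (r n) \<le> 1400000 * (?k ^ 4 * (real n)\<^sup>2 * ?L)" using X r(2)[of n] by linarith
      then have "?k * real (r n) \<le> ?k * (1400000 * (?k ^ 4 * (real n)\<^sup>2 * ?L))" using kk by (intro mult_left_mono) auto
      also have "\<dots> = 1400000 * (?k ^ 5 * (real n)\<^sup>2 * ?L)" by (simp add: power_numeral_reduce)
      finally show ?case by (simp add: abs_mult log_nat_power)
    qed
    show "\<forall>\<^sub>F n in sequentially. \<exists>A.
           wf_query_alg (num_inputs n (k n)) A \<and>
           num_queries A \<le> k n * r n \<and>
           (\<forall>z b. (\<forall>j<k n. z j \<in> sign_cube (2 * 2 ^ n)) \<longrightarrow> forr_xor n (k n) z = Some b \<longrightarrow>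
              output_prob (num_inputs n (k n)) A (concat_input n z) b \<ge> 2 / 3) \<and>
           advantage n (k n)
             (\<lambda>z. expected_output (num_inputs n (k n)) A (concat_input n z)) \<ge> 2 / 3"
      using eventually_parameters[OF k1 ko]
    proof eventually_elim
      case (elim n)
      let ?m = "num_inputs n (k n)"
      have n1: "n \<ge> 1" and e1: "eps n (k n) \<le> 1" using elim by auto
      have e0: "eps n (k n) > 0" by (rule eps_pos[OF n1 k1])
      have "exp (- real (k n)) < 1" using k1[of n] by simp
      then have small: "real (k n) * err1 n (k n) < 1" using elim by linarith
      have "ln (3 * real (k n)) = X n * (eps n (k n))\<^sup>2 / 128" using e0 by (simp add: X_def)
      also have "\<dots> \<le> real (r n) * (eps n (k n))\<^sup>2 / 128" using r(1) by (intro divide_right_mono mult_right_mono) auto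
      finally obtain A where A: "wf_query_alg ?m A" "num_queries A = k n * r n"
        "\<And>z. (\<forall>j<k n. z j \<in> sign_cube (2 * 2 ^ n)) \<Longrightarrow>
           output_prob ?m A (concat_input n z) 1 + output_prob ?m A (concat_input n z) (- 1) = 1"
        "\<And>z b. (\<forall>j<k n. z j \<in> sign_cube (2 * 2 ^ n)) \<Longrightarrow> forr_xor n (k n) z = Some b \<Longrightarrow>
           output_prob ?m A (concat_input n z) b \<ge> 2 / 3"
        using forr_algorithm[OF n1 k1 _ r(3)] by blast
      have "advantage n (k n) (\<lambda>z. expected_output ?m A (concat_input n z)) \<ge> 2 / 3"
        by (rule expected_output_advantage[OF n1 k1 e1 small A(3,4)])
      then show ?case using A by (intro exI[of _ A] conjI allI impI) simp_all
    qed
  qed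
qed

theorem theorem3p10:
  fixes k :: "nat \<Rightarrow> nat"
  assumes k_pos: "\<And>n. k n \<ge> 1"
    and k_small: "(\<lambda>n. real (k n)) \<in> o(\<lambda>n. (2 ^ n) powr (1 / 50))"
  shows
    "(\<exists>q :: nat \<Rightarrow> nat.
        (\<lambda>n. real (q n)) \<in>
          O(\<lambda>n. real (k n) ^ 5 * (log 2 (2 ^ n))\<^sup>2 * max 1 (log 2 (real (k n)))) \<and>
        (\<forall>\<^sub>F n in sequentially. \<exists>A.
           wf_query_alg (num_inputs n (k n)) A \<and>
           num_queries A \<le> q n \<and>
           (\<forall>z b. (\<forall>j<k n. z j \<in> sign_cube (2 * 2 ^ n)) \<longrightarrow> forr_xor n (k n) z = Some b \<longrightarrow>
              output_prob (num_inputs n (k n)) A (concat_input n z) b \<ge> 2 / 3) \<and>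
           advantage n (k n)
             (\<lambda>z. expected_output (num_inputs n (k n)) A (concat_input n z)) \<ge> 2 / 3))
     \<and>
     (\<forall>d::nat. d \<ge> 1 \<longrightarrow>
        (\<exists>c>0. \<forall>s :: nat \<Rightarrow> nat.
           (d \<ge> 2 \<longrightarrow>
              (\<lambda>n. real (s n)) \<in> o(\<lambda>n. exp ((2 ^ n) powr (1 / (4 * (real d - 1)))))) \<longrightarrow>
           (\<forall>\<^sub>F n in sequentially. \<forall>C.
              wf_circuit (num_inputs n (k n)) C \<and> circuit_depth C \<le> d \<and> circuit_size C \<le> s n \<longrightarrow>
              advantage n (k n) (\<lambda>z. circuit_sign C (concat_input n z))
                \<le> exp (- (c * real (k n))))))"
proof (intro conjI quantum_part k_pos k_small allI impI exI[of _ 1])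
  fix d :: nat and s :: "nat \<Rightarrow> nat"
  assume d: "1 \<le> d"
    and s: "2 \<le> d \<longrightarrow> (\<lambda>n. real (s n)) \<in> o(\<lambda>n. exp ((2 ^ n) powr (1 / (4 * (real d - 1)))))"
  \<comment> \<open>\<open>circuit_part\<close> counts the depth from 0, which turns its exponent
    into 4 (d - 1); at depth 1 neither side imposes a bound on the size.\<close>
  have D: "Suc (d - 1) = d" "real (d - 1) = real d - 1" using d by auto
  have s': "(\<lambda>n. real (s n)) \<in> o(\<lambda>n. exp ((2 ^ n) powr (1 / (4 * real (d - 1)))))" if "d - 1 \<ge> 1"
    unfolding D(2) using s that by simp
  show "\<forall>\<^sub>F n in sequentially. \<forall>C.
      wf_circuit (num_inputs n (k n)) C \<and> circuit_depth C \<le> d \<and> circuit_size C \<le> s n \<longrightarrow>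
      advantage n (k n) (\<lambda>z. circuit_sign C (concat_input n z)) \<le> exp (- (1 * real (k n)))"
    using circuit_part[OF k_pos k_small s'] unfolding D(1) .
qed simp

end
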